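(* Let $G$ be a finite group, $k$ a field, and let $$\mathcal P = 0\leftarrow P_m\leftarrow\cdots\leftarrow P_n\leftarrow 0$$ be an indecomposable perfect chain complex of Mackey functors for $G$ over $k$. If the complex $\mathcal P$ is not homotopic to zero then $H_m(\mathcal P)\ne 0$ and $H_n(\mathcal P)\ne 0$.
   Context: Let $G$ be a finite group and $R$ a commutative ring. A Mackey functor $M$ for $G$ over $R$ consists of $R$-modules $M(H)$ for all subgroups $H\le G$ together with $R$-linear maps $I_K^H:M(K)\to M(H)$, $R_K^H:M(H)\to M(K)$ for $K\le H$, and $c_g:M(H)\to M({}^gH)$ for $g\in G$ (where ${}^gH=gHg^{-1}$, $H^g=g^{-1}Hg$), such that: $I_H^H$, $R_H^H$ and $c_h$ ($h\in H$) are identities on $M(H)$; $I_K^HI_J^K=I_J^H$ and $R_J^KR_K^H=R_J^H$ for $J\le K\le H$; $c_gc_h=c_{gh}$; $c_gI_K^H=I_{{}^gK}^{{}^gH}c_g$ and $c_gR_K^H=R_{{}^gK}^{{}^gH}c_g$; and $R_J^HI_K^H=\sum_{x\in[J\backslash H/K]}I_{J\cap{}^xK}^{J}\,c_x\,R_{J^x\cap K}^{K}$ for $J,K\le H$. Morphisms are families of $R$-linear maps commuting with all these maps; Mackey functors for $G$ over $R$ form an abelian category $\mathrm{Mack}_R(G)$. A perfect complex is a chain complex of finitely generated projective objects with only finitely many non-zero terms. Indecomposable means: non-zero and not a direct sum of two non-zero chain complexes. Homotopic to zero means contractible. In $\mathcal P$, the term $P_i$ is in degree $i$, the differentials lower degree,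 and $P_m$ and $P_n$ are the terms at the two ends of the displayed complex. *)

theory Defs
  imports "HOL-Algebra.Module" "HOL-Algebra.AbelCoset"
begin

section \<open>Mackey functors\<close>

text \<open>\<open>ind M K H\<close> is \<open>I\<^sub>K\<^sup>H : M(K) \<rightarrow> M(H)\<close>, \<open>res M H K\<close> is \<open>R\<^sub>K\<^sup>H : M(H) \<rightarrow> M(K)\<close> and
  \<open>cnj M g H\<close> is \<open>c\<^sub>g : M(H) \<rightarrow> M(gHg\<inverse>)\<close>. Only the values at subgroups of \<open>G\<close>, and on the carriers
  of the modules, are meaningful. The fields \<open>mult\<close> and \<open>one\<close> that the \<open>module\<close> record inherits from
  the \<open>ring\<close> record are never used.\<close>

record ('g, 'k, 'm) mackey =
  obj :: "'g set \<Rightarrow> ('k, 'm) module"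
  ind :: "'g set \<Rightarrow> 'g set \<Rightarrow> 'm \<Rightarrow> 'm"
  res :: "'g set \<Rightarrow> 'g set \<Rightarrow> 'm \<Rightarrow> 'm"
  cnj :: "'g \<Rightarrow> 'g set \<Rightarrow> 'm \<Rightarrow> 'm"

definition conj_subgp :: "('g, 'b) monoid_scheme \<Rightarrow> 'g \<Rightarrow> 'g set \<Rightarrow> 'g set" where
  "conj_subgp G g H = g <#\<^bsub>G\<^esub> H #>\<^bsub>G\<^esub> inv\<^bsub>G\<^esub> g"

text \<open>Complete sets of representatives of the double cosets \<open>JhK\<close> in \<open>H\<close>.\<close>

definition dcoset_reps ::
  "('g, 'b) monoid_scheme \<Rightarrow> 'g set \<Rightarrow> 'g set \<Rightarrow> 'g set \<Rightarrow> 'g set set" where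
  "dcoset_reps G J H K =
     {T. T \<subseteq> H \<and> (\<forall>h\<in>H. \<exists>!x. x \<in> T \<and> h \<in> J <#>\<^bsub>G\<^esub> (x <#\<^bsub>G\<^esub> K))}"

definition lin_map ::
  "('k, 'r) ring_scheme \<Rightarrow> ('k, 'm) module \<Rightarrow> ('k, 'n) module \<Rightarrow> ('m \<Rightarrow> 'n) set" where
  "lin_map R A B =
     {f \<in> carrier A \<rightarrow> carrier B.
        (\<forall>x\<in>carrier A. \<forall>y\<in>carrier A. f (x \<oplus>\<^bsub>A\<^esub> y) = f x \<oplus>\<^bsub>B\<^esub> f y) \<and>
        (\<forall>r\<in>carrier R. \<forall>x\<in>carrier A. f (r \<odot>\<^bsub>A\<^esub> x) = r \<odot>\<^bsub>B\<^esub> f x)}"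

text \<open>In the Mackey formula the sum is required to have the stated value for every choice of
  double coset representatives; by the other axioms it does not depend on the choice.\<close>

locale mackey_functor = group G + R: cring R
  for G :: "('g, 'b) monoid_scheme" (structure) and R :: "('k, 'r) ring_scheme" +
  fixes M :: "('g, 'k, 'm) mackey"
  assumes fin: "finite (carrier G)"
    and module_obj: "subgroup H G \<Longrightarrow> module R (obj M H)"
    and ind_lin: "\<lbrakk>subgroup K G; subgroup H G; K \<subseteq> H\<rbrakk> \<Longrightarrow>
          ind M K H \<in> lin_map R (obj M K) (obj M H)"
    and res_lin: "\<lbrakk>subgroup K G; subgroup H G; K \<subseteq> H\<rbrakk> \<Longrightarrow>
          res M H K \<in> lin_map R (obj M H) (obj M K)"
    and cnj_lin: "\<lbrakk>subgroup H G; g \<in> carrier G\<rbrakk> \<Longrightarrow>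
          cnj M g H \<in> lin_map R (obj M H) (obj M (conj_subgp G g H))"
    and ind_id: "\<lbrakk>subgroup H G; a \<in> carrier (obj M H)\<rbrakk> \<Longrightarrow> ind M H H a = a"
    and res_id: "\<lbrakk>subgroup H G; a \<in> carrier (obj M H)\<rbrakk> \<Longrightarrow> res M H H a = a"
    and cnj_id: "\<lbrakk>subgroup H G; h \<in> H; a \<in> carrier (obj M H)\<rbrakk> \<Longrightarrow> cnj M h H a = a"
    and ind_trans: "\<lbrakk>subgroup J G; subgroup K G; subgroup H G; J \<subseteq> K; K \<subseteq> H;
          a \<in> carrier (obj M J)\<rbrakk> \<Longrightarrow> ind M K H (ind M J K a) = ind M J H a"
    and res_trans: "\<lbrakk>subgroup J G; subgroup K G; subgroup H G; J \<subseteq> K; K \<subseteq> H;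
          a \<in> carrier (obj M H)\<rbrakk> \<Longrightarrow> res M K J (res M H K a) = res M H J a"
    and cnj_cnj: "\<lbrakk>subgroup H G; g \<in> carrier G; h \<in> carrier G; a \<in> carrier (obj M H)\<rbrakk> \<Longrightarrow>
          cnj M g (conj_subgp G h H) (cnj M h H a) = cnj M (g \<otimes> h) H a"
    and cnj_ind: "\<lbrakk>subgroup K G; subgroup H G; K \<subseteq> H; g \<in> carrier G; a \<in> carrier (obj M K)\<rbrakk> \<Longrightarrow>
          cnj M g H (ind M K H a) = ind M (conj_subgp G g K) (conj_subgp G g H) (cnj M g K a)"
    and cnj_res: "\<lbrakk>subgroup K G; subgroup H G; K \<subseteq> H; g \<in> carrier G; a \<in> carrier (obj M H)\<rbrakk> \<Longrightarrow>
          cnj M g K (res M H K a) = res M (conj_subgp G g H) (conj_subgp G g K) (cnj M g H a)"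
    and mackey_formula: "\<lbrakk>subgroup J G; subgroup K G; subgroup H G; J \<subseteq> H; K \<subseteq> H;
          T \<in> dcoset_reps G J H K; a \<in> carrier (obj M K)\<rbrakk> \<Longrightarrow>
          res M H J (ind M K H a) =
            (\<Oplus>\<^bsub>obj M J\<^esub> x\<in>T. ind M (J \<inter> conj_subgp G x K) J
               (cnj M x (conj_subgp G (inv x) J \<inter> K)
                  (res M K (conj_subgp G (inv x) J \<inter> K) a)))"

definition mackey_hom ::
  "('g, 'b) monoid_scheme \<Rightarrow> ('k, 'r) ring_scheme \<Rightarrow> ('g, 'k, 'm) mackey \<Rightarrow> ('g, 'k, 'n) mackey
     \<Rightarrow> ('g set \<Rightarrow> 'm \<Rightarrow> 'n) set" where
  "mackey_hom G R M N =
     {f. (\<forall>H. subgroup H G \<longrightarrow> f H \<in> lin_map R (obj M H) (obj N H)) \<and>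
         (\<forall>K H. subgroup K G \<and> subgroup H G \<and> K \<subseteq> H \<longrightarrow>
            (\<forall>a\<in>carrier (obj M K). f H (ind M K H a) = ind N K H (f K a)) \<and>
            (\<forall>a\<in>carrier (obj M H). f K (res M H K a) = res N H K (f H a))) \<and>
         (\<forall>g H. g \<in> carrier G \<and> subgroup H G \<longrightarrow>
            (\<forall>a\<in>carrier (obj M H). f (conj_subgp G g H) (cnj M g H a) = cnj N g H (f H a)))}"

definition mackey_zero :: "('g, 'b) monoid_scheme \<Rightarrow> ('g, 'k, 'm) mackey \<Rightarrow> bool" where
  "mackey_zero G M \<longleftrightarrow> (\<forall>H. subgroup H G \<longrightarrow> carrier (obj M H) = {\<zero>\<^bsub>obj M H\<^esub>})"

text \<open>Epimorphisms and isomorphisms of Mackey functors are the subgroupwise surjective and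
  bijective morphisms.\<close>

definition mackey_epi ::
  "('g, 'b) monoid_scheme \<Rightarrow> ('k, 'r) ring_scheme \<Rightarrow> ('g, 'k, 'm) mackey \<Rightarrow> ('g, 'k, 'n) mackey
     \<Rightarrow> ('g set \<Rightarrow> 'm \<Rightarrow> 'n) set" where
  "mackey_epi G R M N =
     {f \<in> mackey_hom G R M N. \<forall>H. subgroup H G \<longrightarrow> f H ` carrier (obj M H) = carrier (obj N H)}"

definition mackey_iso ::
  "('g, 'b) monoid_scheme \<Rightarrow> ('k, 'r) ring_scheme \<Rightarrow> ('g, 'k, 'm) mackey \<Rightarrow> ('g, 'k, 'n) mackey
     \<Rightarrow> ('g set \<Rightarrow> 'm \<Rightarrow> 'n) set" where
  "mackey_iso G R M N =
     {f \<in> mackey_hom G R M N.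
        \<forall>H. subgroup H G \<longrightarrow> bij_betw (f H) (carrier (obj M H)) (carrier (obj N H))}"

definition subfunctor ::
  "('g, 'b) monoid_scheme \<Rightarrow> ('k, 'r) ring_scheme \<Rightarrow> ('g, 'k, 'm) mackey \<Rightarrow> ('g set \<Rightarrow> 'm set) \<Rightarrow> bool"
  where
  "subfunctor G R M N \<longleftrightarrow>
     (\<forall>H. subgroup H G \<longrightarrow> submodule (N H) R (obj M H)) \<and>
     (\<forall>K H. subgroup K G \<and> subgroup H G \<and> K \<subseteq> H \<longrightarrow>
        ind M K H ` N K \<subseteq> N H \<and> res M H K ` N H \<subseteq> N K) \<and>
     (\<forall>g H. g \<in> carrier G \<and> subgroup H G \<longrightarrow> cnj M g H ` N H \<subseteq> N (conj_subgp G g H))"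

definition fin_gen ::
  "('g, 'b) monoid_scheme \<Rightarrow> ('k, 'r) ring_scheme \<Rightarrow> ('g, 'k, 'm) mackey \<Rightarrow> bool" where
  "fin_gen G R M \<longleftrightarrow>
     (\<exists>S. finite S \<and> (\<forall>(H, x)\<in>S. subgroup H G \<and> x \<in> carrier (obj M H)) \<and>
        (\<forall>N. subfunctor G R M N \<and> (\<forall>(H, x)\<in>S. x \<in> N H) \<longrightarrow>
           (\<forall>H. subgroup H G \<longrightarrow> N H = carrier (obj M H))))"

text \<open>Projectivity is the lifting property against epimorphisms \<open>e : N \<rightarrow> L\<close>. HOL cannot quantify
  over the types of elements of \<open>N\<close> and \<open>L\<close> inside a definition, so one type has to be fixed. The
  type \<open>'m \<times> nat \<Rightarrow> 'k\<close> is large enough for the definition not to depend on this choice: it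
  contains a copy of \<open>P\<close> (unless \<open>R\<close> is the zero ring) and of the direct sum of representable functors
  indexed by all elements of \<open>P\<close>, as the values of that sum at subgroups are free with bases
  that embed in \<open>'m \<times> nat\<close>. Lifting the identity along the canonical map from that sum to \<open>P\<close>
  makes \<open>P\<close> a direct summand of it, whence the lifting property against all epimorphisms.\<close>

definition projective ::
  "('g, 'b) monoid_scheme \<Rightarrow> ('k, 'r) ring_scheme \<Rightarrow> ('g, 'k, 'm) mackey \<Rightarrow> bool" where
  "projective G R P \<longleftrightarrow>
     (\<forall>(N :: ('g, 'k, 'm \<times> nat \<Rightarrow> 'k) mackey) (L :: ('g, 'k, 'm \<times> nat \<Rightarrow> 'k) mackey) e f.
        mackey_functor G R N \<and> mackey_functor G R L \<and>
        e \<in> mackey_epi G R N L \<and> f \<in> mackey_hom G R P L \<longrightarrow>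
        (\<exists>l\<in>mackey_hom G R P N.
           \<forall>H. subgroup H G \<longrightarrow> (\<forall>x\<in>carrier (obj P H). e H (l H x) = f H x)))"

definition mackey_sub :: "('g, 'k, 'm) mackey \<Rightarrow> ('g set \<Rightarrow> 'm set) \<Rightarrow> ('g, 'k, 'm) mackey" where
  "mackey_sub M N = M\<lparr>obj := \<lambda>H. (obj M H)\<lparr>carrier := N H\<rparr>\<rparr>"

text \<open>As for \<open>rcoset_mult\<close> in the library, an operation is applied to a coset by taking the union of
  the cosets of the values at its elements.\<close>

definition mackey_quot ::
  "('g, 'b) monoid_scheme \<Rightarrow> ('g, 'k, 'm) mackey \<Rightarrow> ('g set \<Rightarrow> 'm set) \<Rightarrow> ('g, 'k, 'm set) mackey" where
  "mackey_quot G M N =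
     \<lparr>obj = (\<lambda>H. \<lparr>carrier = a_rcosets\<^bsub>obj M H\<^esub> (N H), mult = undefined, one = undefined,
                zero = N H, add = set_add (obj M H),
                smult = (\<lambda>r T. \<Union>x\<in>T. N H +>\<^bsub>obj M H\<^esub> (r \<odot>\<^bsub>obj M H\<^esub> x))\<rparr>),
      ind = (\<lambda>K H T. \<Union>x\<in>T. N H +>\<^bsub>obj M H\<^esub> ind M K H x),
      res = (\<lambda>H K T. \<Union>x\<in>T. N K +>\<^bsub>obj M K\<^esub> res M H K x),
      cnj = (\<lambda>g H T. \<Union>x\<in>T. N (conj_subgp G g H) +>\<^bsub>obj M (conj_subgp G g H)\<^esub> cnj M g H x)\<rparr>"

definition mod_dsum :: "('k, 'm) module \<Rightarrow> ('k, 'n) module \<Rightarrow> ('k, 'm \<times> 'n) module" where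
  "mod_dsum A B =
     \<lparr>carrier = carrier A \<times> carrier B, mult = undefined, one = undefined,
      zero = (\<zero>\<^bsub>A\<^esub>, \<zero>\<^bsub>B\<^esub>), add = (\<lambda>(a, b) (a', b'). (a \<oplus>\<^bsub>A\<^esub> a', b \<oplus>\<^bsub>B\<^esub> b')),
      smult = (\<lambda>r (a, b). (r \<odot>\<^bsub>A\<^esub> a, r \<odot>\<^bsub>B\<^esub> b))\<rparr>"

definition mackey_dsum ::
  "('g, 'k, 'm) mackey \<Rightarrow> ('g, 'k, 'n) mackey \<Rightarrow> ('g, 'k, 'm \<times> 'n) mackey" where
  "mackey_dsum M N =
     \<lparr>obj = (\<lambda>H. mod_dsum (obj M H) (obj N H)),
      ind = (\<lambda>K H. map_prod (ind M K H) (ind N K H)),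
      res = (\<lambda>H K. map_prod (res M H K) (res N H K)),
      cnj = (\<lambda>g H. map_prod (cnj M g H) (cnj N g H))\<rparr>"


section \<open>Chain complexes of Mackey functors\<close>

record ('g, 'k, 'm) mackey_cx =
  cob :: "int \<Rightarrow> ('g, 'k, 'm) mackey"
  dif :: "int \<Rightarrow> 'g set \<Rightarrow> 'm \<Rightarrow> 'm"

locale chain_complex =
  fixes G :: "('g, 'b) monoid_scheme" and R :: "('k, 'r) ring_scheme"
    and C :: "('g, 'k, 'm) mackey_cx"
  assumes mackey_cob: "mackey_functor G R (cob C i)"
    and dif_hom: "dif C i \<in> mackey_hom G R (cob C i) (cob C (i - 1))"
    and dif_dif: "\<lbrakk>subgroup H G; x \<in> carrier (obj (cob C i) H)\<rbrakk> \<Longrightarrow>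
          dif C (i - 1) H (dif C i H x) = \<zero>\<^bsub>obj (cob C (i - 2)) H\<^esub>"

definition perfect ::
  "('g, 'b) monoid_scheme \<Rightarrow> ('k, 'r) ring_scheme \<Rightarrow> ('g, 'k, 'm) mackey_cx \<Rightarrow> bool" where
  "perfect G R C \<longleftrightarrow> chain_complex G R C \<and>
     (\<forall>i. fin_gen G R (cob C i) \<and> projective G R (cob C i)) \<and>
     finite {i. \<not> mackey_zero G (cob C i)}"

definition cx_zero :: "('g, 'b) monoid_scheme \<Rightarrow> ('g, 'k, 'm) mackey_cx \<Rightarrow> bool" where
  "cx_zero G C \<longleftrightarrow> (\<forall>i. mackey_zero G (cob C i))"

definition cx_dsum ::
  "('g, 'k, 'm) mackey_cx \<Rightarrow> ('g, 'k, 'n) mackey_cx \<Rightarrow> ('g, 'k, 'm \<times> 'n) mackey_cx" where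
  "cx_dsum C D =
     \<lparr>cob = (\<lambda>i. mackey_dsum (cob C i) (cob D i)),
      dif = (\<lambda>i H. map_prod (dif C i H) (dif D i H))\<rparr>"

definition cx_iso ::
  "('g, 'b) monoid_scheme \<Rightarrow> ('k, 'r) ring_scheme \<Rightarrow> ('g, 'k, 'm) mackey_cx \<Rightarrow> ('g, 'k, 'n) mackey_cx
     \<Rightarrow> (int \<Rightarrow> 'g set \<Rightarrow> 'm \<Rightarrow> 'n) set" where
  "cx_iso G R C D =
     {f. (\<forall>i. f i \<in> mackey_iso G R (cob C i) (cob D i)) \<and>
         (\<forall>i H. subgroup H G \<longrightarrow>
            (\<forall>x\<in>carrier (obj (cob C i) H). f (i - 1) H (dif C i H x) = dif D i H (f i H x)))}"

text \<open>Taking the summands \<open>A\<close>, \<open>B\<close> over the same type of elements as \<open>C\<close> is no restriction, since a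
  direct summand of \<open>C\<close> is isomorphic to a subcomplex of \<open>C\<close>.\<close>

definition cx_indecomposable ::
  "('g, 'b) monoid_scheme \<Rightarrow> ('k, 'r) ring_scheme \<Rightarrow> ('g, 'k, 'm) mackey_cx \<Rightarrow> bool" where
  "cx_indecomposable G R C \<longleftrightarrow> \<not> cx_zero G C \<and>
     \<not> (\<exists>(A :: ('g, 'k, 'm) mackey_cx) (B :: ('g, 'k, 'm) mackey_cx).
          chain_complex G R A \<and> chain_complex G R B \<and>
          \<not> cx_zero G A \<and> \<not> cx_zero G B \<and> cx_iso G R C (cx_dsum A B) \<noteq> {})"

definition contractible ::
  "('g, 'b) monoid_scheme \<Rightarrow> ('k, 'r) ring_scheme \<Rightarrow> ('g, 'k, 'm) mackey_cx \<Rightarrow> bool" where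
  "contractible G R C \<longleftrightarrow>
     (\<exists>s. (\<forall>i. s i \<in> mackey_hom G R (cob C i) (cob C (i + 1))) \<and>
          (\<forall>i H. subgroup H G \<longrightarrow> (\<forall>x\<in>carrier (obj (cob C i) H).
             dif C (i + 1) H (s i H x) \<oplus>\<^bsub>obj (cob C i) H\<^esub> s (i - 1) H (dif C i H x) = x)))"

definition cycles :: "('g, 'k, 'm) mackey_cx \<Rightarrow> int \<Rightarrow> 'g set \<Rightarrow> 'm set" where
  "cycles C i H = a_kernel (obj (cob C i) H) (obj (cob C (i - 1)) H) (dif C i H)"

definition boundaries :: "('g, 'k, 'm) mackey_cx \<Rightarrow> int \<Rightarrow> 'g set \<Rightarrow> 'm set" where
  "boundaries C i H = dif C (i + 1) H ` carrier (obj (cob C (i + 1)) H)"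

definition homology ::
  "('g, 'b) monoid_scheme \<Rightarrow> ('g, 'k, 'm) mackey_cx \<Rightarrow> int \<Rightarrow> ('g, 'k, 'm set) mackey" where
  "homology G C i = mackey_quot G (mackey_sub (cob C i) (cycles C i)) (boundaries C i)"

end

theory Submission
  imports Defs
begin

text \<open>If \<open>H\<^sub>m(P) = 0\<close>, then \<open>P\<^sub>m\<^sub>+\<^sub>1 \<rightarrow> P\<^sub>m\<close> is a split epimorphism, as \<open>P\<^sub>m\<close> is projective. If \<open>H\<^sub>n(P) = 0\<close>, then
  \<open>P\<^sub>n \<rightarrow> P\<^sub>n\<^sub>-\<^sub>1\<close> is a monomorphism of finitely generated projective Mackey functors, and these split as
  well. In both cases there is \<open>t\<close> with \<open>dtd = d\<close> and \<open>tdt = t\<close>, and \<open>td\<close>, \<open>dt\<close> form an idempotent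
  endomorphism of the complex. By indecomposability it is \<open>0\<close>, so that the term at that end vanishes,
  or the identity, so that \<open>t\<close> is a contraction.

  To split a monomorphism \<open>f : P \<rightarrow> Q\<close>, write \<open>P\<close> as a direct summand of \<open>F\<^sub>X\<close> for a finite \<open>G\<close>-set \<open>X\<close>,
  where \<open>F\<^sub>X(K)\<close> is the Burnside group of \<open>K\<close>-sets over \<open>X\<close>. It suffices to extend every
  \<open>u : P \<rightarrow> F\<^sub>G\<^sub>/\<^sub>H\<close> along \<open>f\<close>, by induction on the order of \<open>H\<close>. If \<open>u\<close> does not extend, a linear functional
  on the coordinates at the generators of \<open>P\<close> vanishes on the morphisms that extend, but not on \<open>u\<close>. By
  induction it only involves the coordinates at \<open>gHg\<inverse>/gHg\<inverse> \<rightarrow> G/H\<close> with image \<open>gH\<close>, so it is given by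
  \<open>u \<mapsto>\<close> the coefficient of \<open>u(Z)\<close> at the \<open>H\<close>-fixed point of \<open>G/H\<close>, for some \<open>Z \<in> P(H)\<close>. A primitive
  integral multiple \<open>\<theta>\<close> of the idempotent of the Burnside ring of \<open>H\<close> that vanishes on all proper subgroups
  acts on \<open>F\<^sub>X(H)\<close> with kernel spanned by the \<open>H/L \<rightarrow> X\<close> with \<open>L \<noteq> H\<close>. Embedding \<open>Q\<close> in some \<open>F\<^sub>X\<close>,
  one gets \<open>f(\<theta>Z) = 0\<close> from the choice of the functional, hence \<open>\<theta>Z = 0\<close>, but \<open>\<theta>(u(Z)) \<noteq> 0\<close>.\<close>

section \<open>Linear maps and free modules\<close>

text \<open>In positive characteristic projective Mackey functors need not be injective, so the
  splitting of \<open>P \<rightarrow> Q\<close> has to use that \<open>Q\<close> is projective as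
  well. This enters at one point, the embedding of \<open>Q\<close> into \<open>F_X\<close>. The
  functional turns a question about morphisms into one about the single element \<open>Z\<close>,
  where injectivity of \<open>f\<close> can be applied. The coefficient of \<open>f(Z)\<close> at an
  \<open>H\<close>-fixed point of \<open>X\<close> is the functional evaluated at a composite
  \<open>P \<rightarrow> Q \<rightarrow> F_X \<rightarrow> F_{G/H}\<close>, whose last map is the
  transpose of a map \<open>G/H \<rightarrow> X\<close>. This composite extends along
  \<open>f\<close> by construction, so the coefficient is zero. Nothing is known about the other
  coefficients of \<open>f(Z)\<close>; \<theta> is there to remove them. The idempotent itself has
  denominators dividing the order of \<open>H\<close> and may not exist over \<open>k\<close>. Only
  its kernel matters, and a primitive integral multiple stays nonzero modulo every prime. As
  \<theta> is built from induction and restriction, it commutes with all morphisms, which carries it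
  through \<open>f\<close> and \<open>u\<close> alike.\<close>

definition fmod :: "('k, 'r) ring_scheme \<Rightarrow> 'a set \<Rightarrow> ('k, 'a \<Rightarrow> 'k) module" where
  "fmod R A = \<lparr>carrier = {f. (\<forall>a. f a \<in> carrier R) \<and> (\<forall>a. a \<notin> A \<longrightarrow> f a = \<zero>\<^bsub>R\<^esub>)},
     mult = undefined, one = undefined, zero = (\<lambda>_. \<zero>\<^bsub>R\<^esub>), add = (\<lambda>f g a. f a \<oplus>\<^bsub>R\<^esub> g a),
     smult = (\<lambda>r f a. r \<otimes>\<^bsub>R\<^esub> f a)\<rparr>"

definition unit_vec :: "('k, 'r) ring_scheme \<Rightarrow> 'a \<Rightarrow> 'a \<Rightarrow> 'k" where
  "unit_vec R a = (\<lambda>b. if b = a then \<one>\<^bsub>R\<^esub> else \<zero>\<^bsub>R\<^esub>)"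

text \<open>The linear extension of \<open>v\<close> from the basis vectors; the structure maps of
  the Burnside functor and the morphisms out of it are all given in this form.\<close>

definition lin :: "('k, 'm) module \<Rightarrow> 'a set \<Rightarrow> ('a \<Rightarrow> 'm) \<Rightarrow> ('a \<Rightarrow> 'k) \<Rightarrow> 'm" where
  "lin M A v f = (\<Oplus>\<^bsub>M\<^esub> a\<in>A. f a \<odot>\<^bsub>M\<^esub> v a)"

lemma fmod_simps [simp]:
  "zero (fmod R A) = (\<lambda>_. \<zero>\<^bsub>R\<^esub>)" "add (fmod R A) f g = (\<lambda>a. f a \<oplus>\<^bsub>R\<^esub> g a)"
  "smult (fmod R A) r f = (\<lambda>a. r \<otimes>\<^bsub>R\<^esub> f a)"
  by (simp_all add: fmod_def)

lemma fmod_carrier: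
  "f \<in> carrier (fmod R A) \<longleftrightarrow> (\<forall>a. f a \<in> carrier R) \<and> (\<forall>a. a \<notin> A \<longrightarrow> f a = \<zero>\<^bsub>R\<^esub>)"
  by (simp add: fmod_def)

lemma lin_mapI:
  assumes "\<And>x. x \<in> carrier A \<Longrightarrow> f x \<in> carrier B"
    and "\<And>x y. \<lbrakk>x \<in> carrier A; y \<in> carrier A\<rbrakk> \<Longrightarrow> f (x \<oplus>\<^bsub>A\<^esub> y) = f x \<oplus>\<^bsub>B\<^esub> f y"
    and "\<And>r x. \<lbrakk>r \<in> carrier R; x \<in> carrier A\<rbrakk> \<Longrightarrow> f (r \<odot>\<^bsub>A\<^esub> x) = r \<odot>\<^bsub>B\<^esub> f x"
  shows "f \<in> lin_map R A B"
  using assms by (auto simp: lin_map_def)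

lemma lin_mapD:
  assumes "f \<in> lin_map R A B"
  shows "x \<in> carrier A \<Longrightarrow> f x \<in> carrier B"
    and "x \<in> carrier A \<Longrightarrow> y \<in> carrier A \<Longrightarrow> f (x \<oplus>\<^bsub>A\<^esub> y) = f x \<oplus>\<^bsub>B\<^esub> f y"
    and "r \<in> carrier R \<Longrightarrow> x \<in> carrier A \<Longrightarrow> f (r \<odot>\<^bsub>A\<^esub> x) = r \<odot>\<^bsub>B\<^esub> f x"
  using assms by (auto simp: lin_map_def)

lemma lin_map_zero:
  assumes "f \<in> lin_map R A B" "module R A" "module R B"
  shows "f \<zero>\<^bsub>A\<^esub> = \<zero>\<^bsub>B\<^esub>"
proof -
  interpret A: module R A by fact
  interpret B: module R B by fact
  have "f (\<zero>\<^bsub>R\<^esub> \<odot>\<^bsub>A\<^esub> \<zero>\<^bsub>A\<^esub>) = \<zero>\<^bsub>R\<^esub> \<odot>\<^bsub>B\<^esub> f \<zero>\<^bsub>A\<^esub>"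
    using lin_mapD(3)[OF assms(1) A.R.zero_closed A.M.zero_closed] by simp
  then show ?thesis using lin_mapD(1)[OF assms(1) A.M.zero_closed] by simp
qed

lemma lin_map_comp:
  assumes "f \<in> lin_map R A B" "g \<in> lin_map R B C"
  shows "(\<lambda>x. g (f x)) \<in> lin_map R A C"
  by (rule lin_mapI) (simp_all add: lin_mapD[OF assms(1)] lin_mapD[OF assms(2)])

lemma lin_map_id: "(\<lambda>x. x) \<in> lin_map R A A"
  by (rule lin_mapI) auto

lemma lin_map_const_zero:
  assumes "module R B" shows "(\<lambda>_. \<zero>\<^bsub>B\<^esub>) \<in> lin_map R A B"
proof -
  interpret B: module R B by fact
  show ?thesis by (rule lin_mapI) auto
qed

lemma lin_map_add:
  assumes "f \<in> lin_map R A B" "g \<in> lin_map R A B" "module R A" "module R B"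
  shows "(\<lambda>x. f x \<oplus>\<^bsub>B\<^esub> g x) \<in> lin_map R A B"
proof -
  interpret A: module R A by fact
  interpret B: module R B by fact
  show ?thesis
    by (rule lin_mapI) (auto simp: lin_mapD[OF assms(1)] lin_mapD[OF assms(2)] B.M.a_ac B.smult_r_distr)
qed

lemma lin_map_smult:
  assumes "r \<in> carrier R" "f \<in> lin_map R A B" "module R A" "module R B"
  shows "(\<lambda>x. r \<odot>\<^bsub>B\<^esub> f x) \<in> lin_map R A B"
proof -
  interpret A: module R A by fact
  interpret B: module R B by fact
  show ?thesis
    by (rule lin_mapI)
      (use assms(1) in \<open>auto simp: lin_mapD[OF assms(2)] B.smult_r_distr B.smult_assoc1[symmetric] A.R.m_comm\<close>)
qed

lemma lin_map_finsum:
  assumes "f \<in> lin_map R A B" "module R A" "module R B" "g \<in> S \<rightarrow> carrier A"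
  shows "f (\<Oplus>\<^bsub>A\<^esub>x\<in>S. g x) = (\<Oplus>\<^bsub>B\<^esub>x\<in>S. f (g x))"
proof -
  interpret A: module R A by fact
  interpret B: module R B by fact
  show ?thesis
    using assms(4)
  proof (induction S rule: infinite_finite_induct)
    case (infinite S) then show ?case using lin_map_zero[OF assms(1-3)] by simp
  next
    case empty then show ?case using lin_map_zero[OF assms(1-3)] by simp
  next
    case (insert x S)
    then have "g \<in> S \<rightarrow> carrier A" "g x \<in> carrier A" by auto
    with insert show ?case
      using lin_mapD[OF assms(1)] by (subst B.finsum_insert) (auto simp: A.finsum_insert)
  qed
qed

lemma lin_map_finsum_pointwise:
  assumes "module R A" "module R B" "\<And>x. x \<in> S \<Longrightarrow> f x \<in> lin_map R A B"
  shows "(\<lambda>a. \<Oplus>\<^bsub>B\<^esub>x\<in>S. f x a) \<in> lin_map R A B"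
proof -
  interpret A: module R A by fact
  interpret B: module R B by fact
  show ?thesis
    using assms(3)
  proof (induction S rule: infinite_finite_induct)
    case (infinite S) then show ?case using lin_map_const_zero[OF assms(2)] by simp
  next
    case empty then show ?case using lin_map_const_zero[OF assms(2)] by simp
  next
    case (insert x S)
    have *: "(\<lambda>a. f x a \<oplus>\<^bsub>B\<^esub> (\<Oplus>\<^bsub>B\<^esub>x\<in>S. f x a)) \<in> lin_map R A B"
      using insert by (intro lin_map_add assms(1,2)) auto
    have **: "\<And>a. a \<in> carrier A \<Longrightarrow> (\<Oplus>\<^bsub>B\<^esub>y\<in>insert x S. f y a) = f x a \<oplus>\<^bsub>B\<^esub> (\<Oplus>\<^bsub>B\<^esub>x\<in>S. f x a)"
      using insert lin_mapD(1)[OF insert.prems] by (subst B.finsum_insert) auto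
    show ?case
      using * by (intro lin_mapI) (simp_all add: ** lin_mapD[OF *])
  qed
qed

context cring begin

lemma fmod_module: "module R (fmod R A)"
proof (rule moduleI)
  show "abelian_group (fmod R A)"
  proof (rule abelian_groupI)
    fix x assume "x \<in> carrier (fmod R A)"
    then show "\<exists>y\<in>carrier (fmod R A). y \<oplus>\<^bsub>fmod R A\<^esub> x = \<zero>\<^bsub>fmod R A\<^esub>"
      by (intro bexI[of _ "\<lambda>a. \<ominus> x a"]) (auto simp: fmod_carrier l_neg)
  qed (auto simp: fmod_carrier a_ac)
qed (auto simp: fmod_carrier is_cring l_distr r_distr m_assoc)

lemma unit_vec_in: "a \<in> A \<Longrightarrow> unit_vec R a \<in> carrier (fmod R A)"
  by (auto simp: fmod_carrier unit_vec_def)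

lemma lin_lin_map:
  assumes "module R M" "v \<in> A \<rightarrow> carrier M"
  shows "lin M A v \<in> lin_map R (fmod R A) M"
proof -
  interpret M: module R M by fact
  have v: "\<And>a. a \<in> A \<Longrightarrow> v a \<in> carrier M" using assms by auto
  show ?thesis
    unfolding lin_def
  proof (rule lin_map_finsum_pointwise[OF fmod_module assms(1)])
    fix a assume "a \<in> A"
    then show "(\<lambda>f. f a \<odot>\<^bsub>M\<^esub> v a) \<in> lin_map R (fmod R A) M"
      by (intro lin_mapI) (auto simp: v fmod_carrier M.smult_l_distr M.smult_assoc1)
  qed
qed

lemma lin_bv:
  assumes "module R M" "finite A" "v \<in> A \<rightarrow> carrier M" "a \<in> A"
  shows "lin M A v (unit_vec R a) = v a"
proof -
  interpret M: module R M by fact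
  have v: "\<And>a. a \<in> A \<Longrightarrow> v a \<in> carrier M" using assms by auto
  have "lin M A v (unit_vec R a) = (\<Oplus>\<^bsub>M\<^esub>b\<in>A. if a = b then v b else \<zero>\<^bsub>M\<^esub>)"
    unfolding lin_def by (rule M.M.finsum_cong') (auto simp: unit_vec_def v)
  also have "\<dots> = v a" using assms v by (subst M.M.finsum_singleton) auto
  finally show ?thesis .
qed

lemma fmod_finsum_apply:
  assumes "g \<in> S \<rightarrow> carrier (fmod R A)"
  shows "(\<Oplus>\<^bsub>fmod R A\<^esub>x\<in>S. g x) b = (\<Oplus>x\<in>S. g x b)"
proof -
  interpret F: module R "fmod R A" by (rule fmod_module)
  show ?thesis
    using assms
  proof (induction S rule: infinite_finite_induct)
    case (insert x S)
    then have "g \<in> S \<rightarrow> carrier (fmod R A)" "g x \<in> carrier (fmod R A)" by auto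
    with insert show ?case
      by (subst F.finsum_insert) (auto simp: fmod_carrier Pi_iff)
  qed auto
qed

lemma fmod_expand:
  assumes "finite A" "f \<in> carrier (fmod R A)"
  shows "f = lin (fmod R A) A (unit_vec R) f"
proof
  fix b
  have f: "\<And>a. f a \<in> carrier R" "\<And>a. a \<notin> A \<Longrightarrow> f a = \<zero>" using assms by (auto simp: fmod_carrier)
  interpret F: module R "fmod R A" by (rule fmod_module)
  have "lin (fmod R A) A (unit_vec R) f b = (\<Oplus>a\<in>A. (f a \<odot>\<^bsub>fmod R A\<^esub> unit_vec R a) b)"
    unfolding lin_def
    by (rule fmod_finsum_apply) (use f unit_vec_in in \<open>auto intro!: F.smult_closed simp del: fmod_simps\<close>)
  also have "\<dots> = (\<Oplus>a\<in>A. if b = a then f a else \<zero>)"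
    by (rule finsum_cong') (auto simp: unit_vec_def f)
  also have "\<dots> = f b"
    using f assms(1) by (cases "b \<in> A") (auto simp: finsum_singleton intro!: add.finprod_one_eqI)
  finally show "f b = lin (fmod R A) A (unit_vec R) f b" by simp
qed

lemma lin_map_fmod_expand:
  assumes "finite A" "module R M" "h \<in> lin_map R (fmod R A) M" "x \<in> carrier (fmod R A)"
  shows "h x = (\<Oplus>\<^bsub>M\<^esub>a\<in>A. x a \<odot>\<^bsub>M\<^esub> h (unit_vec R a))"
proof -
  interpret F: module R "fmod R A" by (rule fmod_module)
  interpret M: module R M by fact
  have x: "\<And>a. x a \<in> carrier R" using assms by (auto simp: fmod_carrier)
  have "h x = h (\<Oplus>\<^bsub>fmod R A\<^esub>a\<in>A. x a \<odot>\<^bsub>fmod R A\<^esub> unit_vec R a)"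
    using fmod_expand[OF assms(1,4)] by (simp only: lin_def)
  also have "\<dots> = (\<Oplus>\<^bsub>M\<^esub>a\<in>A. h (x a \<odot>\<^bsub>fmod R A\<^esub> unit_vec R a))"
    by (rule lin_map_finsum[OF assms(3) fmod_module assms(2)])
      (use x unit_vec_in in \<open>auto intro!: F.smult_closed simp del: fmod_simps\<close>)
  also have "\<dots> = (\<Oplus>\<^bsub>M\<^esub>a\<in>A. x a \<odot>\<^bsub>M\<^esub> h (unit_vec R a))"
    by (rule M.M.finsum_cong')
      (auto simp: lin_mapD[OF assms(3)] x unit_vec_in simp del: fmod_simps)
  finally show ?thesis .
qed

lemma lin_map_fmod_eqI:
  assumes "finite A" "module R M" "f \<in> lin_map R (fmod R A) M" "g \<in> lin_map R (fmod R A) M"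
    and "\<And>a. a \<in> A \<Longrightarrow> f (unit_vec R a) = g (unit_vec R a)" "x \<in> carrier (fmod R A)"
  shows "f x = g x"
proof -
  interpret M: module R M by fact
  have x: "\<And>a. x a \<in> carrier R" using assms by (auto simp: fmod_carrier)
  show ?thesis
    unfolding lin_map_fmod_expand[OF assms(1,2,3,6)] lin_map_fmod_expand[OF assms(1,2,4,6)]
    by (rule M.M.finsum_cong') (auto simp: x unit_vec_in assms(5) lin_mapD(1)[OF assms(4)])
qed

end

section \<open>Conjugation and double cosets\<close>

lemma (in abelian_monoid) finsum_Sigma:
  assumes "finite T" "\<And>x. x \<in> T \<Longrightarrow> finite (S x)"
    and "\<And>x z. x \<in> T \<Longrightarrow> z \<in> S x \<Longrightarrow> f (x, z) \<in> carrier G"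
  shows "(\<Oplus>p\<in>Sigma T S. f p) = (\<Oplus>x\<in>T. \<Oplus>z\<in>S x. f (x, z))"
  using assms
proof (induction T rule: finite_induct)
  case (insert x T)
  have eq: "Sigma (insert x T) S = Pair x ` S x \<union> Sigma T S" by auto
  have "(\<Oplus>p\<in>Sigma (insert x T) S. f p) = (\<Oplus>p\<in>Pair x ` S x. f p) \<oplus> (\<Oplus>p\<in>Sigma T S. f p)"
    unfolding eq using insert by (intro finsum_Un_disjoint) auto
  also have "(\<Oplus>p\<in>Pair x ` S x. f p) = (\<Oplus>z\<in>S x. f (x, z))"
    using insert by (intro finsum_reindex) (auto simp: inj_on_def)
  finally show ?case
    using insert by (subst finsum_insert) auto
qed auto

section \<open>Conjugates of subgroups\<close>

context group begin

lemma conj_mem: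
  assumes "g \<in> carrier G" "H \<subseteq> carrier G"
  shows "x \<in> conj_subgp G g H \<longleftrightarrow> x \<in> carrier G \<and> inv g \<otimes> x \<otimes> g \<in> H"
proof
  assume "x \<in> conj_subgp G g H"
  then obtain h where "h \<in> H" "x = g \<otimes> h \<otimes> inv g"
    by (auto simp: conj_subgp_def l_coset_def r_coset_def)
  then show "x \<in> carrier G \<and> inv g \<otimes> x \<otimes> g \<in> H"
    using assms by (auto simp: m_assoc subset_iff) (simp add: m_assoc[symmetric] subset_iff)
next
  assume *: "x \<in> carrier G \<and> inv g \<otimes> x \<otimes> g \<in> H"
  then have "x = g \<otimes> (inv g \<otimes> x \<otimes> g) \<otimes> inv g"
    using assms by (simp add: m_assoc) (simp add: m_assoc[symmetric])
  with * show "x \<in> conj_subgp G g H"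
    unfolding conj_subgp_def l_coset_def r_coset_def by blast
qed

lemma conj_cancel:
  assumes "g \<in> carrier G" "h \<in> carrier G"
  shows "inv g \<otimes> (g \<otimes> h \<otimes> inv g) \<otimes> g = h" "g \<otimes> (inv g \<otimes> h \<otimes> g) \<otimes> inv g = h"
  using assms by (simp_all add: m_assoc) (simp_all add: m_assoc[symmetric])

lemma conj_image:
  assumes "g \<in> carrier G" "H \<subseteq> carrier G"
  shows "conj_subgp G g H = (\<lambda>h. g \<otimes> h \<otimes> inv g) ` H"
  by (auto simp: conj_subgp_def l_coset_def r_coset_def)

lemma conj_one: "H \<subseteq> carrier G \<Longrightarrow> conj_subgp G \<one> H = H"
  by (simp add: conj_image subset_iff cong: image_cong)

lemma conj_subset: "g \<in> carrier G \<Longrightarrow> H \<subseteq> carrier G \<Longrightarrow> conj_subgp G g H \<subseteq> carrier G"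
  by (auto simp: conj_mem)

lemma conj_conj:
  assumes "g \<in> carrier G" "h \<in> carrier G" "H \<subseteq> carrier G"
  shows "conj_subgp G g (conj_subgp G h H) = conj_subgp G (g \<otimes> h) H"
  using assms by (auto simp: conj_mem conj_subset inv_mult_group m_assoc)

lemma conj_inv_conj:
  assumes "g \<in> carrier G" "H \<subseteq> carrier G"
  shows "conj_subgp G (inv g) (conj_subgp G g H) = H" "conj_subgp G g (conj_subgp G (inv g) H) = H"
  using assms by (simp_all add: conj_conj conj_one)

lemma conj_Int:
  assumes "g \<in> carrier G" "A \<subseteq> carrier G" "B \<subseteq> carrier G"
  shows "conj_subgp G g (A \<inter> B) = conj_subgp G g A \<inter> conj_subgp G g B"
proof -
  have "A \<inter> B \<subseteq> carrier G" using assms by auto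
  then show ?thesis using assms by (auto simp: conj_mem)
qed

lemma conj_mono:
  assumes "g \<in> carrier G" "B \<subseteq> carrier G" "A \<subseteq> B"
  shows "conj_subgp G g A \<subseteq> conj_subgp G g B"
proof -
  have "A \<subseteq> carrier G" using assms by auto
  then show ?thesis using assms by (auto simp: conj_mem)
qed

lemma conj_subgroup:
  assumes "subgroup H G" "g \<in> carrier G"
  shows "subgroup (conj_subgp G g H) G"
proof -
  interpret H: subgroup H G by fact
  have HG: "H \<subseteq> carrier G" by (rule H.subset)
  show ?thesis
  proof (rule subgroupI)
    show "conj_subgp G g H \<subseteq> carrier G" using conj_subset assms HG by auto
    have "\<one> \<in> conj_subgp G g H" using assms HG by (simp add: conj_mem)
    then show "conj_subgp G g H \<noteq> {}" by auto
  next
    fix a assume a: "a \<in> conj_subgp G g H"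
    then have "inv (inv g \<otimes> a \<otimes> g) \<in> H" using assms HG by (simp add: conj_mem)
    with a show "inv a \<in> conj_subgp G g H"
      using assms HG by (simp add: conj_mem inv_mult_group m_assoc)
  next
    fix a b assume ab: "a \<in> conj_subgp G g H" "b \<in> conj_subgp G g H"
    then have "(inv g \<otimes> a \<otimes> g) \<otimes> (inv g \<otimes> b \<otimes> g) \<in> H" using assms HG by (simp add: conj_mem)
    moreover have "(inv g \<otimes> a \<otimes> g) \<otimes> (inv g \<otimes> b \<otimes> g) = inv g \<otimes> (a \<otimes> b) \<otimes> g"
      using ab assms HG by (simp add: conj_mem m_assoc) (simp add: m_assoc[symmetric])
    ultimately show "a \<otimes> b \<in> conj_subgp G g H" using ab assms HG by (simp add: conj_mem)
  qed
qed

lemma conj_self: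
  assumes "subgroup H G" "h \<in> H"
  shows "conj_subgp G h H = H"
proof -
  interpret H: subgroup H G by fact
  have "h \<in> carrier G" using assms by auto
  have "x \<in> H" if "inv h \<otimes> x \<otimes> h \<in> H" "x \<in> carrier G" for x
  proof -
    have "h \<otimes> (inv h \<otimes> x \<otimes> h) \<otimes> inv h \<in> H" using that assms by simp
    then show ?thesis using that \<open>h \<in> carrier G\<close> by (simp add: conj_cancel)
  qed
  moreover have "inv h \<otimes> x \<otimes> h \<in> H" if "x \<in> H" for x using that assms by simp
  ultimately show ?thesis
    using conj_mem[OF \<open>h \<in> carrier G\<close> H.subset] H.subset by blast
qed

lemma conj_card:
  assumes "g \<in> carrier G" "H \<subseteq> carrier G"
  shows "card (conj_subgp G g H) = card H"
  unfolding conj_image[OF assms]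
  by (rule card_image, rule inj_onI) (use assms in \<open>simp add: subset_iff\<close>)

section \<open>Representatives of double cosets\<close>

lemma dcoset_mem:
  assumes "J \<subseteq> carrier G" "K \<subseteq> carrier G" "x \<in> carrier G"
  shows "h \<in> J <#> (x <# K) \<longleftrightarrow> (\<exists>j\<in>J. \<exists>k\<in>K. h = j \<otimes> x \<otimes> k)"
  unfolding set_mult_def l_coset_def using assms by (auto simp: m_assoc subset_iff)

lemma dcoset_repsI:
  assumes "J \<subseteq> carrier G" "K \<subseteq> carrier G" "H \<subseteq> carrier G" "T \<subseteq> H"
    and "\<And>h. h \<in> H \<Longrightarrow> \<exists>x\<in>T. \<exists>j\<in>J. \<exists>k\<in>K. h = j \<otimes> x \<otimes> k"
    and "\<And>h x j k x' j' k'. \<lbrakk>x \<in> T; x' \<in> T; j \<in> J; j' \<in> J; k \<in> K; k' \<in> K;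
           j \<otimes> x \<otimes> k = j' \<otimes> x' \<otimes> k'\<rbrakk> \<Longrightarrow> x = x'"
  shows "T \<in> dcoset_reps G J H K"
proof -
  have T: "x \<in> carrier G" if "x \<in> T" for x using that assms by auto
  show ?thesis
    unfolding dcoset_reps_def mem_Collect_eq
  proof (intro conjI ballI)
    fix h assume h: "h \<in> H"
    obtain x j k where "x \<in> T" "j \<in> J" "k \<in> K" "h = j \<otimes> x \<otimes> k"
      using assms(5)[OF h] by blast
    then show "\<exists>!x. x \<in> T \<and> h \<in> J <#> (x <# K)"
      by (intro ex1I[of _ x]) (use assms T in \<open>auto simp: dcoset_mem\<close>)
  qed fact
qed

lemma dcoset_repsD:
  assumes "T \<in> dcoset_reps G J H K" "subgroup J G" "subgroup K G" "subgroup H G" "J \<subseteq> H" "K \<subseteq> H"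
  shows "T \<subseteq> H"
    and "h \<in> H \<Longrightarrow> \<exists>x\<in>T. \<exists>j\<in>J. \<exists>k\<in>K. h = j \<otimes> x \<otimes> k"
    and "\<lbrakk>x \<in> T; x' \<in> T; j \<in> J; k \<in> K; x' = j \<otimes> x \<otimes> k\<rbrakk> \<Longrightarrow> x = x'"
proof -
  interpret J: subgroup J G by fact
  interpret K: subgroup K G by fact
  interpret H: subgroup H G by fact
  show TH: "T \<subseteq> H" using assms by (auto simp: dcoset_reps_def)
  have T: "x \<in> carrier G" if "x \<in> T" for x using that TH by auto
  have e: "\<exists>!x. x \<in> T \<and> h \<in> J <#> (x <# K)" if "h \<in> H" for h
    using assms that by (auto simp: dcoset_reps_def)
  have m: "h \<in> J <#> (x <# K) \<longleftrightarrow> (\<exists>j\<in>J. \<exists>k\<in>K. h = j \<otimes> x \<otimes> k)" if "x \<in> T" for h x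
    by (rule dcoset_mem[OF J.subset K.subset T[OF that]])
  show "\<exists>x\<in>T. \<exists>j\<in>J. \<exists>k\<in>K. h = j \<otimes> x \<otimes> k" if "h \<in> H"
    using e[OF that] m by blast
  show "x = x'" if h: "x \<in> T" "x' \<in> T" "j \<in> J" "k \<in> K" "x' = j \<otimes> x \<otimes> k"
  proof -
    have "x' \<in> J <#> (x' <# K)"
      unfolding m[OF h(2)] by (rule bexI[of _ \<one>], rule bexI[of _ \<one>]) (use T[OF h(2)] in auto)
    moreover have "x' \<in> J <#> (x <# K)" unfolding m[OF h(1)] using h(3-5) by blast
    moreover have "\<exists>!x. x \<in> T \<and> x' \<in> J <#> (x <# K)" by (rule e[OF subsetD[OF TH h(2)]])
    ultimately show ?thesis using h(1,2) by (elim ex1E) metis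
  qed
qed

lemma dcoset_reps_unique:
  assumes "T \<in> dcoset_reps G J H K" "subgroup J G" "subgroup K G" "subgroup H G" "J \<subseteq> H" "K \<subseteq> H"
    and "x \<in> T" "x' \<in> T" "j \<in> J" "k \<in> K" "j' \<in> J" "k' \<in> K" "j' \<otimes> x' \<otimes> k' = j \<otimes> x \<otimes> k"
  shows "x = x'"
proof -
  interpret J: subgroup J G by fact
  interpret K: subgroup K G by fact
  interpret H: subgroup H G by fact
  note D = dcoset_repsD[OF assms(1-6)]
  have c: "x \<in> carrier G" "x' \<in> carrier G" "j \<in> carrier G" "k \<in> carrier G" "j' \<in> carrier G" "k' \<in> carrier G"
    using assms(7-12) D(1) by auto
  have "x' = inv j' \<otimes> (j' \<otimes> x' \<otimes> k') \<otimes> inv k'"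
    using c by (simp add: m_assoc) (simp add: m_assoc[symmetric])
  also have "\<dots> = (inv j' \<otimes> j) \<otimes> x \<otimes> (k \<otimes> inv k')"
    unfolding assms(13) using c by (simp add: m_assoc)
  finally have e: "x' = (inv j' \<otimes> j) \<otimes> x \<otimes> (k \<otimes> inv k')" .
  show ?thesis by (rule D(3)[OF assms(7,8) _ _ e]) (use assms(9-12) in simp_all)
qed

lemma dcoset_reps_exist:
  assumes "subgroup J G" "subgroup K G" "subgroup H G" "J \<subseteq> H" "K \<subseteq> H"
  shows "\<exists>T. T \<in> dcoset_reps G J H K"
proof -
  interpret J: subgroup J G by fact
  interpret K: subgroup K G by fact
  interpret H: subgroup H G by fact
  define c where "c h = {j \<otimes> h \<otimes> k | j k. j \<in> J \<and> k \<in> K}" for h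
  have self: "h \<in> c h" if "h \<in> H" for h
    unfolding c_def mem_Collect_eq by (rule exI[of _ \<one>], rule exI[of _ \<one>]) (use that in auto)
  have sub: "c h' \<subseteq> c h" if h: "h \<in> H" and h': "h' \<in> c h" for h h'
  proof
    fix z assume "z \<in> c h'"
    then obtain j k j' k' where *: "z = j' \<otimes> h' \<otimes> k'" "h' = j \<otimes> h \<otimes> k" "j \<in> J" "j' \<in> J" "k \<in> K" "k' \<in> K"
      using h' by (auto simp: c_def)
    then have "z = (j' \<otimes> j) \<otimes> h \<otimes> (k \<otimes> k')" using h by (simp add: m_assoc)
    then show "z \<in> c h" using * unfolding c_def by blast
  qed
  have symm: "h \<in> c h'" if h: "h \<in> H" and h': "h' \<in> c h" for h h'
  proof -
    obtain j k where *: "h' = j \<otimes> h \<otimes> k" "j \<in> J" "k \<in> K" using h' by (auto simp: c_def)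
    then have "h = inv j \<otimes> h' \<otimes> inv k"
      using h by (simp add: m_assoc) (simp add: m_assoc[symmetric])
    then show ?thesis using * unfolding c_def by blast
  qed
  have cH: "c h \<subseteq> H" if "h \<in> H" for h using that assms by (auto simp: c_def subset_iff)
  \<comment> \<open>The choice depends on the double coset as a set, so all its elements get the
    same representative.\<close>
  define r where "r h = (SOME x. x \<in> c h)" for h
  have r: "r h \<in> c h" if "h \<in> H" for h unfolding r_def by (rule someI[of "\<lambda>x. x \<in> c h", OF self[OF that]])
  have ceq: "c h' = c h" if "h \<in> H" "h' \<in> c h" for h h'
    using sub[OF that] sub[OF _ symm[OF that]] that cH by blast
  have req: "r h' = r h" if "h \<in> H" "h' \<in> c h" for h h'
    using ceq[OF that] by (simp add: r_def)
  have "r ` H \<in> dcoset_reps G J H K"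
  proof (rule dcoset_repsI[OF J.subset K.subset H.subset])
    show "r ` H \<subseteq> H" using r cH by blast
  next
    fix h assume h: "h \<in> H"
    have "h \<in> c (r h)" by (rule symm[OF h r[OF h]])
    then show "\<exists>x\<in>r ` H. \<exists>j\<in>J. \<exists>k\<in>K. h = j \<otimes> x \<otimes> k" using h unfolding c_def by blast
  next
    fix h x j k x' j' k'
    assume *: "x \<in> r ` H" "x' \<in> r ` H" "j \<in> J" "j' \<in> J" "k \<in> K" "k' \<in> K" "j \<otimes> x \<otimes> k = j' \<otimes> x' \<otimes> k'"
    then obtain h h' where h: "h \<in> H" "x = r h" "h' \<in> H" "x' = r h'" by auto
    have xH: "x \<in> H" "x' \<in> H" using h r cH by blast+
    have "j \<otimes> x \<otimes> k \<in> c x" "j \<otimes> x \<otimes> k \<in> c x'" using * unfolding c_def by blast+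
    then have "r x = r x'" using req xH by metis
    moreover have "r x = x" "r x' = x'" using h req r by blast+
    ultimately show "x = x'" by simp
  qed
  then show ?thesis by blast
qed

text \<open>A fixed choice, made so that restriction in the Burnside functor can be written down;
  \<open>res_indep\<close> shows that the choice does not matter there.\<close>

definition reps :: "'a set \<Rightarrow> 'a set \<Rightarrow> 'a set \<Rightarrow> 'a set" where
  "reps J H K = (SOME T. T \<in> dcoset_reps G J H K)"

lemma reps_in:
  assumes "subgroup J G" "subgroup K G" "subgroup H G" "J \<subseteq> H" "K \<subseteq> H"
  shows "reps J H K \<in> dcoset_reps G J H K"
  unfolding reps_def using dcoset_reps_exist[OF assms] by (rule someI_ex)

text \<open>Sending an element of \<open>T'\<close> to the representative of its double coset in
  \<open>T\<close> is a bijection, and \<open>f\<close> is constant on double cosets.\<close>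

lemma dcoset_finsum_indep:
  assumes "T \<in> dcoset_reps G J H K" "T' \<in> dcoset_reps G J H K"
    and "subgroup J G" "subgroup K G" "subgroup H G" "J \<subseteq> H" "K \<subseteq> H"
    and M: "abelian_monoid M" and f: "\<And>x. x \<in> H \<Longrightarrow> f x \<in> carrier M"
    and inv: "\<And>x j k. \<lbrakk>x \<in> H; j \<in> J; k \<in> K\<rbrakk> \<Longrightarrow> f (j \<otimes> x \<otimes> k) = f x"
  shows "(\<Oplus>\<^bsub>M\<^esub>x\<in>T. f x) = (\<Oplus>\<^bsub>M\<^esub>x\<in>T'. f x)"
proof -
  interpret M: abelian_monoid M by fact
  interpret J: subgroup J G by fact
  interpret K: subgroup K G by fact
  interpret H: subgroup H G by fact
  note D = dcoset_repsD[OF assms(1,3-7)] and D' = dcoset_repsD[OF assms(2,3-7)]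
  define P where "P h x \<longleftrightarrow> x \<in> T \<and> (\<exists>j\<in>J. \<exists>k\<in>K. h = j \<otimes> x \<otimes> k)" for h x
  define r where "r h = (SOME x. P h x)" for h
  have r: "r h \<in> T" "\<exists>j\<in>J. \<exists>k\<in>K. h = j \<otimes> r h \<otimes> k" if "h \<in> T'" for h
  proof -
    have "\<exists>x. P h x" using D(2)[of h] that D'(1) unfolding P_def by blast
    then have "P h (r h)" unfolding r_def by (rule someI_ex)
    then show "r h \<in> T" "\<exists>j\<in>J. \<exists>k\<in>K. h = j \<otimes> r h \<otimes> k" by (auto simp: P_def)
  qed
  have inj: "inj_on r T'"
  proof (rule inj_onI)
    fix h h' assume h: "h \<in> T'" "h' \<in> T'" "r h = r h'"
    obtain y where y: "y = r h" by blast
    obtain j k where 1: "j \<in> J" "k \<in> K" "h = j \<otimes> y \<otimes> k" using r(2)[OF h(1)] y by blast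
    obtain j' k' where 2: "j' \<in> J" "k' \<in> K" "h' = j' \<otimes> y \<otimes> k'" using r(2)[OF h(2)] unfolding h(3)[symmetric] y[symmetric] by blast
    have c: "y \<in> carrier G" using r(1)[OF h(1)] D(1) y by auto
    have "inv j \<otimes> h \<otimes> inv k = inv j' \<otimes> h' \<otimes> inv k'"
    proof -
      have "inv j \<otimes> h \<otimes> inv k = y" unfolding 1(3)
        using 1(1,2) c by (simp add: m_assoc) (simp add: m_assoc[symmetric])
      moreover have "inv j' \<otimes> h' \<otimes> inv k' = y" unfolding 2(3)
        using 2(1,2) c by (simp add: m_assoc) (simp add: m_assoc[symmetric])
      ultimately show ?thesis by simp
    qed
    then show "h = h'"
      by (intro dcoset_reps_unique[OF assms(2,3-7) h(1,2), of "inv j" "inv k" "inv j'" "inv k'"])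
        (use 1(1,2) 2(1,2) in simp_all)
  qed
  have img: "r ` T' = T"
  proof
    show "r ` T' \<subseteq> T" using r by blast
    show "T \<subseteq> r ` T'"
    proof
      fix x assume x: "x \<in> T"
      then obtain x' j k where x': "x' \<in> T'" "j \<in> J" "k \<in> K" "x = j \<otimes> x' \<otimes> k" using D'(2)[of x] D(1) by blast
      obtain j1 k1 where 1: "j1 \<in> J" "k1 \<in> K" "x' = j1 \<otimes> r x' \<otimes> k1" using r(2)[OF x'(1)] by blast
      have c: "r x' \<in> carrier G" using r(1)[OF x'(1)] D(1) by auto
      have "x = j \<otimes> (j1 \<otimes> r x' \<otimes> k1) \<otimes> k" by (subst 1(3)[symmetric]) (rule x'(4))
      also have "\<dots> = (j \<otimes> j1) \<otimes> r x' \<otimes> (k1 \<otimes> k)" using 1(1,2) x'(2,3) c by (simp add: m_assoc)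
      finally have e: "x = (j \<otimes> j1) \<otimes> r x' \<otimes> (k1 \<otimes> k)" .
      have "r x' = x"
        by (rule D(3)[OF r(1)[OF x'(1)] x _ _ e]) (use 1(1,2) x'(2,3) in simp_all)
      then show "x \<in> r ` T'" using x'(1) by blast
    qed
  qed
  have fr: "f (r h) = f h" if h: "h \<in> T'" for h
  proof -
    obtain j k where j: "j \<in> J" and k: "k \<in> K" and e: "h = j \<otimes> r h \<otimes> k"
      using r(2)[OF h] by (elim bexE)
    have "f h = f (j \<otimes> r h \<otimes> k)" by (rule arg_cong[OF e])
    also have "\<dots> = f (r h)" by (rule inv[OF subsetD[OF D(1) r(1)[OF h]] j k])
    finally show ?thesis by (rule sym)
  qed
  have fT: "f \<in> T \<rightarrow> carrier M" "f \<in> T' \<rightarrow> carrier M"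
    by (rule Pi_I, rule f, erule subsetD[OF D(1)], rule Pi_I, rule f, erule subsetD[OF D'(1)])
  have "(\<Oplus>\<^bsub>M\<^esub>x\<in>T. f x) = (\<Oplus>\<^bsub>M\<^esub>x\<in>T'. f (r x))"
    using M.finsum_reindex[of f r T', OF _ inj] fT(1) unfolding img .
  also have "\<dots> = (\<Oplus>\<^bsub>M\<^esub>x\<in>T'. f x)"
    by (rule M.finsum_cong'[OF refl fT(2) fr])
  finally show ?thesis .
qed

lemma dcoset_refine_left:
  assumes T: "T \<in> dcoset_reps G J H K" and sub: "subgroup J G" "subgroup K G" "subgroup H G" "J \<subseteq> H" "K \<subseteq> H"
    and L: "subgroup L G" "L \<subseteq> K"
    and S: "\<And>x. x \<in> T \<Longrightarrow> S x \<in> dcoset_reps G (conj_subgp G (inv x) J \<inter> K) K L"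
  shows "(\<lambda>(x, z). x \<otimes> z) ` Sigma T S \<in> dcoset_reps G J H L" (is ?A)
    and "inj_on (\<lambda>(x, z). x \<otimes> z) (Sigma T S)" (is ?B)
proof -
  interpret J: subgroup J G by fact
  interpret K: subgroup K G by fact
  interpret H: subgroup H G by fact
  interpret L: subgroup L G by fact
  note D = dcoset_repsD[OF T sub]
  have TG: "x \<in> carrier G" "x \<in> H" if "x \<in> T" for x using that D(1) by auto
  have sub': "subgroup (conj_subgp G (inv x) J \<inter> K) G" if "x \<in> T" for x
    using subgroups_Inter_pair conj_subgroup TG that sub by simp
  note E = dcoset_repsD[OF S sub' L(1) sub(2) _ L(2)]
  have SG: "z \<in> carrier G" "z \<in> K" if "x \<in> T" "z \<in> S x" for x z using that E(1)[of x] by auto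
  have mem: "a \<in> conj_subgp G (inv x) J \<longleftrightarrow> a \<in> carrier G \<and> x \<otimes> a \<otimes> inv x \<in> J" if "x \<in> T" for a x
    using conj_mem[of "inv x" J a] TG[OF that] J.subset by simp
  have un: "x = x' \<and> z = z'" if h: "x \<in> T" "z \<in> S x" "x' \<in> T" "z' \<in> S x'" "j \<in> J" "j' \<in> J" "l \<in> L" "l' \<in> L"
      "j \<otimes> (x \<otimes> z) \<otimes> l = j' \<otimes> (x' \<otimes> z') \<otimes> l'" for x z x' z' j l j' l'
  proof -
    have c: "z \<in> carrier G" "z' \<in> carrier G" "x \<in> carrier G" "x' \<in> carrier G" "z \<in> K" "z' \<in> K" "l \<in> K" "l' \<in> K"
      "l \<in> carrier G" "l' \<in> carrier G" "j \<in> carrier G" "j' \<in> carrier G"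
      using h SG TG L by auto
    have "j' \<otimes> x' \<otimes> (z' \<otimes> l') = j \<otimes> x \<otimes> (z \<otimes> l)" using h(9) c by (simp add: m_assoc)
    then have xx: "x = x'"
      using dcoset_reps_unique[OF T sub h(1,3), of j "z \<otimes> l" j' "z' \<otimes> l'"] h c by simp
    \<comment> \<open>\<open>a\<close> carries \<open>z\<close> to \<open>z'\<close> up to
      \<open>L\<close>: it is in the conjugate of \<open>J\<close> by construction, and in
      \<open>K\<close> because \<open>a z l = z' l'\<close>. So it compares \<open>z\<close> and
      \<open>z'\<close> as representatives for the same \<open>x\<close>.\<close>
    define a where "a = inv x \<otimes> inv j' \<otimes> j \<otimes> x"
    have a1: "a \<in> carrier G" using c by (simp add: a_def)
    have e: "a \<otimes> z \<otimes> l = z' \<otimes> l'"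
    proof -
      have "a \<otimes> z \<otimes> l = inv x \<otimes> inv j' \<otimes> (j \<otimes> (x \<otimes> z) \<otimes> l)" using c by (simp add: a_def m_assoc)
      also have "\<dots> = inv x \<otimes> inv j' \<otimes> (j' \<otimes> (x \<otimes> z') \<otimes> l')" using h(9) xx by simp
      also have "\<dots> = z' \<otimes> l'" using c by (simp add: m_assoc) (simp add: m_assoc[symmetric])
      finally show ?thesis .
    qed
    have "a = (a \<otimes> z \<otimes> l) \<otimes> inv l \<otimes> inv z" using c a1 by (simp add: m_assoc)
    then have "a = z' \<otimes> l' \<otimes> inv l \<otimes> inv z" unfolding e .
    then have "a \<in> K" using c by simp
    moreover have "x \<otimes> a \<otimes> inv x = inv j' \<otimes> j" using c by (simp add: a_def m_assoc) (simp add: m_assoc[symmetric])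
    then have "x \<otimes> a \<otimes> inv x \<in> J" using h by simp
    ultimately have aa: "a \<in> conj_subgp G (inv x) J \<inter> K" using mem[OF h(1)] a1 by simp
    have "z = z'"
      by (rule dcoset_reps_unique[OF S[OF h(1)] sub'[OF h(1)] L(1) sub(2) _ L(2) h(2), of z' a l \<one> l'])
        (use h xx aa e c subgroup.one_closed[OF sub'[OF h(1)]] in auto)
    with xx show ?thesis by simp
  qed
  show ?A
  proof (rule dcoset_repsI[OF J.subset L.subset H.subset])
    show "(\<lambda>(x, z). x \<otimes> z) ` Sigma T S \<subseteq> H" using TG SG sub by (auto simp: subset_iff)
  next
    fix h assume "h \<in> H"
    then obtain x j k where x: "x \<in> T" "j \<in> J" "k \<in> K" "h = j \<otimes> x \<otimes> k" using D(2) by blast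
    have "\<exists>z\<in>S x. \<exists>a\<in>conj_subgp G (inv x) J \<inter> K. \<exists>l\<in>L. k = a \<otimes> z \<otimes> l"
      by (rule E(2)) (use x in auto)
    then obtain z a l where z: "z \<in> S x" "a \<in> conj_subgp G (inv x) J \<inter> K" "l \<in> L" "k = a \<otimes> z \<otimes> l" by blast
    have c: "z \<in> carrier G" "x \<in> carrier G" "j \<in> carrier G" "a \<in> carrier G" using x TG SG z by auto
    have "h = (j \<otimes> (x \<otimes> a \<otimes> inv x)) \<otimes> (x \<otimes> z) \<otimes> l"
      unfolding x(4) z(4) using c z(3) by (simp add: m_assoc) (simp add: m_assoc[symmetric])
    moreover have "j \<otimes> (x \<otimes> a \<otimes> inv x) \<in> J" using z(2) mem[OF x(1)] x by simp
    moreover have "x \<otimes> z \<in> (\<lambda>(x, z). x \<otimes> z) ` Sigma T S"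
      by (rule image_eqI[of _ _ "(x, z)"]) (use x(1) z(1) in simp_all)
    ultimately show "\<exists>y\<in>(\<lambda>(x, z). x \<otimes> z) ` Sigma T S. \<exists>j\<in>J. \<exists>k\<in>L. h = j \<otimes> y \<otimes> k"
      using z(3) by blast
  next
    fix h y j l y' j' l'
    assume "y \<in> (\<lambda>(x, z). x \<otimes> z) ` Sigma T S" "y' \<in> (\<lambda>(x, z). x \<otimes> z) ` Sigma T S"
      "j \<in> J" "j' \<in> J" "l \<in> L" "l' \<in> L" "j \<otimes> y \<otimes> l = j' \<otimes> y' \<otimes> l'"
    then obtain x z x' z' where *: "x \<in> T" "z \<in> S x" "x' \<in> T" "z' \<in> S x'" "y = x \<otimes> z" "y' = x' \<otimes> z'" by auto
    then show "y = y'" using un[OF *(1-4) \<open>j \<in> J\<close> \<open>j' \<in> J\<close> \<open>l \<in> L\<close> \<open>l' \<in> L\<close>] \<open>j \<otimes> y \<otimes> l = j' \<otimes> y' \<otimes> l'\<close> by simp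
  qed
  show ?B
  proof (rule inj_onI, clarify)
    fix x z x' z' assume h: "x \<in> T" "z \<in> S x" "x' \<in> T" "z' \<in> S x'" "x \<otimes> z = x' \<otimes> z'"
    then show "x = x' \<and> z = z'"
      using un[of x z x' z' \<one> \<one> \<one> \<one>] by simp
  qed
qed

text \<open>The mirror image: a double coset \<open>JyL\<close> splits under a subgroup
  \<open>I\<close> of \<open>J\<close> as \<open>J\<close> does under \<open>I\<close> and
  \<open>J \<inter> yLy^-1\<close>, the stabiliser in \<open>J\<close> of the coset
  \<open>yL\<close>. It yields transitivity of restriction.\<close>

lemma dcoset_refine_right:
  assumes T: "T \<in> dcoset_reps G J K L" and sub: "subgroup J G" "subgroup L G" "subgroup K G" "J \<subseteq> K" "L \<subseteq> K"
    and I: "subgroup I G" "I \<subseteq> J"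
    and S: "\<And>y. y \<in> T \<Longrightarrow> S y \<in> dcoset_reps G I J (J \<inter> conj_subgp G y L)"
  shows "(\<lambda>(y, z). z \<otimes> y) ` Sigma T S \<in> dcoset_reps G I K L" (is ?A)
    and "inj_on (\<lambda>(y, z). z \<otimes> y) (Sigma T S)" (is ?B)
proof -
  interpret J: subgroup J G by fact
  interpret K: subgroup K G by fact
  interpret I: subgroup I G by fact
  interpret L: subgroup L G by fact
  note D = dcoset_repsD[OF T sub]
  have TG: "x \<in> carrier G" "x \<in> K" if "x \<in> T" for x using that D(1) by auto
  have sub': "subgroup (J \<inter> conj_subgp G x L) G" if "x \<in> T" for x
    using subgroups_Inter_pair conj_subgroup TG that sub by simp
  note E = dcoset_repsD[OF S I(1) sub' sub(1) I(2) Int_lower1]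
  have SG: "z \<in> carrier G" "z \<in> J" if "x \<in> T" "z \<in> S x" for x z using that E(1)[of x] by auto
  have mem: "a \<in> conj_subgp G x L \<longleftrightarrow> a \<in> carrier G \<and> inv x \<otimes> a \<otimes> x \<in> L" if "x \<in> T" for a x
    using conj_mem[of x L a] TG[OF that] L.subset by simp
  have un: "x = x' \<and> z = z'" if h: "x \<in> T" "z \<in> S x" "x' \<in> T" "z' \<in> S x'" "j \<in> I" "j' \<in> I" "l \<in> L" "l' \<in> L"
      "j \<otimes> (z \<otimes> x) \<otimes> l = j' \<otimes> (z' \<otimes> x') \<otimes> l'" for x z x' z' j l j' l'
  proof -
    have c: "z \<in> carrier G" "z' \<in> carrier G" "x \<in> carrier G" "x' \<in> carrier G" "z \<in> J" "z' \<in> J" "j \<in> J" "j' \<in> J"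
      "l \<in> carrier G" "l' \<in> carrier G" "j \<in> carrier G" "j' \<in> carrier G"
      using h SG TG I by auto
    have "(j' \<otimes> z') \<otimes> x' \<otimes> l' = (j \<otimes> z) \<otimes> x \<otimes> l" using h(9) c by (simp add: m_assoc)
    then have xx: "x = x'"
      using dcoset_reps_unique[OF T sub h(1,3), of "j \<otimes> z" l "j' \<otimes> z'" l'] h c by simp
    define a where "a = x \<otimes> l \<otimes> inv l' \<otimes> inv x"
    have a1: "a \<in> carrier G" using c by (simp add: a_def)
    have e: "j \<otimes> z \<otimes> a = j' \<otimes> z'"
    proof -
      have "j \<otimes> z \<otimes> a = (j \<otimes> (z \<otimes> x) \<otimes> l) \<otimes> inv l' \<otimes> inv x" using c by (simp add: a_def m_assoc)
      also have "\<dots> = (j' \<otimes> (z' \<otimes> x) \<otimes> l') \<otimes> inv l' \<otimes> inv x" using h(9) xx by simp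
      also have "\<dots> = j' \<otimes> z'" using c by (simp add: m_assoc)
      finally show ?thesis .
    qed
    have "a = inv z \<otimes> inv j \<otimes> (j \<otimes> z \<otimes> a)" using c a1
      by (simp add: m_assoc) (simp add: m_assoc[symmetric])
    then have "a = inv z \<otimes> inv j \<otimes> (j' \<otimes> z')" unfolding e .
    then have "a \<in> J" using c by simp
    moreover have "inv x \<otimes> a \<otimes> x = l \<otimes> inv l'" using c by (simp add: a_def m_assoc) (simp add: m_assoc[symmetric])
    then have "inv x \<otimes> a \<otimes> x \<in> L" using h by simp
    ultimately have aa: "a \<in> J \<inter> conj_subgp G x L" using mem[OF h(1)] a1 by simp
    have "z = z'"
      by (rule dcoset_reps_unique[OF S[OF h(1)] I(1) sub'[OF h(1)] sub(1) I(2) _ h(2), of z' j a j' \<one>])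
        (use h xx aa e c subgroup.one_closed[OF sub'[OF h(1)]] in auto)
    with xx show ?thesis by simp
  qed
  show ?A
  proof (rule dcoset_repsI[OF I.subset L.subset K.subset])
    show "(\<lambda>(x, z). z \<otimes> x) ` Sigma T S \<subseteq> K" using TG SG sub by (auto simp: subset_iff)
  next
    fix h assume "h \<in> K"
    then obtain x j l where x: "x \<in> T" "j \<in> J" "l \<in> L" "h = j \<otimes> x \<otimes> l" using D(2) by blast
    have "\<exists>z\<in>S x. \<exists>i\<in>I. \<exists>a\<in>J \<inter> conj_subgp G x L. j = i \<otimes> z \<otimes> a"
      by (rule E(2)) (use x in auto)
    then obtain z a i where z: "z \<in> S x" "a \<in> J \<inter> conj_subgp G x L" "i \<in> I" "j = i \<otimes> z \<otimes> a" by blast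
    have c: "z \<in> carrier G" "x \<in> carrier G" "a \<in> carrier G" "i \<in> carrier G" using x TG SG z by auto
    have "h = i \<otimes> (z \<otimes> x) \<otimes> ((inv x \<otimes> a \<otimes> x) \<otimes> l)"
      unfolding x(4) z(4) using c x(3) by (simp add: m_assoc) (simp add: m_assoc[symmetric])
    moreover have "(inv x \<otimes> a \<otimes> x) \<otimes> l \<in> L" using z(2) mem[OF x(1)] x by simp
    moreover have "z \<otimes> x \<in> (\<lambda>(x, z). z \<otimes> x) ` Sigma T S"
      by (rule image_eqI[of _ _ "(x, z)"]) (use x(1) z(1) in simp_all)
    ultimately show "\<exists>y\<in>(\<lambda>(x, z). z \<otimes> x) ` Sigma T S. \<exists>j\<in>I. \<exists>k\<in>L. h = j \<otimes> y \<otimes> k"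
      using z(3) by blast
  next
    fix h y j l y' j' l'
    assume "y \<in> (\<lambda>(x, z). z \<otimes> x) ` Sigma T S" "y' \<in> (\<lambda>(x, z). z \<otimes> x) ` Sigma T S"
      "j \<in> I" "j' \<in> I" "l \<in> L" "l' \<in> L" "j \<otimes> y \<otimes> l = j' \<otimes> y' \<otimes> l'"
    then obtain x z x' z' where *: "x \<in> T" "z \<in> S x" "x' \<in> T" "z' \<in> S x'" "y = z \<otimes> x" "y' = z' \<otimes> x'" by auto
    then show "y = y'" using un[OF *(1-4) \<open>j \<in> I\<close> \<open>j' \<in> I\<close> \<open>l \<in> L\<close> \<open>l' \<in> L\<close>] \<open>j \<otimes> y \<otimes> l = j' \<otimes> y' \<otimes> l'\<close> by simp
  qed
  show ?B
  proof (rule inj_onI, clarify)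
    fix x z x' z' assume h: "x \<in> T" "z \<in> S x" "x' \<in> T" "z' \<in> S x'" "z \<otimes> x = z' \<otimes> x'"
    then show "x = x' \<and> z = z'"
      using un[of x z x' z' \<one> \<one> \<one> \<one>] SG TG by simp
  qed
qed

end

context group begin

text \<open>\<open>J y (hLh^-1) h = J (yh) L\<close>. It is needed because a pair may be replaced by
  an \<open>H\<close>-conjugate one when restriction is evaluated on an orbit.\<close>

lemma dcoset_reps_translate:
  assumes T: "T \<in> dcoset_reps G J K (conj_subgp G h L)"
    and sub: "subgroup J G" "subgroup L G" "subgroup K G" "J \<subseteq> K" "L \<subseteq> K" "h \<in> K"
  shows "(\<lambda>y. y \<otimes> h) ` T \<in> dcoset_reps G J K L"
proof -
  interpret J: subgroup J G by fact
  interpret K: subgroup K G by fact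
  interpret L: subgroup L G by fact
  have hG: "h \<in> carrier G" using sub by auto
  have cs: "subgroup (conj_subgp G h L) G" by (rule conj_subgroup[OF sub(2) hG])
  have cK: "conj_subgp G h L \<subseteq> K"
    using conj_mono[OF hG K.subset sub(5)] conj_self[OF sub(3,6)] by simp
  note D = dcoset_repsD[OF T sub(1) cs sub(3,4) cK]
  have TG: "x \<in> carrier G" "x \<in> K" if "x \<in> T" for x using that D(1) by auto
  have mem: "h \<otimes> l \<otimes> inv h \<in> conj_subgp G h L" if "l \<in> L" for l
    unfolding conj_image[OF hG L.subset] using that by (rule imageI)
  show ?thesis
  proof (rule dcoset_repsI[OF J.subset L.subset K.subset])
    show "(\<lambda>y. y \<otimes> h) ` T \<subseteq> K" using TG sub by auto
  next
    fix g assume g: "g \<in> K"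
    then have "g \<otimes> inv h \<in> K" using sub by simp
    then obtain x j l where x: "x \<in> T" "j \<in> J" "l \<in> conj_subgp G h L" "g \<otimes> inv h = j \<otimes> x \<otimes> l"
      using D(2) by blast
    then obtain l' where l': "l' \<in> L" "l = h \<otimes> l' \<otimes> inv h" using hG by (auto simp: conj_image[OF hG L.subset])
    have "g = g \<otimes> inv h \<otimes> h" using g hG by (simp add: m_assoc)
    also have "\<dots> = j \<otimes> x \<otimes> (h \<otimes> l' \<otimes> inv h) \<otimes> h" by (simp add: x(4) l'(2))
    also have "\<dots> = j \<otimes> (x \<otimes> h) \<otimes> l'" using x(2) TG(1)[OF x(1)] l'(1) hG by (simp add: m_assoc)
    finally show "\<exists>y\<in>(\<lambda>y. y \<otimes> h) ` T. \<exists>j\<in>J. \<exists>k\<in>L. g = j \<otimes> y \<otimes> k" using x l' by blast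
  next
    fix g y j l y' j' l'
    assume *: "y \<in> (\<lambda>y. y \<otimes> h) ` T" "y' \<in> (\<lambda>y. y \<otimes> h) ` T" "j \<in> J" "j' \<in> J" "l \<in> L" "l' \<in> L"
      "j \<otimes> y \<otimes> l = j' \<otimes> y' \<otimes> l'"
    then obtain x x' where x: "x \<in> T" "x' \<in> T" "y = x \<otimes> h" "y' = x' \<otimes> h" by auto
    have c: "x \<in> carrier G" "x' \<in> carrier G" using x TG by auto
    have "j \<otimes> x \<otimes> (h \<otimes> l \<otimes> inv h) = (j \<otimes> y \<otimes> l) \<otimes> inv h" using *(3-6) c hG by (simp add: x m_assoc)
    also have "\<dots> = (j' \<otimes> y' \<otimes> l') \<otimes> inv h" by (simp add: *(7))
    also have "\<dots> = j' \<otimes> x' \<otimes> (h \<otimes> l' \<otimes> inv h)" using *(3-6) c hG by (simp add: x m_assoc)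
    finally have "x' = x"
      by (rule dcoset_reps_unique[OF T sub(1) cs sub(3,4) cK x(2,1) *(4) mem[OF *(6)] *(3) mem[OF *(5)]])
    then show "y = y'" using x by simp
  qed
qed

lemma dcoset_reps_conj:
  assumes T: "T \<in> dcoset_reps G J K L"
    and sub: "subgroup J G" "subgroup L G" "subgroup K G" "J \<subseteq> K" "L \<subseteq> K" and g: "g \<in> carrier G"
  shows "(\<lambda>y. g \<otimes> y \<otimes> inv g) ` T \<in> dcoset_reps G (conj_subgp G g J) (conj_subgp G g K) (conj_subgp G g L)"
proof -
  interpret J: subgroup J G by fact
  interpret K: subgroup K G by fact
  interpret L: subgroup L G by fact
  note D = dcoset_repsD[OF T sub]
  have TG: "x \<in> carrier G" "x \<in> K" if "x \<in> T" for x using that D(1) by auto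
  have e: "g \<otimes> j \<otimes> inv g \<otimes> (g \<otimes> x \<otimes> inv g) \<otimes> (g \<otimes> l \<otimes> inv g) = g \<otimes> (j \<otimes> x \<otimes> l) \<otimes> inv g"
    if "j \<in> carrier G" "x \<in> carrier G" "l \<in> carrier G" for j x l
    using that g by (simp add: m_assoc) (simp add: m_assoc[symmetric])
  show ?thesis
    unfolding conj_image[OF g J.subset] conj_image[OF g K.subset] conj_image[OF g L.subset]
  proof (rule dcoset_repsI)
    show "(\<lambda>y. g \<otimes> y \<otimes> inv g) ` T \<subseteq> (\<lambda>y. g \<otimes> y \<otimes> inv g) ` K" using TG by auto
  next
    fix h assume "h \<in> (\<lambda>y. g \<otimes> y \<otimes> inv g) ` K"
    then obtain y where y: "y \<in> K" "h = g \<otimes> y \<otimes> inv g" by auto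
    obtain x j l where x: "x \<in> T" "j \<in> J" "l \<in> L" "y = j \<otimes> x \<otimes> l" using D(2)[OF y(1)] by blast
    have "h = g \<otimes> j \<otimes> inv g \<otimes> (g \<otimes> x \<otimes> inv g) \<otimes> (g \<otimes> l \<otimes> inv g)"
      using e[of j x l] x TG y by simp
    then show "\<exists>x\<in>(\<lambda>y. g \<otimes> y \<otimes> inv g) ` T. \<exists>j\<in>(\<lambda>y. g \<otimes> y \<otimes> inv g) ` J. \<exists>k\<in>(\<lambda>y. g \<otimes> y \<otimes> inv g) ` L.
                  h = j \<otimes> x \<otimes> k" using x by blast
  next
    fix h y j l y' j' l'
    assume *: "y \<in> (\<lambda>y. g \<otimes> y \<otimes> inv g) ` T" "y' \<in> (\<lambda>y. g \<otimes> y \<otimes> inv g) ` T"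
       "j \<in> (\<lambda>y. g \<otimes> y \<otimes> inv g) ` J" "j' \<in> (\<lambda>y. g \<otimes> y \<otimes> inv g) ` J"
       "l \<in> (\<lambda>y. g \<otimes> y \<otimes> inv g) ` L" "l' \<in> (\<lambda>y. g \<otimes> y \<otimes> inv g) ` L"
       and eq: "j \<otimes> y \<otimes> l = j' \<otimes> y' \<otimes> l'"
    obtain x x' where x: "x \<in> T" "x' \<in> T" "y = g \<otimes> x \<otimes> inv g" "y' = g \<otimes> x' \<otimes> inv g" using *(1,2) by auto
    obtain i i' where i: "i \<in> J" "i' \<in> J" "j = g \<otimes> i \<otimes> inv g" "j' = g \<otimes> i' \<otimes> inv g" using *(3,4) by auto
    obtain m m' where m: "m \<in> L" "m' \<in> L" "l = g \<otimes> m \<otimes> inv g" "l' = g \<otimes> m' \<otimes> inv g" using *(5,6) by auto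
    have c: "x \<in> carrier G" "x' \<in> carrier G" "i \<in> carrier G" "i' \<in> carrier G" "m \<in> carrier G" "m' \<in> carrier G"
      using x TG i m by auto
    have "g \<otimes> (i \<otimes> x \<otimes> m) \<otimes> inv g = g \<otimes> (i' \<otimes> x' \<otimes> m') \<otimes> inv g"
      using eq e c unfolding x i m by simp
    then have "i \<otimes> x \<otimes> m = i' \<otimes> x' \<otimes> m'" using c g by simp
    then have "x' = x" by (rule dcoset_reps_unique[OF T sub x(2,1) i(2) m(2) i(1) m(1)])
    then show "y = y'" using x by simp
  qed (use g in \<open>auto simp: subset_iff\<close>)
qed

lemma dcoset_reps_triv:
  assumes "subgroup H G" "subgroup L G" "L \<subseteq> H"
  shows "{\<one>} \<in> dcoset_reps G H H L"
proof -
  interpret H: subgroup H G by fact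
  interpret L: subgroup L G by fact
  show ?thesis
  proof (rule dcoset_repsI[OF H.subset L.subset H.subset])
    fix h assume h: "h \<in> H"
    show "\<exists>x\<in>{\<one>}. \<exists>j\<in>H. \<exists>k\<in>L. h = j \<otimes> x \<otimes> k"
      by (rule bexI[of _ \<one>], rule bexI[of _ h], rule bexI[of _ \<one>]) (use h in auto)
  qed auto
qed

end

section \<open>The Burnside Mackey functor of a finite G-set\<close>

locale burnside = group G + k: cring k for G (structure) and k :: "('k, 'r) ring_scheme" +
  fixes X :: "'t set" and act :: "'a \<Rightarrow> 't \<Rightarrow> 't"
  assumes finG: "finite (carrier G)" and finX: "finite X"
    and act_closed: "\<lbrakk>g \<in> carrier G; t \<in> X\<rbrakk> \<Longrightarrow> act g t \<in> X"
    and act_one: "t \<in> X \<Longrightarrow> act \<one> t = t"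
    and act_mult: "\<lbrakk>g \<in> carrier G; h \<in> carrier G; t \<in> X\<rbrakk> \<Longrightarrow> act g (act h t) = act (g \<otimes> h) t"
begin

definition stab :: "'t \<Rightarrow> 'a set" where "stab t = {g \<in> carrier G. act g t = t}"

definition gact :: "'a \<Rightarrow> 'a set \<times> 't \<Rightarrow> 'a set \<times> 't" where
  "gact g b = (conj_subgp G g (fst b), act g (snd b))"

definition adm :: "'a set \<Rightarrow> ('a set \<times> 't) set" where
  "adm K = {(L, t). subgroup L G \<and> L \<subseteq> K \<and> t \<in> X \<and> L \<subseteq> stab t}"

definition pair_orbit :: "'a set \<Rightarrow> 'a set \<times> 't \<Rightarrow> ('a set \<times> 't) set" where
  "pair_orbit K b = (\<lambda>g. gact g b) ` K"

definition pair_orbits :: "'a set \<Rightarrow> ('a set \<times> 't) set set" where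
  "pair_orbits K = pair_orbit K ` adm K"

definition orbit_vec :: "'a set \<Rightarrow> 'a set \<times> 't \<Rightarrow> ('a set \<times> 't) set \<Rightarrow> 'k" where
  "orbit_vec K b = unit_vec k (pair_orbit K b)"

abbreviation FM where "FM K \<equiv> fmod k (pair_orbits K)"

text \<open>The value on an orbit is read off at a chosen pair in it, so this is the intended linear
  extension only for \<open>v\<close> constant on \<open>K\<close>-orbits; that condition appears in
  \<open>orbit_lin_bas\<close>.\<close>

definition orbit_lin :: "('k, 'm) module \<Rightarrow> 'a set \<Rightarrow> ('a set \<times> 't \<Rightarrow> 'm) \<Rightarrow> (('a set \<times> 't) set \<Rightarrow> 'k) \<Rightarrow> 'm" where
  "orbit_lin M K v = lin M (pair_orbits K) (\<lambda>\<beta>. v (SOME b. b \<in> \<beta>))"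

text \<open>The pair \<open>(L, t)\<close> stands for the map \<open>K/L \<rightarrow> X\<close> of \<open>K\<close>-sets sending \<open>L\<close> to \<open>t\<close>; isomorphic maps form
  one orbit of \<open>K\<close> on pairs. Induction is composition, restriction is given by the orbits of \<open>J\<close> on \<open>H/L\<close>.\<close>

definition F :: "('a, 'k, ('a set \<times> 't) set \<Rightarrow> 'k) mackey" where
  "F = \<lparr>obj = (\<lambda>K. FM K),
        ind = (\<lambda>K H. orbit_lin (FM H) K (orbit_vec H)),
        res = (\<lambda>H J. orbit_lin (FM J) H
          (\<lambda>(L, t). \<Oplus>\<^bsub>FM J\<^esub>y\<in>reps J H L. orbit_vec J (J \<inter> conj_subgp G y L, act y t))),
        cnj = (\<lambda>g K. orbit_lin (FM (conj_subgp G g K)) K (\<lambda>b. orbit_vec (conj_subgp G g K) (gact g b)))\<rparr>"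

lemma obj_F [simp]: "obj F K = FM K" by (simp add: F_def)

lemma FM_module: "module k (FM K)" by (rule k.fmod_module)

section \<open>Stabilisers, pairs and their orbits\<close>

lemma sub_carrier: "subgroup H G \<Longrightarrow> H \<subseteq> carrier G" by (rule subgroup.subset)

lemma sub_mem: "subgroup H G \<Longrightarrow> h \<in> H \<Longrightarrow> h \<in> carrier G" by (rule subgroup.mem_carrier)

lemma stab_subgroup: assumes "t \<in> X" shows "subgroup (stab t) G"
proof (rule subgroupI)
  show "stab t \<subseteq> carrier G" by (auto simp: stab_def)
  show "stab t \<noteq> {}" using act_one[OF assms] by (auto simp: stab_def)
next
  fix a assume "a \<in> stab t"
  then have a: "a \<in> carrier G" "act a t = t" by (auto simp: stab_def)
  then have "act (inv a) (act a t) = t" using act_mult[of "inv a" a t] assms act_one by simp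
  then show "inv a \<in> stab t" using a by (simp add: stab_def)
next
  fix a b assume "a \<in> stab t" "b \<in> stab t"
  then show "a \<otimes> b \<in> stab t" using assms by (simp add: stab_def act_mult[symmetric])
qed

lemma stab_act:
  assumes "g \<in> carrier G" "t \<in> X" shows "stab (act g t) = conj_subgp G g (stab t)"
proof (rule Set.set_eqI)
  fix x
  have st: "stab t \<subseteq> carrier G" by (auto simp: stab_def)
  have "x \<in> carrier G \<Longrightarrow> act x (act g t) = act g t \<longleftrightarrow> act (inv g \<otimes> x \<otimes> g) t = t"
  proof
    assume x: "x \<in> carrier G" "act x (act g t) = act g t"
    have "act (inv g \<otimes> x \<otimes> g) t = act (inv g) (act x (act g t))" using assms x(1) by (simp add: act_mult act_closed m_assoc)
    also have "\<dots> = act (inv g) (act g t)" by (simp only: x(2))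
    also have "\<dots> = t" using assms by (simp add: act_mult act_one)
    finally show "act (inv g \<otimes> x \<otimes> g) t = t" .
  next
    assume x: "x \<in> carrier G" "act (inv g \<otimes> x \<otimes> g) t = t"
    have "act x (act g t) = act g (act (inv g \<otimes> x \<otimes> g) t)"
      using assms x(1) by (simp add: act_mult m_assoc[symmetric])
    then show "act x (act g t) = act g t" using x by simp
  qed
  then show "x \<in> stab (act g t) \<longleftrightarrow> x \<in> conj_subgp G g (stab t)"
    unfolding conj_mem[OF assms(1) st] using assms by (auto simp: stab_def)
qed

lemma admD:
  assumes "b \<in> adm K"
  shows "subgroup (fst b) G" "fst b \<subseteq> K" "snd b \<in> X" "fst b \<subseteq> stab (snd b)"
  using assms by (auto simp: adm_def)

lemma admI: "\<lbrakk>subgroup L G; L \<subseteq> K; t \<in> X; L \<subseteq> stab t\<rbrakk> \<Longrightarrow> (L, t) \<in> adm K"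
  by (simp add: adm_def)

lemma adm_mono: "K \<subseteq> H \<Longrightarrow> b \<in> adm K \<Longrightarrow> b \<in> adm H" by (auto simp: adm_def)

lemma finite_adm: "subgroup K G \<Longrightarrow> finite (adm K)"
  by (rule finite_subset[of _ "Pow (carrier G) \<times> X"])
    (use finG finX sub_carrier in \<open>auto simp: adm_def\<close>)

lemma finite_pair_orbits: "subgroup K G \<Longrightarrow> finite (pair_orbits K)"
  by (simp add: pair_orbits_def finite_adm)

lemma gact_one: "b \<in> adm K \<Longrightarrow> gact \<one> b = b"
  using admD[of b K] by (simp add: gact_def conj_one act_one sub_carrier)

lemma gact_mult:
  assumes "b \<in> adm K" "g \<in> carrier G" "h \<in> carrier G"
  shows "gact g (gact h b) = gact (g \<otimes> h) b"
  using assms admD[OF assms(1)] by (simp add: gact_def conj_conj sub_carrier act_mult)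

lemma gact_adm:
  assumes "b \<in> adm K" "subgroup K G" "g \<in> carrier G"
  shows "gact g b \<in> adm (conj_subgp G g K)"
proof -
  note b = admD[OF assms(1)]
  show ?thesis
    unfolding gact_def
    by (rule admI)
      (simp_all add: b assms conj_subgroup act_closed stab_act conj_mono sub_carrier stab_subgroup)
qed

lemma gact_adm_self:
  assumes "b \<in> adm K" "subgroup K G" "g \<in> K" shows "gact g b \<in> adm K"
  using gact_adm[OF assms(1,2) sub_mem[OF assms(2,3)]] conj_self[OF assms(2,3)] by simp

lemma pair_orbit_self: "b \<in> adm K \<Longrightarrow> subgroup K G \<Longrightarrow> b \<in> pair_orbit K b"
  unfolding pair_orbit_def by (rule image_eqI[of _ _ \<one>]) (auto simp: gact_one intro: subgroup.one_closed)

lemma pair_orbit_gact: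
  assumes "b \<in> adm K" "subgroup K G" "h \<in> K" shows "pair_orbit K (gact h b) = pair_orbit K b"
proof -
  interpret K: subgroup K G by fact
  have "pair_orbit K (gact h b) = (\<lambda>g. gact (g \<otimes> h) b) ` K"
    unfolding pair_orbit_def using assms by (intro image_cong) (auto simp: gact_mult)
  also have "\<dots> = (\<lambda>g. gact g b) ` ((\<lambda>g. g \<otimes> h) ` K)" by (simp add: image_image)
  also have "(\<lambda>g. g \<otimes> h) ` K = K"
  proof
    show "K \<subseteq> (\<lambda>g. g \<otimes> h) ` K"
    proof
      fix x assume "x \<in> K"
      then show "x \<in> (\<lambda>g. g \<otimes> h) ` K"
        using assms by (intro image_eqI[of _ _ "x \<otimes> inv h"]) (auto simp: m_assoc)
    qed
  qed (use assms in auto)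
  finally show ?thesis by (simp add: pair_orbit_def)
qed

lemma pair_orbit_eqD:
  assumes "pair_orbit K b = pair_orbit K b'" "b \<in> adm K" "b' \<in> adm K" "subgroup K G"
  shows "\<exists>h\<in>K. b' = gact h b"
  using pair_orbit_self[OF assms(3,4)] assms(1) by (auto simp: pair_orbit_def)

lemma orbit_vec_in: "b \<in> adm K \<Longrightarrow> orbit_vec K b \<in> carrier (FM K)"
  unfolding orbit_vec_def by (rule k.unit_vec_in) (simp add: pair_orbits_def)

lemma orbit_vec_gact: "\<lbrakk>b \<in> adm K; subgroup K G; h \<in> K\<rbrakk> \<Longrightarrow> orbit_vec K (gact h b) = orbit_vec K b"
  by (simp add: orbit_vec_def pair_orbit_gact)

lemma some_cls:
  assumes "b \<in> adm K" "subgroup K G"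
  shows "(SOME b'. b' \<in> pair_orbit K b) \<in> adm K" "\<exists>h\<in>K. (SOME b'. b' \<in> pair_orbit K b) = gact h b"
proof -
  have "(SOME b'. b' \<in> pair_orbit K b) \<in> pair_orbit K b" by (rule someI[of "\<lambda>x. x \<in> pair_orbit K b", OF pair_orbit_self[OF assms]])
  then show *: "\<exists>h\<in>K. (SOME b'. b' \<in> pair_orbit K b) = gact h b" by (auto simp: pair_orbit_def)
  show "(SOME b'. b' \<in> pair_orbit K b) \<in> adm K" using * gact_adm_self[OF assms] by auto
qed

lemma orbit_lin_lin:
  fixes M :: "('k, 'm) module"
  assumes "module k M" "subgroup K G" "\<And>b. b \<in> adm K \<Longrightarrow> v b \<in> carrier M"
  shows "orbit_lin M K v \<in> lin_map k (FM K) M"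
  unfolding orbit_lin_def
  by (rule k.lin_lin_map[OF assms(1)])
    (auto simp: pair_orbits_def intro!: assms(3) some_cls(1)[OF _ assms(2)])

lemma orbit_lin_bas:
  fixes M :: "('k, 'm) module"
  assumes "module k M" "subgroup K G" "\<And>b. b \<in> adm K \<Longrightarrow> v b \<in> carrier M"
    and "\<And>b h. b \<in> adm K \<Longrightarrow> h \<in> K \<Longrightarrow> v (gact h b) = v b" "b \<in> adm K"
  shows "orbit_lin M K v (orbit_vec K b) = v b"
proof -
  have "orbit_lin M K v (orbit_vec K b) = v (SOME b'. b' \<in> pair_orbit K b)"
    unfolding orbit_lin_def orbit_vec_def
    by (rule k.lin_bv[OF assms(1) finite_pair_orbits[OF assms(2)]])
      (auto simp: pair_orbits_def assms(5) simp del: split_paired_All intro!: assms(3) some_cls(1)[OF _ assms(2)])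
  also have "\<dots> = v b" using some_cls(2)[OF assms(5,2)] assms(4)[OF assms(5)] by metis
  finally show ?thesis .
qed

text \<open>The axioms for \<open>F\<close> are checked through this: the two sides are linear, so
  it is enough to compare them on the vectors of pairs.\<close>

lemma F_eqI:
  fixes M :: "('k, 'm) module"
  assumes "subgroup K G" "module k M" "f \<in> lin_map k (FM K) M" "g \<in> lin_map k (FM K) M"
    and "\<And>b. b \<in> adm K \<Longrightarrow> f (orbit_vec K b) = g (orbit_vec K b)" "x \<in> carrier (FM K)"
  shows "f x = g x"
  by (rule k.lin_map_fmod_eqI[OF finite_pair_orbits[OF assms(1)] assms(2-4) _ assms(6)])
    (use assms(5) in \<open>auto simp: pair_orbits_def orbit_vec_def\<close>)

text \<open>\<open>J \<inter> yLy^-1\<close> is the stabiliser in \<open>J\<close> of the point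
  \<open>yL\<close> of \<open>H/L\<close>, and \<open>yL\<close> lies over \<open>yt\<close>. So
  these pairs describe the \<open>J\<close>-orbits of \<open>H/L \<rightarrow> X\<close>.\<close>

lemma adm_res:
  assumes "b \<in> adm H" "subgroup J G" "y \<in> carrier G"
  shows "(J \<inter> conj_subgp G y (fst b), act y (snd b)) \<in> adm J"
proof -
  have "conj_subgp G y (fst b) \<subseteq> conj_subgp G y (stab (snd b))"
    using conj_mono assms admD[OF assms(1)] stab_subgroup sub_carrier by metis
  then show ?thesis
    using admD[OF assms(1)] assms
    by (intro admI) (auto intro: subgroups_Inter_pair conj_subgroup act_closed simp: stab_act)
qed

text \<open>Replacing \<open>y\<close> by \<open>jyl\<close> changes the pair by the action of
  \<open>j\<close> only, because \<open>l\<close> normalises \<open>L\<close> and fixes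
  \<open>t\<close>; its \<open>J\<close>-orbit stays the same.\<close>

lemma res_indep:
  assumes "b \<in> adm H" "subgroup J G" "subgroup H G" "J \<subseteq> H"
    and "T \<in> dcoset_reps G J H (fst b)" "T' \<in> dcoset_reps G J H (fst b)"
  shows "(\<Oplus>\<^bsub>FM J\<^esub>y\<in>T. orbit_vec J (J \<inter> conj_subgp G y (fst b), act y (snd b)))
       = (\<Oplus>\<^bsub>FM J\<^esub>y\<in>T'. orbit_vec J (J \<inter> conj_subgp G y (fst b), act y (snd b)))"
proof -
  interpret FJ: module k "FM J" by (rule FM_module)
  note b = admD[OF assms(1)]
  show ?thesis
  proof (rule dcoset_finsum_indep[OF assms(5,6,2) b(1) assms(3,4) b(2) FJ.abelian_monoid_axioms])
    fix y assume "y \<in> H"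
    then show "orbit_vec J (J \<inter> conj_subgp G y (fst b), act y (snd b)) \<in> carrier (FM J)"
      by (rule orbit_vec_in[OF adm_res[OF assms(1,2) sub_mem[OF assms(3)]]])
  next
    fix y j l assume y: "y \<in> H" "j \<in> J" "l \<in> fst b"
    have c: "y \<in> carrier G" "j \<in> carrier G" "l \<in> carrier G"
      using sub_mem assms(2,3) b(1) y by blast+
    have l: "act l (snd b) = snd b" using b(4) y by (auto simp: stab_def)
    have JJ: "J \<inter> conj_subgp G (j \<otimes> y \<otimes> l) (fst b) = conj_subgp G j (J \<inter> conj_subgp G y (fst b))"
    proof -
      have "conj_subgp G (j \<otimes> y \<otimes> l) (fst b) = conj_subgp G j (conj_subgp G y (conj_subgp G l (fst b)))"
        using c b(1) by (simp add: conj_conj conj_subset sub_carrier m_assoc)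
      then show ?thesis
        using conj_self[OF b(1) y(3)] conj_self[OF assms(2) y(2)] c
        by (simp add: conj_Int conj_subset sub_carrier assms(2) b(1))
    qed
    have tt: "act (j \<otimes> y \<otimes> l) (snd b) = act j (act y (snd b))"
      using c b(3) l by (simp add: act_mult[symmetric] act_closed)
    have "(J \<inter> conj_subgp G (j \<otimes> y \<otimes> l) (fst b), act (j \<otimes> y \<otimes> l) (snd b))
       = gact j (J \<inter> conj_subgp G y (fst b), act y (snd b))"
      unfolding JJ tt by (simp add: gact_def)
    then show "orbit_vec J (J \<inter> conj_subgp G (j \<otimes> y \<otimes> l) (fst b), act (j \<otimes> y \<otimes> l) (snd b)) =
        orbit_vec J (J \<inter> conj_subgp G y (fst b), act y (snd b))"
      using orbit_vec_gact[OF adm_res[OF assms(1,2) c(1)] assms(2) y(2)] by simp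
  qed
qed

lemma res_sum_in:
  assumes "b \<in> adm H" "subgroup J G" "subgroup H G" "J \<subseteq> H" "T \<in> dcoset_reps G J H (fst b)"
  shows "y \<in> T \<Longrightarrow> orbit_vec J (J \<inter> conj_subgp G y (fst b), act y (snd b)) \<in> carrier (FM J)"
    and "(\<lambda>y. orbit_vec J (J \<inter> conj_subgp G y (fst b), act y (snd b))) \<in> T \<rightarrow> carrier (FM J)"
    and "(\<Oplus>\<^bsub>FM J\<^esub>y\<in>T. orbit_vec J (J \<inter> conj_subgp G y (fst b), act y (snd b))) \<in> carrier (FM J)"
proof -
  interpret FJ: module k "FM J" by (rule FM_module)
  note D = dcoset_repsD[OF assms(5,2) admD(1)[OF assms(1)] assms(3,4) admD(2)[OF assms(1)]]
  show "orbit_vec J (J \<inter> conj_subgp G y (fst b), act y (snd b)) \<in> carrier (FM J)" if "y \<in> T" for y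
  proof -
    have "y \<in> H" using D(1) that by blast
    then show ?thesis by (rule orbit_vec_in[OF adm_res[OF assms(1,2) sub_mem[OF assms(3)]]])
  qed
  then show "(\<lambda>y. orbit_vec J (J \<inter> conj_subgp G y (fst b), act y (snd b))) \<in> T \<rightarrow> carrier (FM J)" by simp
  then show "(\<Oplus>\<^bsub>FM J\<^esub>y\<in>T. orbit_vec J (J \<inter> conj_subgp G y (fst b), act y (snd b))) \<in> carrier (FM J)"
    by (rule FJ.finsum_closed)
qed

text \<open>The definition of \<open>res\<close> is tied to \<open>reps\<close> and to a chosen pair
  in each orbit. This frees it from both choices, so that representatives adapted to a situation can
  be inserted later.\<close>

lemma res_orbit_lin:
  assumes "subgroup J G" "subgroup H G" "J \<subseteq> H"
  shows "res F H J \<in> lin_map k (FM H) (FM J)"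
    and "\<lbrakk>b \<in> adm H; T \<in> dcoset_reps G J H (fst b)\<rbrakk> \<Longrightarrow>
      res F H J (orbit_vec H b) = (\<Oplus>\<^bsub>FM J\<^esub>y\<in>T. orbit_vec J (J \<inter> conj_subgp G y (fst b), act y (snd b)))"
proof -
  interpret FJ: module k "FM J" by (rule FM_module)
  define v where "v b = (\<Oplus>\<^bsub>FM J\<^esub>y\<in>reps J H (fst b). orbit_vec J (J \<inter> conj_subgp G y (fst b), act y (snd b)))" for b
  have e: "res F H J = orbit_lin (FM J) H v" by (simp add: F_def v_def[abs_def] case_prod_unfold)
  have r: "reps J H (fst b) \<in> dcoset_reps G J H (fst b)" if "b \<in> adm H" for b
    using that assms admD by (intro reps_in) auto
  have v: "v b \<in> carrier (FM J)" if "b \<in> adm H" for b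
    unfolding v_def by (rule res_sum_in(3)[OF that assms r[OF that]])
  show "res F H J \<in> lin_map k (FM H) (FM J)"
    unfolding e by (rule orbit_lin_lin[OF FM_module assms(2) v])
  assume b: "b \<in> adm H" and T: "T \<in> dcoset_reps G J H (fst b)"
  have inv: "v (gact h c) = v c" if c: "c \<in> adm H" and h: "h \<in> H" for c h
  proof -
    note cc = admD[OF c]
    have g: "gact h c \<in> adm H" by (rule gact_adm_self[OF c assms(2) h])
    have hG: "h \<in> carrier G" using sub_mem assms h by blast
    let ?T = "reps J H (conj_subgp G h (fst c))"
    have T: "?T \<in> dcoset_reps G J H (conj_subgp G h (fst c))" using r[OF g] by (simp add: gact_def)
    have TG: "y \<in> carrier G" if "y \<in> ?T" for y
      using dcoset_repsD(1)[OF T assms(1) _ assms(2,3)] admD[OF g] that sub_mem[OF assms(2)]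
      by (auto simp: gact_def)
    \<comment> \<open>Right translation by \<open>h\<close> turns representatives for
      \<open>hLh^-1\<close> into representatives for \<open>L\<close>, which compares the sums for
      the pair and for its conjugate.\<close>
    have T2: "(\<lambda>y. y \<otimes> h) ` ?T \<in> dcoset_reps G J H (fst c)"
      by (rule dcoset_reps_translate[OF T assms(1) cc(1) assms(2,3) cc(2) h])
    have "v c = (\<Oplus>\<^bsub>FM J\<^esub>y\<in>(\<lambda>y. y \<otimes> h) ` ?T. orbit_vec J (J \<inter> conj_subgp G y (fst c), act y (snd c)))"
      unfolding v_def by (rule res_indep[OF c assms r[OF c] T2])
    also have "\<dots> = (\<Oplus>\<^bsub>FM J\<^esub>y\<in>?T. orbit_vec J (J \<inter> conj_subgp G (y \<otimes> h) (fst c), act (y \<otimes> h) (snd c)))"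
      by (rule FJ.finsum_reindex[OF res_sum_in(2)[OF c assms T2]])
        (rule inj_onI, use TG hG in simp)
    also have "\<dots> = (\<Oplus>\<^bsub>FM J\<^esub>y\<in>?T. orbit_vec J (J \<inter> conj_subgp G y (fst (gact h c)), act y (snd (gact h c))))"
    proof (rule FJ.finsum_cong')
      show "(\<lambda>y. orbit_vec J (J \<inter> conj_subgp G y (fst (gact h c)), act y (snd (gact h c)))) \<in> ?T \<rightarrow> carrier (FM J)"
        by (rule res_sum_in(2)[OF g assms]) (use T in \<open>simp add: gact_def\<close>)
    qed (use TG hG cc in \<open>auto simp: gact_def conj_conj sub_carrier act_mult\<close>)
    finally show ?thesis by (simp add: v_def gact_def)
  qed
  show "res F H J (orbit_vec H b) = (\<Oplus>\<^bsub>FM J\<^esub>y\<in>T. orbit_vec J (J \<inter> conj_subgp G y (fst b), act y (snd b)))"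
    unfolding e
  proof (rule trans[OF orbit_lin_bas[OF FM_module assms(2) v inv b]])
    show "v b = (\<Oplus>\<^bsub>FM J\<^esub>y\<in>T. orbit_vec J (J \<inter> conj_subgp G y (fst b), act y (snd b)))"
      unfolding v_def by (rule res_indep[OF b assms r[OF b] T])
  qed
qed

lemma ind_orbit_lin:
  assumes "subgroup K G" "subgroup H G" "K \<subseteq> H"
  shows "ind F K H \<in> lin_map k (FM K) (FM H)"
    and "b \<in> adm K \<Longrightarrow> ind F K H (orbit_vec K b) = orbit_vec H b"
proof -
  have e: "ind F K H = orbit_lin (FM H) K (orbit_vec H)" by (simp add: F_def)
  have v: "orbit_vec H b \<in> carrier (FM H)" if "b \<in> adm K" for b
    using orbit_vec_in adm_mono[OF assms(3) that] .
  show "ind F K H \<in> lin_map k (FM K) (FM H)"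
    unfolding e by (rule orbit_lin_lin[OF FM_module assms(1) v])
  show "b \<in> adm K \<Longrightarrow> ind F K H (orbit_vec K b) = orbit_vec H b"
    unfolding e
    by (rule orbit_lin_bas[OF FM_module assms(1) v])
      (use assms in \<open>auto intro!: orbit_vec_gact adm_mono[OF assms(3)]\<close>)
qed

lemma cnj_orbit_lin:
  assumes "subgroup K G" "g \<in> carrier G"
  shows "cnj F g K \<in> lin_map k (FM K) (FM (conj_subgp G g K))"
    and "b \<in> adm K \<Longrightarrow> cnj F g K (orbit_vec K b) = orbit_vec (conj_subgp G g K) (gact g b)"
proof -
  have e: "cnj F g K = orbit_lin (FM (conj_subgp G g K)) K (\<lambda>b. orbit_vec (conj_subgp G g K) (gact g b))" by (simp add: F_def)
  have v: "orbit_vec (conj_subgp G g K) (gact g b) \<in> carrier (FM (conj_subgp G g K))" if "b \<in> adm K" for b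
    by (rule orbit_vec_in[OF gact_adm[OF that assms]])
  show "cnj F g K \<in> lin_map k (FM K) (FM (conj_subgp G g K))"
    unfolding e by (rule orbit_lin_lin[OF FM_module assms(1) v])
  assume b: "b \<in> adm K"
  show "cnj F g K (orbit_vec K b) = orbit_vec (conj_subgp G g K) (gact g b)"
    unfolding e
  proof (rule orbit_lin_bas[OF FM_module assms(1) v _ b])
    fix c h assume c: "c \<in> adm K" "h \<in> K"
    have hG: "h \<in> carrier G" by (rule sub_mem[OF assms(1) c(2)])
    have gh: "g \<otimes> h \<otimes> inv g \<in> conj_subgp G g K"
      unfolding conj_image[OF assms(2) sub_carrier[OF assms(1)]] using c(2) by (rule imageI)
    have "gact g (gact h c) = gact (g \<otimes> h \<otimes> inv g) (gact g c)"
      using c hG assms(2) by (simp add: gact_mult[of c K] gact_mult[OF c(1)] m_assoc)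
    then show "orbit_vec (conj_subgp G g K) (gact g (gact h c)) = orbit_vec (conj_subgp G g K) (gact g c)"
      using orbit_vec_gact[OF gact_adm[OF c(1) assms] conj_subgroup[OF assms] gh] by simp
  qed
qed

end

lemma (in abelian_monoid) finsum_single: "f a \<in> carrier G \<Longrightarrow> (\<Oplus>x\<in>{a}. f x) = f a"
  by (subst finsum_insert) auto

lemma mackey_homI:
  assumes "\<And>H. subgroup H G \<Longrightarrow> f H \<in> lin_map R (obj M H) (obj N H)"
    and "\<And>K H a. \<lbrakk>subgroup K G; subgroup H G; K \<subseteq> H; a \<in> carrier (obj M K)\<rbrakk> \<Longrightarrow> f H (ind M K H a) = ind N K H (f K a)"
    and "\<And>K H a. \<lbrakk>subgroup K G; subgroup H G; K \<subseteq> H; a \<in> carrier (obj M H)\<rbrakk> \<Longrightarrow> f K (res M H K a) = res N H K (f H a)"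
    and "\<And>g H a. \<lbrakk>g \<in> carrier G; subgroup H G; a \<in> carrier (obj M H)\<rbrakk> \<Longrightarrow>
          f (conj_subgp G g H) (cnj M g H a) = cnj N g H (f H a)"
  shows "f \<in> mackey_hom G R M N"
  using assms by (auto simp: mackey_hom_def)

lemma mackey_homD:
  assumes "f \<in> mackey_hom G R M N"
  shows "subgroup H G \<Longrightarrow> f H \<in> lin_map R (obj M H) (obj N H)"
    and "\<lbrakk>subgroup K G; subgroup H G; K \<subseteq> H; a \<in> carrier (obj M K)\<rbrakk> \<Longrightarrow> f H (ind M K H a) = ind N K H (f K a)"
    and "\<lbrakk>subgroup K G; subgroup H G; K \<subseteq> H; b \<in> carrier (obj M H)\<rbrakk> \<Longrightarrow> f K (res M H K b) = res N H K (f H b)"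
    and "\<lbrakk>g \<in> carrier G; subgroup H G; b \<in> carrier (obj M H)\<rbrakk> \<Longrightarrow>
          f (conj_subgp G g H) (cnj M g H b) = cnj N g H (f H b)"
    and "\<lbrakk>subgroup H G; b \<in> carrier (obj M H)\<rbrakk> \<Longrightarrow> f H b \<in> carrier (obj N H)"
  using assms by (auto simp: mackey_hom_def lin_map_def)

lemma mackey_hom_comp:
  assumes "f \<in> mackey_hom G R M N" "h \<in> mackey_hom G R N L"
  shows "(\<lambda>H x. h H (f H x)) \<in> mackey_hom G R M L"
  using mackey_homD[OF assms(1)] mackey_homD[OF assms(2)]
  by (intro mackey_homI) (simp_all add: lin_map_comp[OF mackey_homD(1)[OF assms(1)] mackey_homD(1)[OF assms(2)]])

lemma mackey_hom_id: "(\<lambda>H x. x) \<in> mackey_hom G R M M"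
  by (rule mackey_homI) (auto intro: lin_map_id)

section \<open>The axioms of a Mackey functor for \<open>F\<close>\<close>

context burnside begin

text \<open>Everything is counting of orbits. Transitivity of restriction and the Mackey formula are
  the two refinements of double cosets, and conjugation transports representatives; the remaining
  axioms hold pair by pair.\<close>

lemma F_mackey: "mackey_functor G k F"
proof (intro mackey_functor.intro mackey_functor_axioms.intro)
  show "group G" by (rule is_group)
  show "cring k" by (rule k.is_cring)
  show "finite (carrier G)" by (rule finG)
next
  fix H assume "subgroup H G" show "module k (obj F H)" by (simp add: FM_module)
next
  fix K H assume "subgroup K G" "subgroup H G" "K \<subseteq> H"
  then show "ind F K H \<in> lin_map k (obj F K) (obj F H)" "res F H K \<in> lin_map k (obj F H) (obj F K)"
    using ind_orbit_lin(1) res_orbit_lin(1) by simp_all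
next
  fix H g assume "subgroup H G" "g \<in> carrier G"
  then show "cnj F g H \<in> lin_map k (obj F H) (obj F (conj_subgp G g H))" using cnj_orbit_lin(1) by simp
next
  fix H a assume H: "subgroup H G" and a: "a \<in> carrier (obj F H)"
  show "ind F H H a = a"
    by (rule F_eqI[OF H FM_module ind_orbit_lin(1)[OF H H subset_refl] lin_map_id])
      (use a H in \<open>simp_all add: ind_orbit_lin\<close>)
next
  fix H a assume H: "subgroup H G" and a: "a \<in> carrier (obj F H)"
  interpret FH: module k "FM H" by (rule FM_module)
  show "res F H H a = a"
  proof (rule F_eqI[OF H FM_module res_orbit_lin(1)[OF H H subset_refl] lin_map_id])
    fix b assume b: "b \<in> adm H"
    note bb = admD[OF b]
    have "fst b \<subseteq> carrier G" using bb sub_carrier by blast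
    then have e: "(H \<inter> conj_subgp G \<one> (fst b), act \<one> (snd b)) = b"
      using bb by (simp add: conj_one act_one Int_absorb1)
    have "res F H H (orbit_vec H b) = (\<Oplus>\<^bsub>FM H\<^esub>y\<in>{\<one>}. orbit_vec H (H \<inter> conj_subgp G y (fst b), act y (snd b)))"
      by (rule res_orbit_lin(2)[OF H H subset_refl b dcoset_reps_triv[OF H bb(1,2)]])
    also have "\<dots> = orbit_vec H b" by (subst FH.finsum_single) (simp_all only: e orbit_vec_in[OF b])
    finally show "res F H H (orbit_vec H b) = orbit_vec H b" .
  qed (use a in simp)
next
  fix H h a assume H: "subgroup H G" and h: "h \<in> H" and a: "a \<in> carrier (obj F H)"
  have hG: "h \<in> carrier G" by (rule sub_mem[OF H h])
  show "cnj F h H a = a"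
    by (rule F_eqI[OF H FM_module _ lin_map_id])
      (use a cnj_orbit_lin[OF H hG] conj_self[OF H h] orbit_vec_gact[OF _ H h] in simp_all)
next
  fix J K H a assume *: "subgroup J G" "subgroup K G" "subgroup H G" "J \<subseteq> K" "K \<subseteq> H" "a \<in> carrier (obj F J)"
  have JH: "J \<subseteq> H" using * by auto
  show "ind F K H (ind F J K a) = ind F J H a"
    by (rule F_eqI[OF *(1) FM_module lin_map_comp[OF ind_orbit_lin(1)[OF *(1,2,4)] ind_orbit_lin(1)[OF *(2,3,5)]]
          ind_orbit_lin(1)[OF *(1,3) JH]])
      (use * JH adm_mono[OF *(4)] in \<open>simp_all add: ind_orbit_lin\<close>)
next
  fix J K H a assume *: "subgroup J G" "subgroup K G" "subgroup H G" "J \<subseteq> K" "K \<subseteq> H" "a \<in> carrier (obj F H)"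
  have JH: "J \<subseteq> H" using * by auto
  interpret FJ: module k "FM J" by (rule FM_module)
  show "res F K J (res F H K a) = res F H J a"
  proof (rule F_eqI[OF *(3) FM_module lin_map_comp[OF res_orbit_lin(1)[OF *(2,3,5)] res_orbit_lin(1)[OF *(1,2,4)]]
          res_orbit_lin(1)[OF *(1,3) JH]])
    fix b assume b: "b \<in> adm H"
    note bb = admD[OF b]
    define T where "T = reps K H (fst b)"
    have T: "T \<in> dcoset_reps G K H (fst b)" unfolding T_def by (rule reps_in[OF *(2) bb(1) *(3,5) bb(2)])
    define c where "c y = (K \<inter> conj_subgp G y (fst b), act y (snd b))" for y
    define S where "S y = reps J K (fst (c y))" for y
    have TH: "y \<in> H" "y \<in> carrier G" if "y \<in> T" for y
      using dcoset_repsD(1)[OF T *(2) bb(1) *(3,5) bb(2)] that sub_mem[OF *(3)] by auto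
    have c: "c y \<in> adm K" if "y \<in> T" for y unfolding c_def by (rule adm_res[OF b *(2) TH(2)[OF that]])
    have S: "S y \<in> dcoset_reps G J K (fst (c y))" if "y \<in> T" for y
      unfolding S_def by (rule reps_in[OF *(1) admD(1)[OF c[OF that]] *(2,4) admD(2)[OF c[OF that]]])
    have S': "S y \<in> dcoset_reps G J K (K \<inter> conj_subgp G y (fst b))" if "y \<in> T" for y
      using S[OF that] by (simp add: c_def)
    have SK: "z \<in> K" "z \<in> carrier G" if "y \<in> T" "z \<in> S y" for y z
      using dcoset_repsD(1)[OF S[OF that(1)] *(1) admD(1)[OF c[OF that(1)]] *(2,4) admD(2)[OF c[OF that(1)]]] that
        sub_mem[OF *(2)] by auto
    let ?f = "\<lambda>w. orbit_vec J (J \<inter> conj_subgp G w (fst b), act w (snd b))"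
    \<comment> \<open>The \<open>J\<close>-orbits on \<open>H/L\<close> are found in two stages: the
      \<open>K\<close>-orbit of \<open>yL\<close>, then the \<open>J\<close>-orbits on it, given by
      \<open>z\<close>. The products \<open>zy\<close> are representatives for one stage.\<close>
    let ?U = "(\<lambda>(y, z). z \<otimes> y) ` Sigma T S"
    note R = dcoset_refine_right[OF T *(2) bb(1) *(3,5) bb(2) *(1,4) S']
    have finT: "finite T" using TH finG by (meson finite_subset subsetI)
    have finS: "finite (S y)" if "y \<in> T" for y using SK[OF that] finG by (meson finite_subset subsetI)
    have fU: "?f \<in> ?U \<rightarrow> carrier (FM J)" by (rule res_sum_in(2)[OF b *(1,3) JH R(1)])
    have "res F K J (res F H K (orbit_vec H b)) = res F K J (\<Oplus>\<^bsub>FM K\<^esub>y\<in>T. orbit_vec K (c y))"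
      using res_orbit_lin(2)[OF *(2,3,5) b T] by (simp add: c_def)
    also have "\<dots> = (\<Oplus>\<^bsub>FM J\<^esub>y\<in>T. res F K J (orbit_vec K (c y)))"
      by (rule lin_map_finsum[OF res_orbit_lin(1)[OF *(1,2,4)] FM_module FM_module]) (use c orbit_vec_in in auto)
    also have "\<dots> = (\<Oplus>\<^bsub>FM J\<^esub>y\<in>T. \<Oplus>\<^bsub>FM J\<^esub>z\<in>S y. ?f (z \<otimes> y))"
    proof (rule FJ.finsum_cong'[OF refl])
      show "(\<lambda>y. \<Oplus>\<^bsub>FM J\<^esub>z\<in>S y. ?f (z \<otimes> y)) \<in> T \<rightarrow> carrier (FM J)"
        using fU by (intro Pi_I FJ.finsum_closed) force
      fix y assume y: "y \<in> T"
      have "res F K J (orbit_vec K (c y)) = (\<Oplus>\<^bsub>FM J\<^esub>z\<in>S y. orbit_vec J (J \<inter> conj_subgp G z (fst (c y)), act z (snd (c y))))"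
        by (rule res_orbit_lin(2)[OF *(1,2,4) c[OF y] S[OF y]])
      also have "\<dots> = (\<Oplus>\<^bsub>FM J\<^esub>z\<in>S y. ?f (z \<otimes> y))"
      proof (rule FJ.finsum_cong'[OF refl])
        show "(\<lambda>z. ?f (z \<otimes> y)) \<in> S y \<rightarrow> carrier (FM J)" using fU y by force
        fix z assume z: "z \<in> S y"
        note zz = SK[OF y z] TH[OF y]
        have "conj_subgp G z (K \<inter> conj_subgp G y (fst b)) = K \<inter> conj_subgp G (z \<otimes> y) (fst b)"
          using zz bb * by (simp add: conj_Int conj_subset sub_carrier conj_self conj_conj)
        then have "J \<inter> conj_subgp G z (K \<inter> conj_subgp G y (fst b)) = J \<inter> conj_subgp G (z \<otimes> y) (fst b)"
          using *(4) by auto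
        then show "orbit_vec J (J \<inter> conj_subgp G z (fst (c y)), act z (snd (c y))) = ?f (z \<otimes> y)"
          using zz bb by (simp add: c_def act_mult)
      qed
      finally show "res F K J (orbit_vec K (c y)) = (\<Oplus>\<^bsub>FM J\<^esub>z\<in>S y. ?f (z \<otimes> y))" .
    qed
    also have "\<dots> = (\<Oplus>\<^bsub>FM J\<^esub>p\<in>Sigma T S. ?f ((\<lambda>(y, z). z \<otimes> y) p))"
      by (subst FJ.finsum_Sigma[OF finT finS]) (use fU in \<open>force+\<close>)
    also have "\<dots> = (\<Oplus>\<^bsub>FM J\<^esub>w\<in>?U. ?f w)"
      by (rule FJ.finsum_reindex[OF fU R(2), symmetric])
    also have "\<dots> = res F H J (orbit_vec H b)"
      by (rule res_orbit_lin(2)[OF *(1,3) JH b R(1), symmetric])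
    finally show "res F K J (res F H K (orbit_vec H b)) = res F H J (orbit_vec H b)" .
  qed (use * in simp)
next
  fix H g h a assume *: "subgroup H G" "g \<in> carrier G" "h \<in> carrier G" "a \<in> carrier (obj F H)"
  have cc: "conj_subgp G g (conj_subgp G h H) = conj_subgp G (g \<otimes> h) H"
    using * by (simp add: conj_conj sub_carrier)
  have gh: "g \<otimes> h \<in> carrier G" using * by simp
  note hs = conj_subgroup[OF *(1,3)]
  show "cnj F g (conj_subgp G h H) (cnj F h H a) = cnj F (g \<otimes> h) H a"
    by (rule F_eqI[OF *(1) FM_module lin_map_comp[OF cnj_orbit_lin(1)[OF *(1,3)] cnj_orbit_lin(1)[OF hs *(2), unfolded cc]]
          cnj_orbit_lin(1)[OF *(1) gh]])
      (use * hs gact_adm[OF _ *(1,3)] in \<open>simp_all add: cnj_orbit_lin cc gact_mult[of _ H]\<close>)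
next
  fix K H g a assume *: "subgroup K G" "subgroup H G" "K \<subseteq> H" "g \<in> carrier G" "a \<in> carrier (obj F K)"
  note gs = conj_subgroup[OF *(1,4)] conj_subgroup[OF *(2,4)] conj_mono[OF *(4) sub_carrier[OF *(2)] *(3)]
  show "cnj F g H (ind F K H a) = ind F (conj_subgp G g K) (conj_subgp G g H) (cnj F g K a)"
    by (rule F_eqI[OF *(1) FM_module lin_map_comp[OF ind_orbit_lin(1)[OF *(1-3)] cnj_orbit_lin(1)[OF *(2,4)]]
          lin_map_comp[OF cnj_orbit_lin(1)[OF *(1,4)] ind_orbit_lin(1)[OF gs]]])
      (use * gs gact_adm[OF _ *(1,4)] adm_mono[OF *(3)] in \<open>simp_all add: cnj_orbit_lin ind_orbit_lin\<close>)
next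
  fix K H g a assume *: "subgroup K G" "subgroup H G" "K \<subseteq> H" "g \<in> carrier G" "a \<in> carrier (obj F H)"
  note gs = conj_subgroup[OF *(1,4)] conj_subgroup[OF *(2,4)] conj_mono[OF *(4) sub_carrier[OF *(2)] *(3)]
  interpret FK: module k "FM (conj_subgp G g K)" by (rule FM_module)
  show "cnj F g K (res F H K a) = res F (conj_subgp G g H) (conj_subgp G g K) (cnj F g H a)"
  proof (rule F_eqI[OF *(2) FM_module lin_map_comp[OF res_orbit_lin(1)[OF *(1-3)] cnj_orbit_lin(1)[OF *(1,4)]]
          lin_map_comp[OF cnj_orbit_lin(1)[OF *(2,4)] res_orbit_lin(1)[OF gs]]])
    fix b assume b: "b \<in> adm H"
    note bb = admD[OF b]
    define T where "T = reps K H (fst b)"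
    have T: "T \<in> dcoset_reps G K H (fst b)" unfolding T_def by (rule reps_in[OF *(1) bb(1) *(2,3) bb(2)])
    have TG: "y \<in> carrier G" if "y \<in> T" for y
      using dcoset_repsD(1)[OF T *(1) bb(1) *(2,3) bb(2)] that sub_mem[OF *(2)] by auto
    let ?K = "conj_subgp G g K"
    let ?U = "(\<lambda>y. g \<otimes> y \<otimes> inv g) ` T"
    let ?f = "\<lambda>w. orbit_vec ?K (?K \<inter> conj_subgp G w (fst (gact g b)), act w (snd (gact g b)))"
    have gb: "gact g b \<in> adm (conj_subgp G g H)" by (rule gact_adm[OF b *(2,4)])
    have U: "?U \<in> dcoset_reps G ?K (conj_subgp G g H) (fst (gact g b))"
      using dcoset_reps_conj[OF T *(1) bb(1) *(2,3) bb(2) *(4)] by (simp add: gact_def)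
    have fU: "?f \<in> ?U \<rightarrow> carrier (FM ?K)" by (rule res_sum_in(2)[OF gb gs U])
    have "cnj F g K (res F H K (orbit_vec H b)) = cnj F g K (\<Oplus>\<^bsub>FM K\<^esub>y\<in>T. orbit_vec K (K \<inter> conj_subgp G y (fst b), act y (snd b)))"
      using res_orbit_lin(2)[OF *(1-3) b T] by simp
    also have "\<dots> = (\<Oplus>\<^bsub>FM ?K\<^esub>y\<in>T. cnj F g K (orbit_vec K (K \<inter> conj_subgp G y (fst b), act y (snd b))))"
      by (rule lin_map_finsum[OF cnj_orbit_lin(1)[OF *(1,4)] FM_module FM_module res_sum_in(2)[OF b *(1-3) T]])
    also have "\<dots> = (\<Oplus>\<^bsub>FM ?K\<^esub>y\<in>T. ?f (g \<otimes> y \<otimes> inv g))"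
    proof (rule FK.finsum_cong'[OF refl])
      show "(\<lambda>y. ?f (g \<otimes> y \<otimes> inv g)) \<in> T \<rightarrow> carrier (FM ?K)" using fU by force
      fix y assume y: "y \<in> T"
      have e1: "conj_subgp G g (K \<inter> conj_subgp G y (fst b)) =
          ?K \<inter> conj_subgp G (g \<otimes> y \<otimes> inv g) (conj_subgp G g (fst b))"
        using TG[OF y] bb * by (simp add: conj_Int conj_subset sub_carrier conj_conj m_assoc)
      have e2: "act g (act y (snd b)) = act (g \<otimes> y \<otimes> inv g) (act g (snd b))"
        using TG[OF y] bb * by (simp add: act_mult m_assoc)
      show "cnj F g K (orbit_vec K (K \<inter> conj_subgp G y (fst b), act y (snd b))) = ?f (g \<otimes> y \<otimes> inv g)"
        using cnj_orbit_lin(2)[OF *(1,4) adm_res[OF b *(1) TG[OF y]]] by (simp add: gact_def e1 e2)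
    qed
    also have "\<dots> = (\<Oplus>\<^bsub>FM ?K\<^esub>w\<in>?U. ?f w)"
      by (rule FK.finsum_reindex[OF fU, symmetric]) (rule inj_onI, use TG *(4) in \<open>simp add: m_assoc\<close>)
    also have "\<dots> = res F (conj_subgp G g H) ?K (orbit_vec (conj_subgp G g H) (gact g b))"
      by (rule res_orbit_lin(2)[OF gs gb U, symmetric])
    also have "orbit_vec (conj_subgp G g H) (gact g b) = cnj F g H (orbit_vec H b)"
      by (rule cnj_orbit_lin(2)[OF *(2,4) b, symmetric])
    finally show "cnj F g K (res F H K (orbit_vec H b)) = res F (conj_subgp G g H) ?K (cnj F g H (orbit_vec H b))" .
  qed (use * in simp)
next
  fix J K H T a assume *: "subgroup J G" "subgroup K G" "subgroup H G" "J \<subseteq> H" "K \<subseteq> H"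
    and T: "T \<in> dcoset_reps G J H K" and a: "a \<in> carrier (obj F K)"
  interpret FJ: module k "FM J" by (rule FM_module)
  let ?I = "\<lambda>x. conj_subgp G (inv x) J \<inter> K"
  let ?J = "\<lambda>x. J \<inter> conj_subgp G x K"
  let ?g = "\<lambda>x a. ind F (?J x) J (cnj F x (?I x) (res F K (?I x) a))"
  have TH: "x \<in> H" "x \<in> carrier G" if "x \<in> T" for x
    using dcoset_repsD(1)[OF T *(1-5)] that sub_mem[OF *(3)] by auto
  have IJ: "conj_subgp G x (?I x) = ?J x" if "x \<in> T" for x
    using TH[OF that] * by (simp add: conj_Int conj_subset sub_carrier conj_conj conj_one)
  have Is: "subgroup (?I x) G" if "x \<in> T" for x
    using TH[OF that] * by (simp add: subgroups_Inter_pair conj_subgroup)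
  have Js: "subgroup (?J x) G" if "x \<in> T" for x
    using TH[OF that] * by (simp add: subgroups_Inter_pair conj_subgroup)
  have glin: "?g x \<in> lin_map k (FM K) (FM J)" if "x \<in> T" for x
    by (rule lin_map_comp[OF lin_map_comp[OF res_orbit_lin(1)[OF Is[OF that] *(2) Int_lower2]
          cnj_orbit_lin(1)[OF Is[OF that] TH(2)[OF that], unfolded IJ[OF that]]]
          ind_orbit_lin(1)[OF Js[OF that] *(1) Int_lower1]])
  have "res F H J (ind F K H a) = (\<Oplus>\<^bsub>FM J\<^esub>x\<in>T. ?g x a)"
  proof (rule F_eqI[OF *(2) FM_module lin_map_comp[OF ind_orbit_lin(1)[OF *(2,3,5)] res_orbit_lin(1)[OF *(1,3,4)]]
        lin_map_finsum_pointwise[OF FM_module FM_module glin]])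
    fix b assume b: "b \<in> adm K"
    note bb = admD[OF b]
    have bH: "b \<in> adm H" by (rule adm_mono[OF *(5) b])
    define S where "S x = reps (?I x) K (fst b)" for x
    have S: "S x \<in> dcoset_reps G (?I x) K (fst b)" if "x \<in> T" for x
      unfolding S_def by (rule reps_in[OF Is[OF that] bb(1) *(2) Int_lower2 bb(2)])
    have SK: "z \<in> K" "z \<in> carrier G" if "x \<in> T" "z \<in> S x" for x z
      using dcoset_repsD(1)[OF S[OF that(1)] Is[OF that(1)] bb(1) *(2) Int_lower2 bb(2)] that
        sub_mem[OF *(2)] by auto
    let ?f = "\<lambda>w. orbit_vec J (J \<inter> conj_subgp G w (fst b), act w (snd b))"
    \<comment> \<open>Here the first stage is a double coset \<open>JxK\<close> of \<open>H\<close>,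
      and the second one splits it further over \<open>L\<close>; a term of the Mackey formula
      collects the orbits with the same \<open>x\<close>.\<close>
    let ?U = "(\<lambda>(x, z). x \<otimes> z) ` Sigma T S"
    note R = dcoset_refine_left[OF T * bb(1,2) S]
    have finT: "finite T" using TH finG by (meson finite_subset subsetI)
    have finS: "finite (S y)" if "y \<in> T" for y using SK[OF that] finG by (meson finite_subset subsetI)
    have fU: "?f \<in> ?U \<rightarrow> carrier (FM J)" by (rule res_sum_in(2)[OF bH *(1,3,4) R(1)])
    have gx: "?g x (orbit_vec K b) = (\<Oplus>\<^bsub>FM J\<^esub>z\<in>S x. ?f (x \<otimes> z))" if x: "x \<in> T" for x
    proof -
      let ?h = "\<lambda>z. (?I x \<inter> conj_subgp G z (fst b), act z (snd b))"
      have hadm: "?h z \<in> adm (?I x)" if "z \<in> S x" for z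
        by (rule adm_res[OF b Is[OF x] SK(2)[OF x that]])
      have glin': "(\<lambda>a. ind F (?J x) J (cnj F x (?I x) a)) \<in> lin_map k (FM (?I x)) (FM J)"
        by (rule lin_map_comp[OF cnj_orbit_lin(1)[OF Is[OF x] TH(2)[OF x], unfolded IJ[OF x]]
          ind_orbit_lin(1)[OF Js[OF x] *(1) Int_lower1]])
      have "?g x (orbit_vec K b) = ind F (?J x) J (cnj F x (?I x) (\<Oplus>\<^bsub>FM (?I x)\<^esub>z\<in>S x. orbit_vec (?I x) (?h z)))"
        using res_orbit_lin(2)[OF Is[OF x] *(2) Int_lower2 b S[OF x]] by simp
      also have "\<dots> = (\<Oplus>\<^bsub>FM J\<^esub>z\<in>S x. ind F (?J x) J (cnj F x (?I x) (orbit_vec (?I x) (?h z))))"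
        by (rule lin_map_finsum[OF glin' FM_module FM_module]) (use hadm orbit_vec_in in auto)
      also have "\<dots> = (\<Oplus>\<^bsub>FM J\<^esub>z\<in>S x. ?f (x \<otimes> z))"
      proof (rule FJ.finsum_cong'[OF refl])
        show "(\<lambda>z. ?f (x \<otimes> z)) \<in> S x \<rightarrow> carrier (FM J)" using fU x by force
        fix z assume z: "z \<in> S x"
        note zz = SK[OF x z] TH[OF x]
        have g1: "gact x (?h z) \<in> adm (?J x)"
          using gact_adm[OF hadm[OF z] Is[OF x] TH(2)[OF x]] IJ[OF x] by simp
        \<comment> \<open>As \<open>zLz^-1\<close> lies in \<open>K\<close>, its conjugate by
          \<open>x\<close> lies in \<open>xKx^-1\<close>, so the intersection with the latter drops
          out and the pair for \<open>xz\<close> remains.\<close>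
        have "conj_subgp G z (fst b) \<subseteq> K"
          using conj_mono[OF zz(2) sub_carrier[OF *(2)] bb(2)] conj_self[OF *(2) zz(1)] by simp
        then have "conj_subgp G x (conj_subgp G z (fst b)) \<subseteq> conj_subgp G x K"
          using conj_mono[OF zz(4) sub_carrier[OF *(2)]] by blast
        moreover have "conj_subgp G x (?I x \<inter> conj_subgp G z (fst b)) = ?J x \<inter> conj_subgp G x (conj_subgp G z (fst b))"
          using zz bb * Is[OF x] conj_Int[of x "?I x" "conj_subgp G z (fst b)"] IJ[OF x]
          by (simp add: conj_subset sub_carrier)
        ultimately have "conj_subgp G x (?I x \<inter> conj_subgp G z (fst b)) = J \<inter> conj_subgp G (x \<otimes> z) (fst b)"
          using zz bb by (auto simp: conj_conj sub_carrier)
        then have e: "gact x (?h z) = (J \<inter> conj_subgp G (x \<otimes> z) (fst b), act (x \<otimes> z) (snd b))"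
          using zz bb by (simp add: gact_def act_mult)
        have "cnj F x (?I x) (orbit_vec (?I x) (?h z)) = orbit_vec (?J x) (gact x (?h z))"
          using cnj_orbit_lin(2)[OF Is[OF x] TH(2)[OF x] hadm[OF z]] IJ[OF x] by simp
        then show "ind F (?J x) J (cnj F x (?I x) (orbit_vec (?I x) (?h z))) = ?f (x \<otimes> z)"
          using ind_orbit_lin(2)[OF Js[OF x] *(1) Int_lower1 g1] e by simp
      qed
      finally show ?thesis .
    qed
    have "res F H J (ind F K H (orbit_vec K b)) = res F H J (orbit_vec H b)" using ind_orbit_lin(2)[OF *(2,3,5) b] by simp
    also have "\<dots> = (\<Oplus>\<^bsub>FM J\<^esub>w\<in>?U. ?f w)"
      by (rule res_orbit_lin(2)[OF *(1,3,4) bH R(1)])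
    also have "\<dots> = (\<Oplus>\<^bsub>FM J\<^esub>p\<in>Sigma T S. ?f ((\<lambda>(x, z). x \<otimes> z) p))"
      by (rule FJ.finsum_reindex[OF fU R(2)])
    also have "\<dots> = (\<Oplus>\<^bsub>FM J\<^esub>x\<in>T. \<Oplus>\<^bsub>FM J\<^esub>z\<in>S x. ?f (x \<otimes> z))"
      by (subst FJ.finsum_Sigma[OF finT finS]) (use fU in \<open>force+\<close>)
    also have "\<dots> = (\<Oplus>\<^bsub>FM J\<^esub>x\<in>T. ?g x (orbit_vec K b))"
    proof (rule FJ.finsum_cong'[OF refl])
      show "(\<lambda>x. ?g x (orbit_vec K b)) \<in> T \<rightarrow> carrier (FM J)"
        using lin_mapD(1)[OF glin] orbit_vec_in[OF b] by auto
    qed (simp add: gx)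
    finally show "res F H J (ind F K H (orbit_vec K b)) = (\<Oplus>\<^bsub>FM J\<^esub>x\<in>T. ?g x (orbit_vec K b))" .
  qed (use a in simp_all)
  then show "res F H J (ind F K H a) = (\<Oplus>\<^bsub>obj F J\<^esub>x\<in>T. ?g x a)" by simp
qed

section \<open>The universal property of \<open>F\<close>\<close>

definition gen :: "'t \<Rightarrow> ('a set \<times> 't) set \<Rightarrow> 'k" where
  "gen t = orbit_vec (stab t) (stab t, t)"

lemma gen_adm: "t \<in> X \<Longrightarrow> (stab t, t) \<in> adm (stab t)"
  by (auto intro: admI stab_subgroup)

lemma gen_in: "t \<in> X \<Longrightarrow> gen t \<in> carrier (FM (stab t))"
  unfolding gen_def by (intro orbit_vec_in gen_adm)

lemma gen_act: "\<lbrakk>t \<in> X; g \<in> carrier G\<rbrakk> \<Longrightarrow> cnj F g (stab t) (gen t) = gen (act g t)"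
  using cnj_orbit_lin(2)[OF stab_subgroup _ gen_adm] by (simp add: gen_def gact_def stab_act)

text \<open>\<open>K/L \<rightarrow> X\<close> is induced from the point \<open>t\<close> viewed as
  an \<open>L\<close>-set over \<open>X\<close>, and that is a restriction from the whole stabiliser
  of \<open>t\<close>. So the elements \<open>gen t\<close> generate \<open>F\<close>.\<close>

lemma orbit_vec_gen:
  assumes "b \<in> adm K" "subgroup K G"
  shows "orbit_vec K b = ind F (fst b) K (res F (stab (snd b)) (fst b) (gen (snd b)))"
proof -
  note bb = admD[OF assms(1)]
  interpret FL: module k "FM (fst b)" by (rule FM_module)
  have st: "subgroup (stab (snd b)) G" by (rule stab_subgroup[OF bb(3)])
  have "{\<one>} \<in> dcoset_reps G (fst b) (stab (snd b)) (stab (snd b))"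
  proof (rule dcoset_repsI)
    fix h assume h: "h \<in> stab (snd b)"
    show "\<exists>x\<in>{\<one>}. \<exists>j\<in>fst b. \<exists>l\<in>stab (snd b). h = j \<otimes> x \<otimes> l"
      by (rule bexI[of _ \<one>], rule bexI[of _ \<one>], rule bexI[of _ h])
        (use h bb sub_mem[OF st h] in \<open>auto intro: subgroup.one_closed\<close>)
  qed (use bb st sub_carrier in \<open>auto intro: subgroup.one_closed\<close>)
  then have "res F (stab (snd b)) (fst b) (gen (snd b)) =
      (\<Oplus>\<^bsub>FM (fst b)\<^esub>y\<in>{\<one>}. orbit_vec (fst b) (fst b \<inter> conj_subgp G y (stab (snd b)), act y (snd b)))"
    using res_orbit_lin(2)[OF bb(1) st bb(4) gen_adm[OF bb(3)]] by (simp only: gen_def fst_conv snd_conv)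
  moreover have b1: "b \<in> adm (fst b)" using bb by (auto simp: adm_def case_prod_unfold)
  moreover have "(fst b \<inter> conj_subgp G \<one> (stab (snd b)), act \<one> (snd b)) = b"
    using bb st by (auto simp: conj_one sub_carrier act_one intro!: prod_eqI)
  ultimately have "res F (stab (snd b)) (fst b) (gen (snd b)) = orbit_vec (fst b) b"
    using FL.finsum_single[of "\<lambda>y. orbit_vec (fst b) (fst b \<inter> conj_subgp G y (stab (snd b)), act y (snd b))" "\<one>"]
      orbit_vec_in[OF b1] by (simp only:)
  then show ?thesis
    using ind_orbit_lin(2)[OF bb(1) assms(2) bb(2) b1] by (simp only:)
qed

lemma F_hom_eqI:
  assumes "mackey_functor G k M" "f \<in> mackey_hom G k F M" "h \<in> mackey_hom G k F M"
    and "\<And>t. t \<in> X \<Longrightarrow> f (stab t) (gen t) = h (stab t) (gen t)"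
    and "subgroup K G" "x \<in> carrier (FM K)"
  shows "f K x = h K x"
proof -
  interpret M: mackey_functor G k M by fact
  show ?thesis
  proof (rule F_eqI[OF assms(5) M.module_obj[OF assms(5)] _ _ _ assms(6)])
    show "f K \<in> lin_map k (FM K) (obj M K)" "h K \<in> lin_map k (FM K) (obj M K)"
      using mackey_homD(1)[OF assms(2,5)] mackey_homD(1)[OF assms(3,5)] by simp_all
  next
    fix b assume b: "b \<in> adm K"
    note bb = admD[OF b]
    have st: "subgroup (stab (snd b)) G" by (rule stab_subgroup[OF bb(3)])
    have g: "gen (snd b) \<in> carrier (obj F (stab (snd b)))" using gen_in[OF bb(3)] by simp
    have r: "res F (stab (snd b)) (fst b) (gen (snd b)) \<in> carrier (obj F (fst b))"
      using lin_mapD(1)[OF res_orbit_lin(1)[OF bb(1) st bb(4)]] g by simp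
    have e: "u K (orbit_vec K b) = ind M (fst b) K (res M (stab (snd b)) (fst b) (u (stab (snd b)) (gen (snd b))))"
      if "u \<in> mackey_hom G k F M" for u
      unfolding orbit_vec_gen[OF b assms(5)]
      using mackey_homD(2)[OF that bb(1) assms(5) bb(2) r] mackey_homD(3)[OF that bb(1) st bb(4) g] by simp
    show "f K (orbit_vec K b) = h K (orbit_vec K b)"
      unfolding e[OF assms(2)] e[OF assms(3)] assms(4)[OF bb(3)] ..
  qed
qed

text \<open>The value of \<open>M\<close> at the \<open>G\<close>-set \<open>X\<close>, that is, the
  equivariant families of elements at the stabilisers. By \<open>yoneda\<close> they are the
  morphisms from \<open>F\<close> to \<open>M\<close>.\<close>

definition family :: "('a, 'k, 'm) mackey \<Rightarrow> ('t \<Rightarrow> 'm) \<Rightarrow> bool" where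
  "family M m \<longleftrightarrow> (\<forall>t\<in>X. m t \<in> carrier (obj M (stab t)) \<and>
     (\<forall>g\<in>carrier G. cnj M g (stab t) (m t) = m (act g t)))"

definition yoneda :: "('a, 'k, 'm) mackey \<Rightarrow> ('t \<Rightarrow> 'm) \<Rightarrow> 'a set \<Rightarrow> (('a set \<times> 't) set \<Rightarrow> 'k) \<Rightarrow> 'm" where
  "yoneda M m K = orbit_lin (obj M K) K (\<lambda>b. ind M (fst b) K (res M (stab (snd b)) (fst b) (m (snd b))))"

text \<open>The formula is forced by \<open>orbit_vec_gen\<close>. It respects induction by
  transitivity and conjugation by equivariance of the family; for restriction it is the Mackey
  formula of \<open>M\<close>.\<close>

lemma yoneda:
  assumes "mackey_functor G k M" "family M m"
  shows yoneda_bas: "\<lbrakk>subgroup K G; b \<in> adm K\<rbrakk> \<Longrightarrow>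
           yoneda M m K (orbit_vec K b) = ind M (fst b) K (res M (stab (snd b)) (fst b) (m (snd b)))"
    and yoneda_hom: "yoneda M m \<in> mackey_hom G k F M"
    and yoneda_gen: "t \<in> X \<Longrightarrow> yoneda M m (stab t) (gen t) = m t"
proof -
  interpret M: mackey_functor G k M by fact
  have m: "m t \<in> carrier (obj M (stab t))" "g \<in> carrier G \<Longrightarrow> cnj M g (stab t) (m t) = m (act g t)" if "t \<in> X" for t g
    using assms(2) that by (auto simp: family_def)
  define r where "r b = res M (stab (snd b)) (fst b) (m (snd b))" for b
  have r: "r b \<in> carrier (obj M (fst b))" if "b \<in> adm K" for b K
    unfolding r_def using admD[OF that] lin_mapD(1)[OF M.res_lin m(1)] stab_subgroup by blast
  have v: "ind M (fst b) K (r b) \<in> carrier (obj M K)" if "b \<in> adm K" "subgroup K G" for b K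
    using lin_mapD(1)[OF M.ind_lin r[OF that(1)]] admD[OF that(1)] that(2) by blast
  have rg: "r (gact g b) = cnj M g (fst b) (r b)" if "b \<in> adm K" "g \<in> carrier G" for b g K
  proof -
    note bb = admD[OF that(1)]
    have "cnj M g (fst b) (r b) = res M (conj_subgp G g (stab (snd b))) (conj_subgp G g (fst b)) (cnj M g (stab (snd b)) (m (snd b)))"
      unfolding r_def by (rule M.cnj_res[OF bb(1) stab_subgroup[OF bb(3)] bb(4) that(2) m(1)[OF bb(3)]])
    then show ?thesis using m(2)[OF bb(3) that(2)] stab_act[OF that(2) bb(3)] by (simp add: r_def gact_def)
  qed
  have vg: "ind M (fst (gact g b)) (conj_subgp G g K) (r (gact g b)) = cnj M g K (ind M (fst b) K (r b))"
    if "b \<in> adm K" "g \<in> carrier G" "subgroup K G" for b g K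
    using M.cnj_ind[OF admD(1)[OF that(1)] that(3) admD(2)[OF that(1)] that(2) r[OF that(1)]]
    by (simp add: rg[OF that(1,2)]) (simp add: gact_def)
  have e: "yoneda M m K = orbit_lin (obj M K) K (\<lambda>b. ind M (fst b) K (r b))" for K by (simp add: yoneda_def r_def)
  have lin: "yoneda M m K \<in> lin_map k (FM K) (obj M K)" if "subgroup K G" for K
    unfolding e by (rule orbit_lin_lin[OF M.module_obj[OF that] that v[OF _ that]])
  have orbit_vec: "yoneda M m K (orbit_vec K b) = ind M (fst b) K (r b)" if K: "subgroup K G" and b: "b \<in> adm K" for K b
    unfolding e
  proof (rule orbit_lin_bas[OF M.module_obj[OF K] K v[OF _ K] _ b])
    fix c h assume c: "c \<in> adm K" "h \<in> K"
    show "ind M (fst (gact h c)) K (r (gact h c)) = ind M (fst c) K (r c)"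
      using vg[OF c(1) sub_mem[OF K c(2)] K] conj_self[OF K c(2)] M.cnj_id[OF K c(2) v[OF c(1) K]] by simp
  qed
  then show "\<lbrakk>subgroup K G; b \<in> adm K\<rbrakk> \<Longrightarrow>
           yoneda M m K (orbit_vec K b) = ind M (fst b) K (res M (stab (snd b)) (fst b) (m (snd b)))"
    by (simp add: r_def)
  show "yoneda M m (stab t) (gen t) = m t" if t: "t \<in> X"
    using orbit_vec[OF stab_subgroup[OF t] gen_adm[OF t]] t m(1)
    by (simp add: gen_def r_def M.res_id M.ind_id stab_subgroup)
  show "yoneda M m \<in> mackey_hom G k F M"
  proof (rule mackey_homI)
    show "yoneda M m H \<in> lin_map k (obj F H) (obj M H)" if "subgroup H G" for H using lin[OF that] by simp
  next
    fix K H a assume *: "subgroup K G" "subgroup H G" "K \<subseteq> H" "a \<in> carrier (obj F K)"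
    show "yoneda M m H (ind F K H a) = ind M K H (yoneda M m K a)"
    proof (rule F_eqI[OF *(1) M.module_obj[OF *(2)] lin_map_comp[OF ind_orbit_lin(1)[OF *(1-3)] lin[OF *(2)]]
          lin_map_comp[OF lin[OF *(1)] M.ind_lin[OF *(1-3)]]])
      fix b assume b: "b \<in> adm K"
      note bb = admD[OF b]
      show "yoneda M m H (ind F K H (orbit_vec K b)) = ind M K H (yoneda M m K (orbit_vec K b))"
        by (simp add: ind_orbit_lin(2)[OF *(1-3) b] orbit_vec[OF *(1) b] orbit_vec[OF *(2) adm_mono[OF *(3) b]]
            M.ind_trans[OF bb(1) *(1,2) bb(2) *(3) r[OF b]])
    qed (use * in simp)
  next
    fix g H a assume *: "g \<in> carrier G" "subgroup H G" "a \<in> carrier (obj F H)"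
    note gH = conj_subgroup[OF *(2,1)]
    show "yoneda M m (conj_subgp G g H) (cnj F g H a) = cnj M g H (yoneda M m H a)"
    proof (rule F_eqI[OF *(2) M.module_obj[OF gH] lin_map_comp[OF cnj_orbit_lin(1)[OF *(2,1)] lin[OF gH]]
          lin_map_comp[OF lin[OF *(2)] M.cnj_lin[OF *(2,1)]]])
      fix b assume b: "b \<in> adm H"
      show "yoneda M m (conj_subgp G g H) (cnj F g H (orbit_vec H b)) = cnj M g H (yoneda M m H (orbit_vec H b))"
        by (simp add: cnj_orbit_lin(2)[OF *(2,1) b] orbit_vec[OF *(2) b] orbit_vec[OF gH gact_adm[OF b *(2,1)]] vg[OF b *(1,2)])
    qed (use * in simp)
  next
    fix J H a assume *: "subgroup J G" "subgroup H G" "J \<subseteq> H" "a \<in> carrier (obj F H)"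
    interpret MJ: module k "obj M J" by (rule M.module_obj[OF *(1)])
    show "yoneda M m J (res F H J a) = res M H J (yoneda M m H a)"
    proof (rule F_eqI[OF *(2) M.module_obj[OF *(1)] lin_map_comp[OF res_orbit_lin(1)[OF *(1-3)] lin[OF *(1)]]
          lin_map_comp[OF lin[OF *(2)] M.res_lin[OF *(1-3)]]])
      fix b assume b: "b \<in> adm H"
      note bb = admD[OF b]
      define T where "T = reps J H (fst b)"
      have T: "T \<in> dcoset_reps G J H (fst b)" unfolding T_def by (rule reps_in[OF *(1) bb(1) *(2,3) bb(2)])
      have TG: "y \<in> carrier G" if "y \<in> T" for y
        using dcoset_repsD(1)[OF T *(1) bb(1) *(2,3) bb(2)] that sub_mem[OF *(2)] by auto
      let ?c = "\<lambda>y. (J \<inter> conj_subgp G y (fst b), act y (snd b))"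
      have c: "?c y \<in> adm J" if "y \<in> T" for y by (rule adm_res[OF b *(1) TG[OF that]])
      have "yoneda M m J (res F H J (orbit_vec H b)) = (\<Oplus>\<^bsub>obj M J\<^esub>y\<in>T. yoneda M m J (orbit_vec J (?c y)))"
        unfolding res_orbit_lin(2)[OF *(1-3) b T]
        by (rule lin_map_finsum[OF lin[OF *(1)] FM_module M.module_obj[OF *(1)] res_sum_in(2)[OF b *(1-3) T]])
      \<comment> \<open>The sum that defines restriction in \<open>F\<close> becomes the right side
        of the Mackey formula for \<open>M\<close> at \<open>r b\<close>, which is then read from
        right to left.\<close>
      also have "\<dots> = (\<Oplus>\<^bsub>obj M J\<^esub>y\<in>T. ind M (J \<inter> conj_subgp G y (fst b)) J
            (cnj M y (conj_subgp G (inv y) J \<inter> fst b) (res M (fst b) (conj_subgp G (inv y) J \<inter> fst b) (r b))))"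
      proof (rule MJ.finsum_cong'[OF refl])
        have *: "yoneda M m J (orbit_vec J (?c y)) = ind M (J \<inter> conj_subgp G y (fst b)) J
            (cnj M y (conj_subgp G (inv y) J \<inter> fst b) (res M (fst b) (conj_subgp G (inv y) J \<inter> fst b) (r b)))"
          if y: "y \<in> T" for y
        proof -
          let ?I = "conj_subgp G (inv y) J \<inter> fst b"
          have yG: "y \<in> carrier G" by (rule TG[OF y])
          have Is: "subgroup ?I G" using yG * bb by (simp add: subgroups_Inter_pair conj_subgroup)
          have I: "(?I, snd b) \<in> adm H" using Is bb by (auto intro!: admI)
          have gI: "gact y (?I, snd b) = ?c y"
            using yG * bb by (simp add: gact_def conj_Int conj_subset sub_carrier conj_conj conj_one)
          have "res M (fst b) ?I (r b) = r (?I, snd b)"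
            unfolding r_def using M.res_trans[OF Is bb(1) stab_subgroup[OF bb(3)] Int_lower2 bb(4) m(1)[OF bb(3)]] by simp
          then have "cnj M y ?I (res M (fst b) ?I (r b)) = r (?c y)"
            using rg[OF I yG] unfolding gI by simp
          then show ?thesis using orbit_vec[OF *(1) c[OF y]] by simp
        qed
        then show "\<And>y. y \<in> T \<Longrightarrow> yoneda M m J (orbit_vec J (?c y)) = ind M (J \<inter> conj_subgp G y (fst b)) J
            (cnj M y (conj_subgp G (inv y) J \<inter> fst b) (res M (fst b) (conj_subgp G (inv y) J \<inter> fst b) (r b)))" .
        show "(\<lambda>y. ind M (J \<inter> conj_subgp G y (fst b)) J
            (cnj M y (conj_subgp G (inv y) J \<inter> fst b) (res M (fst b) (conj_subgp G (inv y) J \<inter> fst b) (r b))))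
             \<in> T \<rightarrow> carrier (obj M J)"
          using lin_mapD(1)[OF lin[OF \<open>subgroup J G\<close>] orbit_vec_in[OF c]] by (auto simp: *[symmetric])
      qed
      also have "\<dots> = res M H J (ind M (fst b) H (r b))"
        by (rule M.mackey_formula[OF *(1) bb(1) *(2,3) bb(2) T r[OF b], symmetric])
      also have "\<dots> = res M H J (yoneda M m H (orbit_vec H b))" using orbit_vec[OF *(2) b] by simp
      finally show "yoneda M m J (res F H J (orbit_vec H b)) = res M H J (yoneda M m H (orbit_vec H b))" .
    qed (use * in simp)
  qed
qed

end

section \<open>The idempotent vanishing on proper subgroups\<close>

context group begin

text \<open>The map \<open>(j, l, y) \<mapsto> jyl\<close> from
  \<open>J \<times> K \<times> T\<close> to \<open>H\<close> has a fibre of size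
  \<open>|J \<inter> hKh^-1|\<close> over \<open>h\<close>, and \<open>f\<close> is constant along
  double cosets. So a sum over representatives becomes a weighted sum over the group, which is
  easier to rearrange.\<close>

lemma dcoset_card_sum:
  fixes f :: "'a \<Rightarrow> int"
  assumes T: "T \<in> dcoset_reps G J H K"
    and sub: "subgroup J G" "subgroup K G" "subgroup H G" "J \<subseteq> H" "K \<subseteq> H" and fin: "finite (carrier G)"
    and f: "\<And>j y l. \<lbrakk>j \<in> J; y \<in> H; l \<in> K\<rbrakk> \<Longrightarrow> f (j \<otimes> y \<otimes> l) = f y"
  shows "int (card J) * int (card K) * (\<Sum>y\<in>T. f y) = (\<Sum>h\<in>H. int (card (J \<inter> conj_subgp G h K)) * f h)"
proof -
  interpret J: subgroup J G by fact
  interpret K: subgroup K G by fact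
  interpret H: subgroup H G by fact
  note D = dcoset_repsD[OF T sub]
  have TG: "y \<in> H" "y \<in> carrier G" if "y \<in> T" for y using D(1) that by auto
  have finH: "finite H" using fin H.subset finite_subset by blast
  have finJ: "finite J" "finite K" "finite T" using finH sub D(1) finite_subset by blast+
  define P where "P = J \<times> K \<times> T"
  define g where "g = (\<lambda>(j, l, y). j \<otimes> y \<otimes> l)"
  have gP: "g ` P \<subseteq> H" using sub D(1) by (auto simp: P_def g_def subset_iff)
  have fib: "card {p \<in> P. g p = h} = card (J \<inter> conj_subgp G h K)" if h: "h \<in> H" for h
  proof -
    obtain y0 j0 l0 where p0: "y0 \<in> T" "j0 \<in> J" "l0 \<in> K" "h = j0 \<otimes> y0 \<otimes> l0" using D(2)[OF h] by blast
    have hG: "h \<in> carrier G" using h by simp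
    have c0: "y0 \<in> carrier G" "j0 \<in> carrier G" "l0 \<in> carrier G" using p0 TG by auto
    have y0: "y = y0" if "(j, l, y) \<in> P" "g (j, l, y) = h" for j l y
      using dcoset_reps_unique[OF T sub, of y y0 j l j0 l0] that p0 by (simp add: P_def g_def)
    have mem: "a \<in> conj_subgp G h K \<longleftrightarrow> a \<in> carrier G \<and> inv h \<otimes> a \<otimes> h \<in> K" for a
      by (rule conj_mem[OF hG K.subset])
    \<comment> \<open>The triples over \<open>h\<close> share the representative \<open>y0\<close>
      and arise from \<open>(j0, l0, y0)\<close> by multiplying \<open>j0\<close> on the left with
      an element of \<open>J \<inter> hKh^-1\<close>.\<close>
    have "bij_betw (\<lambda>(j, l, y). j \<otimes> inv j0) {p \<in> P. g p = h} (J \<inter> conj_subgp G h K)"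
      unfolding bij_betw_def
    proof
      show "inj_on (\<lambda>(j, l, y). j \<otimes> inv j0) {p \<in> P. g p = h}"
      proof (rule inj_onI)
        fix p q assume pq: "p \<in> {p \<in> P. g p = h}" "q \<in> {p \<in> P. g p = h}"
          "(\<lambda>(j, l, y). j \<otimes> inv j0) p = (\<lambda>(j, l, y). j \<otimes> inv j0) q"
        obtain j l y where p: "p = (j, l, y)" by (cases p)
        obtain j' l' y' where q: "q = (j', l', y')" by (cases q)
        have *: "(j, l, y) \<in> P" "g (j, l, y) = h" "(j', l', y') \<in> P" "g (j', l', y') = h"
          "j \<otimes> inv j0 = j' \<otimes> inv j0" using pq p q by auto
        have yy: "y = y0" "y' = y0" using y0[OF *(1,2)] y0[OF *(3,4)] by simp_all
        have c: "j \<in> carrier G" "j' \<in> carrier G" "l \<in> carrier G" "l' \<in> carrier G" using *(1,3) by (auto simp: P_def)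
        have jj: "j = j'" using *(5) c c0 by simp
        have "j \<otimes> y0 \<otimes> l = j \<otimes> y0 \<otimes> l'" using *(2,4) yy jj by (simp add: g_def)
        then have "l = l'" using c c0 by simp
        then show "p = q" using yy jj p q by simp
      qed
      show "(\<lambda>(j, l, y). j \<otimes> inv j0) ` {p \<in> P. g p = h} = J \<inter> conj_subgp G h K"
      proof (intro equalityI subsetI)
        fix a assume "a \<in> (\<lambda>(j, l, y). j \<otimes> inv j0) ` {p \<in> P. g p = h}"
        then obtain j l y where *: "(j, l, y) \<in> P" "g (j, l, y) = h" "a = j \<otimes> inv j0" by auto
        have yy: "y = y0" using y0 * by auto
        have c: "j \<in> carrier G" "l \<in> carrier G" "j \<in> J" "l \<in> K" using * by (auto simp: P_def)
        have j: "j = h \<otimes> inv l \<otimes> inv y0" using *(2)[symmetric] c c0 yy by (simp add: g_def m_assoc)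
        have j0: "inv j0 = y0 \<otimes> l0 \<otimes> inv h" using p0(4) c0 by (simp add: inv_mult_group m_assoc)
          (simp add: m_assoc[symmetric])
        have "inv h \<otimes> a \<otimes> h = inv l \<otimes> l0" unfolding *(3) j0 using c c0 hG
          by (simp add: j m_assoc) (simp add: m_assoc[symmetric])
        then show "a \<in> J \<inter> conj_subgp G h K" unfolding Int_iff mem using c p0(2,3) *(3) by simp
      next
        fix a assume a: "a \<in> J \<inter> conj_subgp G h K"
        then have aG: "a \<in> carrier G" "a \<in> J" "inv h \<otimes> a \<otimes> h \<in> K" by (auto simp: mem)
        define l where "l = l0 \<otimes> inv (inv h \<otimes> a \<otimes> h)"
        have l: "l \<in> K" using aG p0 by (simp add: l_def)
        have "a \<otimes> j0 \<otimes> y0 \<otimes> l = a \<otimes> h \<otimes> inv (inv h \<otimes> a \<otimes> h)"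
          unfolding l_def p0(4) using aG c0 by (simp add: m_assoc)
        also have "\<dots> = h" using aG hG by (simp add: inv_mult_group m_assoc) (simp add: m_assoc[symmetric])
        finally have "(a \<otimes> j0, l, y0) \<in> {p \<in> P. g p = h}" using aG l p0 by (simp add: P_def g_def)
        moreover have "a = a \<otimes> j0 \<otimes> inv j0" using aG c0 by (simp add: m_assoc)
        ultimately show "a \<in> (\<lambda>(j, l, y). j \<otimes> inv j0) ` {p \<in> P. g p = h}"
          by (intro image_eqI[of _ _ "(a \<otimes> j0, l, y0)"]) simp_all
      qed
    qed
    then show ?thesis by (rule bij_betw_same_card)
  qed
  have "int (card J) * int (card K) * (\<Sum>y\<in>T. f y) = (\<Sum>j\<in>J. \<Sum>l\<in>K. \<Sum>y\<in>T. f y)" by simp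
  also have "\<dots> = (\<Sum>p\<in>P. f (snd (snd p)))"
    unfolding P_def by (simp only: sum.cartesian_product case_prod_unfold fst_conv snd_conv)
  also have "\<dots> = (\<Sum>p\<in>P. f (g p))"
    by (rule sum.cong) (use f TG in \<open>auto simp: P_def g_def\<close>)
  also have "\<dots> = (\<Sum>h\<in>H. \<Sum>p\<in>{p \<in> P. g p = h}. f (g p))"
    by (rule sum.group[symmetric]) (use finJ finH gP in \<open>auto simp: P_def\<close>)
  also have "\<dots> = (\<Sum>h\<in>H. int (card (J \<inter> conj_subgp G h K)) * f h)"
    by (rule sum.cong) (simp_all add: fib)
  finally show ?thesis .
qed

section \<open>Moebius inversion on the lattice of subgroups\<close>

lemma finite_subgroups:
  assumes "finite (carrier G)" shows "finite {L. subgroup L G \<and> P L}"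
  by (rule finite_subset[of _ "Pow (carrier G)"]) (use assms in \<open>auto dest: subgroup.subset\<close>)

text \<open>On subgroups of \<open>H\<close> this is the Moebius function \<mu>(K, H). The recursion
  descends from \<open>H\<close>: the value at \<open>L\<close> uses the subgroups strictly between
  \<open>L\<close> and \<open>H\<close>, together with \<open>H\<close> itself.\<close>

lemma moebius_exists:
  assumes fin: "finite (carrier G)" and H: "subgroup H G"
  shows "\<exists>\<mu>. \<mu> H = (1::int) \<and>
    (\<forall>L. subgroup L G \<and> L \<subset> H \<longrightarrow> (\<Sum>K | subgroup K G \<and> L \<subseteq> K \<and> K \<subseteq> H. \<mu> K) = 0)"
proof -
  have finH: "finite H" using fin subgroup.subset[OF H] finite_subset by blast
  define r where "r = {(K, L). L \<subset> K \<and> K \<subseteq> H}"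
  have "wf r"
  proof (rule wf_subset[OF wf_measure[of "\<lambda>K. card H - card K"]])
    show "r \<subseteq> measure (\<lambda>K. card H - card K)"
    proof clarify
      fix K L assume "(K, L) \<in> r"
      then have *: "L \<subset> K" "K \<subseteq> H" by (auto simp: r_def)
      then have "card L < card K" "card K \<le> card H"
        using finH by (meson finite_subset psubset_card_mono, meson card_mono)
      then show "(K, L) \<in> measure (\<lambda>K. card H - card K)" by simp
    qed
  qed
  define \<mu> where "\<mu> = wfrec r (\<lambda>f L. if L = H then 1 else - (\<Sum>K | subgroup K G \<and> L \<subset> K \<and> K \<subseteq> H. f K :: int))"
  have rec: "\<mu> L = - (\<Sum>K | subgroup K G \<and> L \<subset> K \<and> K \<subseteq> H. \<mu> K)" if "L \<noteq> H" for L
  proof -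
    have "\<mu> L = - (\<Sum>K | subgroup K G \<and> L \<subset> K \<and> K \<subseteq> H. cut \<mu> r L K)"
      using that by (subst \<mu>_def, subst wfrec[OF \<open>wf r\<close>]) (simp add: \<mu>_def[symmetric])
    also have "(\<Sum>K | subgroup K G \<and> L \<subset> K \<and> K \<subseteq> H. cut \<mu> r L K) = (\<Sum>K | subgroup K G \<and> L \<subset> K \<and> K \<subseteq> H. \<mu> K)"
      by (rule sum.cong) (auto simp: cut_def r_def)
    finally show ?thesis .
  qed
  have "(\<Sum>K | subgroup K G \<and> L \<subseteq> K \<and> K \<subseteq> H. \<mu> K) = 0" if L: "subgroup L G" "L \<subset> H" for L
  proof -
    have e: "{K. subgroup K G \<and> L \<subseteq> K \<and> K \<subseteq> H} = insert L {K. subgroup K G \<and> L \<subset> K \<and> K \<subseteq> H}"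
      using L by auto
    show ?thesis unfolding e using rec[of L] L finite_subgroups[OF fin]
      by (subst sum.insert) auto
  qed
  moreover have "\<mu> H = 1" by (subst \<mu>_def, subst wfrec[OF \<open>wf r\<close>]) simp
  ultimately show ?thesis by blast
qed

text \<open>Weisner's theorem. The sum over all \<open>K\<close> above \<open>S\<close> is zero;
  grouped by \<open>K \<inter> L\<close> it has one group for each \<open>U\<close> between
  \<open>S\<close> and \<open>L\<close>. The groups with \<open>U \<noteq> S\<close> vanish by
  induction, so the one for \<open>S\<close> does too.\<close>

lemma weisner:
  fixes \<mu> :: "'a set \<Rightarrow> int"
  assumes fin: "finite (carrier G)" and H: "subgroup H G"
    and \<mu>: "\<And>L. subgroup L G \<Longrightarrow> L \<subset> H \<Longrightarrow> (\<Sum>K | subgroup K G \<and> L \<subseteq> K \<and> K \<subseteq> H. \<mu> K) = 0"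
    and L: "subgroup L G" "L \<subset> H" and S: "subgroup S G" "S \<subseteq> L"
  shows "(\<Sum>K | subgroup K G \<and> K \<subseteq> H \<and> K \<inter> L = S. \<mu> K) = 0"
  using S
proof (induction "card L - card S" arbitrary: S rule: less_induct)
  case less
  have finL: "finite L" using fin subgroup.subset[OF L(1)] finite_subset by blast
  define A where "A = {K. subgroup K G \<and> S \<subseteq> K \<and> K \<subseteq> H}"
  define B where "B = {U. subgroup U G \<and> S \<subseteq> U \<and> U \<subseteq> L}"
  have finAB: "finite A" "finite B" unfolding A_def B_def by (rule finite_subgroups[OF fin])+
  have "(\<Sum>K\<in>A. \<mu> K) = (\<Sum>U\<in>B. \<Sum>K\<in>{K \<in> A. K \<inter> L = U}. \<mu> K)"
    by (rule sum.group[symmetric]) (use finAB less.prems L in \<open>auto simp: A_def B_def subgroups_Inter_pair\<close>)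
  also have "\<dots> = (\<Sum>U\<in>B. if U = S then (\<Sum>K | subgroup K G \<and> K \<subseteq> H \<and> K \<inter> L = S. \<mu> K) else 0)"
  proof (rule sum.cong[OF refl])
    fix U assume U: "U \<in> B"
    have e: "{K \<in> A. K \<inter> L = U} = {K. subgroup K G \<and> K \<subseteq> H \<and> K \<inter> L = U}"
      using U by (auto simp: A_def B_def)
    show "(\<Sum>K\<in>{K \<in> A. K \<inter> L = U}. \<mu> K) =
      (if U = S then (\<Sum>K | subgroup K G \<and> K \<subseteq> H \<and> K \<inter> L = S. \<mu> K) else 0)"
    proof (cases "U = S")
      case False
      then have "S \<subset> U" "U \<subseteq> L" using U by (auto simp: B_def)
      then have "card S < card U" "card U \<le> card L"
        using finL by (meson finite_subset psubset_card_mono, meson card_mono)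
      then have "card L - card U < card L - card S" by simp
      then show ?thesis using less.hyps[of U] U False unfolding e by (auto simp: B_def)
    qed (use e in simp)
  qed
  also have "\<dots> = (\<Sum>K | subgroup K G \<and> K \<subseteq> H \<and> K \<inter> L = S. \<mu> K)"
    using finAB less.prems by (subst sum.delta) (auto simp: B_def)
  finally have e: "(\<Sum>K\<in>A. \<mu> K) = (\<Sum>K | subgroup K G \<and> K \<subseteq> H \<and> K \<inter> L = S. \<mu> K)" .
  have "S \<subset> H" using less.prems L by auto
  then have "(\<Sum>K\<in>A. \<mu> K) = 0" unfolding A_def by (rule \<mu>[OF less.prems(1)])
  with e show ?case by simp
qed

lemma conj_bij_subgroups:
  assumes H: "subgroup H G" and h: "h \<in> H"
  shows "bij_betw (conj_subgp G h) {L. subgroup L G \<and> L \<subseteq> H} {L. subgroup L G \<and> L \<subseteq> H}"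
proof -
  have hG: "h \<in> carrier G" "inv h \<in> H" using subgroup.mem_carrier[OF H h] subgroup.m_inv_closed[OF H h] by auto
  have c: "conj_subgp G a L \<subseteq> H" if "a \<in> H" "L \<subseteq> H" for a L
    using conj_mono[OF subgroup.mem_carrier[OF H that(1)] subgroup.subset[OF H] that(2)] conj_self[OF H that(1)] by simp
  show ?thesis
    by (rule bij_betw_byWitness[of _ "conj_subgp G (inv h)"])
      (use c h hG in \<open>auto simp: conj_inv_conj subgroup.subset conj_subgroup\<close>)
qed

lemma conj_sum:
  fixes f :: "'a set \<Rightarrow> int"
  assumes "subgroup H G" "h \<in> H"
  shows "(\<Sum>L | subgroup L G \<and> L \<subseteq> H. f (conj_subgp G h L)) = (\<Sum>L | subgroup L G \<and> L \<subseteq> H. f L)"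
  by (rule sum.reindex_bij_betw[OF conj_bij_subgroups[OF assms]])

lemma mult_bij:
  assumes H: "subgroup H G" "h \<in> H"
  shows "bij_betw (\<lambda>y. h \<otimes> y) H H" "bij_betw (\<lambda>y. y \<otimes> h) H H"
proof -
  interpret H: subgroup H G by fact
  show "bij_betw (\<lambda>y. h \<otimes> y) H H"
    by (rule bij_betw_byWitness[of _ "\<lambda>y. inv h \<otimes> y"]) (use H in \<open>auto simp: m_assoc[symmetric]\<close>)
  show "bij_betw (\<lambda>y. y \<otimes> h) H H"
    by (rule bij_betw_byWitness[of _ "\<lambda>y. y \<otimes> inv h"]) (use H in \<open>auto simp: m_assoc\<close>)
qed

lemma class_reps_exist:
  assumes fin: "finite (carrier G)" and H: "subgroup H G"
  shows "\<exists>rp. (\<forall>L. subgroup L G \<and> L \<subseteq> H \<longrightarrow> (\<exists>h\<in>H. rp L = conj_subgp G h L) \<and>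
     (\<forall>h\<in>H. rp (conj_subgp G h L) = rp L))"
proof -
  interpret H: subgroup H G by fact
  define rp where "rp L = (SOME M. \<exists>h\<in>H. M = conj_subgp G h L)" for L
  have "\<exists>h\<in>H. rp L = conj_subgp G h L" for L
    unfolding rp_def by (rule someI_ex) (use H.one_closed in blast)
  moreover have "rp (conj_subgp G h L) = rp L" if "subgroup L G" "L \<subseteq> H" "h \<in> H" for h L
  proof -
    have LG: "L \<subseteq> carrier G" using that(1) by (rule subgroup.subset)
    have "(\<exists>a\<in>H. M = conj_subgp G a (conj_subgp G h L)) = (\<exists>a\<in>H. M = conj_subgp G a L)" for M
    proof
      assume "\<exists>a\<in>H. M = conj_subgp G a (conj_subgp G h L)"
      then obtain a where "a \<in> H" "M = conj_subgp G a (conj_subgp G h L)" by blast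
      then show "\<exists>a\<in>H. M = conj_subgp G a L" using that LG
        by (intro bexI[of _ "a \<otimes> h"]) (simp_all add: conj_conj)
    next
      assume "\<exists>a\<in>H. M = conj_subgp G a L"
      then obtain a where "a \<in> H" "M = conj_subgp G a L" by blast
      then show "\<exists>a\<in>H. M = conj_subgp G a (conj_subgp G h L)" using that LG
        by (intro bexI[of _ "a \<otimes> inv h"]) (simp_all add: conj_conj conj_subset m_assoc)
    qed
    then show ?thesis by (simp add: rp_def)
  qed
  ultimately show ?thesis by blast
qed

text \<open>The vector of coefficients \<open>x\<close> is a multiple of the idempotent of the rational Burnside ring of \<open>H\<close>
  that vanishes on all proper subgroups; dividing by the greatest common divisor keeps it nonzero
  in every characteristic.\<close>

lemma primitive_coefficients:
  assumes fin: "finite (carrier G)" and H: "subgroup H G"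
  shows "\<exists>Rp (x :: 'a set \<Rightarrow> int). finite Rp \<and> Rp \<subseteq> {L. subgroup L G \<and> L \<subseteq> H} \<and>
     (\<forall>L\<in>Rp. \<forall>M\<in>Rp. \<forall>h\<in>H. M = conj_subgp G h L \<longrightarrow> L = M) \<and> Gcd (x ` Rp) = 1 \<and>
     (\<forall>K T c. subgroup K G \<and> K \<subset> H \<and> (\<forall>L\<in>Rp. T L \<in> dcoset_reps G L H K) \<and>
        (\<forall>S\<subseteq>K. \<forall>a\<in>K. c (conj_subgp G a S) = (c S :: int)) \<longrightarrow>
        (\<Sum>L\<in>Rp. x L * (\<Sum>y\<in>T L. c (conj_subgp G (inv y) L \<inter> K))) = 0)"
proof -
  interpret H: subgroup H G by fact
  have finH: "finite H" using fin H.subset finite_subset by blast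
  define Sub where "Sub = {L. subgroup L G \<and> L \<subseteq> H}"
  have finS: "finite Sub" unfolding Sub_def by (rule finite_subgroups[OF fin])
  have SubG: "L \<subseteq> carrier G" if "L \<in> Sub" for L using that subgroup.subset by (auto simp: Sub_def)
  obtain \<mu> :: "'a set \<Rightarrow> int" where \<mu>1: "\<mu> H = 1" and
    \<mu>: "\<And>L. subgroup L G \<Longrightarrow> L \<subset> H \<Longrightarrow> (\<Sum>K | subgroup K G \<and> L \<subseteq> K \<and> K \<subseteq> H. \<mu> K) = 0"
    using moebius_exists[OF fin H] by blast
  \<comment> \<open>Averaging over \<open>H\<close> makes the coefficients constant on conjugacy
    classes by construction, with no appeal to uniqueness of \<mu>.\<close>
  define \<nu> where "\<nu> L = (\<Sum>h\<in>H. \<mu> (conj_subgp G h L))" for L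
  have \<nu>H: "\<nu> H = int (card H)" by (simp add: \<nu>_def conj_self[OF H] \<mu>1)
  have \<nu>conj: "\<nu> (conj_subgp G y L) = \<nu> L" if "y \<in> H" "L \<in> Sub" for y L
  proof -
    have "\<nu> (conj_subgp G y L) = (\<Sum>h\<in>H. \<mu> (conj_subgp G (h \<otimes> y) L))"
      unfolding \<nu>_def by (rule sum.cong) (use that SubG[OF that(2)] in \<open>simp_all add: conj_conj\<close>)
    also have "\<dots> = \<nu> L"
      unfolding \<nu>_def by (rule sum.reindex_bij_betw[OF mult_bij(2)[OF H that(1)], where g = "\<lambda>h. \<mu> (conj_subgp G h L)"])
    finally show ?thesis .
  qed
  \<comment> \<open>Weisner's theorem survives the averaging: the summand for \<open>h\<close> is
    the theorem for the conjugates of \<open>K\<close> and \<open>S\<close> by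
    \<open>h\<close>.\<close>
  have \<nu>w: "(\<Sum>L\<in>{L \<in> Sub. L \<inter> K = S}. \<nu> L) = 0"
    if K: "subgroup K G" "K \<subset> H" "subgroup S G" "S \<subseteq> K" for K S
  proof -
    have KG: "K \<subseteq> carrier G" "S \<subseteq> carrier G" using K subgroup.subset by auto
    have "(\<Sum>L\<in>{L \<in> Sub. L \<inter> K = S}. \<nu> L) = (\<Sum>h\<in>H. \<Sum>L\<in>{L \<in> Sub. L \<inter> K = S}. \<mu> (conj_subgp G h L))"
      unfolding \<nu>_def by (rule sum.swap)
    also have "\<dots> = (\<Sum>h\<in>H. 0)"
    proof (rule sum.cong[OF refl])
      fix h assume h: "h \<in> H"
      have hG: "h \<in> carrier G" using h by simp
      let ?c = "conj_subgp G h"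
      have "(\<Sum>L\<in>{L \<in> Sub. L \<inter> K = S}. \<mu> (?c L)) = (\<Sum>L\<in>Sub. if L \<inter> K = S then \<mu> (?c L) else 0)"
        using finS by (simp add: sum.inter_filter)
      also have "\<dots> = (\<Sum>L\<in>Sub. (\<lambda>M. if M \<inter> ?c K = ?c S then \<mu> M else 0) (?c L))"
      proof (rule sum.cong[OF refl])
        fix L assume L: "L \<in> Sub"
        have "?c L \<inter> ?c K = ?c S \<longleftrightarrow> L \<inter> K = S"
        proof -
          have "?c L \<inter> ?c K = ?c (L \<inter> K)" using conj_Int[OF hG SubG[OF L] KG(1)] by simp
          moreover have "?c (L \<inter> K) = ?c S \<longleftrightarrow> L \<inter> K = S"
          proof
            assume "?c (L \<inter> K) = ?c S"
            then have "conj_subgp G (inv h) (?c (L \<inter> K)) = conj_subgp G (inv h) (?c S)" by (rule arg_cong)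
            then show "L \<inter> K = S" using conj_inv_conj(1)[OF hG, of "L \<inter> K"] conj_inv_conj(1)[OF hG KG(2)] KG(1) by auto
          qed simp
          ultimately show ?thesis by simp
        qed
        then show "(if L \<inter> K = S then \<mu> (?c L) else 0) = (\<lambda>M. if M \<inter> ?c K = ?c S then \<mu> M else 0) (?c L)" by simp
      qed
      also have "\<dots> = (\<Sum>M\<in>Sub. if M \<inter> ?c K = ?c S then \<mu> M else 0)"
        unfolding Sub_def by (rule conj_sum[OF H h])
      also have "\<dots> = (\<Sum>M\<in>{M \<in> Sub. M \<inter> ?c K = ?c S}. \<mu> M)" using finS by (simp add: sum.inter_filter)
      also have "\<dots> = 0"
      proof -
        have "?c K \<subseteq> H" using conj_mono[OF hG H.subset] K(2) conj_self[OF H h] by auto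
        moreover have "?c K \<noteq> H"
        proof
          assume "?c K = H"
          then have "K = conj_subgp G (inv h) H" using conj_inv_conj(1)[OF hG KG(1)] by simp
          then show False using conj_self[OF H, of "inv h"] h K(2) by simp
        qed
        ultimately have "?c K \<subset> H" by auto
        then show ?thesis
          using weisner[OF fin H \<mu> conj_subgroup[OF K(1) hG] _ conj_subgroup[OF K(3) hG] conj_mono[OF hG KG(1) K(4)]]
          by (simp add: Sub_def conj_assoc)
      qed
      finally show "(\<Sum>L\<in>{L \<in> Sub. L \<inter> K = S}. \<mu> (?c L)) = 0" .
    qed
    finally show ?thesis by simp
  qed
  obtain rp where rp0: "\<forall>L. subgroup L G \<and> L \<subseteq> H \<longrightarrow> (\<exists>h\<in>H. rp L = conj_subgp G h L) \<and>
     (\<forall>h\<in>H. rp (conj_subgp G h L) = rp L)"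
    using class_reps_exist[OF fin H] by (elim exE)
  have rp: "\<And>L. L \<in> Sub \<Longrightarrow> \<exists>h\<in>H. rp L = conj_subgp G h L"
    "\<And>L h. L \<in> Sub \<Longrightarrow> h \<in> H \<Longrightarrow> rp (conj_subgp G h L) = rp L"
    using rp0 by (simp_all add: Sub_def)
  define Rp where "Rp = rp ` Sub"
  have conjSub: "conj_subgp G h L \<in> Sub" if "h \<in> H" "L \<in> Sub" for h L
    using conj_bij_subgroups[OF H that(1)] that(2) unfolding Sub_def bij_betw_def by blast
  have RpSub: "Rp \<subseteq> Sub" unfolding Rp_def using rp(1) conjSub by fastforce
  have finRp: "finite Rp" using finS by (simp add: Rp_def)
  have rpRp: "rp L = L" if "L \<in> Rp" for L
  proof -
    obtain M where M: "M \<in> Sub" "L = rp M" using \<open>L \<in> Rp\<close> by (auto simp: Rp_def)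
    then show ?thesis using rp(1)[OF M(1)] rp(2)[OF M(1)] by metis
  qed
  define w where "w M = int (card {L \<in> Sub. rp L = M})" for M
  have class_sum: "(\<Sum>L\<in>Sub. g L) = (\<Sum>M\<in>Rp. w M * g M)"
    if g: "\<And>L h. L \<in> Sub \<Longrightarrow> h \<in> H \<Longrightarrow> g (conj_subgp G h L) = (g L :: int)" for g
  proof -
    have "(\<Sum>L\<in>Sub. g L) = (\<Sum>M\<in>Rp. \<Sum>L\<in>{L \<in> Sub. rp L = M}. g L)"
      by (rule sum.group[symmetric]) (use finS finRp in \<open>auto simp: Rp_def\<close>)
    also have "\<dots> = (\<Sum>M\<in>Rp. \<Sum>L\<in>{L \<in> Sub. rp L = M}. g M)"
      by (intro sum.cong refl) (use rp(1) g in fastforce)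
    finally show ?thesis by (simp add: w_def)
  qed
  \<comment> \<open>Gluck's formula: the idempotent is \<open>1/|H|\<close> times the sum of
    \<open>|L| \<mu>(L, H) [H/L]\<close> over all \<open>L\<close>. Clearing the denominator and
    collecting the \<open>w M\<close> conjugates of \<open>M\<close> gives these integers.\<close>
  define z where "z M = w M * int (card M) * \<nu> M" for M
  have zsum: "(\<Sum>L\<in>Rp. z L * (\<Sum>y\<in>T L. c (conj_subgp G (inv y) L \<inter> K))) = 0"
    if K: "subgroup K G" "K \<subset> H" and T: "\<And>L. L \<in> Rp \<Longrightarrow> T L \<in> dcoset_reps G L H K"
      and c: "\<And>S a. S \<subseteq> K \<Longrightarrow> a \<in> K \<Longrightarrow> c (conj_subgp G a S) = (c S :: int)" for K T c
  proof -
    interpret K: subgroup K G by fact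
    have KH: "K \<subseteq> H" using K by auto
    have "finite K" by (rule finite_subset[OF KH finH])
    moreover have "K \<noteq> {}" using K.one_closed by blast
    ultimately have finK: "card K \<noteq> 0" by simp
    \<comment> \<open>The weight \<open>card S\<close> is the fibre size in
      \<open>dcoset_card_sum\<close>, up to conjugation, so the sum over double cosets becomes a sum
      of \<psi> over \<open>H\<close>.\<close>
    define \<psi> where "\<psi> S = int (card S) * c S" for S
    define g where "g L = \<nu> L * (\<Sum>y\<in>H. \<psi> (conj_subgp G (inv y) L \<inter> K))" for L
    have gconj: "g (conj_subgp G h L) = g L" if "L \<in> Sub" "h \<in> H" for L h
    proof -
      have "(\<Sum>y\<in>H. \<psi> (conj_subgp G (inv y) (conj_subgp G h L) \<inter> K))
          = (\<Sum>y\<in>H. \<psi> (conj_subgp G (inv (inv h \<otimes> y)) L \<inter> K))"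
        by (rule sum.cong) (use that SubG[OF that(1)] in \<open>simp_all add: conj_conj inv_mult_group\<close>)
      also have "\<dots> = (\<Sum>y\<in>H. \<psi> (conj_subgp G (inv y) L \<inter> K))"
        by (rule sum.reindex_bij_betw[OF mult_bij(1)[OF H], where g = "\<lambda>y. \<psi> (conj_subgp G (inv y) L \<inter> K)"])
          (use that in simp)
      finally show ?thesis using \<nu>conj[OF that(2,1)] by (simp add: g_def)
    qed
    have 1: "int (card L) * int (card K) * (\<Sum>y\<in>T L. c (conj_subgp G (inv y) L \<inter> K))
        = (\<Sum>y\<in>H. \<psi> (conj_subgp G (inv y) L \<inter> K))" if L: "L \<in> Rp" for L
    proof -
      have L': "subgroup L G" "L \<subseteq> H" "L \<subseteq> carrier G" using L RpSub SubG by (auto simp: Sub_def)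
      have "int (card L) * int (card K) * (\<Sum>y\<in>T L. c (conj_subgp G (inv y) L \<inter> K))
        = (\<Sum>y\<in>H. int (card (L \<inter> conj_subgp G y K)) * c (conj_subgp G (inv y) L \<inter> K))"
      proof (rule dcoset_card_sum[OF T[OF L] L'(1) K(1) H L'(2) KH fin])
        fix j y l assume *: "j \<in> L" "y \<in> H" "l \<in> K"
        have cc: "j \<in> carrier G" "y \<in> carrier G" "l \<in> carrier G" "inv j \<in> L" "inv l \<in> K"
          using * L' subgroup.m_inv_closed[OF L'(1)] by auto
        have "conj_subgp G (inv (j \<otimes> y \<otimes> l)) L = conj_subgp G (inv l) (conj_subgp G (inv y) (conj_subgp G (inv j) L))"
          using cc L' by (simp add: conj_conj conj_subset inv_mult_group m_assoc)
        also have "\<dots> = conj_subgp G (inv l) (conj_subgp G (inv y) L)" using conj_self[OF L'(1) cc(4)] by simp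
        finally have "conj_subgp G (inv (j \<otimes> y \<otimes> l)) L \<inter> K = conj_subgp G (inv l) (conj_subgp G (inv y) L \<inter> K)"
          using cc L' conj_self[OF K(1) cc(5)] K.subset by (simp add: conj_Int conj_subset)
        then show "c (conj_subgp G (inv (j \<otimes> y \<otimes> l)) L \<inter> K) = c (conj_subgp G (inv y) L \<inter> K)"
          using c[of "conj_subgp G (inv y) L \<inter> K" "inv l"] cc(5) by simp
      qed
      also have "\<dots> = (\<Sum>y\<in>H. \<psi> (conj_subgp G (inv y) L \<inter> K))"
      proof (rule sum.cong[OF refl])
        fix y assume "y \<in> H"
        then have y: "y \<in> carrier G" by simp
        have "L \<inter> conj_subgp G y K \<subseteq> carrier G" using L' by auto
        then have "card (conj_subgp G (inv y) (L \<inter> conj_subgp G y K)) = card (L \<inter> conj_subgp G y K)"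
          using y by (simp add: conj_card)
        moreover have "conj_subgp G (inv y) (L \<inter> conj_subgp G y K) = conj_subgp G (inv y) L \<inter> K"
          using y L' K.subset by (simp add: conj_Int conj_subset conj_inv_conj)
        ultimately show "int (card (L \<inter> conj_subgp G y K)) * c (conj_subgp G (inv y) L \<inter> K) = \<psi> (conj_subgp G (inv y) L \<inter> K)"
          by (simp add: \<psi>_def)
      qed
      finally show ?thesis .
    qed
    \<comment> \<open>The factor \<open>card K\<close> prepares the use of fact \<open>1\<close>; it
      is nonzero and is cancelled at the end.\<close>
    have "int (card K) * (\<Sum>L\<in>Rp. z L * (\<Sum>y\<in>T L. c (conj_subgp G (inv y) L \<inter> K)))
       = (\<Sum>L\<in>Rp. w L * \<nu> L * (int (card L) * int (card K) * (\<Sum>y\<in>T L. c (conj_subgp G (inv y) L \<inter> K))))"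
      unfolding z_def sum_distrib_left by (intro sum.cong refl) (simp add: algebra_simps sum_distrib_left)
    also have "\<dots> = (\<Sum>L\<in>Rp. w L * g L)"
      by (intro sum.cong refl) (simp add: 1 g_def)
    also have "\<dots> = (\<Sum>L\<in>Sub. g L)" by (rule class_sum[OF gconj, symmetric])
    also have "\<dots> = (\<Sum>y\<in>H. \<Sum>L\<in>Sub. \<nu> L * \<psi> (conj_subgp G (inv y) L \<inter> K))"
      unfolding g_def sum_distrib_left by (rule sum.swap)
    also have "\<dots> = (\<Sum>y\<in>H. 0)"
    proof (rule sum.cong[OF refl])
      fix y assume y: "y \<in> H"
      have iy: "inv y \<in> H" using y by simp
      have "(\<Sum>L\<in>Sub. \<nu> L * \<psi> (conj_subgp G (inv y) L \<inter> K))
          = (\<Sum>L\<in>Sub. (\<lambda>M. \<nu> M * \<psi> (M \<inter> K)) (conj_subgp G (inv y) L))"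
        by (rule sum.cong) (simp_all add: \<nu>conj[OF iy])
      also have "\<dots> = (\<Sum>M\<in>Sub. \<nu> M * \<psi> (M \<inter> K))"
        unfolding Sub_def by (rule conj_sum[OF H iy])
      \<comment> \<open>Now \<psi> depends on \<open>M\<close> only through
        \<open>M \<inter> K\<close>; grouped by this intersection, each inner sum vanishes by
        \<open>\<nu>w\<close>.\<close>
      also have "\<dots> = (\<Sum>S\<in>{S. subgroup S G \<and> S \<subseteq> K}. \<Sum>M\<in>{M \<in> Sub. M \<inter> K = S}. \<nu> M * \<psi> (M \<inter> K))"
        by (rule sum.group[symmetric])
          (use finS finite_subgroups[OF fin] K(1) in \<open>auto simp: Sub_def subgroups_Inter_pair\<close>)
      also have "\<dots> = (\<Sum>S\<in>{S. subgroup S G \<and> S \<subseteq> K}. (\<Sum>M\<in>{M \<in> Sub. M \<inter> K = S}. \<nu> M) * \<psi> S)"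
        by (intro sum.cong refl) (simp add: sum_distrib_right)
      also have "\<dots> = 0" by (rule sum.neutral) (use \<nu>w[OF K] in auto)
      finally show "(\<Sum>L\<in>Sub. \<nu> L * \<psi> (conj_subgp G (inv y) L \<inter> K)) = 0" .
    qed
    finally show ?thesis using finK by simp
  qed
  \<comment> \<open>\<open>d\<close> is nonzero because the coefficient at \<open>H\<close> is:
    \<mu> is one there, so \<nu> is the order of \<open>H\<close>.\<close>
  define d where "d = Gcd (z ` Rp)"
  define x where "x L = z L div d" for L
  have HSub: "H \<in> Sub" using H by (simp add: Sub_def)
  have rpH: "rp H = H" using rp(1)[OF HSub] conj_self[OF H] by auto
  have HRp: "H \<in> Rp" unfolding Rp_def using HSub rpH by (metis imageI)
  have "z H \<noteq> 0"
  proof -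
    have "H \<in> {L \<in> Sub. rp L = H}" using HSub rpH by simp
    then have "w H \<noteq> 0" using finS by (auto simp: w_def card_eq_0_iff)
    moreover have "H \<noteq> {}" using H.one_closed by blast
    then have "card H \<noteq> 0" using finH by simp
    ultimately show ?thesis using \<nu>H by (simp add: z_def)
  qed
  then have d0: "d \<noteq> 0" using HRp by (auto simp: d_def)
  have xz: "d * x L = z L" if "L \<in> Rp" for L using that by (simp add: x_def d_def Gcd_dvd)
  have "(*) d ` x ` Rp = z ` Rp" unfolding image_image by (rule image_cong) (simp_all add: xz)
  then have "d = normalize (d * Gcd (x ` Rp))" using Gcd_mult[of d "x ` Rp"] by (simp add: d_def)
  moreover have "d \<ge> 0" by (simp add: d_def)
  ultimately have "d = d * Gcd (x ` Rp)" by (simp add: abs_mult)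
  then have gcd1: "Gcd (x ` Rp) = 1" using d0 by simp
  have xsum: "(\<Sum>L\<in>Rp. x L * (\<Sum>y\<in>T L. c (conj_subgp G (inv y) L \<inter> K))) = 0"
    if "subgroup K G" "K \<subset> H" "\<forall>L\<in>Rp. T L \<in> dcoset_reps G L H K"
      "\<forall>S\<subseteq>K. \<forall>a\<in>K. c (conj_subgp G a S) = (c S :: int)" for K T c
  proof -
    have "d * (\<Sum>L\<in>Rp. x L * (\<Sum>y\<in>T L. c (conj_subgp G (inv y) L \<inter> K)))
       = (\<Sum>L\<in>Rp. z L * (\<Sum>y\<in>T L. c (conj_subgp G (inv y) L \<inter> K)))"
      unfolding sum_distrib_left by (intro sum.cong refl) (simp add: xz[symmetric] mult.assoc sum_distrib_left)
    also have "\<dots> = 0" using that by (intro zsum) auto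
    finally show ?thesis using d0 by simp
  qed
  have distinct: "L = M" if "L \<in> Rp" "M \<in> Rp" "h \<in> H" "M = conj_subgp G h L" for L M h
    using rp(2)[of L h] rpRp[OF that(1)] rpRp[OF that(2)] that RpSub by auto
  have "\<forall>L\<in>Rp. \<forall>M\<in>Rp. \<forall>h\<in>H. M = conj_subgp G h L \<longrightarrow> L = M" using distinct by blast
  moreover have "Rp \<subseteq> {L. subgroup L G \<and> L \<subseteq> H}" using RpSub by (simp add: Sub_def)
  moreover have "\<forall>K T c. subgroup K G \<and> K \<subset> H \<and> (\<forall>L\<in>Rp. T L \<in> dcoset_reps G L H K) \<and>
        (\<forall>S\<subseteq>K. \<forall>a\<in>K. c (conj_subgp G a S) = (c S :: int)) \<longrightarrow>
        (\<Sum>L\<in>Rp. x L * (\<Sum>y\<in>T L. c (conj_subgp G (inv y) L \<inter> K))) = 0"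
    by (intro allI impI, elim conjE) (rule xsum)
  ultimately show ?thesis using finRp gcd1 by blast
qed

end

section \<open>Integers in the ground ring and the action of the Burnside ring\<close>

context cring begin

definition ring_int :: "int \<Rightarrow> 'a" where "ring_int n = [n] \<cdot> \<one>"

lemma ring_int_closed [simp]: "ring_int n \<in> carrier R" by (simp add: ring_int_def)

lemma ring_int_0 [simp]: "ring_int 0 = \<zero>" unfolding ring_int_def add_pow_def by simp

lemma ring_int_1 [simp]: "ring_int 1 = \<one>" by (simp add: ring_int_def)

lemma ring_int_add: "ring_int (m + n) = ring_int m \<oplus> ring_int n" by (simp add: ring_int_def add.int_pow_mult)

lemma ring_int_mult: "ring_int (m * n) = ring_int m \<otimes> ring_int n"
  by (simp add: ring_int_def add_pow_ldistr_int add.int_pow_pow mult.commute)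

lemma ring_int_sum: "ring_int (\<Sum>a\<in>A. f a) = (\<Oplus>a\<in>A. ring_int (f a))"
proof (induction A rule: infinite_finite_induct)
  case (insert a A)
  then show ?case by (subst finsum_insert) (auto simp: ring_int_add)
qed simp_all

text \<open>By Bezout, if all members of \<open>A\<close> became zero in the ring, so would their
  greatest common divisor one. This is what makes primitive coefficients work in every
  characteristic.\<close>

lemma ring_int_Gcd_nonzero:
  assumes "finite A" "Gcd A = 1" "\<one> \<noteq> \<zero>"
  shows "\<exists>a\<in>A. ring_int a \<noteq> \<zero>"
proof (rule ccontr)
  assume "\<not> (\<exists>a\<in>A. ring_int a \<noteq> \<zero>)"
  then have *: "\<forall>a\<in>A. ring_int a = \<zero>" by blast
  from assms(1) * have "ring_int (Gcd A) = \<zero>"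
  proof (induction A rule: finite_induct)
    case (insert a A)
    obtain u v where "u * a + v * Gcd A = gcd a (Gcd A)" using bezout_int by blast
    then have "ring_int (gcd a (Gcd A)) = ring_int u \<otimes> ring_int a \<oplus> ring_int v \<otimes> ring_int (Gcd A)"
      by (metis ring_int_add ring_int_mult)
    then show ?case using insert by simp
  qed simp
  then show False using assms by simp
qed

end

text \<open>The action of the Burnside ring element with coefficient \<open>x L\<close> at
  \<open>[H/L]\<close> on the value at \<open>H\<close>: a transitive \<open>H\<close>-set
  \<open>H/L\<close> acts as restriction to \<open>L\<close> followed by induction.\<close>

definition theta :: "('g, 'b) monoid_scheme \<Rightarrow> ('k, 'r) ring_scheme \<Rightarrow> ('g, 'k, 'm) mackey \<Rightarrow> 'g set set \<Rightarrow>
    ('g set \<Rightarrow> int) \<Rightarrow> 'g set \<Rightarrow> 'm \<Rightarrow> 'm" where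
  "theta G k M Rp x H z = (\<Oplus>\<^bsub>obj M H\<^esub>L\<in>Rp. cring.ring_int k (x L) \<odot>\<^bsub>obj M H\<^esub> ind M L H (res M H L z))"

text \<open>The last condition says that \<open>\<Sum>\<^sub>L x\<^sub>L [H/L]\<close> restricts to zero on every proper
  subgroup, tested against the class functions \<open>c\<close>.\<close>

definition (in group) primitive_coeffs :: "'a set \<Rightarrow> 'a set set \<Rightarrow> ('a set \<Rightarrow> int) \<Rightarrow> bool" where
  "primitive_coeffs H Rp x \<longleftrightarrow> finite Rp \<and> Rp \<subseteq> {L. subgroup L G \<and> L \<subseteq> H} \<and>
     (\<forall>L\<in>Rp. \<forall>M\<in>Rp. \<forall>h\<in>H. M = conj_subgp G h L \<longrightarrow> L = M) \<and> Gcd (x ` Rp) = 1 \<and>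
     (\<forall>K T c. subgroup K G \<and> K \<subset> H \<and> (\<forall>L\<in>Rp. T L \<in> dcoset_reps G L H K) \<and>
        (\<forall>S\<subseteq>K. \<forall>a\<in>K. c (conj_subgp G a S) = (c S :: int)) \<longrightarrow>
        (\<Sum>L\<in>Rp. x L * (\<Sum>y\<in>T L. c (conj_subgp G (inv y) L \<inter> K))) = 0)"

lemma (in group) primitive_coeffsD:
  assumes "primitive_coeffs H Rp x"
  shows "finite Rp" "L \<in> Rp \<Longrightarrow> subgroup L G" "L \<in> Rp \<Longrightarrow> L \<subseteq> H"
    "\<lbrakk>L \<in> Rp; M \<in> Rp; h \<in> H; M = conj_subgp G h L\<rbrakk> \<Longrightarrow> L = M" "Gcd (x ` Rp) = 1"
    "\<lbrakk>subgroup K G; K \<subset> H; \<And>L. L \<in> Rp \<Longrightarrow> T L \<in> dcoset_reps G L H K;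
      \<And>S a. S \<subseteq> K \<Longrightarrow> a \<in> K \<Longrightarrow> c (conj_subgp G a S) = (c S :: int)\<rbrakk> \<Longrightarrow>
      (\<Sum>L\<in>Rp. x L * (\<Sum>y\<in>T L. c (conj_subgp G (inv y) L \<inter> K))) = 0"
proof -
  note * = assms[unfolded primitive_coeffs_def]
  show "finite Rp" "L \<in> Rp \<Longrightarrow> subgroup L G" "L \<in> Rp \<Longrightarrow> L \<subseteq> H" "Gcd (x ` Rp) = 1"
    using * by auto
  show "\<lbrakk>L \<in> Rp; M \<in> Rp; h \<in> H; M = conj_subgp G h L\<rbrakk> \<Longrightarrow> L = M"
    using *[THEN conjunct2, THEN conjunct2, THEN conjunct1] by blast
  note v = *[THEN conjunct2, THEN conjunct2, THEN conjunct2, THEN conjunct2, rule_format]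
  show "\<lbrakk>subgroup K G; K \<subset> H; \<And>L. L \<in> Rp \<Longrightarrow> T L \<in> dcoset_reps G L H K;
      \<And>S a. S \<subseteq> K \<Longrightarrow> a \<in> K \<Longrightarrow> c (conj_subgp G a S) = (c S :: int)\<rbrakk> \<Longrightarrow>
      (\<Sum>L\<in>Rp. x L * (\<Sum>y\<in>T L. c (conj_subgp G (inv y) L \<inter> K))) = 0"
    by (rule v) simp
qed

context mackey_functor begin

lemma theta_lin:
  assumes "primitive_coeffs H Rp x" "subgroup H G"
  shows "theta G R M Rp x H \<in> lin_map R (obj M H) (obj M H)"
  unfolding theta_def[abs_def]
proof (rule lin_map_finsum_pointwise[OF module_obj[OF assms(2)] module_obj[OF assms(2)]])
  fix L assume L: "L \<in> Rp"
  show "(\<lambda>z. R.ring_int (x L) \<odot>\<^bsub>obj M H\<^esub> ind M L H (res M H L z)) \<in> lin_map R (obj M H) (obj M H)"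
    by (rule lin_map_smult[OF R.ring_int_closed lin_map_comp[OF res_lin ind_lin] module_obj module_obj])
      (use primitive_coeffsD(2,3)[OF assms(1) L] assms(2) in auto)
qed

lemma theta_hom:
  assumes "primitive_coeffs H Rp x" "subgroup H G" "mackey_functor G R N" "f \<in> mackey_hom G R M N" "z \<in> carrier (obj M H)"
  shows "f H (theta G R M Rp x H z) = theta G R N Rp x H (f H z)"
proof -
  interpret N: mackey_functor G R N by fact
  interpret MH: module R "obj M H" by (rule module_obj[OF assms(2)])
  interpret NH: module R "obj N H" by (rule N.module_obj[OF assms(2)])
  note t = primitive_coeffsD(2,3)[OF assms(1)]
  have r: "res M H L z \<in> carrier (obj M L)" if "L \<in> Rp" for L
    using lin_mapD(1)[OF res_lin[OF t(1)[OF that] assms(2) t(2)[OF that]] assms(5)] .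
  have i: "ind M L H (res M H L z) \<in> carrier (obj M H)" if "L \<in> Rp" for L
    using lin_mapD(1)[OF ind_lin[OF t(1)[OF that] assms(2) t(2)[OF that]] r[OF that]] .
  have "f H (theta G R M Rp x H z) = (\<Oplus>\<^bsub>obj N H\<^esub>L\<in>Rp. f H (R.ring_int (x L) \<odot>\<^bsub>obj M H\<^esub> ind M L H (res M H L z)))"
    unfolding theta_def
    by (rule lin_map_finsum[OF mackey_homD(1)[OF assms(4,2)] module_obj[OF assms(2)] N.module_obj[OF assms(2)]])
      (use i in auto)
  also have "\<dots> = theta G R N Rp x H (f H z)"
    unfolding theta_def
  proof (rule NH.M.finsum_cong'[OF refl])
    show *: "f H (R.ring_int (x L) \<odot>\<^bsub>obj M H\<^esub> ind M L H (res M H L z)) =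
        R.ring_int (x L) \<odot>\<^bsub>obj N H\<^esub> ind N L H (res N H L (f H z))" if L: "L \<in> Rp" for L
      using lin_mapD(3)[OF mackey_homD(1)[OF assms(4,2)] R.ring_int_closed i[OF L]]
        mackey_homD(2)[OF assms(4) t(1)[OF L] assms(2) t(2)[OF L] r[OF L]]
        mackey_homD(3)[OF assms(4) t(1)[OF L] assms(2) t(2)[OF L] assms(5)] by simp
    show "(\<lambda>L. R.ring_int (x L) \<odot>\<^bsub>obj N H\<^esub> ind N L H (res N H L (f H z))) \<in> Rp \<rightarrow> carrier (obj N H)"
      using mackey_homD(5)[OF assms(4,2)] i by (auto simp: *[symmetric])
  qed
  finally show ?thesis .
qed

end

context burnside begin

lemma fixed_cls: "\<lbrakk>subgroup H G; t \<in> X; H \<subseteq> stab t\<rbrakk> \<Longrightarrow> pair_orbit H (H, t) = {(H, t)}"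
  using conj_self[of H] subgroup.one_closed[of H G]
  by (auto simp: pair_orbit_def gact_def stab_def subset_iff image_constant_conv)

lemma res_fixed:
  assumes "subgroup J G" "subgroup H G" "J \<subseteq> H" "t \<in> X" "H \<subseteq> stab t"
  shows "res F H J (orbit_vec H (H, t)) = orbit_vec J (J, t)"
proof -
  interpret FJ: module k "FM J" by (rule FM_module)
  have adm: "(H, t) \<in> adm H" "(J, t) \<in> adm J" using assms by (auto intro!: admI)
  have "{\<one>} \<in> dcoset_reps G J H H"
  proof (rule dcoset_repsI[OF sub_carrier[OF assms(1)] sub_carrier[OF assms(2)] sub_carrier[OF assms(2)]])
    fix h assume h: "h \<in> H"
    show "\<exists>x\<in>{\<one>}. \<exists>j\<in>J. \<exists>l\<in>H. h = j \<otimes> x \<otimes> l"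
      by (rule bexI[of _ \<one>], rule bexI[of _ \<one>], rule bexI[of _ h])
        (use h assms(1) sub_mem[OF assms(2) h] in \<open>auto intro: subgroup.one_closed\<close>)
  qed (use assms(2) in \<open>auto intro: subgroup.one_closed\<close>)
  then have "res F H J (orbit_vec H (H, t)) =
      (\<Oplus>\<^bsub>FM J\<^esub>y\<in>{\<one>}. orbit_vec J (J \<inter> conj_subgp G y H, act y t))"
    using res_orbit_lin(2)[OF assms(1-3) adm(1)] by (simp only: fst_conv snd_conv)
  moreover have "(J \<inter> conj_subgp G \<one> H, act \<one> t) = (J, t)"
    using assms by (auto simp: conj_one sub_carrier act_one)
  ultimately show ?thesis
    using FJ.finsum_single[of "\<lambda>y. orbit_vec J (J \<inter> conj_subgp G y H, act y t)" "\<one>"] orbit_vec_in[OF adm(2)]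
    by (simp only:)
qed

text \<open>Frobenius reciprocity in coordinates. The pair \<open>(K, t)\<close> with
  \<open>K \<noteq> H\<close> is induced from \<open>K\<close>, so the element acts on it through
  its restriction to \<open>K\<close>, and that restriction is zero by
  \<open>primitive_coeffs\<close>.\<close>

lemma theta_bas_proper:
  assumes "primitive_coeffs H Rp x" "subgroup H G" "b \<in> adm H" "fst b \<noteq> H"
  shows "theta G k F Rp x H (orbit_vec H b) = \<zero>\<^bsub>FM H\<^esub>"
proof -
  interpret FH: module k "FM H" by (rule FM_module)
  note t = primitive_coeffsD(2,3)[OF assms(1)] and bb = admD[OF assms(3)]
  define K where "K = fst b"
  have K: "subgroup K G" "K \<subset> H" using bb assms(4) by (auto simp: K_def)
  define T where "T L = reps L H K" for L
  have T: "T L \<in> dcoset_reps G L H K" if "L \<in> Rp" for L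
    unfolding T_def by (rule reps_in) (use t[OF that] K assms(2) in auto)
  have TG: "y \<in> H" "y \<in> carrier G" if "L \<in> Rp" "y \<in> T L" for L y
    using dcoset_repsD(1)[OF T[OF that(1)] t(1)[OF that(1)] K(1) assms(2) t(2)[OF that(1)]] K(2) that(2)
      sub_mem[OF assms(2)] by auto
  \<comment> \<open>The pair produced by \<open>y\<close> moved back by \<open>inv y\<close>, which
    is in \<open>H\<close>: all of them now have the same second component.\<close>
  define s where "s L y = (conj_subgp G (inv y) L \<inter> K, snd b)" for L y
  have sadm: "s L y \<in> adm H" if "L \<in> Rp" "y \<in> T L" for L y
    unfolding s_def using t[OF that(1)] TG[OF that] K bb
    by (intro admI) (auto simp: K_def intro!: subgroups_Inter_pair conj_subgroup)
  have ir: "ind F L H (res F H L (orbit_vec H b)) = (\<Oplus>\<^bsub>FM H\<^esub>y\<in>T L. orbit_vec H (s L y))" if L: "L \<in> Rp" for L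
  proof -
    let ?c = "\<lambda>y. (L \<inter> conj_subgp G y (fst b), act y (snd b))"
    have c: "?c y \<in> adm L" if "y \<in> T L" for y by (rule adm_res[OF assms(3) t(1)[OF L] TG(2)[OF L that]])
    have T': "T L \<in> dcoset_reps G L H (fst b)" using T[OF L] by (simp add: K_def)
    have "ind F L H (res F H L (orbit_vec H b)) = (\<Oplus>\<^bsub>FM H\<^esub>y\<in>T L. ind F L H (orbit_vec L (?c y)))"
      unfolding res_orbit_lin(2)[OF t(1)[OF L] assms(2) t(2)[OF L] assms(3) T']
      by (rule lin_map_finsum[OF ind_orbit_lin(1)[OF t(1)[OF L] assms(2) t(2)[OF L]] FM_module FM_module])
        (use c orbit_vec_in in auto)
    also have "\<dots> = (\<Oplus>\<^bsub>FM H\<^esub>y\<in>T L. orbit_vec H (s L y))"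
    proof (rule FH.finsum_cong'[OF refl])
      show "(\<lambda>y. orbit_vec H (s L y)) \<in> T L \<rightarrow> carrier (FM H)" using sadm[OF L] orbit_vec_in by auto
      fix y assume y: "y \<in> T L"
      note yy = TG[OF L y]
      have "inv y \<in> H" using yy assms(2) by (simp add: subgroup.m_inv_closed)
      moreover have "gact (inv y) (?c y) = s L y"
        using yy t(1)[OF L] bb by (simp add: gact_def s_def K_def conj_Int conj_subset sub_carrier conj_inv_conj act_mult act_one)
      moreover have "?c y \<in> adm H" using adm_mono[OF t(2)[OF L] c[OF y]] .
      ultimately have "orbit_vec H (s L y) = orbit_vec H (?c y)" using orbit_vec_gact[OF _ assms(2)] by metis
      then show "ind F L H (orbit_vec L (?c y)) = orbit_vec H (s L y)"
        using ind_orbit_lin(2)[OF t(1)[OF L] assms(2) t(2)[OF L] c[OF y]] by simp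
    qed
    finally show ?thesis .
  qed
  have irc: "ind F L H (res F H L (orbit_vec H b)) \<in> carrier (FM H)" if "L \<in> Rp" for L
    unfolding ir[OF that] by (rule FH.finsum_closed) (use sadm[OF that] orbit_vec_in in auto)
  show ?thesis
  proof
    fix \<beta>
    \<comment> \<open>The coefficient at \<beta> is tested with the indicator of this orbit. It is a
      class function on the subgroups of \<open>K\<close> because \<open>K\<close> fixes
      \<open>snd b\<close>.\<close>
    define c :: "'a set \<Rightarrow> int" where "c S = (if subgroup S G \<and> pair_orbit H (S, snd b) = \<beta> then 1 else 0)" for S
    have cs: "orbit_vec H (s L y) \<beta> = k.ring_int (c (conj_subgp G (inv y) L \<inter> K))" if "L \<in> Rp" "y \<in> T L" for L y
    proof -
      have "subgroup (conj_subgp G (inv y) L \<inter> K) G" using admD(1)[OF sadm[OF that]] by (simp add: s_def)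
      then show ?thesis by (simp add: c_def s_def orbit_vec_def unit_vec_def)
    qed
    have ccon: "c (conj_subgp G a S) = c S" if S: "S \<subseteq> K" and a: "a \<in> K" for S a
    proof -
      have aG: "a \<in> carrier G" "S \<subseteq> carrier G" using S a K sub_carrier by auto
      have sg: "subgroup (conj_subgp G a S) G \<longleftrightarrow> subgroup S G"
        using conj_subgroup[of S a] conj_subgroup[of "conj_subgp G a S" "inv a"] aG conj_inv_conj by auto
      have "pair_orbit H (conj_subgp G a S, snd b) = pair_orbit H (S, snd b)" if "subgroup S G"
      proof -
        have "(S, snd b) \<in> adm H" using that S K bb by (auto simp: K_def intro!: admI)
        moreover have "gact a (S, snd b) = (conj_subgp G a S, snd b)"
          using a bb(4) by (auto simp: gact_def K_def stab_def)
        ultimately show ?thesis using pair_orbit_gact[OF _ assms(2), of "(S, snd b)" a] a K by auto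
      qed
      then show ?thesis using sg by (auto simp: c_def)
    qed
    have "theta G k F Rp x H (orbit_vec H b) \<beta>
       = (\<Oplus>\<^bsub>k\<^esub>L\<in>Rp. (k.ring_int (x L) \<odot>\<^bsub>FM H\<^esub> ind F L H (res F H L (orbit_vec H b))) \<beta>)"
      unfolding theta_def obj_F
      by (rule k.fmod_finsum_apply) (use irc in \<open>auto intro!: FH.smult_closed simp del: fmod_simps\<close>)
    also have "\<dots> = (\<Oplus>\<^bsub>k\<^esub>L\<in>Rp. k.ring_int (x L * (\<Sum>y\<in>T L. c (conj_subgp G (inv y) L \<inter> K))))"
    proof (rule k.finsum_cong'[OF refl])
      fix L assume L: "L \<in> Rp"
      have "ind F L H (res F H L (orbit_vec H b)) \<beta> = (\<Oplus>\<^bsub>k\<^esub>y\<in>T L. orbit_vec H (s L y) \<beta>)"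
        unfolding ir[OF L] by (rule k.fmod_finsum_apply) (use sadm[OF L] orbit_vec_in in auto)
      also have "\<dots> = (\<Oplus>\<^bsub>k\<^esub>y\<in>T L. k.ring_int (c (conj_subgp G (inv y) L \<inter> K)))"
        by (rule k.finsum_cong'[OF refl]) (use cs[OF L] in auto)
      finally show "(k.ring_int (x L) \<odot>\<^bsub>FM H\<^esub> ind F L H (res F H L (orbit_vec H b))) \<beta> =
          k.ring_int (x L * (\<Sum>y\<in>T L. c (conj_subgp G (inv y) L \<inter> K)))"
        by (simp add: k.ring_int_mult k.ring_int_sum)
    qed simp
    also have "\<dots> = k.ring_int (\<Sum>L\<in>Rp. x L * (\<Sum>y\<in>T L. c (conj_subgp G (inv y) L \<inter> K)))"
      by (rule k.ring_int_sum[symmetric])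
    also have "\<dots> = \<zero>\<^bsub>k\<^esub>"
      using primitive_coeffsD(6)[OF assms(1) K T, where c = c] ccon by simp
    finally show "theta G k F Rp x H (orbit_vec H b) \<beta> = \<zero>\<^bsub>FM H\<^esub> \<beta>" by simp
  qed
qed

text \<open>\<open>[H/L]\<close> sends the fixed point \<open>(H, t)\<close> to
  \<open>(L, t)\<close>. As the members of \<open>Rp\<close> are pairwise non-conjugate and fixed
  points are not moved by \<open>H\<close>, these pairs lie in different orbits, so the coefficients
  \<open>x L\<close> do not merge.\<close>

lemma theta_bas_fixed:
  assumes "primitive_coeffs H Rp x" "subgroup H G" "t \<in> X" "H \<subseteq> stab t" "t' \<in> X" "H \<subseteq> stab t'" "L0 \<in> Rp"
  shows "theta G k F Rp x H (orbit_vec H (H, t)) (pair_orbit H (L0, t')) = (if t = t' then k.ring_int (x L0) else \<zero>\<^bsub>k\<^esub>)"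
proof -
  interpret FH: module k "FM H" by (rule FM_module)
  note tc = primitive_coeffsD(2,3)[OF assms(1)]
  have adm: "(L, u) \<in> adm H" if "L \<in> Rp" "u \<in> X" "H \<subseteq> stab u" for L u
    using tc[OF that(1)] that by (auto intro!: admI)
  have ir: "ind F L H (res F H L (orbit_vec H (H, t))) = orbit_vec H (L, t)" if "L \<in> Rp" for L
    unfolding res_fixed[OF tc(1)[OF that] assms(2) tc(2)[OF that] assms(3,4)]
    by (rule ind_orbit_lin(2)[OF tc(1)[OF that] assms(2) tc(2)[OF that]])
      (use tc[OF that] assms in \<open>auto intro!: admI\<close>)
  have cl: "pair_orbit H (L0, t') = pair_orbit H (L, t) \<longleftrightarrow> L = L0 \<and> t = t'" if L: "L \<in> Rp" for L
  proof
    assume "pair_orbit H (L0, t') = pair_orbit H (L, t)"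
    then obtain h where h: "h \<in> H" "(L, t) = gact h (L0, t')"
      using pair_orbit_eqD[OF _ adm[OF assms(7,5,6)] adm[OF L assms(3,4)] assms(2)] by blast
    then have "t = t'" using assms(6) by (auto simp: gact_def stab_def)
    moreover have "L0 = L" using primitive_coeffsD(4)[OF assms(1,7) L h(1)] h(2) by (simp add: gact_def)
    ultimately show "L = L0 \<and> t = t'" by simp
  qed simp
  have "theta G k F Rp x H (orbit_vec H (H, t)) (pair_orbit H (L0, t'))
       = (\<Oplus>\<^bsub>k\<^esub>L\<in>Rp. (k.ring_int (x L) \<odot>\<^bsub>FM H\<^esub> ind F L H (res F H L (orbit_vec H (H, t)))) (pair_orbit H (L0, t')))"
    unfolding theta_def obj_F
    by (rule k.fmod_finsum_apply)
      (use adm[OF _ assms(3,4)] orbit_vec_in in \<open>auto intro!: FH.smult_closed simp: ir simp del: fmod_simps\<close>)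
  also have "\<dots> = (\<Oplus>\<^bsub>k\<^esub>L\<in>Rp. if L0 = L then (if t = t' then k.ring_int (x L) else \<zero>\<^bsub>k\<^esub>) else \<zero>\<^bsub>k\<^esub>)"
  proof (rule k.finsum_cong'[OF refl])
    fix L assume L: "L \<in> Rp"
    have "orbit_vec H (L, t) (pair_orbit H (L0, t')) = (if L = L0 \<and> t = t' then \<one>\<^bsub>k\<^esub> else \<zero>\<^bsub>k\<^esub>)"
      using cl[OF L] by (simp add: orbit_vec_def unit_vec_def)
    then show "(k.ring_int (x L) \<odot>\<^bsub>FM H\<^esub> ind F L H (res F H L (orbit_vec H (H, t)))) (pair_orbit H (L0, t')) =
        (if L0 = L then (if t = t' then k.ring_int (x L) else \<zero>\<^bsub>k\<^esub>) else \<zero>\<^bsub>k\<^esub>)"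
      using ir[OF L] by auto
  qed auto
  also have "\<dots> = (if t = t' then k.ring_int (x L0) else \<zero>\<^bsub>k\<^esub>)"
    using k.finsum_singleton[OF assms(7) primitive_coeffsD(1)[OF assms(1)], of "\<lambda>L. if t = t' then k.ring_int (x L) else \<zero>\<^bsub>k\<^esub>"] by simp
  finally show ?thesis .
qed

text \<open>Pairs \<open>(L, t)\<close> with \<open>L \<noteq> H\<close> are killed, and the images
  of different fixed points have disjoint supports. So the action is injective on the span of fixed
  points as soon as one coefficient survives in \<open>k\<close>.\<close>

lemma theta_eq_zero_iff:
  assumes "domain k" and tc: "primitive_coeffs H Rp x" and H: "subgroup H G" and z: "z \<in> carrier (FM H)"
  shows "theta G k F Rp x H z = \<zero>\<^bsub>FM H\<^esub> \<longleftrightarrow> (\<forall>t\<in>X. H \<subseteq> stab t \<longrightarrow> z {(H, t)} = \<zero>\<^bsub>k\<^esub>)"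
proof -
  interpret kd: "domain" k by fact
  interpret FH: module k "FM H" by (rule FM_module)
  interpret FF: mackey_functor G k F by (rule F_mackey)
  have zc: "\<And>\<beta>. z \<beta> \<in> carrier k" using z by (simp add: fmod_carrier)
  have lin: "theta G k F Rp x H \<in> lin_map k (FM H) (FM H)" using FF.theta_lin[OF tc H] by simp
  have bvc: "unit_vec k \<beta> \<in> carrier (FM H)" if "\<beta> \<in> pair_orbits H" for \<beta> by (rule k.unit_vec_in[OF that])
  have e: "theta G k F Rp x H z = (\<Oplus>\<^bsub>FM H\<^esub>\<beta>\<in>pair_orbits H. z \<beta> \<odot>\<^bsub>FM H\<^esub> theta G k F Rp x H (unit_vec k \<beta>))"
    by (rule k.lin_map_fmod_expand[OF finite_pair_orbits[OF H] FM_module lin z])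
  have proper: "theta G k F Rp x H (unit_vec k \<beta>) = \<zero>\<^bsub>FM H\<^esub>"
    if "\<beta> \<in> pair_orbits H" "\<not> (\<exists>t\<in>X. H \<subseteq> stab t \<and> \<beta> = {(H, t)})" for \<beta>
  proof -
    obtain b where b: "b \<in> adm H" "\<beta> = pair_orbit H b" using \<open>\<beta> \<in> pair_orbits H\<close> by (auto simp: pair_orbits_def)
    note bb = admD[OF b(1)]
    have "fst b \<noteq> H"
    proof
      assume "fst b = H"
      then have "b = (H, snd b)" "H \<subseteq> stab (snd b)" using bb by (auto intro: prod_eqI)
      then show False using that(2) bb(3) b(2) fixed_cls[OF H bb(3)] by metis
    qed
    then show ?thesis using theta_bas_proper[OF tc H b(1)] b(2) by (simp add: orbit_vec_def)
  qed
  show ?thesis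
  proof
    assume z0: "\<forall>t\<in>X. H \<subseteq> stab t \<longrightarrow> z {(H, t)} = \<zero>\<^bsub>k\<^esub>"
    have "z \<beta> \<odot>\<^bsub>FM H\<^esub> theta G k F Rp x H (unit_vec k \<beta>) = \<zero>\<^bsub>FM H\<^esub>" if \<beta>: "\<beta> \<in> pair_orbits H" for \<beta>
    proof (cases "\<exists>t\<in>X. H \<subseteq> stab t \<and> \<beta> = {(H, t)}")
      case True
      then have "z \<beta> = \<zero>\<^bsub>k\<^esub>" using z0 by blast
      then show ?thesis using lin_mapD(1)[OF lin bvc[OF \<beta>]] FH.smult_l_null by metis
    next
      case False
      then show ?thesis using proper[OF \<beta>] FH.smult_r_null[OF zc] by simp
    qed
    then show "theta G k F Rp x H z = \<zero>\<^bsub>FM H\<^esub>"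
      unfolding e by (rule FH.add.finprod_one_eqI)
  next
    assume th: "theta G k F Rp x H z = \<zero>\<^bsub>FM H\<^esub>"
    show "\<forall>t\<in>X. H \<subseteq> stab t \<longrightarrow> z {(H, t)} = \<zero>\<^bsub>k\<^esub>"
    proof (intro ballI impI)
      fix t assume t: "t \<in> X" "H \<subseteq> stab t"
      \<comment> \<open>A coefficient that is nonzero in \<open>k\<close>, whatever its
        characteristic, by primitivity.\<close>
      obtain L0 where L0: "L0 \<in> Rp" "k.ring_int (x L0) \<noteq> \<zero>\<^bsub>k\<^esub>"
        using k.ring_int_Gcd_nonzero[of "x ` Rp"] primitive_coeffsD(1,5)[OF tc] kd.one_not_zero by auto
      have tin: "{(H, t)} \<in> pair_orbits H"
        unfolding pair_orbits_def using fixed_cls[OF H t] t H by (intro image_eqI[of _ _ "(H, t)"]) (auto intro!: admI)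
      have "theta G k F Rp x H z (pair_orbit H (L0, t))
          = (\<Oplus>\<^bsub>k\<^esub>\<beta>\<in>pair_orbits H. (z \<beta> \<odot>\<^bsub>FM H\<^esub> theta G k F Rp x H (unit_vec k \<beta>)) (pair_orbit H (L0, t)))"
        unfolding e by (rule k.fmod_finsum_apply)
          (use lin_mapD(1)[OF lin bvc] zc in \<open>auto intro!: FH.smult_closed simp del: fmod_simps\<close>)
      also have "\<dots> = (\<Oplus>\<^bsub>k\<^esub>\<beta>\<in>pair_orbits H. if {(H, t)} = \<beta> then z \<beta> \<otimes>\<^bsub>k\<^esub> k.ring_int (x L0) else \<zero>\<^bsub>k\<^esub>)"
      proof (rule k.finsum_cong'[OF refl])
        fix \<beta> assume \<beta>: "\<beta> \<in> pair_orbits H"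
        have "theta G k F Rp x H (unit_vec k \<beta>) (pair_orbit H (L0, t)) = (if {(H, t)} = \<beta> then k.ring_int (x L0) else \<zero>\<^bsub>k\<^esub>)"
        proof (cases "\<exists>t\<in>X. H \<subseteq> stab t \<and> \<beta> = {(H, t)}")
          case True
          then obtain u where u: "u \<in> X" "H \<subseteq> stab u" "\<beta> = {(H, u)}" by blast
          then have "unit_vec k \<beta> = orbit_vec H (H, u)" using fixed_cls[OF H u(1,2)] by (simp add: orbit_vec_def)
          then show ?thesis using theta_bas_fixed[OF tc H u(1,2) t L0(1)] u(3) by auto
        next
          case False
          then show ?thesis using proper[OF \<beta>] t by auto
        qed
        then show "(z \<beta> \<odot>\<^bsub>FM H\<^esub> theta G k F Rp x H (unit_vec k \<beta>)) (pair_orbit H (L0, t)) =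
            (if {(H, t)} = \<beta> then z \<beta> \<otimes>\<^bsub>k\<^esub> k.ring_int (x L0) else \<zero>\<^bsub>k\<^esub>)" using zc by simp
      qed (use zc in auto)
      also have "\<dots> = z {(H, t)} \<otimes>\<^bsub>k\<^esub> k.ring_int (x L0)"
        by (rule k.finsum_singleton[OF tin finite_pair_orbits[OF H]]) (use zc in auto)
      finally have "z {(H, t)} \<otimes>\<^bsub>k\<^esub> k.ring_int (x L0) = \<zero>\<^bsub>k\<^esub>" using th by simp
      then show "z {(H, t)} = \<zero>\<^bsub>k\<^esub>" using kd.integral[of "z {(H, t)}" "k.ring_int (x L0)"] zc L0(2) by simp
    qed
  qed
qed

end

section \<open>Coordinates and separating functionals\<close>

context cring begin

lemma fmod_apply_expand:
  assumes "finite A" "h \<in> lin_map R (fmod R A) (fmod R B)" "z \<in> carrier (fmod R A)"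
  shows "h z b = (\<Oplus>a\<in>A. z a \<otimes> h (unit_vec R a) b)"
proof -
  interpret B: module R "fmod R B" by (rule fmod_module)
  have z: "\<And>a. z a \<in> carrier R" using assms by (simp add: fmod_carrier)
  have hb: "h (unit_vec R a) \<in> carrier (fmod R B)" if "a \<in> A" for a
    by (rule lin_mapD(1)[OF assms(2) unit_vec_in[OF that]])
  have "h z b = (\<Oplus>a\<in>A. (z a \<odot>\<^bsub>fmod R B\<^esub> h (unit_vec R a)) b)"
    unfolding lin_map_fmod_expand[OF assms(1) fmod_module assms(2,3)]
    by (rule fmod_finsum_apply) (use hb z in \<open>auto intro!: B.smult_closed simp del: fmod_simps\<close>)
  then show ?thesis by simp
qed

lemma fmod_coord:
  assumes "finite A" "h \<in> lin_map R (fmod R A) (fmod R B)" "z \<in> carrier (fmod R A)"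
    and "\<And>a. a \<in> A \<Longrightarrow> h (unit_vec R a) b = (if a = a0 then \<one> else \<zero>)" "a0 \<in> A"
  shows "h z b = z a0"
proof -
  have z: "\<And>a. z a \<in> carrier R" using assms by (simp add: fmod_carrier)
  have "h z b = (\<Oplus>a\<in>A. if a0 = a then z a else \<zero>)"
    unfolding fmod_apply_expand[OF assms(1-3)] by (rule finsum_cong'[OF refl]) (use z assms(4) in auto)
  then show ?thesis using finsum_singleton[OF assms(5,1)] z by simp
qed

lemma fmod_coord_zero:
  assumes "finite A" "h \<in> lin_map R (fmod R A) (fmod R B)" "z \<in> carrier (fmod R A)"
    and "\<And>a. a \<in> A \<Longrightarrow> h (unit_vec R a) b = \<zero>"
  shows "h z b = \<zero>"
proof -
  have z: "\<And>a. z a \<in> carrier R" using assms by (simp add: fmod_carrier)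
  show ?thesis
    unfolding fmod_apply_expand[OF assms(1-3)] by (rule add.finprod_one_eqI) (use z assms(4) in simp)
qed

end

definition pairing :: "('k, 'r) ring_scheme \<Rightarrow> 'a set \<Rightarrow> ('a \<Rightarrow> 'k) \<Rightarrow> ('a \<Rightarrow> 'k) \<Rightarrow> 'k" where
  "pairing R A \<phi> v = (\<Oplus>\<^bsub>R\<^esub>a\<in>A. \<phi> a \<otimes>\<^bsub>R\<^esub> v a)"

context field begin

text \<open>By induction on \<open>A\<close>, eliminating one coordinate \<open>a\<close> at a time.\<close>

lemma separating_functional:
  assumes "finite A" "W \<subseteq> carrier (fmod R A)" "(\<lambda>_. \<zero>) \<in> W"
    and "\<And>u v. u \<in> W \<Longrightarrow> v \<in> W \<Longrightarrow> (\<lambda>a. u a \<oplus> v a) \<in> W"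
    and "\<And>r v. r \<in> carrier R \<Longrightarrow> v \<in> W \<Longrightarrow> (\<lambda>a. r \<otimes> v a) \<in> W"
    and "m \<in> carrier (fmod R A)" "m \<notin> W"
  shows "\<exists>\<phi>. (\<forall>a. \<phi> a \<in> carrier R) \<and> (\<forall>w\<in>W. pairing R A \<phi> w = \<zero>) \<and> pairing R A \<phi> m \<noteq> \<zero>"
  using assms
proof (induction A arbitrary: W m rule: finite_induct)
  case empty
  have "m = (\<lambda>_. \<zero>)" using empty by (auto simp: fmod_carrier)
  then show ?case using empty by simp
next
  case (insert a A)
  have Wc: "w b \<in> carrier R" "b \<notin> insert a A \<Longrightarrow> w b = \<zero>" if "w \<in> W" for w b
    using insert.prems(1) that by (auto simp: fmod_carrier)
  have mc: "m b \<in> carrier R" "b \<notin> insert a A \<Longrightarrow> m b = \<zero>" for b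
    using insert.prems(5) by (auto simp: fmod_carrier)
  have split: "pairing R (insert a A) \<phi> v = \<phi> a \<otimes> v a \<oplus> pairing R A \<phi> v"
    if "\<And>b. \<phi> b \<in> carrier R" "\<And>b. v b \<in> carrier R" for \<phi> v
    unfolding pairing_def using insert.hyps that by (subst finsum_insert) auto
  have pcong: "pairing R A (\<phi>(a := r)) v = pairing R A \<phi> v"
    if "\<And>b. \<phi> b \<in> carrier R" "\<And>b. v b \<in> carrier R" for \<phi> r v
    unfolding pairing_def by (rule finsum_cong'[OF refl]) (use insert.hyps that in auto)
  have pclosed: "pairing R A \<phi> v \<in> carrier R"
    if "\<And>b. \<phi> b \<in> carrier R" "\<And>b. v b \<in> carrier R" for \<phi> v
    unfolding pairing_def by (rule finsum_closed) (use that in auto)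
  show ?case
  proof (cases "\<forall>w\<in>W. w a = \<zero>")
    case W0: True
    show ?thesis
    proof (cases "m a = \<zero>")
      case False
      let ?\<phi> = "\<lambda>b. if b = a then \<one> else \<zero>"
      have "pairing R A ?\<phi> v = \<zero>" if "\<And>b. v b \<in> carrier R" for v
        unfolding pairing_def by (rule add.finprod_one_eqI) (use insert.hyps that in auto)
      then have "pairing R (insert a A) ?\<phi> v = v a" if "\<And>b. v b \<in> carrier R" for v
        using that by (subst split) auto
      then show ?thesis using W0 False Wc(1) mc(1) by (intro exI[of _ ?\<phi>]) auto
    next
      case True
      have "\<exists>\<phi>. (\<forall>a. \<phi> a \<in> carrier R) \<and> (\<forall>w\<in>W. pairing R A \<phi> w = \<zero>) \<and> pairing R A \<phi> m \<noteq> \<zero>"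
      proof (rule insert.IH)
        have "w b = \<zero>" if "w \<in> W" "b \<notin> A" for w b
          using W0 Wc(2)[OF that(1), of b] that by (cases "b = a") auto
        then show "W \<subseteq> carrier (fmod R A)" using Wc(1) by (auto simp: fmod_carrier)
        have "m b = \<zero>" if "b \<notin> A" for b using True mc(2)[of b] that by (cases "b = a") auto
        then show "m \<in> carrier (fmod R A)" using mc(1) by (auto simp: fmod_carrier)
      qed (use insert.prems in auto)
      then obtain \<phi> where \<phi>: "\<And>a. \<phi> a \<in> carrier R" "\<And>w. w \<in> W \<Longrightarrow> pairing R A \<phi> w = \<zero>" "pairing R A \<phi> m \<noteq> \<zero>"
        by blast
      define \<phi>' where "\<phi>' = \<phi>(a := \<zero>)"
      have e: "pairing R (insert a A) \<phi>' v = pairing R A \<phi> v" if "\<And>b. v b \<in> carrier R" for v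
        unfolding \<phi>'_def using \<phi>(1) that pclosed[OF \<phi>(1) that] by (subst split) (auto simp: pcong[OF \<phi>(1) that])
      have "\<forall>b. \<phi>' b \<in> carrier R" using \<phi>(1) by (simp add: \<phi>'_def)
      moreover have "pairing R (insert a A) \<phi>' w = \<zero>" if w: "w \<in> W" for w
        using e[of w] Wc(1)[OF w] \<phi>(2)[OF w] by simp
      moreover have "pairing R (insert a A) \<phi>' m \<noteq> \<zero>" using e[of m] mc(1) \<phi>(3) by simp
      ultimately show ?thesis by blast
    qed
  next
    case False
    then obtain w0 where w0: "w0 \<in> W" "w0 a \<noteq> \<zero>" by blast
    have iw: "inv (w0 a) \<in> carrier R" "inv (w0 a) \<otimes> w0 a = \<one>"
      using w0 Wc(1)[OF w0(1)] field_Units by auto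
    \<comment> \<open>The pivot: a vector of \<open>W\<close> with coordinate one at
      \<open>a\<close>.\<close>
    define w1 where "w1 = (\<lambda>b. inv (w0 a) \<otimes> w0 b)"
    have w1: "w1 \<in> W" "w1 a = \<one>" unfolding w1_def using insert.prems(4)[OF iw(1) w0(1)] iw by auto
    have w1c: "w1 b \<in> carrier R" for b using Wc(1)[OF w1(1)] .
    \<comment> \<open>Subtracting a multiple of the pivot clears the coordinate at \<open>a\<close>.
      It does not affect membership in \<open>W\<close> and moves the problem to the smaller set
      \<open>A\<close>.\<close>
    define red where "red v = (\<lambda>b. v b \<oplus> (\<ominus> (v a)) \<otimes> w1 b)" for v
    have redW: "red v \<in> W \<longleftrightarrow> v \<in> W" if v: "\<And>b. v b \<in> carrier R" for v
    proof
      assume "v \<in> W"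
      then show "red v \<in> W" unfolding red_def using v insert.prems(3,4) w1(1) by simp
    next
      assume "red v \<in> W"
      then have "(\<lambda>b. red v b \<oplus> v a \<otimes> w1 b) \<in> W" using v insert.prems(3,4) w1(1) by simp
      moreover have "red v b \<oplus> v a \<otimes> w1 b = v b" for b
        using v w1c by (simp add: red_def a_assoc l_minus l_neg)
      ultimately show "v \<in> W" by simp
    qed
    have redA: "red v \<in> carrier (fmod R A)" if v: "\<And>b. v b \<in> carrier R" "\<And>b. b \<notin> insert a A \<Longrightarrow> v b = \<zero>" for v
    proof -
      have "red v b = \<zero>" if "b \<notin> A" for b
        using that v w1 w1c Wc(2)[OF w1(1), of b] by (cases "b = a") (auto simp: red_def r_neg)
      then show ?thesis using v w1c by (auto simp: fmod_carrier) (simp add: red_def)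
    qed
    have "\<exists>\<phi>. (\<forall>a. \<phi> a \<in> carrier R) \<and> (\<forall>w\<in>{w \<in> W. w a = \<zero>}. pairing R A \<phi> w = \<zero>) \<and> pairing R A \<phi> (red m) \<noteq> \<zero>"
    proof (rule insert.IH)
      have "w b = \<zero>" if "w \<in> W" "w a = \<zero>" "b \<notin> A" for w b
        using Wc(2)[OF that(1), of b] that by (cases "b = a") auto
      then show "{w \<in> W. w a = \<zero>} \<subseteq> carrier (fmod R A)" using Wc(1) by (auto simp: fmod_carrier)
      show "red m \<in> carrier (fmod R A)" by (rule redA[OF mc])
      show "red m \<notin> {w \<in> W. w a = \<zero>}" using redW[OF mc(1)] insert.prems(6) by auto
    qed (use insert.prems in auto)
    then obtain \<phi> where \<phi>: "\<And>a. \<phi> a \<in> carrier R"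
      "\<And>w. w \<in> W \<Longrightarrow> w a = \<zero> \<Longrightarrow> pairing R A \<phi> w = \<zero>" "pairing R A \<phi> (red m) \<noteq> \<zero>"
      by blast
    \<comment> \<open>The value at \<open>a\<close> is the one for which the pivot pairs to zero, so
      that \<open>v\<close> and \<open>red v\<close> have the same pairing.\<close>
    define \<phi>' where "\<phi>' = \<phi>(a := \<ominus> pairing R A \<phi> w1)"
    have p1: "pairing R A \<phi> w1 \<in> carrier R" by (rule pclosed[OF \<phi>(1) w1c])
    then have \<phi>'c: "\<phi>' b \<in> carrier R" for b using \<phi>(1) by (simp add: \<phi>'_def)
    have key: "pairing R (insert a A) \<phi>' v = pairing R A \<phi> (red v)" if v: "\<And>b. v b \<in> carrier R" for v
    proof -
      have "pairing R A \<phi> (red v) = (\<Oplus>b\<in>A. \<phi> b \<otimes> v b \<oplus> (\<ominus> (v a)) \<otimes> (\<phi> b \<otimes> w1 b))"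
        unfolding pairing_def red_def
        by (rule finsum_cong'[OF refl]) (use \<phi>(1) v w1c in \<open>auto simp: r_distr m_lcomm\<close>)
      also have "\<dots> = pairing R A \<phi> v \<oplus> (\<Oplus>b\<in>A. (\<ominus> (v a)) \<otimes> (\<phi> b \<otimes> w1 b))"
        unfolding pairing_def by (rule finsum_addf) (use \<phi>(1) v w1c in auto)
      also have "(\<Oplus>b\<in>A. (\<ominus> (v a)) \<otimes> (\<phi> b \<otimes> w1 b)) = (\<ominus> (v a)) \<otimes> pairing R A \<phi> w1"
        unfolding pairing_def by (rule finsum_rdistr[symmetric]) (use insert.hyps \<phi>(1) v w1c in auto)
      also have "pairing R A \<phi> v \<oplus> (\<ominus> (v a)) \<otimes> pairing R A \<phi> w1 = pairing R (insert a A) \<phi>' v"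
      proof -
        have s1: "pairing R (insert a A) \<phi>' v = \<phi>' a \<otimes> v a \<oplus> pairing R A \<phi>' v"
          by (rule split) (use \<phi>'c v in auto)
        have s2: "pairing R A \<phi>' v = pairing R A \<phi> v"
          unfolding \<phi>'_def by (rule pcong) (use \<phi>(1) v in auto)
        have s3: "pairing R A \<phi> v \<in> carrier R" by (rule pclosed) (use \<phi>(1) v in auto)
        have "\<phi>' a = \<ominus> pairing R A \<phi> w1" by (simp add: \<phi>'_def)
        then show ?thesis unfolding s1 s2 using p1 v s3 by (simp add: a_comm l_minus r_minus m_comm)
      qed
      finally show ?thesis by simp
    qed
    have "pairing R (insert a A) \<phi>' w = \<zero>" if w: "w \<in> W" for w
    proof -
      have "red w \<in> W" using redW[of w] Wc(1)[OF w] w by simp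
      moreover have "red w a = \<zero>" using Wc(1)[OF w] w1 by (simp add: red_def r_neg)
      ultimately show ?thesis using key[OF Wc(1)[OF w]] \<phi>(2) by simp
    qed
    moreover have "pairing R (insert a A) \<phi>' m \<noteq> \<zero>" using key[OF mc(1)] \<phi>(3) by simp
    ultimately show ?thesis using \<phi>'c by blast
  qed
qed

end

section \<open>Coefficients at fixed points\<close>

context burnside begin

lemma pair_orbits_fixed: "\<lbrakk>subgroup H G; t \<in> X; H \<subseteq> stab t\<rbrakk> \<Longrightarrow> {(H, t)} \<in> pair_orbits H"
  unfolding pair_orbits_def using fixed_cls[of H t] by (intro image_eqI[of _ _ "(H, t)"]) (auto intro!: admI)

lemma pair_orbit_eq_fixed_iff:
  assumes "subgroup H G" "t \<in> X" "H \<subseteq> stab t" "b \<in> adm H"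
  shows "pair_orbit H b = {(H, t)} \<longleftrightarrow> b = (H, t)"
  using pair_orbit_self[OF assms(4,1)] fixed_cls[OF assms(1-3)] by auto

text \<open>Induction keeps the first component of a pair inside \<open>L\<close> up to conjugation,
  so the pair \<open>(H, t)\<close> cannot occur.\<close>

lemma coef_ind_proper:
  assumes "subgroup L G" "subgroup H G" "L \<subset> H" "t \<in> X" "H \<subseteq> stab t" "z \<in> carrier (FM L)"
  shows "ind F L H z {(H, t)} = \<zero>\<^bsub>k\<^esub>"
proof -
  have LH: "L \<subseteq> H" using assms by auto
  show ?thesis
  proof (rule k.fmod_coord_zero[OF finite_pair_orbits[OF assms(1)] ind_orbit_lin(1)[OF assms(1,2) LH] assms(6)])
    fix \<beta> assume "\<beta> \<in> pair_orbits L"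
    then obtain b where b: "b \<in> adm L" "\<beta> = pair_orbit L b" by (auto simp: pair_orbits_def)
    have "b \<noteq> (H, t)" using admD(2)[OF b(1)] assms(3) by auto
    then have "pair_orbit H b \<noteq> {(H, t)}" using pair_orbit_eq_fixed_iff[OF assms(2,4,5) adm_mono[OF LH b(1)]] by simp
    then show "ind F L H (unit_vec k \<beta>) {(H, t)} = \<zero>\<^bsub>k\<^esub>"
      using ind_orbit_lin(2)[OF assms(1,2) LH b(1)] b(2) by (simp add: orbit_vec_def) (auto simp: unit_vec_def)
  qed
qed

text \<open>Conjugation by \<open>g\<close> is a bijection from the \<open>K\<close>-orbits of pairs
  to those of \<open>gKg^-1\<close>; coefficients are only relabelled.\<close>

lemma coef_cnj:
  assumes "subgroup K G" "g \<in> carrier G" "b \<in> adm K" "z \<in> carrier (FM K)"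
  shows "cnj F g K z (pair_orbit (conj_subgp G g K) (gact g b)) = z (pair_orbit K b)"
proof (rule k.fmod_coord[OF finite_pair_orbits[OF assms(1)] cnj_orbit_lin(1)[OF assms(1,2)] assms(4)])
  show "pair_orbit K b \<in> pair_orbits K" using assms(3) by (simp add: pair_orbits_def)
  fix \<beta> assume "\<beta> \<in> pair_orbits K"
  then obtain c where c: "c \<in> adm K" "\<beta> = pair_orbit K c" by (auto simp: pair_orbits_def)
  note gK = conj_subgroup[OF assms(1,2)]
  have gadm: "gact g d \<in> adm (conj_subgp G g K)" if "d \<in> adm K" for d by (rule gact_adm[OF that assms(1,2)])
  have "pair_orbit (conj_subgp G g K) (gact g b) = pair_orbit (conj_subgp G g K) (gact g c) \<longleftrightarrow> pair_orbit K c = pair_orbit K b"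
  proof
    assume "pair_orbit (conj_subgp G g K) (gact g b) = pair_orbit (conj_subgp G g K) (gact g c)"
    then obtain h where h: "h \<in> conj_subgp G g K" "gact g c = gact h (gact g b)"
      using pair_orbit_eqD[OF _ gadm[OF assms(3)] gadm[OF c(1)] gK] by blast
    have hG: "h \<in> carrier G" "inv g \<otimes> h \<otimes> g \<in> K"
      using h(1) conj_mem[OF assms(2) sub_carrier[OF assms(1)]] by auto
    have "c = gact (inv g) (gact g c)" using c(1) assms(2) by (simp add: gact_mult[OF c(1)] gact_one[OF c(1)])
    also have "\<dots> = gact (inv g) (gact (h \<otimes> g) b)" using h(2) gact_mult[OF assms(3) hG(1) assms(2)] by simp
    also have "\<dots> = gact (inv g \<otimes> h \<otimes> g) b" using gact_mult[OF assms(3)] hG(1) assms(2) by (simp add: m_assoc)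
    finally show "pair_orbit K c = pair_orbit K b" using pair_orbit_gact[OF assms(3,1) hG(2)] by simp
  next
    assume "pair_orbit K c = pair_orbit K b"
    then obtain h where h: "h \<in> K" "b = gact h c" using pair_orbit_eqD[OF _ c(1) assms(3,1)] by blast
    have hG: "h \<in> carrier G" by (rule sub_mem[OF assms(1) h(1)])
    have gh: "g \<otimes> h \<otimes> inv g \<in> conj_subgp G g K"
      unfolding conj_image[OF assms(2) sub_carrier[OF assms(1)]] using h(1) by (rule imageI)
    have "gact g b = gact (g \<otimes> h \<otimes> inv g) (gact g c)"
      unfolding h(2) using hG assms(2) by (simp add: gact_mult[OF c(1)] m_assoc)
    then show "pair_orbit (conj_subgp G g K) (gact g b) = pair_orbit (conj_subgp G g K) (gact g c)"
      using pair_orbit_gact[OF gadm[OF c(1)] gK gh] by simp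
  qed
  then show "cnj F g K (unit_vec k \<beta>) (pair_orbit (conj_subgp G g K) (gact g b)) = (if \<beta> = pair_orbit K b then \<one>\<^bsub>k\<^esub> else \<zero>\<^bsub>k\<^esub>)"
    using cnj_orbit_lin(2)[OF assms(1,2) c(1)] c(2) by (simp add: orbit_vec_def) (auto simp: unit_vec_def)
qed

text \<open>If \<open>yLy^-1\<close> contains \<open>stab t\<close> and \<open>yL\<close> lies over
  \<open>t\<close>, then \<open>yLy^-1\<close> equals \<open>stab t\<close>, so only the orbit of
  \<open>(stab t, t)\<close> contributes. It does so once: the fixed points of \<open>stab t\<close>
  on \<open>K/stab t\<close> form a quotient of the normaliser, but only one of them lies over
  \<open>t\<close>.\<close>

lemma coef_stab:
  assumes t: "t \<in> X" and K: "subgroup K G" "stab t \<subseteq> K" and z: "z \<in> carrier (FM K)"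
  shows "res F K (stab t) z {(stab t, t)} = z (pair_orbit K (stab t, t))"
proof -
  define S where "S = stab t"
  have S: "subgroup S G" "S \<subseteq> K" using stab_subgroup[OF t] K by (auto simp: S_def)
  interpret FS: module k "FM S" by (rule FM_module)
  have St: "(S, t) \<in> adm K" "(S, t) \<in> adm S" using S t by (auto intro!: admI simp: S_def)
  have "res F K S z {(S, t)} = z (pair_orbit K (S, t))"
  proof (rule k.fmod_coord[OF finite_pair_orbits[OF K(1)] res_orbit_lin(1)[OF S(1) K(1) S(2)] z])
    show "pair_orbit K (S, t) \<in> pair_orbits K" using St by (simp add: pair_orbits_def)
    fix \<beta> assume "\<beta> \<in> pair_orbits K"
    then obtain b where b: "b \<in> adm K" "\<beta> = pair_orbit K b" by (auto simp: pair_orbits_def)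
    have expand: "res F K S (orbit_vec K c) {(S, t)} = (\<Oplus>\<^bsub>k\<^esub>y\<in>T. if gact y c = (S, t) then \<one>\<^bsub>k\<^esub> else \<zero>\<^bsub>k\<^esub>)"
      if c: "c \<in> adm K" and T: "T \<in> dcoset_reps G S K (fst c)" for c T
    proof -
      note cc = admD[OF c]
      have TG: "y \<in> carrier G" if "y \<in> T" for y
        using dcoset_repsD(1)[OF T S(1) cc(1) K(1) S(2) cc(2)] that sub_mem[OF K(1)] by auto
      have "res F K S (orbit_vec K c) {(S, t)} = (\<Oplus>\<^bsub>k\<^esub>y\<in>T. orbit_vec S (S \<inter> conj_subgp G y (fst c), act y (snd c)) {(S, t)})"
        unfolding res_orbit_lin(2)[OF S(1) K(1) S(2) c T]
        by (rule k.fmod_finsum_apply[OF res_sum_in(2)[OF c S(1) K(1) S(2) T]])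
      also have "\<dots> = (\<Oplus>\<^bsub>k\<^esub>y\<in>T. if gact y c = (S, t) then \<one>\<^bsub>k\<^esub> else \<zero>\<^bsub>k\<^esub>)"
      proof (rule k.finsum_cong'[OF refl])
        fix y assume y: "y \<in> T"
        have "pair_orbit S (S \<inter> conj_subgp G y (fst c), act y (snd c)) = {(S, t)} \<longleftrightarrow>
            (S \<inter> conj_subgp G y (fst c), act y (snd c)) = (S, t)"
          by (rule pair_orbit_eq_fixed_iff[OF S(1) t _ adm_res[OF c S(1) TG[OF y]]]) (simp add: S_def)
        also have "\<dots> \<longleftrightarrow> gact y c = (S, t)"
        proof -
          have "conj_subgp G y (fst c) \<subseteq> S" if "act y (snd c) = t"
            using conj_mono[OF TG[OF y] sub_carrier[OF stab_subgroup[OF cc(3)]] cc(4)]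
              stab_act[OF TG[OF y] cc(3)] that by (simp add: S_def)
          then show ?thesis by (auto simp: gact_def)
        qed
        finally show "orbit_vec S (S \<inter> conj_subgp G y (fst c), act y (snd c)) {(S, t)} =
            (if gact y c = (S, t) then \<one>\<^bsub>k\<^esub> else \<zero>\<^bsub>k\<^esub>)" by (auto simp: orbit_vec_def unit_vec_def)
      qed auto
      finally show ?thesis .
    qed
    show "res F K S (unit_vec k \<beta>) {(S, t)} = (if \<beta> = pair_orbit K (S, t) then \<one>\<^bsub>k\<^esub> else \<zero>\<^bsub>k\<^esub>)"
    proof (cases "\<beta> = pair_orbit K (S, t)")
      case True
      define T where "T = reps S K S"
      have T: "T \<in> dcoset_reps G S K S" unfolding T_def by (rule reps_in[OF S(1) S(1) K(1) S(2) S(2)])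
      note D = dcoset_repsD[OF T S(1) S(1) K(1) S(2) S(2)]
      have "finite T" by (rule finite_subset[OF D(1)]) (use finG sub_carrier[OF K(1)] finite_subset in blast)
      obtain y0 j l where y0: "y0 \<in> T" "j \<in> S" "l \<in> S" "\<one> = j \<otimes> y0 \<otimes> l"
        using D(2)[OF subgroup.one_closed[OF K(1)]] by blast
      have c0: "y0 \<in> carrier G" "j \<in> carrier G" "l \<in> carrier G"
        using y0 D(1) sub_mem S(1) K(1) by blast+
      have "y0 = inv j \<otimes> inv l"
      proof -
        have "y0 = inv j \<otimes> (j \<otimes> y0 \<otimes> l) \<otimes> inv l" using c0 by (simp add: m_assoc) (simp add: m_assoc[symmetric])
        then show ?thesis using y0(4)[symmetric] c0 by simp
      qed
      then have y0S: "y0 \<in> S" using y0 S(1) by (simp add: subgroup.m_closed subgroup.m_inv_closed)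
      \<comment> \<open>A \<open>y\<close> that fixes the pair fixes \<open>t\<close> and so lies in
        \<open>S\<close>; within \<open>T\<close> only the representative \<open>y0\<close> of the
        double coset of one does.\<close>
      have iff: "gact y (S, t) = (S, t) \<longleftrightarrow> y0 = y" if y: "y \<in> T" for y
      proof
        have yG: "y \<in> carrier G" using y D(1) sub_mem[OF K(1)] by blast
        assume "gact y (S, t) = (S, t)"
        then have "y \<in> S" using yG by (simp add: gact_def S_def stab_def)
        then show "y0 = y"
          using D(3)[OF y0(1) y, of "y \<otimes> inv y0" \<one>] y0S c0 yG S(1)
          by (simp add: subgroup.m_closed subgroup.m_inv_closed subgroup.one_closed m_assoc)
      next
        assume "y0 = y"
        then show "gact y (S, t) = (S, t)" using y0S conj_self[OF S(1)] by (auto simp: gact_def S_def stab_def)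
      qed
      have "res F K S (unit_vec k \<beta>) {(S, t)} = (\<Oplus>\<^bsub>k\<^esub>y\<in>T. if gact y (S, t) = (S, t) then \<one>\<^bsub>k\<^esub> else \<zero>\<^bsub>k\<^esub>)"
        using expand[OF St(1)] T True by (simp add: orbit_vec_def)
      also have "\<dots> = (\<Oplus>\<^bsub>k\<^esub>y\<in>T. if y0 = y then \<one>\<^bsub>k\<^esub> else \<zero>\<^bsub>k\<^esub>)"
        by (rule k.finsum_cong'[OF refl]) (auto simp: iff)
      also have "\<dots> = \<one>\<^bsub>k\<^esub>" using k.finsum_singleton[OF y0(1) \<open>finite T\<close>, of "\<lambda>_. \<one>\<^bsub>k\<^esub>"] by simp
      finally show ?thesis using True by simp
    next
      case False
      define T where "T = reps S K (fst b)"
      have T: "T \<in> dcoset_reps G S K (fst b)"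
        unfolding T_def by (rule reps_in[OF S(1) admD(1)[OF b(1)] K(1) S(2) admD(2)[OF b(1)]])
      have "gact y b \<noteq> (S, t)" if "y \<in> T" for y
      proof
        assume e: "gact y b = (S, t)"
        have "y \<in> K" using dcoset_repsD(1)[OF T S(1) admD(1)[OF b(1)] K(1) S(2) admD(2)[OF b(1)]] that by auto
        then show False using pair_orbit_gact[OF b(1) K(1)] e b(2) False by metis
      qed
      then have "(\<Oplus>\<^bsub>k\<^esub>y\<in>T. if gact y b = (S, t) then \<one>\<^bsub>k\<^esub> else \<zero>\<^bsub>k\<^esub>) = \<zero>\<^bsub>k\<^esub>"
        by (intro k.add.finprod_one_eqI) simp
      then show ?thesis using expand[OF b(1) T] b(2) False by (simp add: orbit_vec_def)
    qed
  qed
  then show ?thesis by (simp add: S_def)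
qed

end

section \<open>Morphisms out of permutation Mackey functors\<close>

context mackey_functor begin

lemma hom_zero: "mackey_functor G R N \<Longrightarrow> (\<lambda>H _. \<zero>\<^bsub>obj N H\<^esub>) \<in> mackey_hom G R M N"
proof -
  assume "mackey_functor G R N"
  then interpret N: mackey_functor G R N .
  note z = lin_map_zero[OF N.ind_lin N.module_obj N.module_obj] lin_map_zero[OF N.res_lin N.module_obj N.module_obj]
     lin_map_zero[OF N.cnj_lin N.module_obj N.module_obj]
  show ?thesis
    by (rule mackey_homI) (simp_all add: z lin_map_const_zero N.module_obj conj_subgroup)
qed

lemma hom_add:
  assumes "mackey_functor G R N" "f \<in> mackey_hom G R M N" "h \<in> mackey_hom G R M N"
  shows "(\<lambda>H x. f H x \<oplus>\<^bsub>obj N H\<^esub> h H x) \<in> mackey_hom G R M N"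
proof -
  interpret N: mackey_functor G R N by fact
  note f = mackey_homD[OF assms(2)] and h = mackey_homD[OF assms(3)]
  show ?thesis
  proof (rule mackey_homI)
    show "(\<lambda>x. f H x \<oplus>\<^bsub>obj N H\<^esub> h H x) \<in> lin_map R (obj M H) (obj N H)" if "subgroup H G" for H
      by (rule lin_map_add[OF f(1)[OF that] h(1)[OF that] module_obj[OF that] N.module_obj[OF that]])
  qed (simp_all add: f(2-5) h(2-5) lin_mapD(2)[OF N.ind_lin] lin_mapD(2)[OF N.res_lin] lin_mapD(2)[OF N.cnj_lin])
qed

lemma hom_smult:
  assumes "mackey_functor G R N" "r \<in> carrier R" "f \<in> mackey_hom G R M N"
  shows "(\<lambda>H x. r \<odot>\<^bsub>obj N H\<^esub> f H x) \<in> mackey_hom G R M N"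
proof -
  interpret N: mackey_functor G R N by fact
  note f = mackey_homD[OF assms(3)]
  show ?thesis
  proof (rule mackey_homI)
    show "(\<lambda>x. r \<odot>\<^bsub>obj N H\<^esub> f H x) \<in> lin_map R (obj M H) (obj N H)" if "subgroup H G" for H
      by (rule lin_map_smult[OF assms(2) f(1)[OF that] module_obj[OF that] N.module_obj[OF that]])
  qed (simp_all add: f(2-5) assms(2) lin_mapD(3)[OF N.ind_lin] lin_mapD(3)[OF N.res_lin] lin_mapD(3)[OF N.cnj_lin])
qed

lemma hom_finsum:
  assumes "mackey_functor G R N" "finite S" "\<And>i. i \<in> S \<Longrightarrow> f i \<in> mackey_hom G R M N"
  shows "\<exists>h\<in>mackey_hom G R M N. \<forall>H x. subgroup H G \<longrightarrow> x \<in> carrier (obj M H) \<longrightarrow> h H x = (\<Oplus>\<^bsub>obj N H\<^esub>i\<in>S. f i H x)"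
  using assms(2,3)
proof (induction S rule: finite_induct)
  case empty
  interpret N: mackey_functor G R N by fact
  have "(\<Oplus>\<^bsub>obj N H\<^esub>i\<in>{}. f i H x) = \<zero>\<^bsub>obj N H\<^esub>" if "subgroup H G" for H x
  proof -
    interpret NH: module R "obj N H" by (rule N.module_obj[OF that])
    show ?thesis by simp
  qed
  then show ?case by (intro bexI[OF _ hom_zero[OF assms(1)]]) auto
next
  case (insert i S)
  interpret N: mackey_functor G R N by fact
  obtain h where h: "h \<in> mackey_hom G R M N"
    "\<forall>H x. subgroup H G \<longrightarrow> x \<in> carrier (obj M H) \<longrightarrow> h H x = (\<Oplus>\<^bsub>obj N H\<^esub>i\<in>S. f i H x)"
    using insert by auto
  have fi: "f i \<in> mackey_hom G R M N" using insert by simp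
  have "(\<Oplus>\<^bsub>obj N H\<^esub>j\<in>insert i S. f j H x) = f i H x \<oplus>\<^bsub>obj N H\<^esub> h H x"
    if "subgroup H G" "x \<in> carrier (obj M H)" for H x
  proof -
    interpret NH: module R "obj N H" by (rule N.module_obj[OF that(1)])
    have c: "f j H x \<in> carrier (obj N H)" if "j \<in> insert i S" for j
      using mackey_homD(5)[OF insert.prems[OF that]] \<open>subgroup H G\<close> \<open>x \<in> carrier (obj M H)\<close> by blast
    show ?thesis using insert.hyps h(2) that c by (subst NH.finsum_insert) auto
  qed
  then show ?case by (intro bexI[OF _ hom_add[OF assms(1) fi h(1)]]) auto
qed

text \<open>Elements built with the structure maps are carried along by every morphism. In the
  extension argument this condenses a functional on the coordinates of a morphism into evaluation at
  one element of \<open>P(H)\<close>.\<close>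

lemma hom_combination:
  assumes N: "mackey_functor G R N" and f: "f \<in> mackey_hom G R M N" and H: "subgroup H G"
    and a: "\<And>a. a \<in> A \<Longrightarrow> c a \<in> carrier R \<and> g a \<in> carrier G \<and> subgroup (K a) G \<and> conj_subgp G (g a) H \<subseteq> K a \<and>
      s a \<in> carrier (obj M (K a))"
  shows "(\<Oplus>\<^bsub>obj M H\<^esub>a\<in>A. c a \<odot>\<^bsub>obj M H\<^esub> cnj M (inv (g a)) (conj_subgp G (g a) H) (res M (K a) (conj_subgp G (g a) H) (s a)))
       \<in> carrier (obj M H)" (is "?x \<in> _")
    and "f H (\<Oplus>\<^bsub>obj M H\<^esub>a\<in>A. c a \<odot>\<^bsub>obj M H\<^esub> cnj M (inv (g a)) (conj_subgp G (g a) H) (res M (K a) (conj_subgp G (g a) H) (s a)))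
       = (\<Oplus>\<^bsub>obj N H\<^esub>a\<in>A. c a \<odot>\<^bsub>obj N H\<^esub> cnj N (inv (g a)) (conj_subgp G (g a) H) (res N (K a) (conj_subgp G (g a) H) (f (K a) (s a))))"
proof -
  interpret N: mackey_functor G R N by fact
  interpret MH: module R "obj M H" by (rule module_obj[OF H])
  interpret NH: module R "obj N H" by (rule N.module_obj[OF H])
  note ff = mackey_homD[OF f]
  let ?C = "\<lambda>a. conj_subgp G (g a) H"
  have C: "subgroup (?C a) G" "?C a \<subseteq> K a" "subgroup (K a) G" "inv (g a) \<in> carrier G"
    "conj_subgp G (inv (g a)) (?C a) = H" "c a \<in> carrier R" "s a \<in> carrier (obj M (K a))" if "a \<in> A" for a
    using a[OF that] conj_subgroup[OF H] conj_inv_conj(1) subgroup.subset[OF H] by auto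
  have r: "res M (K a) (?C a) (s a) \<in> carrier (obj M (?C a))" if "a \<in> A" for a
    using lin_mapD(1)[OF res_lin] C[OF that] by blast
  have cr: "cnj M (inv (g a)) (?C a) (res M (K a) (?C a) (s a)) \<in> carrier (obj M H)" if "a \<in> A" for a
    using lin_mapD(1)[OF cnj_lin[OF C(1)[OF that] C(4)[OF that]] r[OF that]] C(5)[OF that] by simp
  show "?x \<in> carrier (obj M H)" by (rule MH.finsum_closed) (use cr C(6) in auto)
  have e: "f H (c a \<odot>\<^bsub>obj M H\<^esub> cnj M (inv (g a)) (?C a) (res M (K a) (?C a) (s a))) =
    c a \<odot>\<^bsub>obj N H\<^esub> cnj N (inv (g a)) (?C a) (res N (K a) (?C a) (f (K a) (s a)))" if "a \<in> A" for a
    using lin_mapD(3)[OF ff(1)[OF H] C(6)[OF that] cr[OF that]] ff(4)[OF C(4)[OF that] C(1)[OF that] r[OF that]]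
      ff(3)[OF C(1)[OF that] C(3)[OF that] C(2)[OF that] C(7)[OF that]] C(5)[OF that] by simp
  have "f H ?x = (\<Oplus>\<^bsub>obj N H\<^esub>a\<in>A. f H (c a \<odot>\<^bsub>obj M H\<^esub> cnj M (inv (g a)) (?C a) (res M (K a) (?C a) (s a))))"
    by (rule lin_map_finsum[OF ff(1)[OF H] module_obj[OF H] N.module_obj[OF H]]) (use cr C(6) in auto)
  also have "\<dots> = (\<Oplus>\<^bsub>obj N H\<^esub>a\<in>A. c a \<odot>\<^bsub>obj N H\<^esub> cnj N (inv (g a)) (?C a) (res N (K a) (?C a) (f (K a) (s a))))"
    by (rule NH.M.finsum_cong'[OF refl]) (use ff(5)[OF H] cr C(6) in \<open>auto simp: e[symmetric]\<close>)
  finally show "f H ?x = (\<Oplus>\<^bsub>obj N H\<^esub>a\<in>A. c a \<odot>\<^bsub>obj N H\<^esub> cnj N (inv (g a)) (?C a) (res N (K a) (?C a) (f (K a) (s a))))" .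
qed

end

text \<open>The disjoint union of the \<open>G/Hf i\<close>. The tag \<open>i\<close> keeps orbits
  apart when several generators have the same subgroup.\<close>

definition coset_gset :: "('g, 'b) monoid_scheme \<Rightarrow> 'i set \<Rightarrow> ('i \<Rightarrow> 'g set) \<Rightarrow> ('i \<times> 'g set) set" where
  "coset_gset G I Hf = (SIGMA i:I. (\<lambda>g. g <#\<^bsub>G\<^esub> Hf i) ` carrier G)"

definition coset_act :: "('g, 'b) monoid_scheme \<Rightarrow> 'g \<Rightarrow> 'i \<times> 'g set \<Rightarrow> 'i \<times> 'g set" where
  "coset_act G g t = (fst t, g <#\<^bsub>G\<^esub> snd t)"

locale cosets = group G + k: cring k for G (structure) and k :: "('k, 'r) ring_scheme" +
  fixes I :: "'i set" and Hf :: "'i \<Rightarrow> 'a set"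
  assumes finG': "finite (carrier G)" and finI: "finite I" and Hf: "\<And>i. i \<in> I \<Longrightarrow> subgroup (Hf i) G"

sublocale cosets \<subseteq> burnside G k "coset_gset G I Hf" "coset_act G"
proof
  show "finite (carrier G)" by (rule finG')
  show "finite (coset_gset G I Hf)" using finG' finI by (simp add: coset_gset_def)
next
  fix g t assume "g \<in> carrier G" "t \<in> coset_gset G I Hf"
  then show "coset_act G g t \<in> coset_gset G I Hf"
    by (auto simp: coset_gset_def coset_act_def lcos_m_assoc subgroup.subset[OF Hf] intro!: imageI)
next
  fix t assume "t \<in> coset_gset G I Hf"
  then show "coset_act G \<one> t = t"
    by (auto simp: coset_gset_def coset_act_def lcos_m_assoc subgroup.subset[OF Hf])
next
  fix g h t assume "g \<in> carrier G" "h \<in> carrier G" "t \<in> coset_gset G I Hf"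
  then show "coset_act G g (coset_act G h t) = coset_act G (g \<otimes> h) t"
    by (auto simp: coset_gset_def coset_act_def lcos_m_assoc subgroup.subset[OF Hf] m_assoc)
qed

context cosets begin

definition base :: "'i \<Rightarrow> 'i \<times> 'a set" where "base i = (i, Hf i)"

definition coset_gen :: "'i \<Rightarrow> ('a set \<times> 'i \<times> 'a set) set \<Rightarrow> 'k" where "coset_gen i = gen (base i)"

text \<open>Each \<open>m i\<close> is spread over its orbit by conjugation with some
  \<open>g\<close> representing the coset. The choice is harmless since \<open>Hf i\<close> acts
  trivially on the value of \<open>M\<close> at \<open>Hf i\<close>.\<close>

definition gens_hom :: "('a, 'k, 'm) mackey \<Rightarrow> ('i \<Rightarrow> 'm) \<Rightarrow> 'a set \<Rightarrow> (('a set \<times> 'i \<times> 'a set) set \<Rightarrow> 'k) \<Rightarrow> 'm" where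
  "gens_hom M m = yoneda M (\<lambda>t. cnj M (SOME g. g \<in> carrier G \<and> snd t = g <# Hf (fst t)) (Hf (fst t)) (m (fst t)))"

lemma base_in: "i \<in> I \<Longrightarrow> base i \<in> coset_gset G I Hf"
  using lcos_mult_one[OF subgroup.subset[OF Hf]] by (auto simp: base_def coset_gset_def intro!: image_eqI[of _ _ \<one>])

lemma coset_eq_iff:
  assumes "subgroup H G" "g \<in> carrier G" "h \<in> carrier G"
  shows "g <# H = h <# H \<longleftrightarrow> inv h \<otimes> g \<in> H"
proof
  assume "g <# H = h <# H"
  moreover have "g \<in> g <# H" using assms subgroup.one_closed[OF assms(1)] by (force simp: l_coset_def)
  ultimately obtain x where "x \<in> H" "g = h \<otimes> x" by (auto simp: l_coset_def)
  then show "inv h \<otimes> g \<in> H" using assms subgroup.mem_carrier[OF assms(1)] by (simp add: m_assoc[symmetric])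
next
  assume *: "inv h \<otimes> g \<in> H"
  have "g = h \<otimes> (inv h \<otimes> g)" using assms by (simp add: m_assoc[symmetric])
  then have "g \<in> h <# H" using * by (auto simp: l_coset_def)
  then show "g <# H = h <# H" using l_repr_independence[OF _ assms(3,1)] by simp
qed

lemma stab_base:
  assumes "i \<in> I" shows "stab (base i) = Hf i"
proof -
  have "g <# Hf i = Hf i \<longleftrightarrow> g \<in> Hf i" if "g \<in> carrier G" for g
    using coset_eq_iff[OF Hf[OF assms] that one_closed] lcos_mult_one[OF subgroup.subset[OF Hf[OF assms]]] that by simp
  then show ?thesis using subgroup.subset[OF Hf[OF assms]] by (auto simp: stab_def base_def coset_act_def)
qed

lemma orbit: "t \<in> coset_gset G I Hf \<Longrightarrow> \<exists>g\<in>carrier G. fst t \<in> I \<and> t = coset_act G g (base (fst t))"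
  by (auto simp: coset_gset_def coset_act_def base_def)

lemma coset_gen_in: "i \<in> I \<Longrightarrow> coset_gen i \<in> carrier (FM (Hf i))"
  using gen_in[OF base_in] stab_base by (simp add: coset_gen_def)

lemma coset_gen_bas: "i \<in> I \<Longrightarrow> coset_gen i = orbit_vec (Hf i) (Hf i, base i)"
  by (simp add: coset_gen_def gen_def stab_base)

context
  fixes M :: "('a, 'k, 'm) mackey" and m :: "'i \<Rightarrow> 'm"
  assumes M: "mackey_functor G k M" and m: "\<And>i. i \<in> I \<Longrightarrow> m i \<in> carrier (obj M (Hf i))"
begin

lemma gens_hom_family_value:
  assumes "i \<in> I" "g \<in> carrier G"
  shows "cnj M (SOME h. h \<in> carrier G \<and> g <# Hf i = h <# Hf i) (Hf i) (m i) = cnj M g (Hf i) (m i)"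
proof -
  interpret M: mackey_functor G k M by (rule M)
  define h where "h = (SOME h. h \<in> carrier G \<and> g <# Hf i = h <# Hf i)"
  have "h \<in> carrier G \<and> g <# Hf i = h <# Hf i" unfolding h_def by (rule someI) (use assms in blast)
  then have h: "h \<in> carrier G" "inv h \<otimes> g \<in> Hf i" using coset_eq_iff[OF Hf[OF assms(1)] assms(2)] by auto
  have "cnj M g (Hf i) (m i) = cnj M (h \<otimes> (inv h \<otimes> g)) (Hf i) (m i)" using assms h(1) by (simp add: m_assoc[symmetric])
  also have "\<dots> = cnj M h (conj_subgp G (inv h \<otimes> g) (Hf i)) (cnj M (inv h \<otimes> g) (Hf i) (m i))"
    by (rule M.cnj_cnj[OF Hf[OF assms(1)] h(1) _ m[OF assms(1)], symmetric]) (use assms h in simp)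
  also have "\<dots> = cnj M h (Hf i) (m i)"
    using conj_self[OF Hf[OF assms(1)] h(2)] M.cnj_id[OF Hf[OF assms(1)] h(2) m[OF assms(1)]] by simp
  finally show ?thesis by (simp add: h_def)
qed

lemma gens_hom_family:
  "family M (\<lambda>t. cnj M (SOME g. g \<in> carrier G \<and> snd t = g <# Hf (fst t)) (Hf (fst t)) (m (fst t)))"
proof -
  interpret M: mackey_functor G k M by (rule M)
  let ?f = "\<lambda>t. cnj M (SOME g. g \<in> carrier G \<and> snd t = g <# Hf (fst t)) (Hf (fst t)) (m (fst t))"
  have v: "?f (coset_act G g (base i)) = cnj M g (Hf i) (m i)" if "i \<in> I" "g \<in> carrier G" for g i
    using gens_hom_family_value[OF that] by (simp add: coset_act_def base_def)
  show ?thesis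
    unfolding family_def
  proof (intro ballI conjI)
    fix t assume t: "t \<in> coset_gset G I Hf"
    then obtain i g where ig: "i \<in> I" "g \<in> carrier G" "t = coset_act G g (base i)" using orbit by blast
    have st: "stab t = conj_subgp G g (Hf i)" using stab_act[OF ig(2) base_in[OF ig(1)]] stab_base[OF ig(1)] ig(3) by simp
    show "?f t \<in> carrier (obj M (stab t))"
      unfolding ig(3) v[OF ig(1,2)] using lin_mapD(1)[OF M.cnj_lin[OF Hf[OF ig(1)] ig(2)] m[OF ig(1)]] st ig(3) by simp
    fix h assume h: "h \<in> carrier G"
    have "coset_act G h t = coset_act G (h \<otimes> g) (base i)" unfolding ig(3) by (rule act_mult[OF h ig(2) base_in[OF ig(1)]])
    then have "?f (coset_act G h t) = cnj M (h \<otimes> g) (Hf i) (m i)" using v[OF ig(1), of "h \<otimes> g"] h ig(2) by simp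
    also have "\<dots> = cnj M h (stab t) (cnj M g (Hf i) (m i))"
      unfolding st by (rule M.cnj_cnj[OF Hf[OF ig(1)] h ig(2) m[OF ig(1)], symmetric])
    finally show "cnj M h (stab t) (?f t) = ?f (coset_act G h t)" using v[OF ig(1,2)] ig(3) by simp
  qed
qed

lemma gens_hom_hom: "gens_hom M m \<in> mackey_hom G k F M"
  unfolding gens_hom_def by (rule yoneda_hom[OF M gens_hom_family])

lemma gens_hom_bas:
  assumes "subgroup K G" "i \<in> I" "g \<in> carrier G" "(L, coset_act G g (base i)) \<in> adm K"
  shows "gens_hom M m K (orbit_vec K (L, coset_act G g (base i))) = ind M L K (res M (conj_subgp G g (Hf i)) L (cnj M g (Hf i) (m i)))"
  using yoneda_bas[OF M gens_hom_family assms(1,4)] gens_hom_family_value[OF assms(2,3)]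
    stab_act[OF assms(3) base_in[OF assms(2)]] stab_base[OF assms(2)]
  by (simp add: gens_hom_def coset_act_def base_def)

lemma gens_hom_coset_gen: assumes "i \<in> I" shows "gens_hom M m (Hf i) (coset_gen i) = m i"
proof -
  interpret M: mackey_functor G k M by (rule M)
  have "coset_act G \<one> (base i) = base i" by (rule act_one[OF base_in[OF assms]])
  then have "gens_hom M m (Hf i) (coset_gen i) = ind M (Hf i) (Hf i) (res M (conj_subgp G \<one> (Hf i)) (Hf i) (cnj M \<one> (Hf i) (m i)))"
    using gens_hom_bas[OF Hf[OF assms] assms one_closed, of "Hf i"] gen_adm[OF base_in[OF assms]] stab_base[OF assms]
    by (simp add: coset_gen_bas[OF assms])
  then show ?thesis
    using Hf[OF assms] m[OF assms]
    by (simp add: conj_one subgroup.subset M.cnj_id subgroup.one_closed M.res_id M.ind_id)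
qed

end

lemma hom_eqI_coset_gen:
  assumes "mackey_functor G k M" "f \<in> mackey_hom G k F M" "h \<in> mackey_hom G k F M"
    and "\<And>i. i \<in> I \<Longrightarrow> f (Hf i) (coset_gen i) = h (Hf i) (coset_gen i)"
    and "subgroup K G" "x \<in> carrier (FM K)"
  shows "f K x = h K x"
proof (rule F_hom_eqI[OF assms(1-3) _ assms(5,6)])
  fix t assume "t \<in> coset_gset G I Hf"
  then obtain i g where ig: "i \<in> I" "g \<in> carrier G" "t = coset_act G g (base i)" using orbit by blast
  have g: "gen t = cnj F g (Hf i) (coset_gen i)" "stab t = conj_subgp G g (Hf i)"
    using gen_act[OF base_in[OF ig(1)] ig(2)] stab_base[OF ig(1)] stab_act[OF ig(2) base_in[OF ig(1)]] ig(3)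
    by (simp_all add: coset_gen_def)
  have oi: "coset_gen i \<in> carrier (obj F (Hf i))" using coset_gen_in[OF ig(1)] by simp
  show "f (stab t) (gen t) = h (stab t) (gen t)"
    unfolding g using mackey_homD(4)[OF assms(2) ig(2) Hf[OF ig(1)] oi] mackey_homD(4)[OF assms(3) ig(2) Hf[OF ig(1)] oi]
      assms(4)[OF ig(1)] by simp
qed

end

context burnside begin

text \<open>The morphism below is the transpose of the map \<open>G/H \<rightarrow> X\<close> with \<open>gH \<mapsto> g\<cdot>s\<close>.\<close>

lemma transpose_exists:
  assumes H: "subgroup H G" and s: "s \<in> X" "H \<subseteq> stab s"
    and FT: "FT = burnside.F G k (coset_gset G {()} (\<lambda>_. H)) (coset_act G)"
  shows "\<exists>\<eta>\<in>mackey_hom G k F FT. \<forall>z\<in>carrier (FM H). \<eta> H z {(H, ((), H))} = z {(H, s)}"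
proof -
  interpret T: cosets G k "{()}" "\<lambda>_. H" by (intro cosets.intro cosets_axioms.intro is_group k.is_cring finG H) simp
  have FT: "FT = T.F" by (simp add: FT)
  define bp where "bp = T.base ()"
  have oX: "bp \<in> coset_gset G {()} (\<lambda>_. H)" unfolding bp_def by (rule T.base_in) simp
  have so: "T.stab bp = H" unfolding bp_def by (rule T.stab_base) simp
  \<comment> \<open>Over \<open>gs\<close> the fibre of \<open>G/H \<rightarrow> X\<close> is the
    transitive \<open>stab (gs)\<close>-set generated by \<open>gH\<close>; this pair describes it
    as a set over \<open>G/H\<close>.\<close>
  define e where "e g = (conj_subgp G g H, coset_act G g bp)" for g
  have e_adm: "e g \<in> T.adm (stab (act g s))" if "g \<in> carrier G" for g
    unfolding e_def
  proof (rule T.admI)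
    show "subgroup (conj_subgp G g H) G" by (rule conj_subgroup[OF H that])
    show "conj_subgp G g H \<subseteq> stab (act g s)"
      unfolding stab_act[OF that s(1)] by (rule conj_mono[OF that sub_carrier[OF stab_subgroup[OF s(1)]] s(2)])
    show "coset_act G g bp \<in> coset_gset G {()} (\<lambda>_. H)" by (rule T.act_closed[OF that oX])
    show "conj_subgp G g H \<subseteq> T.stab (coset_act G g bp)" unfolding T.stab_act[OF that oX] so by simp
  qed
  have e_gact: "T.gact y (e g) = e (y \<otimes> g)" if "y \<in> carrier G" "g \<in> carrier G" for y g
    using that H oX by (simp add: e_def T.gact_def conj_conj sub_carrier T.act_mult)
  have e_indep: "T.orbit_vec (stab (act g s)) (e g') = T.orbit_vec (stab (act g s)) (e g)"
    if g: "g \<in> carrier G" "g' \<in> carrier G" "act g s = act g' s" for g g'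
  proof -
    have "act (g' \<otimes> inv g) (act g s) = act g' s"
      using g(1,2) s by (simp add: act_mult act_closed m_assoc)
    then have "g' \<otimes> inv g \<in> stab (act g s)" using g by (simp add: stab_def)
    moreover have "T.gact (g' \<otimes> inv g) (e g) = e g'" using g by (simp add: e_gact m_assoc)
    ultimately show ?thesis
      using T.orbit_vec_gact[OF e_adm[OF g(1)] stab_subgroup] s g act_closed by metis
  qed
  \<comment> \<open>The equivariant family of the transpose: the fibre over \<open>t\<close>, which
    is empty, hence zero, when \<open>t\<close> is not in the orbit of \<open>s\<close>.\<close>
  define m where "m t = (if \<exists>g\<in>carrier G. t = act g s then T.orbit_vec (stab t) (e (SOME g. g \<in> carrier G \<and> t = act g s))
     else \<zero>\<^bsub>obj T.F (stab t)\<^esub>)" for t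
  have m_act: "m (act g s) = T.orbit_vec (stab (act g s)) (e g)" if g: "g \<in> carrier G" for g
  proof -
    have "(SOME h. h \<in> carrier G \<and> act g s = act h s) \<in> carrier G \<and> act g s = act (SOME h. h \<in> carrier G \<and> act g s = act h s) s"
      by (rule someI) (use g in blast)
    then have "T.orbit_vec (stab (act g s)) (e (SOME h. h \<in> carrier G \<and> act g s = act h s)) = T.orbit_vec (stab (act g s)) (e g)"
      using e_indep[OF g] by blast
    moreover have "\<exists>h\<in>carrier G. act g s = act h s" using g by blast
    ultimately show ?thesis by (simp add: m_def)
  qed
  have fam: "family T.F m"
    unfolding family_def
  proof (intro ballI conjI)
    fix t assume t: "t \<in> X"
    show "m t \<in> carrier (obj T.F (stab t))"
    proof (cases "\<exists>g\<in>carrier G. t = act g s")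
      case True
      then obtain g where "g \<in> carrier G" "t = act g s" by blast
      then show ?thesis using m_act T.orbit_vec_in[OF e_adm] by simp
    next
      case False
      interpret TM: module k "T.FM (stab t)" by (rule T.FM_module)
      show ?thesis using False TM.zero_closed by (simp add: m_def del: fmod_simps)
    qed
    fix y assume y: "y \<in> carrier G"
    show "cnj T.F y (stab t) (m t) = m (act y t)"
    proof (cases "\<exists>g\<in>carrier G. t = act g s")
      case True
      then obtain g where g: "g \<in> carrier G" "t = act g s" by blast
      have "cnj T.F y (stab t) (m t) = T.orbit_vec (conj_subgp G y (stab t)) (T.gact y (e g))"
        unfolding g(2) m_act[OF g(1)] by (rule T.cnj_orbit_lin(2)[OF stab_subgroup y e_adm[OF g(1)]]) (use g s act_closed in simp)
      also have "\<dots> = m (act (y \<otimes> g) s)"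
        using m_act[of "y \<otimes> g"] y g s t stab_act[OF y t] by (simp add: e_gact act_mult)
      finally show ?thesis using y g s by (simp add: act_mult)
    next
      case False
      have "\<not> (\<exists>g\<in>carrier G. act y t = act g s)"
      proof
        assume "\<exists>g\<in>carrier G. act y t = act g s"
        then obtain g where g: "g \<in> carrier G" "act y t = act g s" by blast
        have "t = act (inv y) (act y t)" using y t by (simp add: act_mult act_one)
        also have "\<dots> = act (inv y \<otimes> g) s" unfolding g(2) using y g(1) s by (simp add: act_mult)
        finally show False using False y g(1) by auto
      qed
      then show ?thesis
        using False lin_map_zero[OF T.cnj_orbit_lin(1)[OF stab_subgroup[OF t] y] T.FM_module T.FM_module] stab_act[OF y t]
        by (simp add: m_def)
    qed
  qed
  have TF: "mackey_functor G k T.F" by (rule T.F_mackey)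
  define \<eta> where "\<eta> = yoneda T.F m"
  have \<eta>h: "\<eta> \<in> mackey_hom G k F T.F" unfolding \<eta>_def by (rule yoneda_hom[OF TF fam])
  have o': "(H, ((), H)) = (H, bp)" by (simp add: bp_def T.base_def)
  have \<eta>lin: "\<eta> H \<in> lin_map k (FM H) (T.FM H)" using mackey_homD(1)[OF \<eta>h H] by simp
  have "\<eta> H z {(H, bp)} = z {(H, s)}" if z: "z \<in> carrier (FM H)" for z
  proof (rule k.fmod_coord[OF finite_pair_orbits[OF H] \<eta>lin z])
    show "{(H, s)} \<in> pair_orbits H" by (rule pair_orbits_fixed[OF H s])
    fix \<beta> assume "\<beta> \<in> pair_orbits H"
    then obtain L u where b: "(L, u) \<in> adm H" "\<beta> = pair_orbit H (L, u)" by (auto simp: pair_orbits_def)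
    note bb = admD[OF b(1), simplified]
    have rm: "res T.F (stab u) L (m u) \<in> carrier (T.FM L)"
      using lin_mapD(1)[OF T.res_orbit_lin(1)[OF bb(1) stab_subgroup[OF bb(3)] bb(4)]] fam bb(3) by (simp add: family_def)
    have v: "\<eta> H (unit_vec k \<beta>) = ind T.F L H (res T.F (stab u) L (m u))"
      using yoneda_bas[OF TF fam H b(1)] b(2) by (simp add: \<eta>_def orbit_vec_def)
    \<comment> \<open>For \<open>L \<noteq> H\<close> the value is induced from a proper subgroup
      and has no component at \<open>(H, bp)\<close>. For \<open>L = H\<close>,
      \<open>coef_stab\<close> turns the component into a coefficient of the single basis vector
      \<open>m u\<close>, and it is one exactly for \<open>u = s\<close>.\<close>
    have key: "\<eta> H (unit_vec k \<beta>) {(H, bp)} = (if (L, u) = (H, s) then \<one>\<^bsub>k\<^esub> else \<zero>\<^bsub>k\<^esub>)"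
    proof (cases "L = H")
      case False
      then show ?thesis
        using T.coef_ind_proper[OF bb(1) H _ oX _ rm] bb(2) so by (auto simp: v)
    next
      case True
      have Hu: "H \<subseteq> stab u" using bb True by simp
      interpret TFm: mackey_functor G k T.F by (rule TF)
      have v': "\<eta> H (unit_vec k \<beta>) = res T.F (stab u) H (m u)"
        using v True TFm.ind_id[OF H] rm by simp
      show ?thesis
      proof (cases "\<exists>g\<in>carrier G. u = act g s")
        case False
        then have "u \<noteq> s" using act_one[OF s(1)] by force
        moreover have "res T.F (stab u) H (m u) = \<zero>\<^bsub>T.FM H\<^esub>"
          using False lin_map_zero[OF T.res_orbit_lin(1)[OF H stab_subgroup[OF bb(3)] Hu] T.FM_module T.FM_module] by (simp add: m_def)
        ultimately show ?thesis using v' by simp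
      next
        case True
        then obtain g where g: "g \<in> carrier G" "u = act g s" by blast
        have su: "subgroup (stab u) G" by (rule stab_subgroup[OF bb(3)])
        have eg: "e g \<in> T.adm (stab u)" using e_adm[OF g(1)] g(2) by simp
        have Ho: "(H, bp) \<in> T.adm (stab u)" by (rule T.admI[OF H Hu oX]) (simp add: so)
        have "res T.F (stab u) H (m u) {(H, bp)} = m u (T.pair_orbit (stab u) (H, bp))"
          using T.coef_stab[OF oX su, of "m u"] so Hu fam bb(3) by (simp add: family_def)
        also have "\<dots> = (if T.pair_orbit (stab u) (H, bp) = T.pair_orbit (stab u) (e g) then \<one>\<^bsub>k\<^esub> else \<zero>\<^bsub>k\<^esub>)"
          using m_act[OF g(1)] g(2) by (simp add: T.orbit_vec_def unit_vec_def)
        also have "T.pair_orbit (stab u) (H, bp) = T.pair_orbit (stab u) (e g) \<longleftrightarrow> u = s"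
        proof
          assume "T.pair_orbit (stab u) (H, bp) = T.pair_orbit (stab u) (e g)"
          then obtain y where y: "y \<in> stab u" "(H, bp) = T.gact y (e g)" using T.pair_orbit_eqD[OF _ eg Ho su] by metis
          have yG: "y \<in> carrier G" using y(1) by (simp add: stab_def)
          have "coset_act G (y \<otimes> g) bp = bp" using y(2) e_gact[OF yG g(1)] by (simp add: e_def)
          then have "y \<otimes> g \<in> T.stab bp" using yG g(1) by (simp add: T.stab_def)
          then have "act (y \<otimes> g) s = s" using so s(2) by (auto simp: stab_def)
          moreover have "act (y \<otimes> g) s = u" using y(1) yG g s by (simp add: act_mult[symmetric]) (simp add: stab_def)
          ultimately show "u = s" by simp
        next
          assume us: "u = s"
          have "act (inv g) (act g s) = s" using g(1) s by (simp add: act_mult act_one)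
          moreover have "act g s = s" using trans[OF g(2)[symmetric] us] .
          ultimately have ig: "inv g \<in> stab u" using g(1) us by (simp add: stab_def)
          have "T.gact (inv g) (e g) = e \<one>" using e_gact[of "inv g" g] g(1) by simp
          also have "e \<one> = (H, bp)" using H oX by (simp add: e_def conj_one sub_carrier T.act_one)
          finally show "T.pair_orbit (stab u) (H, bp) = T.pair_orbit (stab u) (e g)" using T.pair_orbit_gact[OF eg su ig] by simp
        qed
        finally show ?thesis using v' \<open>L = H\<close> by simp
      qed
    qed
    have "(L, u) = (H, s) \<longleftrightarrow> \<beta> = {(H, s)}" using pair_orbit_eq_fixed_iff[OF H s b(1)] b(2) by simp
    then show "\<eta> H (unit_vec k \<beta>) {(H, bp)} = (if \<beta> = {(H, s)} then \<one>\<^bsub>k\<^esub> else \<zero>\<^bsub>k\<^esub>)" using key by simp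
  qed
  then show ?thesis unfolding FT o' using \<eta>h by blast
qed

end

section \<open>Extension along monomorphisms\<close>

text \<open>\<open>P\<close> is given as a retract of the Burnside functor of a sum of coset spaces,
  so morphisms out of it have finitely many coordinates; \<open>Q\<close> comes with an embedding
  into another Burnside functor.\<close>

locale projective_mono = cosets G k I Hf
  for G :: "('a, 'b) monoid_scheme" (structure) and k :: "('k, 'r) ring_scheme" and I :: "'i set" and Hf +
  fixes P :: "('a, 'k, 'm) mackey" and Q :: "('a, 'k, 'n) mackey" and f :: "'a set \<Rightarrow> 'm \<Rightarrow> 'n"
    and \<pi> \<iota> and X :: "'t set" and act and \<iota>Q
  assumes fieldk: "field k" and P: "mackey_functor G k P" and Q: "mackey_functor G k Q"
    and f: "f \<in> mackey_hom G k P Q"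
    and f_inj: "\<lbrakk>subgroup K G; x \<in> carrier (obj P K); f K x = \<zero>\<^bsub>obj Q K\<^esub>\<rbrakk> \<Longrightarrow> x = \<zero>\<^bsub>obj P K\<^esub>"
    and \<pi>: "\<pi> \<in> mackey_hom G k F P" and \<iota>: "\<iota> \<in> mackey_hom G k P F"
    and \<pi>\<iota>: "\<lbrakk>subgroup K G; x \<in> carrier (obj P K)\<rbrakk> \<Longrightarrow> \<pi> K (\<iota> K x) = x"
    and B: "burnside G k X act" and \<iota>Q: "\<iota>Q \<in> mackey_hom G k Q (burnside.F G k X act)"
    and \<iota>Q_inj: "\<lbrakk>subgroup K G; y \<in> carrier (obj Q K); \<iota>Q K y = \<zero>\<^bsub>obj (burnside.F G k X act) K\<^esub>\<rbrakk> \<Longrightarrow>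
        y = \<zero>\<^bsub>obj Q K\<^esub>"
begin

abbreviation FT where "FT H \<equiv> burnside.F G k (coset_gset G {()} (\<lambda>_. H)) (coset_act G)"

definition extends :: "('a, 'k, 'x) mackey \<Rightarrow> ('a set \<Rightarrow> 'm \<Rightarrow> 'x) \<Rightarrow> bool" where
  "extends M u \<longleftrightarrow> (\<exists>v\<in>mackey_hom G k Q M. \<forall>K x. subgroup K G \<longrightarrow> x \<in> carrier (obj P K) \<longrightarrow> v K (f K x) = u K x)"

lemma transitive: "subgroup H G \<Longrightarrow> cosets G k {()} (\<lambda>_. H)"
  by (intro cosets.intro cosets_axioms.intro is_group k.is_cring finG) simp

definition p where "p i = \<pi> (Hf i) (coset_gen i)"

lemma p_in: "i \<in> I \<Longrightarrow> p i \<in> carrier (obj P (Hf i))"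
  unfolding p_def using mackey_homD(5)[OF \<pi> Hf] coset_gen_in by simp

text \<open>\<open>gens_hom M m\<close> and \<open>u\<close> composed with \<pi> agree on the
  generators of \<open>F\<close>, and \<pi> is undone by \<iota>. So \<open>u\<close> can be
  reconstructed from its values at the \<open>p i\<close>.\<close>

lemma gens_hom_determined:
  assumes M: "mackey_functor G k M" and u: "u \<in> mackey_hom G k P M"
    and m: "\<And>i. i \<in> I \<Longrightarrow> m i = u (Hf i) (p i)" and K: "subgroup K G" "x \<in> carrier (obj P K)"
  shows "gens_hom M m K (\<iota> K x) = u K x"
proof -
  have mc: "m i \<in> carrier (obj M (Hf i))" if "i \<in> I" for i
    using mackey_homD(5)[OF u Hf[OF that] p_in[OF that]] m[OF that] by simp
  have "gens_hom M m K (\<iota> K x) = u K (\<pi> K (\<iota> K x))"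
  proof (rule hom_eqI_coset_gen[OF M gens_hom_hom[OF M mc] mackey_hom_comp[OF \<pi> u] _ K(1)])
    show "gens_hom M m (Hf i) (coset_gen i) = u (Hf i) (\<pi> (Hf i) (coset_gen i))" if "i \<in> I" for i
      using gens_hom_coset_gen[OF M mc that] m[OF that] by (simp add: p_def)
    show "\<iota> K x \<in> carrier (FM K)" using mackey_homD(5)[OF \<iota> K] by simp
  qed
  then show ?thesis using \<pi>\<iota>[OF K] by simp
qed

lemma extends_transitive:
  assumes "subgroup H G" "u \<in> mackey_hom G k P (FT H)"
  shows "extends (FT H) u"
  using assms
proof (induction "card H" arbitrary: H u rule: less_induct)
  case less
  have H: "subgroup H G" by (rule less.prems(1))
  interpret kf: field k by (rule fieldk)
  interpret PF: mackey_functor G k P by (rule P)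
  interpret QF: mackey_functor G k Q by (rule Q)
  interpret AF: mackey_functor G k F by (rule F_mackey)
  interpret B: burnside G k X act by (rule B)
  interpret T: cosets G k "{()}" "\<lambda>_. H" by (rule transitive[OF H])
  have TF: "mackey_functor G k T.F" by (rule T.F_mackey)
  interpret TF: mackey_functor G k T.F by (rule TF)
  have u: "u \<in> mackey_hom G k P T.F" by (rule less.prems(2))
  define bp where "bp = T.base ()"
  have bpX: "bp \<in> coset_gset G {()} (\<lambda>_. H)" unfolding bp_def by (rule T.base_in) simp
  have sbp: "T.stab bp = H" unfolding bp_def by (rule T.stab_base) simp
  have finH: "finite H" using finite_subset[OF sub_carrier[OF H] finG] .
  \<comment> \<open>A morphism from \<open>F\<close> to \<open>T.F\<close> is given by its values at
    the \<open>coset_gen i\<close>. \<open>A\<close> indexes the coordinates of these values, so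
    \<open>fmod k A\<close> is the space of such morphisms, of finite dimension.\<close>
  define A where "A = (SIGMA i:I. T.pair_orbits (Hf i))"
  have finA: "finite A" unfolding A_def using finI T.finite_pair_orbits[OF Hf] by simp
  have cm: "(\<lambda>\<beta>. m (i, \<beta>)) \<in> carrier (T.FM (Hf i))" if "m \<in> carrier (fmod k A)" "i \<in> I" for m i
    using that by (auto simp: fmod_carrier A_def)
  have cm': "\<And>i. i \<in> I \<Longrightarrow> (\<lambda>\<beta>. m (i, \<beta>)) \<in> carrier (obj T.F (Hf i))" if "m \<in> carrier (fmod k A)" for m
    using cm[OF that] by simp
  \<comment> \<open>Composition with \<iota>: coordinate vectors give morphisms out of
    \<open>P\<close>, and by \<open>Dco\<close> below every morphism arises.\<close>
  define D where "D m K x = gens_hom T.F (\<lambda>i \<beta>. m (i, \<beta>)) K (\<iota> K x)" for m K x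
  have hh: "gens_hom T.F (\<lambda>i \<beta>. m (i, \<beta>)) \<in> mackey_hom G k F T.F" if "m \<in> carrier (fmod k A)" for m
    by (rule gens_hom_hom[OF TF cm'[OF that]])
  have h1: "gens_hom T.F (\<lambda>i \<beta>. m (i, \<beta>)) (Hf i) (coset_gen i) = (\<lambda>\<beta>. m (i, \<beta>))" if "m \<in> carrier (fmod k A)" "i \<in> I" for m i
    by (rule gens_hom_coset_gen[OF TF cm'[OF that(1)] that(2)])
  have Dh: "D m \<in> mackey_hom G k P T.F" if "m \<in> carrier (fmod k A)" for m
    using mackey_hom_comp[OF \<iota> hh[OF that]] by (simp add: D_def[abs_def])
  have ic: "\<iota> K x \<in> carrier (FM K)" if "subgroup K G" "x \<in> carrier (obj P K)" for K x
    using mackey_homD(5)[OF \<iota> that] by simp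
  interpret FA: module k "fmod k A" by (rule k.fmod_module)
  \<comment> \<open>The coordinate vectors of extendable morphisms. \<open>W\<close> is a subspace,
    so a vector outside it can be separated from it by a functional.\<close>
  define W where "W = {m \<in> carrier (fmod k A). extends T.F (D m)}"
  have W0: "(\<lambda>_. \<zero>\<^bsub>k\<^esub>) \<in> W"
  proof -
    have z: "(\<lambda>_. \<zero>\<^bsub>k\<^esub>) \<in> carrier (fmod k A)" by (simp add: fmod_carrier)
    have e: "D (\<lambda>_. \<zero>\<^bsub>k\<^esub>) K x = \<zero>\<^bsub>obj T.F K\<^esub>" if "subgroup K G" "x \<in> carrier (obj P K)" for K x
      unfolding D_def using hom_eqI_coset_gen[OF TF hh[OF z] AF.hom_zero[OF TF] _ that(1) ic[OF that]] h1[OF z] by simp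
    have "extends T.F (D (\<lambda>_. \<zero>\<^bsub>k\<^esub>))"
      unfolding extends_def by (rule bexI[OF _ QF.hom_zero[OF TF]]) (simp add: e del: obj_F fmod_simps)
    then show ?thesis using z by (simp add: W_def)
  qed
  have Wadd: "(\<lambda>a. m a \<oplus>\<^bsub>k\<^esub> m' a) \<in> W" if mm: "m \<in> W" "m' \<in> W" for m m'
  proof -
    have c: "m \<in> carrier (fmod k A)" "m' \<in> carrier (fmod k A)" using mm by (auto simp: W_def)
    have s: "(\<lambda>a. m a \<oplus>\<^bsub>k\<^esub> m' a) \<in> carrier (fmod k A)" using FA.add.m_closed[OF c] by simp
    have e: "D (\<lambda>a. m a \<oplus>\<^bsub>k\<^esub> m' a) K x = D m K x \<oplus>\<^bsub>obj T.F K\<^esub> D m' K x"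
      if "subgroup K G" "x \<in> carrier (obj P K)" for K x
      unfolding D_def
      using hom_eqI_coset_gen[OF TF hh[OF s] AF.hom_add[OF TF hh[OF c(1)] hh[OF c(2)]] _ that(1) ic[OF that]]
        h1[OF s] h1[OF c(1)] h1[OF c(2)] by simp
    obtain v v' where v: "v \<in> mackey_hom G k Q T.F" "v' \<in> mackey_hom G k Q T.F"
      "\<forall>K x. subgroup K G \<longrightarrow> x \<in> carrier (obj P K) \<longrightarrow> v K (f K x) = D m K x"
      "\<forall>K x. subgroup K G \<longrightarrow> x \<in> carrier (obj P K) \<longrightarrow> v' K (f K x) = D m' K x"
      using mm unfolding W_def extends_def by blast
    have "extends T.F (D (\<lambda>a. m a \<oplus>\<^bsub>k\<^esub> m' a))"
      unfolding extends_def by (rule bexI[OF _ QF.hom_add[OF TF v(1,2)]]) (simp add: v e del: obj_F fmod_simps)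
    then show ?thesis using s by (simp add: W_def)
  qed
  have Wsm: "(\<lambda>a. r \<otimes>\<^bsub>k\<^esub> m a) \<in> W" if r: "r \<in> carrier k" and mm: "m \<in> W" for r m
  proof -
    have c: "m \<in> carrier (fmod k A)" using mm by (auto simp: W_def)
    have s: "(\<lambda>a. r \<otimes>\<^bsub>k\<^esub> m a) \<in> carrier (fmod k A)" using FA.smult_closed[OF r c] by simp
    have e: "D (\<lambda>a. r \<otimes>\<^bsub>k\<^esub> m a) K x = r \<odot>\<^bsub>obj T.F K\<^esub> D m K x"
      if "subgroup K G" "x \<in> carrier (obj P K)" for K x
      unfolding D_def
      using hom_eqI_coset_gen[OF TF hh[OF s] AF.hom_smult[OF TF r hh[OF c]] _ that(1) ic[OF that]]
        h1[OF s] h1[OF c] by simp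
    obtain v where v: "v \<in> mackey_hom G k Q T.F"
      "\<forall>K x. subgroup K G \<longrightarrow> x \<in> carrier (obj P K) \<longrightarrow> v K (f K x) = D m K x"
      using mm unfolding W_def extends_def by blast
    have "extends T.F (D (\<lambda>a. r \<otimes>\<^bsub>k\<^esub> m a))"
      unfolding extends_def by (rule bexI[OF _ QF.hom_smult[OF TF r v(1)]]) (simp add: v e del: obj_F fmod_simps)
    then show ?thesis using s by (simp add: W_def)
  qed
  \<comment> \<open>The coordinates of \<open>w\<close> composed with \<pi>. Several vectors may
    give the same morphism out of \<open>P\<close>, but \<open>D (co w)\<close> is \<open>w\<close>,
    so \<open>co w\<close> decides whether \<open>w\<close> extends.\<close>
  define co where "co w = (\<lambda>a. if a \<in> A then w (Hf (fst a)) (p (fst a)) (snd a) else \<zero>\<^bsub>k\<^esub>)"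
    for w :: "'a set \<Rightarrow> 'm \<Rightarrow> ('a set \<times> unit \<times> 'a set) set \<Rightarrow> 'k"
  have wc: "w (Hf i) (p i) \<in> carrier (T.FM (Hf i))" if "w \<in> mackey_hom G k P T.F" "i \<in> I" for w i
    using mackey_homD(5)[OF that(1) Hf[OF that(2)] p_in[OF that(2)]] by simp
  have coA: "co w \<in> carrier (fmod k A)" if "w \<in> mackey_hom G k P T.F" for w
    using wc[OF that] by (auto simp: fmod_carrier co_def A_def)
  have coi: "(\<lambda>\<beta>. co w (i, \<beta>)) = w (Hf i) (p i)" if "w \<in> mackey_hom G k P T.F" "i \<in> I" for w i
    using wc[OF that] that(2) by (auto simp: fmod_carrier co_def A_def)
  have Dco: "D (co w) K x = w K x" if "w \<in> mackey_hom G k P T.F" "subgroup K G" "x \<in> carrier (obj P K)" for w K x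
    unfolding D_def by (rule gens_hom_determined[OF TF that(1) coi[OF that(1)] that(2,3)])
  have coW: "co w \<in> W \<longleftrightarrow> extends T.F w" if "w \<in> mackey_hom G k P T.F" for w
    unfolding W_def extends_def using coA[OF that] Dco[OF that] by simp
  show ?case
  proof (rule ccontr)
    assume "\<not> extends (FT H) u"
    then have uW: "co u \<notin> W" using coW[OF u] by simp
    obtain \<phi> where \<phi>: "\<And>a. \<phi> a \<in> carrier k" "\<And>w. w \<in> W \<Longrightarrow> pairing k A \<phi> w = \<zero>\<^bsub>k\<^esub>"
      "pairing k A \<phi> (co u) \<noteq> \<zero>\<^bsub>k\<^esub>"
      using kf.separating_functional[OF finA _ W0 Wadd Wsm coA[OF u] uW] unfolding W_def by blast
    text \<open>Coordinates outside \<open>N\<close> belong to morphisms that factor through \<open>F\<^sub>G\<^sub>/\<^sub>J\<close> with \<open>J\<close> smaller than \<open>H\<close>.\<close>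
    define N where "N = {a \<in> A. \<exists>g\<in>carrier G. conj_subgp G g H \<subseteq> Hf (fst a) \<and>
       snd a = T.pair_orbit (Hf (fst a)) (conj_subgp G g H, coset_act G g bp)}"
    have \<phi>0: "\<phi> a = \<zero>\<^bsub>k\<^esub>" if a: "a \<in> A - N" for a
    proof -
      obtain i \<beta> where i: "a = (i, \<beta>)" "i \<in> I" "\<beta> \<in> T.pair_orbits (Hf i)" using a by (auto simp: A_def)
      obtain L t where b: "(L, t) \<in> T.adm (Hf i)" "\<beta> = T.pair_orbit (Hf i) (L, t)" using i(3) by (auto simp: T.pair_orbits_def)
      note bb = T.admD[OF b(1), simplified]
      obtain g where g: "g \<in> carrier G" "t = coset_act G g bp" using T.orbit[OF bb(3)] by (auto simp: bp_def)
      have st: "T.stab t = conj_subgp G g H" using T.stab_act[OF g(1) bpX] g(2) sbp by simp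
      have Lne: "L \<noteq> conj_subgp G g H"
      proof
        assume "L = conj_subgp G g H"
        then have "a \<in> N" using a i b g bb by (auto simp: N_def)
        then show False using a by simp
      qed
      have ig: "inv g \<in> carrier G" using g by simp
      have LG: "L \<subseteq> carrier G" by (rule sub_carrier[OF bb(1)])
      \<comment> \<open>\<open>(L, t)\<close> with \<open>t = gH\<close> and \<open>L\<close>
        strictly smaller than the stabiliser of \<open>t\<close> is the image of
        \<open>(L, gJ)\<close> under \<open>G/J \<rightarrow> G/H\<close>. As \<open>J\<close> is a
        proper subgroup of \<open>H\<close>, the induction hypothesis applies to it.\<close>
      define J where "J = conj_subgp G (inv g) L"
      have J: "subgroup J G" unfolding J_def by (rule conj_subgroup[OF bb(1) ig])
      have gJ: "conj_subgp G g J = L" unfolding J_def by (rule conj_inv_conj(2)[OF g(1) LG])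
      have JH: "J \<subseteq> H"
        using conj_mono[OF ig conj_subset[OF g(1) sub_carrier[OF H]], of L] bb(4) st
          conj_inv_conj(1)[OF g(1) sub_carrier[OF H]] by (simp add: J_def)
      have "J \<noteq> H" using Lne gJ by auto
      then have card: "card J < card H" using JH finH by (simp add: psubset_card_mono)
      interpret TJ: cosets G k "{()}" "\<lambda>_. J" by (rule transitive[OF J])
      have TJF: "mackey_functor G k TJ.F" by (rule TJ.F_mackey)
      interpret TJF: mackey_functor G k TJ.F by (rule TJF)
      have bJ: "(J, bp) \<in> T.adm J" by (rule T.admI[OF J subset_refl bpX]) (simp add: sbp JH)
      have qc: "\<And>i. i \<in> {()} \<Longrightarrow> T.orbit_vec J (J, bp) \<in> carrier (obj T.F J)" using T.orbit_vec_in[OF bJ] by simp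
      \<comment> \<open>The morphism of Burnside functors induced by the projection
        \<open>G/J \<rightarrow> G/H\<close>.\<close>
      define q where "q = TJ.gens_hom T.F (\<lambda>_. T.orbit_vec J (J, bp))"
      have q: "q \<in> mackey_hom G k TJ.F T.F" unfolding q_def by (rule TJ.gens_hom_hom[OF TF qc])
      define bpJ where "bpJ = TJ.base ()"
      have bpJX: "bpJ \<in> coset_gset G {()} (\<lambda>_. J)" unfolding bpJ_def by (rule TJ.base_in) simp
      have sbpJ: "TJ.stab bpJ = J" unfolding bpJ_def by (rule TJ.stab_base) simp
      have adJ: "(L, coset_act G g bpJ) \<in> TJ.adm (Hf i)"
        by (rule TJ.admI[OF bb(1,2) TJ.act_closed[OF g(1) bpJX]])
          (simp add: TJ.stab_act[OF g(1) bpJX] sbpJ gJ)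
      have ti: "(L, t) \<in> T.adm L" by (rule T.admI[OF bb(1) subset_refl bb(3,4)])
      have "q (Hf i) (TJ.orbit_vec (Hf i) (L, coset_act G g bpJ))
         = ind T.F L (Hf i) (res T.F (conj_subgp G g J) L (cnj T.F g J (T.orbit_vec J (J, bp))))"
        unfolding q_def bpJ_def
        by (rule TJ.gens_hom_bas[OF TF qc Hf[OF i(2)] _ g(1)]) (use adJ in \<open>simp_all add: bpJ_def\<close>)
      also have "cnj T.F g J (T.orbit_vec J (J, bp)) = T.orbit_vec L (L, t)"
        using T.cnj_orbit_lin(2)[OF J g(1) bJ] gJ g(2) by (simp add: T.gact_def)
      also have "res T.F (conj_subgp G g J) L (T.orbit_vec L (L, t)) = T.orbit_vec L (L, t)"
        unfolding gJ using TF.res_id[OF bb(1)] T.orbit_vec_in[OF ti] by simp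
      also have "ind T.F L (Hf i) (T.orbit_vec L (L, t)) = T.orbit_vec (Hf i) (L, t)"
        by (rule T.ind_orbit_lin(2)[OF bb(1) Hf[OF i(2)] bb(2) ti])
      finally have qv: "q (Hf i) (TJ.orbit_vec (Hf i) (L, coset_act G g bpJ)) = T.orbit_vec (Hf i) (L, t)" .
      \<comment> \<open>The lift through \<open>q\<close> of the morphism with the single coordinate
        \<open>a\<close>: it is supported on the generator \<open>i\<close>.\<close>
      define mJ where "mJ j = (if j = i then TJ.orbit_vec (Hf i) (L, coset_act G g bpJ) else \<zero>\<^bsub>obj TJ.F (Hf j)\<^esub>)" for j
      have mJ: "mJ j \<in> carrier (obj TJ.F (Hf j))" if "j \<in> I" for j
      proof -
        interpret Mj: module k "TJ.FM (Hf j)" by (rule TJ.FM_module)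
        show ?thesis using TJ.orbit_vec_in[OF adJ] Mj.zero_closed by (simp add: mJ_def del: fmod_simps)
      qed
      have hJ: "gens_hom TJ.F mJ \<in> mackey_hom G k F TJ.F" by (rule gens_hom_hom[OF TJF mJ])
      have bvA: "unit_vec k a \<in> carrier (fmod k A)" using a by (intro k.unit_vec_in) simp
      have eq: "q K (gens_hom TJ.F mJ K y) = gens_hom T.F (\<lambda>i \<beta>. unit_vec k a (i, \<beta>)) K y"
        if "subgroup K G" "y \<in> carrier (FM K)" for K y
      proof (rule hom_eqI_coset_gen[OF TF mackey_hom_comp[OF hJ q] hh[OF bvA] _ that])
        fix j assume j: "j \<in> I"
        have "q (Hf j) (gens_hom TJ.F mJ (Hf j) (coset_gen j)) = q (Hf j) (mJ j)"
          using gens_hom_coset_gen[OF TJF mJ j] by simp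
        also have "\<dots> = (\<lambda>\<gamma>. unit_vec k a (j, \<gamma>))"
        proof (cases "j = i")
          case True
          then show ?thesis using qv i(1) b(2) by (auto simp: mJ_def T.orbit_vec_def unit_vec_def)
        next
          case False
          then show ?thesis
            using lin_map_zero[OF mackey_homD(1)[OF q Hf[OF j]] TJF.module_obj[OF Hf[OF j]] TF.module_obj[OF Hf[OF j]]] i(1)
            by (auto simp: mJ_def unit_vec_def)
        qed
        also have "\<dots> = gens_hom T.F (\<lambda>i \<beta>. unit_vec k a (i, \<beta>)) (Hf j) (coset_gen j)" by (rule h1[OF bvA j, symmetric])
        finally show "q (Hf j) (gens_hom TJ.F mJ (Hf j) (coset_gen j)) = gens_hom T.F (\<lambda>i \<beta>. unit_vec k a (i, \<beta>)) (Hf j) (coset_gen j)" .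
      qed
      obtain v where v: "v \<in> mackey_hom G k Q TJ.F"
        "\<forall>K x. subgroup K G \<longrightarrow> x \<in> carrier (obj P K) \<longrightarrow> v K (f K x) = gens_hom TJ.F mJ K (\<iota> K x)"
        using less.hyps[OF card J mackey_hom_comp[OF \<iota> hJ]] unfolding extends_def by blast
      have "extends T.F (D (unit_vec k a))"
        unfolding extends_def by (rule bexI[OF _ mackey_hom_comp[OF v(1) q]]) (simp add: v(2) eq ic D_def)
      then have "unit_vec k a \<in> W" using bvA by (simp add: W_def)
      then have "pairing k A \<phi> (unit_vec k a) = \<zero>\<^bsub>k\<^esub>" by (rule \<phi>(2))
      moreover have "pairing k A \<phi> (unit_vec k a) = \<phi> a"
      proof -
        have "pairing k A \<phi> (unit_vec k a) = (\<Oplus>\<^bsub>k\<^esub>b\<in>A. if a = b then \<phi> b else \<zero>\<^bsub>k\<^esub>)"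
          unfolding pairing_def by (rule k.finsum_cong'[OF refl]) (use \<phi>(1) in \<open>auto simp: unit_vec_def\<close>)
        then show ?thesis using k.finsum_singleton[of a A \<phi>] a finA \<phi>(1) by simp
      qed
      ultimately show ?thesis by simp
    qed
    define \<gamma> where "\<gamma> a = (SOME g. g \<in> carrier G \<and> conj_subgp G g H \<subseteq> Hf (fst a) \<and>
       snd a = T.pair_orbit (Hf (fst a)) (conj_subgp G g H, coset_act G g bp))" for a
    have \<gamma>: "\<gamma> a \<in> carrier G" "conj_subgp G (\<gamma> a) H \<subseteq> Hf (fst a)"
       "snd a = T.pair_orbit (Hf (fst a)) (conj_subgp G (\<gamma> a) H, coset_act G (\<gamma> a) bp)" "fst a \<in> I" if "a \<in> N" for a
    proof -
      have "\<exists>g. g \<in> carrier G \<and> conj_subgp G g H \<subseteq> Hf (fst a) \<and>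
       snd a = T.pair_orbit (Hf (fst a)) (conj_subgp G g H, coset_act G g bp)" using that by (auto simp: N_def)
      from someI_ex[OF this] show "\<gamma> a \<in> carrier G" "conj_subgp G (\<gamma> a) H \<subseteq> Hf (fst a)"
       "snd a = T.pair_orbit (Hf (fst a)) (conj_subgp G (\<gamma> a) H, coset_act G (\<gamma> a) bp)" unfolding \<gamma>_def by blast+
      show "fst a \<in> I" using that by (auto simp: N_def A_def)
    qed
    have NA: "N \<subseteq> A" by (auto simp: N_def)
    \<comment> \<open>A coordinate in \<open>N\<close> sits at a point \<open>gH\<close> and at its
      full stabiliser. Restricting \<open>p i\<close> to that stabiliser and conjugating back moves
      all these coordinates to the one at \<open>(H, bp)\<close>.\<close>
    define Z where "Z = (\<Oplus>\<^bsub>obj P H\<^esub>a\<in>N. \<phi> a \<odot>\<^bsub>obj P H\<^esub> cnj P (inv (\<gamma> a)) (conj_subgp G (\<gamma> a) H)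
        (res P (Hf (fst a)) (conj_subgp G (\<gamma> a) H) (p (fst a))))"
    have pre: "\<And>a. a \<in> N \<Longrightarrow> \<phi> a \<in> carrier k \<and> \<gamma> a \<in> carrier G \<and> subgroup (Hf (fst a)) G \<and>
        conj_subgp G (\<gamma> a) H \<subseteq> Hf (fst a) \<and> p (fst a) \<in> carrier (obj P (Hf (fst a)))"
      using \<phi>(1) \<gamma> Hf p_in by auto
    note comb = PF.hom_combination[where A = N and c = \<phi> and g = \<gamma> and K = "\<lambda>a. Hf (fst a)" and s = "\<lambda>a. p (fst a)",
        OF _ _ H pre, folded Z_def]
    have Zc: "Z \<in> carrier (obj P H)" by (rule comb(1)[OF P mackey_hom_id])
    \<comment> \<open>\<open>coef_cnj\<close> and \<open>coef_stab\<close> show that a term of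
      \<open>Z\<close> contributes just the coordinate \<open>a\<close> of \<open>w\<close>;
      coordinates outside \<open>N\<close> do not enter the pairing by
      \<open>\<phi>0\<close>.\<close>
    have coef: "w H Z {(H, bp)} = pairing k A \<phi> (co w)" if w: "w \<in> mackey_hom G k P T.F" for w
    proof -
      let ?C = "\<lambda>a. conj_subgp G (\<gamma> a) H"
      let ?e = "\<lambda>a. cnj T.F (inv (\<gamma> a)) (?C a) (res T.F (Hf (fst a)) (?C a) (w (Hf (fst a)) (p (fst a))))"
      interpret TM: module k "T.FM H" by (rule T.FM_module)
      have e: "?e a \<in> carrier (T.FM H)" "?e a {(H, bp)} = co w a" if a: "a \<in> N" for a
      proof -
        note g = \<gamma>[OF a]
        have C: "subgroup (?C a) G" by (rule conj_subgroup[OF H g(1)])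
        have ig: "inv (\<gamma> a) \<in> carrier G" using g(1) by simp
        have igC: "conj_subgp G (inv (\<gamma> a)) (?C a) = H" by (rule conj_inv_conj(1)[OF g(1) sub_carrier[OF H]])
        define t where "t = coset_act G (\<gamma> a) bp"
        have t: "t \<in> coset_gset G {()} (\<lambda>_. H)" unfolding t_def by (rule T.act_closed[OF g(1) bpX])
        have st: "T.stab t = ?C a" unfolding t_def by (simp add: T.stab_act[OF g(1) bpX] sbp)
        have wi: "w (Hf (fst a)) (p (fst a)) \<in> carrier (T.FM (Hf (fst a)))" by (rule wc[OF w g(4)])
        have r: "res T.F (Hf (fst a)) (?C a) (w (Hf (fst a)) (p (fst a))) \<in> carrier (T.FM (?C a))"
          by (rule lin_mapD(1)[OF T.res_orbit_lin(1)[OF C Hf[OF g(4)] g(2)] wi])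
        have ad: "(?C a, t) \<in> T.adm (?C a)" by (rule T.admI[OF C subset_refl t]) (simp add: st)
        have gt: "T.gact (inv (\<gamma> a)) (?C a, t) = (H, bp)"
          using g(1) bpX igC by (simp add: T.gact_def t_def T.act_mult T.act_one)
        show "?e a \<in> carrier (T.FM H)" using lin_mapD(1)[OF T.cnj_orbit_lin(1)[OF C ig] r] igC by simp
        have "?e a (T.pair_orbit H (H, bp)) = res T.F (Hf (fst a)) (?C a) (w (Hf (fst a)) (p (fst a))) (T.pair_orbit (?C a) (?C a, t))"
          using T.coef_cnj[OF C ig ad r] unfolding igC gt .
        also have "T.pair_orbit (?C a) (?C a, t) = {(?C a, t)}" by (rule T.fixed_cls[OF C t]) (simp add: st)
        also have "res T.F (Hf (fst a)) (?C a) (w (Hf (fst a)) (p (fst a))) {(?C a, t)} =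
            w (Hf (fst a)) (p (fst a)) (T.pair_orbit (Hf (fst a)) (?C a, t))"
          using T.coef_stab[OF t Hf[OF g(4)] _ wi] g(2) unfolding st by blast
        also have "\<dots> = co w a" using g(3) a NA by (auto simp: co_def t_def)
        finally show "?e a {(H, bp)} = co w a" using T.fixed_cls[OF H bpX] by (simp add: sbp)
      qed
      have "w H Z = (\<Oplus>\<^bsub>T.FM H\<^esub>a\<in>N. \<phi> a \<odot>\<^bsub>T.FM H\<^esub> ?e a)" using comb(2)[OF TF w] by simp
      then have "w H Z {(H, bp)} = (\<Oplus>\<^bsub>k\<^esub>a\<in>N. (\<phi> a \<odot>\<^bsub>T.FM H\<^esub> ?e a) {(H, bp)})"
        using k.fmod_finsum_apply[of "\<lambda>a. \<phi> a \<odot>\<^bsub>T.FM H\<^esub> ?e a" N "T.pair_orbits H" "{(H, bp)}"] e(1) \<phi>(1)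
        by (auto intro!: TM.smult_closed simp del: fmod_simps)
      also have "\<dots> = (\<Oplus>\<^bsub>k\<^esub>a\<in>A. \<phi> a \<otimes>\<^bsub>k\<^esub> co w a)"
        by (rule k.add.finprod_mono_neutral_cong_left[OF finA NA])
          (use \<phi>0 \<phi>(1) coA[OF w] e(2) in \<open>auto simp: fmod_carrier\<close>)
      finally show ?thesis by (simp add: pairing_def)
    qed
    have "\<exists>Rp x. primitive_coeffs H Rp x" using primitive_coefficients[OF finG H] by (simp only: primitive_coeffs_def)
    then obtain Rp x where tc: "primitive_coeffs H Rp x" by (elim exE)
    \<comment> \<open>Only the coefficients of the image of \<open>Z\<close> at fixed points are
      under control, so \<open>f\<close> is shown to vanish on \<open>y\<close> and not on
      \<open>Z\<close>.\<close>
    define y where "y = theta G k P Rp x H Z"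
    have y: "y \<in> carrier (obj P H)" unfolding y_def by (rule lin_mapD(1)[OF PF.theta_lin[OF tc H] Zc])
    have fy: "f H y \<in> carrier (obj Q H)" by (rule mackey_homD(5)[OF f H y])
    have BF: "mackey_functor G k B.F" by (rule B.F_mackey)
    define w where "w K x = \<iota>Q K (f K x)" for K x
    have w: "w \<in> mackey_hom G k P B.F" unfolding w_def[abs_def] by (rule mackey_hom_comp[OF f \<iota>Q])
    have "w H Z {(H, s)} = \<zero>\<^bsub>k\<^esub>" if s: "s \<in> X" "H \<subseteq> B.stab s" for s
    proof -
      \<comment> \<open>The transpose at \<open>s\<close> makes the coefficient at
        \<open>(H, s)\<close> a value of the functional. After composition with \<eta> the morphism
        \<open>w\<close> extends along \<open>f\<close> by definition, so this value is
        zero.\<close>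
      obtain \<eta> where \<eta>: "\<eta> \<in> mackey_hom G k B.F T.F" "\<And>z. z \<in> carrier (B.FM H) \<Longrightarrow> \<eta> H z {(H, ((), H))} = z {(H, s)}"
        using B.transpose_exists[OF H s refl] by blast
      have bp': "((), H) = bp" by (simp add: bp_def T.base_def)
      have \<eta>w: "(\<lambda>K x. \<eta> K (w K x)) \<in> mackey_hom G k P T.F" by (rule mackey_hom_comp[OF w \<eta>(1)])
      have "extends T.F (\<lambda>K x. \<eta> K (w K x))"
        unfolding extends_def by (rule bexI[OF _ mackey_hom_comp[OF \<iota>Q \<eta>(1)]]) (simp add: w_def)
      then have "pairing k A \<phi> (co (\<lambda>K x. \<eta> K (w K x))) = \<zero>\<^bsub>k\<^esub>" using coW[OF \<eta>w] \<phi>(2) by blast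
      then have "\<eta> H (w H Z) {(H, bp)} = \<zero>\<^bsub>k\<^esub>" using coef[OF \<eta>w] by simp
      moreover have "w H Z \<in> carrier (B.FM H)" using mackey_homD(5)[OF w H Zc] by simp
      ultimately show ?thesis using \<eta>(2) bp' by metis
    qed
    moreover have "w H Z \<in> carrier (B.FM H)" using mackey_homD(5)[OF w H Zc] by simp
    ultimately have "theta G k B.F Rp x H (w H Z) = \<zero>\<^bsub>B.FM H\<^esub>"
      using B.theta_eq_zero_iff[OF kf.domain_axioms tc H] by blast
    then have "\<iota>Q H (f H y) = \<zero>\<^bsub>obj B.F H\<^esub>"
      using PF.theta_hom[OF tc H BF w Zc] by (simp add: y_def w_def del: fmod_simps)
    then have "f H y = \<zero>\<^bsub>obj Q H\<^esub>" by (rule \<iota>Q_inj[OF H fy])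
    then have "y = \<zero>\<^bsub>obj P H\<^esub>" by (rule f_inj[OF H y])
    then have "u H y = \<zero>\<^bsub>obj T.F H\<^esub>"
      using lin_map_zero[OF mackey_homD(1)[OF u H] PF.module_obj[OF H] TF.module_obj[OF H]] by simp
    then have "theta G k T.F Rp x H (u H Z) = \<zero>\<^bsub>T.FM H\<^esub>"
      using PF.theta_hom[OF tc H TF u Zc] by (simp add: y_def del: fmod_simps)
    moreover have "u H Z \<in> carrier (T.FM H)" using mackey_homD(5)[OF u H Zc] by simp
    \<comment> \<open>The vanishing is pushed forward along \<open>u\<close> and read with the same
      description of the kernel, now in \<open>T.F\<close>; this coefficient is the pairing of
      \<phi> with \<open>co u\<close>.\<close>
    ultimately have "u H Z {(H, bp)} = \<zero>\<^bsub>k\<^esub>"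
      using T.theta_eq_zero_iff[OF kf.domain_axioms tc H] bpX by (simp add: sbp)
    then show False using coef[OF u] \<phi>(3) by simp
  qed
qed

text \<open>The identity of \<open>P\<close> is the sum of the composites of \<iota>, a projection
  \<open>pr i\<close> to \<open>F_{G/Hf i}\<close> and the morphism \<open>\<rho> i\<close> given by
  \<open>p i\<close>. Extending each \<open>pr i\<close> after \<iota> along \<open>f\<close> and
  adding up gives the retraction.\<close>

theorem retraction_exists:
  "\<exists>r\<in>mackey_hom G k Q P. \<forall>K x. subgroup K G \<longrightarrow> x \<in> carrier (obj P K) \<longrightarrow> r K (f K x) = x"
proof -
  interpret PF: mackey_functor G k P by (rule P)
  interpret QF: mackey_functor G k Q by (rule Q)
  interpret AF: mackey_functor G k F by (rule F_mackey)
  \<comment> \<open>\<open>S\<close> collects what is chosen for \<open>i\<close>. Its last clause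
    says on generators that \<open>\<rho> i\<close> after \<open>pr i\<close> is the component of
    \<pi> at \<open>i\<close>.\<close>
  define S where "S i v \<rho> pr \<longleftrightarrow> v \<in> mackey_hom G k Q (FT (Hf i)) \<and> \<rho> \<in> mackey_hom G k (FT (Hf i)) P \<and>
     pr \<in> mackey_hom G k F (FT (Hf i)) \<and>
     (\<forall>K x. subgroup K G \<longrightarrow> x \<in> carrier (obj P K) \<longrightarrow> v K (f K x) = pr K (\<iota> K x)) \<and>
     (\<forall>j\<in>I. \<rho> (Hf j) (pr (Hf j) (coset_gen j)) = (if i = j then p j else \<zero>\<^bsub>obj P (Hf j)\<^esub>))" for i v \<rho> pr
  have ex: "\<exists>v \<rho> pr. S i v \<rho> pr" if i: "i \<in> I" for i
  proof -
    interpret T: cosets G k "{()}" "\<lambda>_. Hf i" by (rule transitive[OF Hf[OF i]])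
    have TF: "mackey_functor G k T.F" by (rule T.F_mackey)
    interpret TF: mackey_functor G k T.F by (rule TF)
    define m where "m j = (if j = i then T.coset_gen () else \<zero>\<^bsub>obj T.F (Hf j)\<^esub>)" for j
    have m: "m j \<in> carrier (obj T.F (Hf j))" if "j \<in> I" for j
    proof -
      interpret Mj: module k "T.FM (Hf j)" by (rule T.FM_module)
      show ?thesis using T.coset_gen_in Mj.zero_closed by (simp add: m_def del: fmod_simps)
    qed
    have pr: "gens_hom T.F m \<in> mackey_hom G k F T.F" by (rule gens_hom_hom[OF TF m])
    have pi: "\<And>j. j \<in> {()} \<Longrightarrow> p i \<in> carrier (obj P (Hf i))" using p_in[OF i] by simp
    have \<rho>: "T.gens_hom P (\<lambda>_. p i) \<in> mackey_hom G k T.F P" by (rule T.gens_hom_hom[OF P pi])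
    have "T.gens_hom P (\<lambda>_. p i) (Hf j) (gens_hom T.F m (Hf j) (coset_gen j)) = (if i = j then p j else \<zero>\<^bsub>obj P (Hf j)\<^esub>)"
      if j: "j \<in> I" and mm: "gens_hom T.F m (Hf j) (coset_gen j) = m j" for j
    proof (cases "j = i")
      case True
      have "T.gens_hom P (\<lambda>_. p i) (Hf i) (T.coset_gen ()) = p i" by (rule T.gens_hom_coset_gen[OF P pi]) simp_all
      moreover have "gens_hom T.F m (Hf j) (coset_gen j) = T.coset_gen ()" using mm True by (simp add: m_def)
      ultimately show ?thesis using True by simp
    next
      case False
      then show ?thesis
        unfolding mm
        using lin_map_zero[OF mackey_homD(1)[OF \<rho> Hf[OF j]] TF.module_obj[OF Hf[OF j]] PF.module_obj[OF Hf[OF j]]]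
        by (simp add: m_def)
    qed
    note 1 = this
    obtain v where v: "v \<in> mackey_hom G k Q T.F"
      "\<forall>K x. subgroup K G \<longrightarrow> x \<in> carrier (obj P K) \<longrightarrow> v K (f K x) = gens_hom T.F m K (\<iota> K x)"
      using extends_transitive[OF Hf[OF i] mackey_hom_comp[OF \<iota> pr]] unfolding extends_def by blast
    have "S i v (T.gens_hom P (\<lambda>_. p i)) (gens_hom T.F m)"
      unfolding S_def by (intro conjI ballI v pr \<rho> 1 gens_hom_coset_gen[OF TF m])
    then show ?thesis by blast
  qed
  obtain v \<rho> pr where vrp: "\<And>i. i \<in> I \<Longrightarrow> v i \<in> mackey_hom G k Q (FT (Hf i))"
    "\<And>i. i \<in> I \<Longrightarrow> \<rho> i \<in> mackey_hom G k (FT (Hf i)) P" "\<And>i. i \<in> I \<Longrightarrow> pr i \<in> mackey_hom G k F (FT (Hf i))"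
    "\<And>i K x. \<lbrakk>i \<in> I; subgroup K G; x \<in> carrier (obj P K)\<rbrakk> \<Longrightarrow> v i K (f K x) = pr i K (\<iota> K x)"
    "\<And>i j. \<lbrakk>i \<in> I; j \<in> I\<rbrakk> \<Longrightarrow> \<rho> i (Hf j) (pr i (Hf j) (coset_gen j)) = (if i = j then p j else \<zero>\<^bsub>obj P (Hf j)\<^esub>)"
  proof -
    have "\<forall>i\<in>I. \<exists>t. S i (fst t) (fst (snd t)) (snd (snd t))"
    proof
      fix i assume "i \<in> I"
      then obtain v \<rho> pr where "S i v \<rho> pr" using ex by blast
      then show "\<exists>t. S i (fst t) (fst (snd t)) (snd (snd t))" by (intro exI[of _ "(v, \<rho>, pr)"]) simp
    qed
    then obtain t where t: "\<forall>i\<in>I. S i (fst (t i)) (fst (snd (t i))) (snd (snd (t i)))" by (drule_tac bchoice) (elim exE)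
    show ?thesis
      by (rule that[of "\<lambda>i. fst (t i)" "\<lambda>i. fst (snd (t i))" "\<lambda>i. snd (snd (t i))"])
        (use t in \<open>simp_all add: S_def\<close>)
  qed
  obtain r where r: "r \<in> mackey_hom G k Q P"
    "\<forall>K y. subgroup K G \<longrightarrow> y \<in> carrier (obj Q K) \<longrightarrow> r K y = (\<Oplus>\<^bsub>obj P K\<^esub>i\<in>I. \<rho> i K (v i K y))"
    using QF.hom_finsum[OF P finI, of "\<lambda>i K y. \<rho> i K (v i K y)"] mackey_hom_comp[OF vrp(1) vrp(2)] by blast
  obtain h where h: "h \<in> mackey_hom G k F P"
    "\<forall>K z. subgroup K G \<longrightarrow> z \<in> carrier (obj F K) \<longrightarrow> h K z = (\<Oplus>\<^bsub>obj P K\<^esub>i\<in>I. \<rho> i K (pr i K z))"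
    using AF.hom_finsum[OF P finI, of "\<lambda>i K y. \<rho> i K (pr i K y)"] mackey_hom_comp[OF vrp(3) vrp(2)] by blast
  \<comment> \<open>On the generator \<open>j\<close> only the summand \<open>i = j\<close> is
    nonzero, so the sum of the components is \<pi>.\<close>
  have hpi: "h K z = \<pi> K z" if "subgroup K G" "z \<in> carrier (FM K)" for K z
  proof (rule hom_eqI_coset_gen[OF P h(1) \<pi> _ that])
    fix j assume j: "j \<in> I"
    interpret Pj: module k "obj P (Hf j)" by (rule PF.module_obj[OF Hf[OF j]])
    have "h (Hf j) (coset_gen j) = (\<Oplus>\<^bsub>obj P (Hf j)\<^esub>i\<in>I. \<rho> i (Hf j) (pr i (Hf j) (coset_gen j)))"
      using h(2) Hf[OF j] coset_gen_in[OF j] by simp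
    also have "\<dots> = (\<Oplus>\<^bsub>obj P (Hf j)\<^esub>i\<in>I. if j = i then p j else \<zero>\<^bsub>obj P (Hf j)\<^esub>)"
      by (rule Pj.M.finsum_cong'[OF refl]) (use vrp(5)[OF _ j] p_in[OF j] in auto)
    also have "\<dots> = p j" using Pj.M.finsum_singleton[OF j finI, of "\<lambda>_. p j"] p_in[OF j] by simp
    finally show "h (Hf j) (coset_gen j) = \<pi> (Hf j) (coset_gen j)" by (simp add: p_def)
  qed
  have "r K (f K x) = x" if K: "subgroup K G" "x \<in> carrier (obj P K)" for K x
  proof -
    interpret PK: module k "obj P K" by (rule PF.module_obj[OF K(1)])
    have ic: "\<iota> K x \<in> carrier (obj F K)" by (rule mackey_homD(5)[OF \<iota> K])
    have "r K (f K x) = (\<Oplus>\<^bsub>obj P K\<^esub>i\<in>I. \<rho> i K (v i K (f K x)))" using r(2) K mackey_homD(5)[OF f K] by blast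
    also have "\<dots> = (\<Oplus>\<^bsub>obj P K\<^esub>i\<in>I. \<rho> i K (pr i K (\<iota> K x)))"
      by (rule PK.M.finsum_cong'[OF refl])
        (use vrp(4)[OF _ K] mackey_homD(5)[OF vrp(2) K(1) mackey_homD(5)[OF vrp(3) K(1) ic]] in auto)
    also have "\<dots> = h K (\<iota> K x)" using h(2) K(1) ic by simp
    also have "\<dots> = x" using hpi[OF K(1)] ic \<pi>\<iota>[OF K] by simp
    finally show ?thesis .
  qed
  then show ?thesis using r(1) by blast
qed

end

section \<open>Projective Mackey functors\<close>

text \<open>Transport of structure along an injection \<open>E\<close> with left inverse
  \<open>D\<close>. \<open>projective\<close> tests functors over one fixed type of elements; a
  functor over another type is copied there first.\<close>

definition tobj :: "('k, 'm) module \<Rightarrow> ('m \<Rightarrow> 'n) \<Rightarrow> ('n \<Rightarrow> 'm) \<Rightarrow> ('k, 'n) module" where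
  "tobj A E D = \<lparr>carrier = E ` carrier A, mult = undefined, one = undefined, zero = E \<zero>\<^bsub>A\<^esub>,
     add = (\<lambda>a b. E (D a \<oplus>\<^bsub>A\<^esub> D b)), smult = (\<lambda>r a. E (r \<odot>\<^bsub>A\<^esub> D a))\<rparr>"

definition transport :: "('g, 'k, 'm) mackey \<Rightarrow> ('m \<Rightarrow> 'n) \<Rightarrow> ('n \<Rightarrow> 'm) \<Rightarrow> ('g, 'k, 'n) mackey" where
  "transport M E D = \<lparr>obj = (\<lambda>H. tobj (obj M H) E D), ind = (\<lambda>K H a. E (ind M K H (D a))),
     res = (\<lambda>H K a. E (res M H K (D a))), cnj = (\<lambda>g H a. E (cnj M g H (D a)))\<rparr>"

lemma transport_simps [simp]:
  "obj (transport M E D) H = tobj (obj M H) E D" "ind (transport M E D) K H a = E (ind M K H (D a))"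
  "res (transport M E D) H K a = E (res M H K (D a))" "cnj (transport M E D) g H a = E (cnj M g H (D a))"
  by (simp_all add: transport_def)

lemma tobj_simps [simp]:
  "carrier (tobj A E D) = E ` carrier A" "zero (tobj A E D) = E \<zero>\<^bsub>A\<^esub>"
  "add (tobj A E D) a b = E (D a \<oplus>\<^bsub>A\<^esub> D b)" "smult (tobj A E D) r a = E (r \<odot>\<^bsub>A\<^esub> D a)"
  by (simp_all add: tobj_def)

lemma tobj_module:
  assumes "module R A" and DE: "\<And>a. a \<in> carrier A \<Longrightarrow> D (E a) = a"
  shows "module R (tobj A E D)"
proof -
  interpret A: module R A by fact
  show ?thesis
  proof (rule moduleI)
    show "abelian_group (tobj A E D)"
    proof (rule abelian_groupI)
      fix x assume "x \<in> carrier (tobj A E D)"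
      then obtain a where a: "a \<in> carrier A" "x = E a" by auto
      then show "\<exists>y\<in>carrier (tobj A E D). y \<oplus>\<^bsub>tobj A E D\<^esub> x = \<zero>\<^bsub>tobj A E D\<^esub>"
        by (intro bexI[of _ "E (\<ominus>\<^bsub>A\<^esub> a)"]) (auto simp: DE A.l_neg)
    qed (auto simp: DE A.M.a_ac)
  qed (auto simp: DE A.R.is_cring A.smult_l_distr A.smult_r_distr A.smult_assoc1)
qed

lemma transport_lin:
  assumes "f \<in> lin_map R A B" "module R A" "module R B"
    and "\<And>a. a \<in> carrier A \<Longrightarrow> D (E a) = a" "\<And>b. b \<in> carrier B \<Longrightarrow> D' (E' b) = b"
  shows "(\<lambda>x. E' (f (D x))) \<in> lin_map R (tobj A E D) (tobj B E' D')"
proof -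
  interpret A: module R A by fact
  interpret B: module R B by fact
  show ?thesis
    by (rule lin_mapI) (auto simp: assms(4,5) lin_mapD[OF assms(1)])
qed

context mackey_functor begin

context
  fixes E :: "'m \<Rightarrow> 'n" and D :: "'n \<Rightarrow> 'm"
  assumes DE: "\<And>H a. subgroup H G \<Longrightarrow> a \<in> carrier (obj M H) \<Longrightarrow> D (E a) = a"
begin

lemma transport_E: "subgroup H G \<Longrightarrow> E \<in> lin_map R (obj M H) (tobj (obj M H) E D)"
  by (rule lin_mapI) (auto simp: DE)

lemma transport_D: "subgroup H G \<Longrightarrow> D \<in> lin_map R (tobj (obj M H) E D) (obj M H)"
proof -
  assume H: "subgroup H G"
  interpret MH: module R "obj M H" by (rule module_obj[OF H])
  show ?thesis by (rule lin_mapI) (auto simp: DE[OF H])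
qed

lemma transport_mackey: "mackey_functor G R (transport M E D)"
proof (intro mackey_functor.intro mackey_functor_axioms.intro is_group R.is_cring fin)
  note cl = lin_mapD(1)[OF ind_lin] lin_mapD(1)[OF res_lin] lin_mapD(1)[OF cnj_lin]
  show "module R (obj (transport M E D) H)" if "subgroup H G" for H
    unfolding transport_simps by (rule tobj_module[where D = D and E = E, OF module_obj[OF that] DE[OF that]])
  show "ind (transport M E D) K H \<in> lin_map R (obj (transport M E D) K) (obj (transport M E D) H)"
    if "subgroup K G" "subgroup H G" "K \<subseteq> H" for K H
    using transport_lin[where D = D and E = E and D' = D and E' = E, OF ind_lin[OF that] module_obj[OF that(1)] module_obj[OF that(2)] DE[OF that(1)] DE[OF that(2)]]
    by (simp add: transport_def)
  show "res (transport M E D) H K \<in> lin_map R (obj (transport M E D) H) (obj (transport M E D) K)"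
    if "subgroup K G" "subgroup H G" "K \<subseteq> H" for K H
    using transport_lin[where D = D and E = E and D' = D and E' = E, OF res_lin[OF that] module_obj[OF that(2)] module_obj[OF that(1)] DE[OF that(2)] DE[OF that(1)]]
    by (simp add: transport_def)
  show "cnj (transport M E D) g H \<in> lin_map R (obj (transport M E D) H) (obj (transport M E D) (conj_subgp G g H))"
    if "subgroup H G" "g \<in> carrier G" for g H
    using transport_lin[where D = D and E = E and D' = D and E' = E, OF cnj_lin[OF that] module_obj[OF that(1)] module_obj[OF conj_subgroup[OF that]]
        DE[OF that(1)] DE[OF conj_subgroup[OF that]]]
    by (simp add: transport_def)
  show "ind (transport M E D) H H a = a" if "subgroup H G" "a \<in> carrier (obj (transport M E D) H)" for H a
    using that by (auto simp: DE ind_id)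
  show "res (transport M E D) H H a = a" if "subgroup H G" "a \<in> carrier (obj (transport M E D) H)" for H a
    using that by (auto simp: DE res_id)
  show "cnj (transport M E D) h H a = a" if "subgroup H G" "h \<in> H" "a \<in> carrier (obj (transport M E D) H)" for H h a
    using that by (auto simp: DE cnj_id)
  show "ind (transport M E D) K H (ind (transport M E D) J K a) = ind (transport M E D) J H a"
    if "subgroup J G" "subgroup K G" "subgroup H G" "J \<subseteq> K" "K \<subseteq> H" "a \<in> carrier (obj (transport M E D) J)" for J K H a
    using that by (auto simp: DE[OF that(1)] DE[OF that(2)] cl ind_trans)
  show "res (transport M E D) K J (res (transport M E D) H K a) = res (transport M E D) H J a"
    if "subgroup J G" "subgroup K G" "subgroup H G" "J \<subseteq> K" "K \<subseteq> H" "a \<in> carrier (obj (transport M E D) H)" for J K H a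
    using that by (auto simp: DE[OF that(3)] DE[OF that(2)] cl res_trans)
  show "cnj (transport M E D) g (conj_subgp G h H) (cnj (transport M E D) h H a) = cnj (transport M E D) (g \<otimes> h) H a"
    if "subgroup H G" "g \<in> carrier G" "h \<in> carrier G" "a \<in> carrier (obj (transport M E D) H)" for H g h a
    using that by (auto simp: DE[OF that(1)] DE[OF conj_subgroup[OF that(1,3)]] cl cnj_cnj)
  show "cnj (transport M E D) g H (ind (transport M E D) K H a) =
      ind (transport M E D) (conj_subgp G g K) (conj_subgp G g H) (cnj (transport M E D) g K a)"
    if "subgroup K G" "subgroup H G" "K \<subseteq> H" "g \<in> carrier G" "a \<in> carrier (obj (transport M E D) K)" for K H g a
    using that by (auto simp: DE[OF that(1)] DE[OF that(2)] DE[OF conj_subgroup[OF that(1,4)]] cl cnj_ind)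
  show "cnj (transport M E D) g K (res (transport M E D) H K a) =
      res (transport M E D) (conj_subgp G g H) (conj_subgp G g K) (cnj (transport M E D) g H a)"
    if "subgroup K G" "subgroup H G" "K \<subseteq> H" "g \<in> carrier G" "a \<in> carrier (obj (transport M E D) H)" for K H g a
    using that by (auto simp: DE[OF that(1)] DE[OF that(2)] DE[OF conj_subgroup[OF that(2,4)]] cl cnj_res)
  fix J K H T a assume *: "subgroup J G" "subgroup K G" "subgroup H G" "J \<subseteq> H" "K \<subseteq> H"
    "T \<in> dcoset_reps G J H K" "a \<in> carrier (obj (transport M E D) K)"
  let ?I = "\<lambda>x. conj_subgp G (inv x) J \<inter> K" and ?J = "\<lambda>x. J \<inter> conj_subgp G x K"
  interpret TJ: module R "tobj (obj M J) E D" by (rule tobj_module[where D = D and E = E, OF module_obj[OF *(1)] DE[OF *(1)]])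
  obtain b where b: "b \<in> carrier (obj M K)" "a = E b" using *(7) by auto
  have term_: "E (ind M (?J x) J (cnj M x (?I x) (res M K (?I x) b))) =
     ind (transport M E D) (?J x) J (cnj (transport M E D) x (?I x) (res (transport M E D) K (?I x) a))"
    and tcl: "ind M (?J x) J (cnj M x (?I x) (res M K (?I x) b)) \<in> carrier (obj M J)" if "x \<in> T" for x
  proof -
    have x: "x \<in> carrier G" using dcoset_repsD(1)[OF *(6,1-5)] that subgroup.mem_carrier[OF *(3)] by auto
    have Is: "subgroup (?I x) G" using * x by (simp add: subgroups_Inter_pair conj_subgroup)
    have Js: "subgroup (?J x) G" using * x by (simp add: subgroups_Inter_pair conj_subgroup)
    have IJ: "conj_subgp G x (?I x) = ?J x"
      using * x by (simp add: conj_Int conj_subset subgroup.subset conj_inv_conj)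
    have r: "res M K (?I x) b \<in> carrier (obj M (?I x))"
      by (rule lin_mapD(1)[OF res_lin[OF Is *(2) Int_lower2] b(1)])
    have c: "cnj M x (?I x) (res M K (?I x) b) \<in> carrier (obj M (?J x))"
      using lin_mapD(1)[OF cnj_lin[OF Is x] r] IJ by simp
    show "E (ind M (?J x) J (cnj M x (?I x) (res M K (?I x) b))) =
     ind (transport M E D) (?J x) J (cnj (transport M E D) x (?I x) (res (transport M E D) K (?I x) a))"
      using DE[OF *(2) b(1)] DE[OF Is r] DE[OF Js c] b(2) by simp
    show "ind M (?J x) J (cnj M x (?I x) (res M K (?I x) b)) \<in> carrier (obj M J)"
      by (rule lin_mapD(1)[OF ind_lin[OF Js *(1) Int_lower1] c])
  qed
  have i: "ind M K H b \<in> carrier (obj M H)" by (rule lin_mapD(1)[OF ind_lin[OF *(2,3,5)] b(1)])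
  have "res (transport M E D) H J (ind (transport M E D) K H a) = E (res M H J (ind M K H b))"
    using DE[OF *(2) b(1)] DE[OF *(3) i] b(2) by simp
  also have "\<dots> = E (\<Oplus>\<^bsub>obj M J\<^esub>x\<in>T. ind M (?J x) J (cnj M x (?I x) (res M K (?I x) b)))"
    unfolding mackey_formula[OF *(1-6) b(1)] ..
  also have "\<dots> = (\<Oplus>\<^bsub>tobj (obj M J) E D\<^esub>x\<in>T. E (ind M (?J x) J (cnj M x (?I x) (res M K (?I x) b))))"
    by (rule lin_map_finsum[OF transport_E[OF *(1)] module_obj[OF *(1)] TJ.module_axioms]) (use tcl in auto)
  also have "\<dots> = (\<Oplus>\<^bsub>tobj (obj M J) E D\<^esub>x\<in>T.
      ind (transport M E D) (?J x) J (cnj (transport M E D) x (?I x) (res (transport M E D) K (?I x) a)))"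
    by (rule TJ.M.finsum_cong'[OF refl]) (use tcl in \<open>auto simp only: term_[symmetric] tobj_simps Pi_iff intro!: imageI\<close>)
  finally show "res (transport M E D) H J (ind (transport M E D) K H a) = (\<Oplus>\<^bsub>obj (transport M E D) J\<^esub>x\<in>T.
      ind (transport M E D) (?J x) J (cnj (transport M E D) x (?I x) (res (transport M E D) K (?I x) a)))"
    by simp
qed

lemma transport_hom_E: "(\<lambda>H. E) \<in> mackey_hom G R M (transport M E D)"
  by (rule mackey_homI) (auto simp: DE intro: transport_E)

lemma transport_hom_D: "(\<lambda>H. D) \<in> mackey_hom G R (transport M E D) M"
proof (rule mackey_homI)
  note cl = lin_mapD(1)[OF ind_lin] lin_mapD(1)[OF res_lin] lin_mapD(1)[OF cnj_lin]
  show "D \<in> lin_map R (obj (transport M E D) H) (obj M H)" if "subgroup H G" for H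
    using transport_D[OF that] by simp
  show "D (ind (transport M E D) K H a) = ind M K H (D a)"
    if "subgroup K G" "subgroup H G" "K \<subseteq> H" "a \<in> carrier (obj (transport M E D) K)" for K H a
    using that by (auto simp: DE[OF that(1)] DE[OF that(2)] cl)
  show "D (res (transport M E D) H K a) = res M H K (D a)"
    if "subgroup K G" "subgroup H G" "K \<subseteq> H" "a \<in> carrier (obj (transport M E D) H)" for K H a
    using that by (auto simp: DE[OF that(1)] DE[OF that(2)] cl)
  show "D (cnj (transport M E D) g H a) = cnj M g H (D a)"
    if "g \<in> carrier G" "subgroup H G" "a \<in> carrier (obj (transport M E D) H)" for g H a
    using that by (auto simp: DE[OF that(2)] DE[OF conj_subgroup[OF that(2,1)]] cl)
qed

end

end

text \<open>Lifting against functors over other types: copy \<open>N\<close> and \<open>L\<close>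
  into the test type, lift there and decode. Left inverses on the values at subgroups are enough for
  this.\<close>

lemma projective_lift:
  fixes P :: "('g, 'k, 'm) mackey" and N :: "('g, 'k, 'n) mackey" and L :: "('g, 'k, 'l) mackey"
    and EN :: "'n \<Rightarrow> 'm \<times> nat \<Rightarrow> 'k" and EL :: "'l \<Rightarrow> 'm \<times> nat \<Rightarrow> 'k"
  assumes proj: "projective G R P" and N: "mackey_functor G R N" and L: "mackey_functor G R L"
    and e: "e \<in> mackey_epi G R N L" and h: "h \<in> mackey_hom G R P L"
    and DN: "\<And>H a. subgroup H G \<Longrightarrow> a \<in> carrier (obj N H) \<Longrightarrow> DN (EN a) = a"
    and DL: "\<And>H a. subgroup H G \<Longrightarrow> a \<in> carrier (obj L H) \<Longrightarrow> DL (EL a) = a"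
  shows "\<exists>l\<in>mackey_hom G R P N. \<forall>H. subgroup H G \<longrightarrow> (\<forall>x\<in>carrier (obj P H). e H (l H x) = h H x)"
proof -
  interpret N: mackey_functor G R N by fact
  interpret L: mackey_functor G R L by fact
  let ?N = "transport N EN DN" and ?L = "transport L EL DL"
  have eh: "e \<in> mackey_hom G R N L" and es: "\<And>H. subgroup H G \<Longrightarrow> e H ` carrier (obj N H) = carrier (obj L H)"
    using e by (auto simp: mackey_epi_def)
  define e' where "e' H a = EL (e H (DN a))" for H a
  have e'h: "e' \<in> mackey_hom G R ?N ?L"
    using mackey_hom_comp[OF mackey_hom_comp[OF N.transport_hom_D[where E = EN and D = DN, OF DN] eh]
        L.transport_hom_E[where E = EL and D = DL, OF DL]]
    by (simp add: e'_def[abs_def])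
  have e's: "e' H ` carrier (obj ?N H) = carrier (obj ?L H)" if "subgroup H G" for H
  proof -
    have "e' H ` carrier (obj ?N H) = EL ` e H ` carrier (obj N H)"
      unfolding image_image transport_simps tobj_simps by (rule image_cong) (simp_all add: e'_def DN[OF that])
    then show ?thesis using es[OF that] by simp
  qed
  have h': "(\<lambda>H x. EL (h H x)) \<in> mackey_hom G R P ?L"
    by (rule mackey_hom_comp[OF h L.transport_hom_E[where E = EL and D = DL, OF DL]])
  have "e' \<in> mackey_epi G R ?N ?L" using e'h e's by (simp add: mackey_epi_def)
  moreover have "mackey_functor G R ?N" "mackey_functor G R ?L"
    using N.transport_mackey[where E = EN and D = DN, OF DN] L.transport_mackey[where E = EL and D = DL, OF DL] by simp_all
  ultimately obtain l' where l': "l' \<in> mackey_hom G R P ?N"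
    "\<forall>H. subgroup H G \<longrightarrow> (\<forall>x\<in>carrier (obj P H). e' H (l' H x) = EL (h H x))"
    using proj[unfolded projective_def, rule_format, of ?N ?L e' "\<lambda>H x. EL (h H x)"] h' by blast
  have l: "(\<lambda>H x. DN (l' H x)) \<in> mackey_hom G R P N"
    by (rule mackey_hom_comp[OF l'(1) N.transport_hom_D[where E = EN and D = DN, OF DN]])
  have "e H (DN (l' H x)) = h H x" if H: "subgroup H G" and x: "x \<in> carrier (obj P H)" for H x
  proof -
    have a: "e H (DN (l' H x)) \<in> carrier (obj L H)" by (rule mackey_homD(5)[OF eh H mackey_homD(5)[OF l H x]])
    have "EL (e H (DN (l' H x))) = EL (h H x)" using l'(2) H x by (simp add: e'_def)
    then have "DL (EL (e H (DN (l' H x)))) = DL (EL (h H x))" by simp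
    then show ?thesis using DL[OF H a] DL[OF H mackey_homD(5)[OF h H x]] by simp
  qed
  then show ?thesis by (intro bexI[OF _ l]) simp
qed

text \<open>An element becomes the indicator of its fibre under the first projection, which is
  injective as soon as one differs from zero; thus \<open>P\<close> itself fits into the test
  type.\<close>

definition enc :: "('k, 'r) ring_scheme \<Rightarrow> 'm \<Rightarrow> 'm \<times> nat \<Rightarrow> 'k" where
  "enc R a = (\<lambda>(m, n). if m = a then \<one>\<^bsub>R\<^esub> else \<zero>\<^bsub>R\<^esub>)"

lemma (in "domain") inv_enc: "inv_into UNIV (enc R) (enc R a) = (a :: 'm)"
proof -
  have "inj (enc R :: 'm \<Rightarrow> 'm \<times> nat \<Rightarrow> 'a)"
  proof (rule injI)
    fix a b :: 'm assume "enc R a = enc R b"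
    then have "enc R a (b, 0) = enc R b (b, 0)" by simp
    then show "a = b" by (auto simp: enc_def split: if_splits)
  qed
  then show ?thesis by simp
qed

text \<open>Only finitely many orbits of pairs occur over all subgroups, so a vector is stored in
  the \<open>nat\<close> coordinate alone and is read off at an arbitrary first coordinate.\<close>

lemma (in burnside) F_encode:
  "\<exists>(EN :: (('a set \<times> 't) set \<Rightarrow> 'k) \<Rightarrow> 'm \<times> nat \<Rightarrow> 'k) DN.
     \<forall>H a. subgroup H G \<longrightarrow> a \<in> carrier (obj F H) \<longrightarrow> DN (EN a) = a"
proof -
  define U where "U = (\<Union>K\<in>{K. subgroup K G \<and> True}. pair_orbits K)"
  have "finite U" unfolding U_def using finite_subgroups[OF finG, of "\<lambda>_. True"] finite_pair_orbits by auto
  then obtain c :: "('a set \<times> 't) set \<Rightarrow> nat" where c: "inj_on c U" using finite_imp_inj_to_nat_seg by blast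
  define EN :: "(('a set \<times> 't) set \<Rightarrow> 'k) \<Rightarrow> 'm \<times> nat \<Rightarrow> 'k" where "EN a = (\<lambda>(m, n). a (inv_into U c n))" for a
  define DN :: "('m \<times> nat \<Rightarrow> 'k) \<Rightarrow> ('a set \<times> 't) set \<Rightarrow> 'k"
    where "DN b = (\<lambda>\<beta>. if \<beta> \<in> U then b (undefined, c \<beta>) else \<zero>\<^bsub>k\<^esub>)" for b
  have "DN (EN a) = a" if "subgroup H G" "a \<in> carrier (obj F H)" for H a
  proof
    fix \<beta>
    have "\<beta> \<notin> U \<Longrightarrow> a \<beta> = \<zero>\<^bsub>k\<^esub>" using that by (auto simp: U_def fmod_carrier)
    then show "DN (EN a) \<beta> = a \<beta>" by (auto simp: DN_def EN_def inv_into_f_f[OF c])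
  qed
  then show ?thesis by blast
qed

section \<open>Images and kernels, and presentations of projective functors\<close>

lemma lin_image_submodule:
  assumes "f \<in> lin_map R A B" "module R A" "module R B"
  shows "submodule (f ` carrier A) R B"
proof -
  interpret A: module R A by fact
  interpret B: module R B by fact
  note f = lin_mapD[OF assms(1)]
  show ?thesis
  proof (rule B.submoduleI)
    show "\<zero>\<^bsub>B\<^esub> \<in> f ` carrier A" using lin_map_zero[OF assms] by (metis A.M.zero_closed imageI)
    fix a assume "a \<in> f ` carrier A"
    then obtain x where x: "x \<in> carrier A" "a = f x" by auto
    have "f (\<ominus>\<^bsub>A\<^esub> x) \<oplus>\<^bsub>B\<^esub> f x = \<zero>\<^bsub>B\<^esub>"
      using f(2)[of "\<ominus>\<^bsub>A\<^esub> x" x] x lin_map_zero[OF assms] by (simp add: A.l_neg)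
    then have "\<ominus>\<^bsub>B\<^esub> a = f (\<ominus>\<^bsub>A\<^esub> x)" using B.M.minus_equality[of "f (\<ominus>\<^bsub>A\<^esub> x)" a] f(1) x by simp
    then show "\<ominus>\<^bsub>B\<^esub> a \<in> f ` carrier A" using x by simp
  next
    fix a b assume "a \<in> f ` carrier A" "b \<in> f ` carrier A"
    then show "a \<oplus>\<^bsub>B\<^esub> b \<in> f ` carrier A" using f(2) by (auto simp: image_iff) (metis A.M.a_closed)
  next
    fix r b assume "r \<in> carrier R" "b \<in> f ` carrier A"
    then show "r \<odot>\<^bsub>B\<^esub> b \<in> f ` carrier A" using f(3) by (auto simp: image_iff) (metis A.smult_closed)
  qed (use f(1) in auto)
qed

lemma lin_kernel_submodule:
  assumes "f \<in> lin_map R A B" "module R A" "module R B"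
  shows "submodule {x \<in> carrier A. f x = \<zero>\<^bsub>B\<^esub>} R A"
proof -
  interpret A: module R A by fact
  interpret B: module R B by fact
  note f = lin_mapD[OF assms(1)]
  show ?thesis
  proof (rule A.submoduleI)
    fix x assume x: "x \<in> {x \<in> carrier A. f x = \<zero>\<^bsub>B\<^esub>}"
    then have "f (\<ominus>\<^bsub>A\<^esub> x) \<oplus>\<^bsub>B\<^esub> f x = \<zero>\<^bsub>B\<^esub>"
      using f(2)[of "\<ominus>\<^bsub>A\<^esub> x" x] lin_map_zero[OF assms] by (simp add: A.l_neg)
    then show "\<ominus>\<^bsub>A\<^esub> x \<in> {x \<in> carrier A. f x = \<zero>\<^bsub>B\<^esub>}" using x f(1) by simp
  qed (use f lin_map_zero[OF assms] in auto)
qed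

lemma subfunctor_image:
  assumes "mackey_functor G R M" "mackey_functor G R N" "f \<in> mackey_hom G R M N"
  shows "subfunctor G R N (\<lambda>H. f H ` carrier (obj M H))"
proof -
  interpret M: mackey_functor G R M by fact
  interpret N: mackey_functor G R N by fact
  note f = mackey_homD[OF assms(3)]
  show ?thesis
    unfolding subfunctor_def
  proof (intro conjI allI impI)
    fix H assume H: "subgroup H G"
    show "submodule (f H ` carrier (obj M H)) R (obj N H)"
      by (rule lin_image_submodule[OF f(1)[OF H] M.module_obj[OF H] N.module_obj[OF H]])
  next
    fix K H assume *: "subgroup K G \<and> subgroup H G \<and> K \<subseteq> H"
    show "ind N K H ` f K ` carrier (obj M K) \<subseteq> f H ` carrier (obj M H)"
      using * f(2) lin_mapD(1)[OF M.ind_lin] by (auto simp: image_iff) metis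
    show "res N H K ` f H ` carrier (obj M H) \<subseteq> f K ` carrier (obj M K)"
      using * f(3) lin_mapD(1)[OF M.res_lin] by (auto simp: image_iff) metis
  next
    fix g H assume *: "g \<in> carrier G \<and> subgroup H G"
    show "cnj N g H ` f H ` carrier (obj M H) \<subseteq> f (conj_subgp G g H) ` carrier (obj M (conj_subgp G g H))"
      using * f(4) lin_mapD(1)[OF M.cnj_lin] by (auto simp: image_iff) metis
  qed
qed

lemma subfunctor_kernel:
  assumes "mackey_functor G R M" "mackey_functor G R N" "f \<in> mackey_hom G R M N"
  shows "subfunctor G R M (\<lambda>H. {x \<in> carrier (obj M H). f H x = \<zero>\<^bsub>obj N H\<^esub>})"
proof -
  interpret M: mackey_functor G R M by fact
  interpret N: mackey_functor G R N by fact
  note f = mackey_homD[OF assms(3)]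
  note z = lin_map_zero[OF N.ind_lin N.module_obj N.module_obj] lin_map_zero[OF N.res_lin N.module_obj N.module_obj]
     lin_map_zero[OF N.cnj_lin N.module_obj N.module_obj]
  show ?thesis
    unfolding subfunctor_def
  proof (intro conjI allI impI)
    fix H assume H: "subgroup H G"
    show "submodule {x \<in> carrier (obj M H). f H x = \<zero>\<^bsub>obj N H\<^esub>} R (obj M H)"
      by (rule lin_kernel_submodule[OF f(1)[OF H] M.module_obj[OF H] N.module_obj[OF H]])
  next
    fix K H assume *: "subgroup K G \<and> subgroup H G \<and> K \<subseteq> H"
    show "ind M K H ` {x \<in> carrier (obj M K). f K x = \<zero>\<^bsub>obj N K\<^esub>} \<subseteq> {x \<in> carrier (obj M H). f H x = \<zero>\<^bsub>obj N H\<^esub>}"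
      using * f(2) lin_mapD(1)[OF M.ind_lin] z by auto
    show "res M H K ` {x \<in> carrier (obj M H). f H x = \<zero>\<^bsub>obj N H\<^esub>} \<subseteq> {x \<in> carrier (obj M K). f K x = \<zero>\<^bsub>obj N K\<^esub>}"
      using * f(3) lin_mapD(1)[OF M.res_lin] z by auto
  next
    fix g H assume *: "g \<in> carrier G \<and> subgroup H G"
    show "cnj M g H ` {x \<in> carrier (obj M H). f H x = \<zero>\<^bsub>obj N H\<^esub>} \<subseteq>
        {x \<in> carrier (obj M (conj_subgp G g H)). f (conj_subgp G g H) x = \<zero>\<^bsub>obj N (conj_subgp G g H)\<^esub>}"
      using * f(4) lin_mapD(1)[OF M.cnj_lin] z M.conj_subgroup by auto
  qed
qed

text \<open>The finite set of generators serves as its own index set: \<open>(H, x)\<close>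
  contributes an orbit \<open>G/H\<close> whose generator goes to \<open>x\<close>. The image is a
  subfunctor containing all generators, so the map is onto, and \<iota> is a lift of the
  identity.\<close>

lemma projective_presentation:
  fixes P :: "('g, 'k, 'm) mackey"
  assumes fieldk: "field k" and P: "mackey_functor G k P" and fg: "fin_gen G k P" and proj: "projective G k P"
  shows "\<exists>S :: ('g set \<times> 'm) set. cosets G k S fst \<and>
    (\<exists>\<pi>\<in>mackey_hom G k (burnside.F G k (coset_gset G S fst) (coset_act G)) P.
     \<exists>\<iota>\<in>mackey_hom G k P (burnside.F G k (coset_gset G S fst) (coset_act G)).
     \<forall>K x. subgroup K G \<longrightarrow> x \<in> carrier (obj P K) \<longrightarrow> \<pi> K (\<iota> K x) = x)"
proof -
  interpret kf: field k by fact
  interpret P: mackey_functor G k P by fact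
  obtain S where S: "finite S" "\<forall>(H, x)\<in>S. subgroup H G \<and> x \<in> carrier (obj P H)"
    "\<forall>N. subfunctor G k P N \<and> (\<forall>(H, x)\<in>S. x \<in> N H) \<longrightarrow> (\<forall>H. subgroup H G \<longrightarrow> N H = carrier (obj P H))"
    using fg unfolding fin_gen_def by blast
  have cos: "cosets G k S fst"
    by (intro cosets.intro cosets_axioms.intro P.is_group kf.is_cring P.fin S(1)) (use S(2) in auto)
  interpret A: cosets G k S fst by (rule cos)
  have m: "\<And>i. i \<in> S \<Longrightarrow> snd i \<in> carrier (obj P (fst i))" using S(2) by auto
  have \<pi>: "A.gens_hom P snd \<in> mackey_hom G k A.F P" by (rule A.gens_hom_hom[OF P m])
  define N where "N H = A.gens_hom P snd H ` carrier (obj A.F H)" for H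
  have "subfunctor G k P N"
    unfolding N_def[abs_def] by (rule subfunctor_image[OF A.F_mackey P \<pi>])
  moreover have "\<forall>(H, x)\<in>S. x \<in> N H"
  proof clarify
    fix H x assume i: "(H, x) \<in> S"
    have "A.gens_hom P snd H (A.coset_gen (H, x)) = x" using A.gens_hom_coset_gen[OF P m i] by simp
    moreover have "A.coset_gen (H, x) \<in> carrier (obj A.F H)" using A.coset_gen_in[OF i] by simp
    ultimately show "x \<in> N H" unfolding N_def by (metis imageI)
  qed
  ultimately have "\<forall>H. subgroup H G \<longrightarrow> N H = carrier (obj P H)" using S(3)[rule_format, of N] by blast
  then have epi: "A.gens_hom P snd \<in> mackey_epi G k A.F P"
    using \<pi> unfolding mackey_epi_def N_def by blast
  obtain EN :: "(('g set \<times> ('g set \<times> 'm) \<times> 'g set) set \<Rightarrow> 'k) \<Rightarrow> 'm \<times> nat \<Rightarrow> 'k" and DN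
    where EN: "\<forall>H a. subgroup H G \<longrightarrow> a \<in> carrier (obj A.F H) \<longrightarrow> DN (EN a) = a"
    using A.F_encode by blast
  have "\<exists>\<iota>\<in>mackey_hom G k P A.F. \<forall>H. subgroup H G \<longrightarrow> (\<forall>x\<in>carrier (obj P H). A.gens_hom P snd H (\<iota> H x) = x)"
    by (rule projective_lift[where EN = EN and DN = DN and EL = "enc k" and DL = "inv_into UNIV (enc k)",
          OF proj A.F_mackey P epi mackey_hom_id])
      (use EN in \<open>simp_all add: kf.inv_enc\<close>)
  then obtain \<iota> where \<iota>: "\<iota> \<in> mackey_hom G k P A.F"
    "\<forall>H. subgroup H G \<longrightarrow> (\<forall>x\<in>carrier (obj P H). A.gens_hom P snd H (\<iota> H x) = x)"
    by (elim bexE)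
  have "\<forall>K x. subgroup K G \<longrightarrow> x \<in> carrier (obj P K) \<longrightarrow> A.gens_hom P snd K (\<iota> K x) = x" using \<iota>(2) by simp
  then show ?thesis by (intro exI[of _ S] conjI cos bexI[OF _ \<pi>] bexI[OF _ \<iota>(1)])
qed

text \<open>Both functors are presented as retracts of Burnside functors. For \<open>Q\<close> this
  supplies the embedding \<open>\<iota>'\<close>, injective because \<open>\<pi>'\<close> undoes
  it.\<close>

theorem projective_mono_splits:
  fixes P :: "('g, 'k, 'm) mackey" and Q :: "('g, 'k, 'n) mackey"
  assumes fieldk: "field k" and P: "mackey_functor G k P" "fin_gen G k P" "projective G k P"
    and Q: "mackey_functor G k Q" "fin_gen G k Q" "projective G k Q"
    and f: "f \<in> mackey_hom G k P Q"
    and f_inj: "\<And>K x. \<lbrakk>subgroup K G; x \<in> carrier (obj P K); f K x = \<zero>\<^bsub>obj Q K\<^esub>\<rbrakk> \<Longrightarrow> x = \<zero>\<^bsub>obj P K\<^esub>"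
  shows "\<exists>r\<in>mackey_hom G k Q P. \<forall>K x. subgroup K G \<longrightarrow> x \<in> carrier (obj P K) \<longrightarrow> r K (f K x) = x"
proof -
  interpret P: mackey_functor G k P by fact
  interpret Q: mackey_functor G k Q by fact
  obtain S \<pi> \<iota> where A: "cosets G k (S :: ('g set \<times> 'm) set) fst"
    and \<pi>: "\<pi> \<in> mackey_hom G k (burnside.F G k (coset_gset G S fst) (coset_act G)) P"
    and \<iota>: "\<iota> \<in> mackey_hom G k P (burnside.F G k (coset_gset G S fst) (coset_act G))"
    and \<pi>\<iota>: "\<forall>K x. subgroup K G \<longrightarrow> x \<in> carrier (obj P K) \<longrightarrow> \<pi> K (\<iota> K x) = x"
    using projective_presentation[OF fieldk P] by blast
  obtain S' \<pi>' \<iota>' where B: "cosets G k (S' :: ('g set \<times> 'n) set) fst"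
    and \<pi>': "\<pi>' \<in> mackey_hom G k (burnside.F G k (coset_gset G S' fst) (coset_act G)) Q"
    and \<iota>': "\<iota>' \<in> mackey_hom G k Q (burnside.F G k (coset_gset G S' fst) (coset_act G))"
    and \<pi>\<iota>': "\<forall>K x. subgroup K G \<longrightarrow> x \<in> carrier (obj Q K) \<longrightarrow> \<pi>' K (\<iota>' K x) = x"
    using projective_presentation[OF fieldk Q] by blast
  interpret A: cosets G k S fst by (rule A)
  interpret B: cosets G k S' fst by (rule B)
  interpret BF: mackey_functor G k B.F by (rule B.F_mackey)
  have "projective_mono G k S fst P Q f \<pi> \<iota> (coset_gset G S' fst) (coset_act G) \<iota>'"
  proof (intro projective_mono.intro projective_mono_axioms.intro A fieldk P(1) Q(1) f f_inj \<pi> \<iota> B.burnside_axioms \<iota>')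
    show "\<pi> K (\<iota> K x) = x" if "subgroup K G" "x \<in> carrier (obj P K)" for K x using \<pi>\<iota> that by blast
    show "y = \<zero>\<^bsub>obj Q K\<^esub>" if K: "subgroup K G" "y \<in> carrier (obj Q K)" and 0: "\<iota>' K y = \<zero>\<^bsub>obj B.F K\<^esub>" for K y
    proof -
      have "y = \<pi>' K (\<iota>' K y)" using \<pi>\<iota>' K by simp
      also have "\<dots> = \<zero>\<^bsub>obj Q K\<^esub>"
        unfolding 0 by (rule lin_map_zero[OF mackey_homD(1)[OF \<pi>' K(1)] BF.module_obj[OF K(1)] Q.module_obj[OF K(1)]])
      finally show ?thesis .
    qed
  qed
  then show ?thesis by (rule projective_mono.retraction_exists)
qed

lemma projective_epi_splits:
  fixes P :: "('g, 'k, 'm) mackey" and N :: "('g, 'k, 'm) mackey"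
  assumes fieldk: "field k" and P: "mackey_functor G k P" "projective G k P" and N: "mackey_functor G k N"
    and e: "e \<in> mackey_epi G k N P"
  shows "\<exists>s\<in>mackey_hom G k P N. \<forall>H. subgroup H G \<longrightarrow> (\<forall>x\<in>carrier (obj P H). e H (s H x) = x)"
proof -
  interpret kf: field k by fact
  show ?thesis
    by (rule projective_lift[OF P(2) N P(1) e mackey_hom_id, of "inv_into UNIV (enc k)" "enc k" "inv_into UNIV (enc k)" "enc k"])
      (simp_all add: kf.inv_enc)
qed

section \<open>Splitting idempotents of complexes\<close>

lemma mackey_sub_simps [simp]:
  "obj (mackey_sub M N) H = (obj M H)\<lparr>carrier := N H\<rparr>" "ind (mackey_sub M N) = ind M"
  "res (mackey_sub M N) = res M" "cnj (mackey_sub M N) = cnj M"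
  by (simp_all add: mackey_sub_def)

lemma (in mackey_functor) mackey_sub_mackey:
  assumes S: "subfunctor G R M N"
  shows "mackey_functor G R (mackey_sub M N)"
proof (intro mackey_functor.intro mackey_functor_axioms.intro is_group R.is_cring fin)
  have sm: "submodule (N H) R (obj M H)" if "subgroup H G" for H using S that by (auto simp: subfunctor_def)
  have sub: "N H \<subseteq> carrier (obj M H)" if "subgroup H G" for H
    by (rule module.submoduleE(1)[OF module_obj[OF that] sm[OF that]])
  have c: "a \<in> carrier (obj M H)" if "subgroup H G" "a \<in> N H" for H a using sub that by blast
  have Ni: "ind M K H a \<in> N H" if "subgroup K G" "subgroup H G" "K \<subseteq> H" "a \<in> N K" for K H a
    using S that by (force simp: subfunctor_def)
  have Nr: "res M H K a \<in> N K" if "subgroup K G" "subgroup H G" "K \<subseteq> H" "a \<in> N H" for K H a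
    using S that by (force simp: subfunctor_def)
  have Nc: "cnj M g H a \<in> N (conj_subgp G g H)" if "g \<in> carrier G" "subgroup H G" "a \<in> N H" for g H a
    using S that by (force simp: subfunctor_def)
  show mo: "module R (obj (mackey_sub M N) H)" if "subgroup H G" for H
    using submodule.submodule_is_module[OF sm[OF that] module_obj[OF that]] by simp
  show "ind (mackey_sub M N) K H \<in> lin_map R (obj (mackey_sub M N) K) (obj (mackey_sub M N) H)"
    if "subgroup K G" "subgroup H G" "K \<subseteq> H" for K H
    by (rule lin_mapI) (use Ni[OF that] lin_mapD[OF ind_lin[OF that]] c[OF that(1)] in auto)
  show "res (mackey_sub M N) H K \<in> lin_map R (obj (mackey_sub M N) H) (obj (mackey_sub M N) K)"
    if "subgroup K G" "subgroup H G" "K \<subseteq> H" for K H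
    by (rule lin_mapI) (use Nr[OF that] lin_mapD[OF res_lin[OF that]] c[OF that(2)] in auto)
  show "cnj (mackey_sub M N) g H \<in> lin_map R (obj (mackey_sub M N) H) (obj (mackey_sub M N) (conj_subgp G g H))"
    if "subgroup H G" "g \<in> carrier G" for g H
    by (rule lin_mapI) (use Nc[OF that(2,1)] lin_mapD[OF cnj_lin[OF that]] c[OF that(1)] in auto)
  show "ind (mackey_sub M N) H H a = a" "res (mackey_sub M N) H H a = a"
    if "subgroup H G" "a \<in> carrier (obj (mackey_sub M N) H)" for H a
    using that by (simp_all add: c ind_id res_id)
  show "cnj (mackey_sub M N) h H a = a" if "subgroup H G" "h \<in> H" "a \<in> carrier (obj (mackey_sub M N) H)" for h H a
    using that by (simp add: c cnj_id)
  show "ind (mackey_sub M N) K H (ind (mackey_sub M N) J K a) = ind (mackey_sub M N) J H a"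
    if "subgroup J G" "subgroup K G" "subgroup H G" "J \<subseteq> K" "K \<subseteq> H" "a \<in> carrier (obj (mackey_sub M N) J)" for J K H a
    using that by (simp add: c ind_trans)
  show "res (mackey_sub M N) K J (res (mackey_sub M N) H K a) = res (mackey_sub M N) H J a"
    if "subgroup J G" "subgroup K G" "subgroup H G" "J \<subseteq> K" "K \<subseteq> H" "a \<in> carrier (obj (mackey_sub M N) H)" for J K H a
    using that by (simp add: c res_trans)
  show "cnj (mackey_sub M N) g (conj_subgp G h H) (cnj (mackey_sub M N) h H a) = cnj (mackey_sub M N) (g \<otimes> h) H a"
    if "subgroup H G" "g \<in> carrier G" "h \<in> carrier G" "a \<in> carrier (obj (mackey_sub M N) H)" for g h H a
    using that by (simp add: c cnj_cnj)
  show "cnj (mackey_sub M N) g H (ind (mackey_sub M N) K H a) =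
      ind (mackey_sub M N) (conj_subgp G g K) (conj_subgp G g H) (cnj (mackey_sub M N) g K a)"
    if "subgroup K G" "subgroup H G" "K \<subseteq> H" "g \<in> carrier G" "a \<in> carrier (obj (mackey_sub M N) K)" for g K H a
    using that by (simp add: c cnj_ind)
  show "cnj (mackey_sub M N) g K (res (mackey_sub M N) H K a) =
      res (mackey_sub M N) (conj_subgp G g H) (conj_subgp G g K) (cnj (mackey_sub M N) g H a)"
    if "subgroup K G" "subgroup H G" "K \<subseteq> H" "g \<in> carrier G" "a \<in> carrier (obj (mackey_sub M N) H)" for g K H a
    using that by (simp add: c cnj_res)
  fix J K H T a assume *: "subgroup J G" "subgroup K G" "subgroup H G" "J \<subseteq> H" "K \<subseteq> H"
    "T \<in> dcoset_reps G J H K" and a: "a \<in> carrier (obj (mackey_sub M N) K)"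
  let ?I = "\<lambda>x. conj_subgp G (inv x) J \<inter> K" and ?J = "\<lambda>x. J \<inter> conj_subgp G x K"
  have t: "ind M (?J x) J (cnj M x (?I x) (res M K (?I x) a)) \<in> N J" if "x \<in> T" for x
  proof -
    have x: "x \<in> carrier G" using dcoset_repsD(1)[OF *(6,1-5)] that subgroup.mem_carrier[OF *(3)] by auto
    have Is: "subgroup (?I x) G" using * x by (simp add: subgroups_Inter_pair conj_subgroup)
    have Js: "subgroup (?J x) G" using * x by (simp add: subgroups_Inter_pair conj_subgroup)
    have IJ: "conj_subgp G x (?I x) = ?J x"
      using * x by (simp add: conj_Int conj_subset subgroup.subset conj_inv_conj)
    have r: "res M K (?I x) a \<in> N (?I x)" by (rule Nr[OF Is *(2) Int_lower2]) (use a in simp)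
    show ?thesis using Ni[OF Js *(1) Int_lower1] Nc[OF x Is r] IJ by simp
  qed
  \<comment> \<open>The sum in the formula is taken over a smaller carrier; linearity of the
    inclusion identifies it with the sum in \<open>M\<close>.\<close>
  have incl: "(\<lambda>x. x) \<in> lin_map R (obj (mackey_sub M N) J) (obj M J)"
    by (rule lin_mapI) (use c[OF *(1)] in auto)
  have "(\<Oplus>\<^bsub>obj (mackey_sub M N) J\<^esub>x\<in>T. ind M (?J x) J (cnj M x (?I x) (res M K (?I x) a))) =
     (\<Oplus>\<^bsub>obj M J\<^esub>x\<in>T. ind M (?J x) J (cnj M x (?I x) (res M K (?I x) a)))"
    by (rule lin_map_finsum[OF incl mo[OF *(1)] module_obj[OF *(1)]]) (use t in auto)
  moreover have "res M H J (ind M K H a) = (\<Oplus>\<^bsub>obj M J\<^esub>x\<in>T. ind M (?J x) J (cnj M x (?I x) (res M K (?I x) a)))"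
    by (rule mackey_formula[OF *]) (use a c[OF *(2)] in simp)
  ultimately show "res (mackey_sub M N) H J (ind (mackey_sub M N) K H a) =
     (\<Oplus>\<^bsub>obj (mackey_sub M N) J\<^esub>x\<in>T. ind (mackey_sub M N) (?J x) J
        (cnj (mackey_sub M N) x (?I x) (res (mackey_sub M N) K (?I x) a)))"
    by (simp only: mackey_sub_simps)
qed

lemma mackey_sub_hom:
  assumes "f \<in> mackey_hom G R M N" "subfunctor G R M A" "mackey_functor G R M"
    and "\<And>H x. subgroup H G \<Longrightarrow> x \<in> A H \<Longrightarrow> f H x \<in> B H"
  shows "f \<in> mackey_hom G R (mackey_sub M A) (mackey_sub N B)"
proof -
  interpret M: mackey_functor G R M by fact
  have c: "a \<in> carrier (obj M H)" if "subgroup H G" "a \<in> A H" for H a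
    using module.submoduleE(1)[OF M.module_obj[OF that(1)], of "A H"] assms(2) that by (auto simp: subfunctor_def)
  note f = mackey_homD[OF assms(1)]
  show ?thesis
  proof (rule mackey_homI)
    show "f H \<in> lin_map R (obj (mackey_sub M A) H) (obj (mackey_sub N B) H)" if "subgroup H G" for H
      by (rule lin_mapI) (use assms(4)[OF that] c[OF that] lin_mapD[OF f(1)[OF that]] in auto)
  qed (simp_all add: f(2-4) c)
qed

lemma mod_dsum_simps [simp]:
  "carrier (mod_dsum A B) = carrier A \<times> carrier B" "zero (mod_dsum A B) = (\<zero>\<^bsub>A\<^esub>, \<zero>\<^bsub>B\<^esub>)"
  "add (mod_dsum A B) x y = (fst x \<oplus>\<^bsub>A\<^esub> fst y, snd x \<oplus>\<^bsub>B\<^esub> snd y)"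
  "smult (mod_dsum A B) r x = (r \<odot>\<^bsub>A\<^esub> fst x, r \<odot>\<^bsub>B\<^esub> snd x)"
  by (simp_all add: mod_dsum_def case_prod_unfold)

lemma mackey_dsum_simps [simp]:
  "obj (mackey_dsum M N) H = mod_dsum (obj M H) (obj N H)"
  "ind (mackey_dsum M N) K H = map_prod (ind M K H) (ind N K H)"
  "res (mackey_dsum M N) H K = map_prod (res M H K) (res N H K)"
  "cnj (mackey_dsum M N) g H = map_prod (cnj M g H) (cnj N g H)"
  by (simp_all add: mackey_dsum_def)

lemma mackey_hom_pair:
  assumes "f \<in> mackey_hom G R M N" "h \<in> mackey_hom G R M L"
  shows "(\<lambda>H x. (f H x, h H x)) \<in> mackey_hom G R M (mackey_dsum N L)"
proof -
  note f = mackey_homD[OF assms(1)] and h = mackey_homD[OF assms(2)]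
  show ?thesis
  proof (rule mackey_homI)
    show "(\<lambda>x. (f H x, h H x)) \<in> lin_map R (obj M H) (obj (mackey_dsum N L) H)" if "subgroup H G" for H
      by (rule lin_mapI) (simp_all add: lin_mapD[OF f(1)[OF that]] lin_mapD[OF h(1)[OF that]])
  qed (simp_all add: f(2-4) h(2-4))
qed

lemma mackey_hom_into_sub:
  assumes "f \<in> mackey_hom G R M N" "\<And>H x. subgroup H G \<Longrightarrow> x \<in> carrier (obj M H) \<Longrightarrow> f H x \<in> B H"
  shows "f \<in> mackey_hom G R M (mackey_sub N B)"
proof -
  note f = mackey_homD[OF assms(1)]
  show ?thesis
  proof (rule mackey_homI)
    show "f H \<in> lin_map R (obj M H) (obj (mackey_sub N B) H)" if "subgroup H G" for H
      by (rule lin_mapI) (simp_all add: lin_mapD[OF f(1)[OF that]] assms(2)[OF that])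
  qed (simp_all add: f(2-4))
qed

text \<open>The complex is the direct sum of the image and the kernel of the idempotent through
  \<open>x \<mapsto> (e x, x - e x)\<close>, with addition as inverse. One of the two summands must
  be zero.\<close>

lemma indecomposable_idempotent:
  fixes C :: "('g, 'k, 'm) mackey_cx"
  assumes C: "chain_complex G R C" and ind: "cx_indecomposable G R C"
    and e: "\<And>i. e i \<in> mackey_hom G R (cob C i) (cob C i)"
    and idem: "\<And>i H x. \<lbrakk>subgroup H G; x \<in> carrier (obj (cob C i) H)\<rbrakk> \<Longrightarrow> e i H (e i H x) = e i H x"
    and chain: "\<And>i H x. \<lbrakk>subgroup H G; x \<in> carrier (obj (cob C i) H)\<rbrakk> \<Longrightarrow> e (i - 1) H (dif C i H x) = dif C i H (e i H x)"
  shows "(\<forall>i H x. subgroup H G \<longrightarrow> x \<in> carrier (obj (cob C i) H) \<longrightarrow> e i H x = \<zero>\<^bsub>obj (cob C i) H\<^esub>) \<or>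
    (\<forall>i H x. subgroup H G \<longrightarrow> x \<in> carrier (obj (cob C i) H) \<longrightarrow> e i H x = x)"
proof -
  interpret C: chain_complex G R C by fact
  have M: "mackey_functor G R (cob C i)" for i by (rule C.mackey_cob)
  have mod: "module R (obj (cob C i) H)" if "subgroup H G" for i H by (rule mackey_functor.module_obj[OF M that])
  define A0 where "A0 i H = e i H ` carrier (obj (cob C i) H)" for i H
  define B0 where "B0 i H = {x \<in> carrier (obj (cob C i) H). e i H x = \<zero>\<^bsub>obj (cob C i) H\<^esub>}" for i H
  have sA: "subfunctor G R (cob C i) (A0 i)" for i
    unfolding A0_def[abs_def] by (rule subfunctor_image[OF M M e])
  have sB: "subfunctor G R (cob C i) (B0 i)" for i
    unfolding B0_def[abs_def] by (rule subfunctor_kernel[OF M M e])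
  define A where "A = \<lparr>cob = (\<lambda>i. mackey_sub (cob C i) (A0 i)), dif = dif C\<rparr>"
  define B where "B = \<lparr>cob = (\<lambda>i. mackey_sub (cob C i) (B0 i)), dif = dif C\<rparr>"
  note ec = mackey_homD(5)[OF e] and dc = mackey_homD(5)[OF C.dif_hom]
  have dA: "dif C i H x \<in> A0 (i - 1) H" if "subgroup H G" "x \<in> A0 i H" for i H x
    using that chain[OF that(1)] dc[OF that(1)] by (auto simp: A0_def) (metis imageI)
  have dB: "dif C i H x \<in> B0 (i - 1) H" if "subgroup H G" "x \<in> B0 i H" for i H x
    using that chain[OF that(1)] dc[OF that(1)] lin_map_zero[OF mackey_homD(1)[OF C.dif_hom that(1)] mod[OF that(1)] mod[OF that(1)]]
    by (auto simp: B0_def)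
  have Ac: "x \<in> carrier (obj (cob C i) H)" if "subgroup H G" "x \<in> A0 i H" for i H x
    using that ec[OF that(1)] by (auto simp: A0_def)
  have Bc: "x \<in> carrier (obj (cob C i) H)" if "x \<in> B0 i H" for i H x
    using that by (auto simp: B0_def)
  have cA: "chain_complex G R A"
  proof (rule chain_complex.intro)
    show "mackey_functor G R (cob A i)" for i
      unfolding A_def by simp (rule mackey_functor.mackey_sub_mackey[OF M sA])
    show "dif A i \<in> mackey_hom G R (cob A i) (cob A (i - 1))" for i
      unfolding A_def by simp (rule mackey_sub_hom[OF C.dif_hom sA M dA])
    show "dif A (i - 1) H (dif A i H x) = \<zero>\<^bsub>obj (cob A (i - 2)) H\<^esub>" if "subgroup H G" "x \<in> carrier (obj (cob A i) H)" for i H x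
      using C.dif_dif[OF that(1) Ac[OF that(1)]] that(2) by (simp add: A_def)
  qed
  have cB: "chain_complex G R B"
  proof (rule chain_complex.intro)
    show "mackey_functor G R (cob B i)" for i
      unfolding B_def by simp (rule mackey_functor.mackey_sub_mackey[OF M sB])
    show "dif B i \<in> mackey_hom G R (cob B i) (cob B (i - 1))" for i
      unfolding B_def by simp (rule mackey_sub_hom[OF C.dif_hom sB M dB])
    show "dif B (i - 1) H (dif B i H x) = \<zero>\<^bsub>obj (cob B (i - 2)) H\<^esub>" if "subgroup H G" "x \<in> carrier (obj (cob B i) H)" for i H x
      using C.dif_dif[OF that(1) Bc] that(2) by (simp add: B_def)
  qed
  define c where "c i H x = x \<ominus>\<^bsub>obj (cob C i) H\<^esub> e i H x" for i H x
  have c_alt: "c i H x = x \<oplus>\<^bsub>obj (cob C i) H\<^esub> (\<ominus>\<^bsub>R\<^esub> \<one>\<^bsub>R\<^esub>) \<odot>\<^bsub>obj (cob C i) H\<^esub> e i H x"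
    if H: "subgroup H G" "x \<in> carrier (obj (cob C i) H)" for i H x
  proof -
    interpret CH: module R "obj (cob C i) H" by (rule mod[OF H(1)])
    show ?thesis using ec[OF H] by (simp add: c_def CH.minus_eq CH.smult_l_minus)
  qed
  \<comment> \<open>On carriers \<open>c i\<close> is the identity plus minus one times
    \<open>e i\<close>, which is a morphism. The two expressions need not agree off the carriers, so
    the laws are transferred pointwise.\<close>
  have ch: "c i \<in> mackey_hom G R (cob C i) (cob C i)" for i
  proof -
    interpret Mi: mackey_functor G R "cob C i" by (rule M)
    have "(\<lambda>H x. x \<oplus>\<^bsub>obj (cob C i) H\<^esub> (\<ominus>\<^bsub>R\<^esub> \<one>\<^bsub>R\<^esub>) \<odot>\<^bsub>obj (cob C i) H\<^esub> e i H x) \<in> mackey_hom G R (cob C i) (cob C i)" (is "?h \<in> _")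
      by (rule Mi.hom_add[OF M mackey_hom_id Mi.hom_smult[OF M _ e]]) simp
    note h = mackey_homD[OF this]
    note cl = lin_mapD(1)[OF Mi.ind_lin] lin_mapD(1)[OF Mi.res_lin] lin_mapD(1)[OF Mi.cnj_lin]
    show ?thesis
    proof (rule mackey_homI)
      show "c i H \<in> lin_map R (obj (cob C i) H) (obj (cob C i) H)" if "subgroup H G" for H
      proof -
        interpret CH: module R "obj (cob C i) H" by (rule mod[OF that])
        show ?thesis
          by (rule lin_mapI) (use lin_mapD[OF h(1)[OF that]] in \<open>simp_all add: c_alt[OF that]\<close>)
      qed
      show "c i H (ind (cob C i) K H a) = ind (cob C i) K H (c i K a)"
        if "subgroup K G" "subgroup H G" "K \<subseteq> H" "a \<in> carrier (obj (cob C i) K)" for K H a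
        using h(2)[OF that] by (simp add: c_alt that cl)
      show "c i K (res (cob C i) H K a) = res (cob C i) H K (c i H a)"
        if "subgroup K G" "subgroup H G" "K \<subseteq> H" "a \<in> carrier (obj (cob C i) H)" for K H a
        using h(3)[OF that] by (simp add: c_alt that cl)
      show "c i (conj_subgp G g H) (cnj (cob C i) g H a) = cnj (cob C i) g H (c i H a)"
        if "g \<in> carrier G" "subgroup H G" "a \<in> carrier (obj (cob C i) H)" for g H a
        using h(4)[OF that] by (simp add: c_alt that cl Mi.conj_subgroup)
    qed
  qed
  have cB0: "c i H x \<in> B0 i H" if H: "subgroup H G" "x \<in> carrier (obj (cob C i) H)" for i H x
  proof -
    interpret CH: module R "obj (cob C i) H" by (rule mod[OF H(1)])
    note l = lin_mapD[OF mackey_homD(1)[OF e H(1), of i]]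
    have "e i H (c i H x) = e i H x \<oplus>\<^bsub>obj (cob C i) H\<^esub> (\<ominus>\<^bsub>R\<^esub> \<one>\<^bsub>R\<^esub>) \<odot>\<^bsub>obj (cob C i) H\<^esub> e i H (e i H x)"
      using ec[OF H] H(2) by (simp add: c_alt[OF H] l)
    also have "\<dots> = \<zero>\<^bsub>obj (cob C i) H\<^esub>"
      using ec[OF H] by (simp add: idem[OF H] CH.smult_l_minus CH.r_neg)
    finally show ?thesis using mackey_homD(5)[OF ch H] by (simp add: B0_def)
  qed
  define f where "f i H x = (e i H x, c i H x)" for i H x
  have "f \<in> cx_iso G R C (cx_dsum A B)"
    unfolding cx_iso_def mem_Collect_eq
  proof (intro conjI allI impI ballI)
    fix i
    have "f i \<in> mackey_hom G R (cob C i) (mackey_dsum (cob A i) (cob B i))"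
      unfolding f_def[abs_def] A_def B_def mackey_cx.simps
      by (rule mackey_hom_pair[OF mackey_hom_into_sub[OF e] mackey_hom_into_sub[OF ch cB0]]) (simp add: A0_def)
    moreover have "bij_betw (f i H) (carrier (obj (cob C i) H)) (carrier (obj (mackey_dsum (cob A i) (cob B i)) H))"
      if H: "subgroup H G" for H
    proof (rule bij_betw_byWitness[where f' = "\<lambda>(a, b). a \<oplus>\<^bsub>obj (cob C i) H\<^esub> b"])
      interpret CH: module R "obj (cob C i) H" by (rule mod[OF H])
      note l = lin_mapD[OF mackey_homD(1)[OF e H, of i]]
      show "\<forall>x\<in>carrier (obj (cob C i) H). (case f i H x of (a, b) \<Rightarrow> a \<oplus>\<^bsub>obj (cob C i) H\<^esub> b) = x"
      proof
        fix x assume x: "x \<in> carrier (obj (cob C i) H)"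
        show "(case f i H x of (a, b) \<Rightarrow> a \<oplus>\<^bsub>obj (cob C i) H\<^esub> b) = x"
          using ec[OF H x] x by (simp add: f_def c_def CH.minus_eq CH.M.a_lcomm[of "e i H x" x] CH.r_neg)
      qed
      show "\<forall>y\<in>carrier (obj (mackey_dsum (cob A i) (cob B i)) H). f i H (case y of (a, b) \<Rightarrow> a \<oplus>\<^bsub>obj (cob C i) H\<^esub> b) = y"
      proof clarify
        fix a b assume ab: "(a, b) \<in> carrier (obj (mackey_dsum (cob A i) (cob B i)) H)"
        then have ab: "a \<in> A0 i H" "b \<in> B0 i H" by (simp_all add: A_def B_def)
        have abc: "a \<in> carrier (obj (cob C i) H)" "b \<in> carrier (obj (cob C i) H)" using Ac[OF H ab(1)] Bc[OF ab(2)] .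
        have "e i H a = a" using ab(1) idem[OF H] by (auto simp: A0_def)
        then have "e i H (a \<oplus>\<^bsub>obj (cob C i) H\<^esub> b) = a" using l(2)[OF abc] ab(2) abc by (simp add: B0_def)
        then show "f i H (a \<oplus>\<^bsub>obj (cob C i) H\<^esub> b) = (a, b)"
          using abc by (simp add: f_def c_def CH.minus_eq CH.M.a_comm[of a b] CH.M.a_assoc CH.r_neg)
      qed
      show "f i H ` carrier (obj (cob C i) H) \<subseteq> carrier (obj (mackey_dsum (cob A i) (cob B i)) H)"
        using cB0[OF H] by (auto simp: f_def A_def B_def A0_def)
      show "(\<lambda>(a, b). a \<oplus>\<^bsub>obj (cob C i) H\<^esub> b) ` carrier (obj (mackey_dsum (cob A i) (cob B i)) H) \<subseteq> carrier (obj (cob C i) H)"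
        using Ac[OF H] Bc by (auto simp: A_def B_def)
    qed
    ultimately show "f i \<in> mackey_iso G R (cob C i) (cob (cx_dsum A B) i)"
      by (simp add: mackey_iso_def cx_dsum_def)
  next
    fix i H x assume H: "subgroup H G" and x: "x \<in> carrier (obj (cob C i) H)"
    interpret CH: module R "obj (cob C i) H" by (rule mod[OF H])
    note l = lin_mapD[OF mackey_homD(1)[OF C.dif_hom H, of i]]
    have "c (i - 1) H (dif C i H x) = dif C i H (c i H x)"
      using ec[OF H x] x by (simp add: c_alt[OF H] dc[OF H] l chain[OF H x])
    then show "f (i - 1) H (dif C i H x) = dif (cx_dsum A B) i H (f i H x)"
      using chain[OF H x] by (simp add: f_def cx_dsum_def A_def B_def)
  qed
  then have "cx_zero G A \<or> cx_zero G B"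
    using ind cA cB unfolding cx_indecomposable_def by blast
  then show ?thesis
  proof
    assume z: "cx_zero G A"
    have "e i H x = \<zero>\<^bsub>obj (cob C i) H\<^esub>" if H: "subgroup H G" "x \<in> carrier (obj (cob C i) H)" for i H x
      using z that by (auto simp: cx_zero_def mackey_zero_def A_def A0_def)
    then show ?thesis by blast
  next
    assume z: "cx_zero G B"
    have "e i H x = x" if H: "subgroup H G" "x \<in> carrier (obj (cob C i) H)" for i H x
    proof -
      interpret CH: module R "obj (cob C i) H" by (rule mod[OF H(1)])
      have "c i H x = \<zero>\<^bsub>obj (cob C i) H\<^esub>"
        using z cB0[OF H] H(1) by (auto simp: cx_zero_def mackey_zero_def B_def)
      then show ?thesis
        using ec[OF H] H(2) CH.M.minus_equality[of x "\<ominus>\<^bsub>obj (cob C i) H\<^esub> e i H x"]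
        by (simp add: c_def CH.M.minus_eq)
    qed
    then show ?thesis by blast
  qed
qed

lemma quasi_inverse_dichotomy:
  fixes C :: "('g, 'k, 'm) mackey_cx"
  assumes C: "chain_complex G R C" and ind: "cx_indecomposable G R C"
    and t: "t \<in> mackey_hom G R (cob C (j - 1)) (cob C j)"
    and dtd: "\<And>H x. \<lbrakk>subgroup H G; x \<in> carrier (obj (cob C j) H)\<rbrakk> \<Longrightarrow> dif C j H (t H (dif C j H x)) = dif C j H x"
    and tdt: "\<And>H y. \<lbrakk>subgroup H G; y \<in> carrier (obj (cob C (j - 1)) H)\<rbrakk> \<Longrightarrow> t H (dif C j H (t H y)) = t H y"
  shows "(\<forall>H. subgroup H G \<longrightarrow> (\<forall>x\<in>carrier (obj (cob C j) H). t H (dif C j H x) = \<zero>\<^bsub>obj (cob C j) H\<^esub>) \<and>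
      (\<forall>y\<in>carrier (obj (cob C (j - 1)) H). dif C j H (t H y) = \<zero>\<^bsub>obj (cob C (j - 1)) H\<^esub>)) \<or> contractible G R C"
proof -
  interpret C: chain_complex G R C by fact
  have M: "mackey_functor G R (cob C i)" for i by (rule C.mackey_cob)
  have mod: "module R (obj (cob C i) H)" if "subgroup H G" for i H by (rule mackey_functor.module_obj[OF M that])
  note tc = mackey_homD(5)[OF t] and dc = mackey_homD(5)[OF C.dif_hom]
  have d0: "dif C i H \<zero>\<^bsub>obj (cob C i) H\<^esub> = \<zero>\<^bsub>obj (cob C (i - 1)) H\<^esub>" if "subgroup H G" for i H
    by (rule lin_map_zero[OF mackey_homD(1)[OF C.dif_hom that] mod[OF that] mod[OF that]])
  have t0: "t H \<zero>\<^bsub>obj (cob C (j - 1)) H\<^esub> = \<zero>\<^bsub>obj (cob C j) H\<^esub>" if "subgroup H G" for H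
    by (rule lin_map_zero[OF mackey_homD(1)[OF t that] mod[OF that] mod[OF that]])
  \<comment> \<open>The two hypotheses on \<open>t\<close> make the components in degrees
    \<open>j\<close> and \<open>j - 1\<close> idempotent. Compatibility with the differential is
    immediate in degree \<open>j\<close>, and in the neighbouring degrees both sides vanish since
    the square of the differential is zero.\<close>
  define e where "e i = (if i = j then (\<lambda>H x. t H (dif C j H x)) else if i = j - 1 then (\<lambda>H y. dif C j H (t H y))
     else (\<lambda>H _. \<zero>\<^bsub>obj (cob C i) H\<^esub>))" for i
  have "(\<forall>i H x. subgroup H G \<longrightarrow> x \<in> carrier (obj (cob C i) H) \<longrightarrow> e i H x = \<zero>\<^bsub>obj (cob C i) H\<^esub>) \<or>
    (\<forall>i H x. subgroup H G \<longrightarrow> x \<in> carrier (obj (cob C i) H) \<longrightarrow> e i H x = x)"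
  proof (rule indecomposable_idempotent[OF C ind])
    show "e i \<in> mackey_hom G R (cob C i) (cob C i)" for i
      using mackey_hom_comp[OF C.dif_hom[of j] t] mackey_hom_comp[OF t C.dif_hom[of j]] mackey_functor.hom_zero[OF M M]
      by (simp add: e_def)
    show "e i H (e i H x) = e i H x" if "subgroup H G" "x \<in> carrier (obj (cob C i) H)" for i H x
    proof -
      consider "i = j" | "i = j - 1" | "i \<noteq> j" "i \<noteq> j - 1" by blast
      then show ?thesis
      proof cases
        case 1
        then show ?thesis using dtd[OF that(1), of x] that(2) by (simp add: e_def)
      next
        case 2
        then show ?thesis using tdt[OF that(1), of x] that(2) by (simp add: e_def)
      next
        case 3
        then show ?thesis by (simp add: e_def)
      qed
    qed
    show "e (i - 1) H (dif C i H x) = dif C i H (e i H x)" if H: "subgroup H G" "x \<in> carrier (obj (cob C i) H)" for i H x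
    proof -
      consider "i = j" | "i = j - 1" | "i = j + 1" | "i \<noteq> j" "i \<noteq> j - 1" "i \<noteq> j + 1" by blast
      then show ?thesis
      proof cases
        case 1
        then show ?thesis by (simp add: e_def)
      next
        case 2
        have "dif C (j - 1) H (dif C j H (t H x)) = \<zero>\<^bsub>obj (cob C (j - 2)) H\<^esub>"
          by (rule C.dif_dif[OF H(1) tc[OF H(1)]]) (use H 2 in simp)
        then show ?thesis using 2 by (simp add: e_def)
      next
        case 3
        have "dif C (j + 1 - 1) H (dif C (j + 1) H x) = \<zero>\<^bsub>obj (cob C (j + 1 - 2)) H\<^esub>"
          by (rule C.dif_dif[OF H(1)]) (use H 3 in simp)
        then show ?thesis using 3 t0[OF H(1)] d0[OF H(1), of "j + 1"] by (simp add: e_def)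
      next
        case 4
        then show ?thesis using d0[OF H(1), of i] by (simp add: e_def)
      qed
    qed
  qed
  then show ?thesis
  proof
    assume z: "\<forall>i H x. subgroup H G \<longrightarrow> x \<in> carrier (obj (cob C i) H) \<longrightarrow> e i H x = \<zero>\<^bsub>obj (cob C i) H\<^esub>"
    show ?thesis
      using z[rule_format, of _ _ j] z[rule_format, of _ _ "j - 1"] by (simp add: e_def)
  next
    assume z: "\<forall>i H x. subgroup H G \<longrightarrow> x \<in> carrier (obj (cob C i) H) \<longrightarrow> e i H x = x"
    \<comment> \<open>Outside degrees \<open>j\<close> and \<open>j - 1\<close> the idempotent is
      zero. Being the identity there, it forces the terms to vanish, so \<open>t\<close> in one
      degree is a full contraction.\<close>
    define s where "s i = (if i = j - 1 then t else (\<lambda>H _. \<zero>\<^bsub>obj (cob C (i + 1)) H\<^esub>))" for i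
    have sh: "s i \<in> mackey_hom G R (cob C i) (cob C (i + 1))" for i
      using t mackey_functor.hom_zero[OF M M] by (simp add: s_def)
    have "dif C (i + 1) H (s i H x) \<oplus>\<^bsub>obj (cob C i) H\<^esub> s (i - 1) H (dif C i H x) = x"
      if H: "subgroup H G" "x \<in> carrier (obj (cob C i) H)" for i H x
    proof -
      interpret CH: module R "obj (cob C i) H" by (rule mod[OF H(1)])
      have ex: "e i H x = x" using z H by blast
      consider "i = j" | "i = j - 1" | "i \<noteq> j" "i \<noteq> j - 1" by blast
      then show ?thesis
      proof cases
        case 1
        then show ?thesis using ex d0[OF H(1), of "j + 1"] H(2) CH.M.l_zero[OF H(2)] by (simp add: e_def s_def)
      next
        case 2
        then show ?thesis using ex H(2) CH.M.r_zero[OF H(2)] by (simp add: e_def s_def)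
      next
        case 3
        then show ?thesis using ex d0[OF H(1), of "i + 1"] CH.M.r_zero[OF H(2)] by (simp add: e_def s_def)
      qed
    qed
    then show ?thesis unfolding contractible_def using sh by blast
  qed
qed

text \<open>In the zero quotient the boundaries are the only coset. A cycle lies in its own coset
  because zero is a boundary, hence it is a boundary.\<close>

lemma homology_zero_imp:
  assumes C: "chain_complex G R C" and z: "mackey_zero G (homology G C i)"
    and H: "subgroup H G" and x: "x \<in> carrier (obj (cob C i) H)" "dif C i H x = \<zero>\<^bsub>obj (cob C (i - 1)) H\<^esub>"
  shows "\<exists>y\<in>carrier (obj (cob C (i + 1)) H). dif C (i + 1) H y = x"
proof -
  interpret C: chain_complex G R C by fact
  have mod: "module R (obj (cob C i) H)" for i by (rule mackey_functor.module_obj[OF C.mackey_cob H])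
  interpret CH: module R "obj (cob C i) H" by (rule mod)
  let ?B = "boundaries C i H"
  have h: "dif C (i + 1) \<in> mackey_hom G R (cob C (i + 1)) (cob C i)" using C.dif_hom[of "i + 1"] by simp
  have "dif C (i + 1) H \<zero>\<^bsub>obj (cob C (i + 1)) H\<^esub> = \<zero>\<^bsub>obj (cob C i) H\<^esub>"
    by (rule lin_map_zero[OF mackey_homD(1)[OF h H] mod mod])
  then have B0: "\<zero>\<^bsub>obj (cob C i) H\<^esub> \<in> ?B"
    unfolding boundaries_def using module.axioms(2)[OF mod] by (metis abelian_group.axioms(1) abelian_monoid.zero_closed imageI)
  have xc: "x \<in> cycles C i H" using x by (simp add: cycles_def a_kernel_def kernel_def)
  let ?S = "(obj (cob C i) H)\<lparr>carrier := cycles C i H\<rparr>"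
  have "?B +>\<^bsub>?S\<^esub> x \<in> a_rcosets\<^bsub>?S\<^esub> ?B"
    using xc by (auto simp: A_RCOSETS_def RCOSETS_def a_r_coset_def)
  moreover have "a_rcosets\<^bsub>?S\<^esub> ?B = {?B}"
    using z H by (simp add: mackey_zero_def homology_def mackey_quot_def)
  ultimately have "?B +>\<^bsub>?S\<^esub> x = ?B" by simp
  moreover have "x \<in> ?B +>\<^bsub>?S\<^esub> x"
    using B0 x(1) by (auto simp: a_r_coset_def r_coset_def intro!: bexI[of _ "\<zero>\<^bsub>obj (cob C i) H\<^esub>"])
  ultimately have "x \<in> ?B" by simp
  then show ?thesis by (auto simp: boundaries_def)
qed

lemma nonzero_object:
  assumes "mackey_functor G R M" "\<not> mackey_zero G M"
  shows "\<exists>H x. subgroup H G \<and> x \<in> carrier (obj M H) \<and> x \<noteq> \<zero>\<^bsub>obj M H\<^esub>"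
proof (rule ccontr)
  assume a: "\<not> ?thesis"
  have "carrier (obj M H) = {\<zero>\<^bsub>obj M H\<^esub>}" if H: "subgroup H G" for H
  proof -
    interpret MH: module R "obj M H" by (rule mackey_functor.module_obj[OF assms(1) H])
    show ?thesis using a H MH.M.zero_closed by blast
  qed
  then show False using assms(2) by (simp add: mackey_zero_def)
qed

theorem corollary1p5:
  fixes G :: "('g, 'b) monoid_scheme" and k :: "('k, 'r) ring_scheme"
    and P :: "('g, 'k, 'm) mackey_cx" and m n :: int
  assumes "group G" and "finite (carrier G)" and "field k"
    and "perfect G k P"
    and "m \<le> n"
    and "\<And>i. i < m \<or> n < i \<Longrightarrow> mackey_zero G (cob P i)"
    and "\<not> mackey_zero G (cob P m)" and "\<not> mackey_zero G (cob P n)"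
    and "cx_indecomposable G k P"
    and "\<not> contractible G k P"
  shows "\<not> mackey_zero G (homology G P m) \<and> \<not> mackey_zero G (homology G P n)"
proof -
  have C: "chain_complex G k P" using assms(4) by (simp add: perfect_def)
  interpret C: chain_complex G k P by (rule C)
  have M: "mackey_functor G k (cob P i)" and fg: "fin_gen G k (cob P i)" and pr: "projective G k (cob P i)" for i
    using assms(4) C.mackey_cob by (simp_all add: perfect_def)
  have zero: "x = \<zero>\<^bsub>obj (cob P i) H\<^esub>" if "i < m \<or> n < i" "subgroup H G" "x \<in> carrier (obj (cob P i) H)" for i H x
    using assms(6)[OF that(1)] that(2,3) by (auto simp: mackey_zero_def)
  have cl: "dif P i H x \<in> carrier (obj (cob P (i - 1)) H)" if "subgroup H G" "x \<in> carrier (obj (cob P i) H)" for i H x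
    by (rule mackey_homD(5)[OF C.dif_hom that])
  have "\<not> mackey_zero G (homology G P m)"
  proof
    assume hz: "mackey_zero G (homology G P m)"
    have dh: "dif P (m + 1) \<in> mackey_hom G k (cob P (m + 1)) (cob P m)" using C.dif_hom[of "m + 1"] by simp
    have "dif P (m + 1) H ` carrier (obj (cob P (m + 1)) H) = carrier (obj (cob P m) H)" if H: "subgroup H G" for H
    proof
      show "dif P (m + 1) H ` carrier (obj (cob P (m + 1)) H) \<subseteq> carrier (obj (cob P m) H)"
        using mackey_homD(5)[OF dh H] by blast
      show "carrier (obj (cob P m) H) \<subseteq> dif P (m + 1) H ` carrier (obj (cob P (m + 1)) H)"
      proof
        fix x assume x: "x \<in> carrier (obj (cob P m) H)"
        \<comment> \<open>Below the lowest degree the complex is zero, so every element of degree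
          \<open>m\<close> is a cycle.\<close>
        have "dif P m H x = \<zero>\<^bsub>obj (cob P (m - 1)) H\<^esub>" by (rule zero[OF _ H cl[OF H x]]) simp
        then show "x \<in> dif P (m + 1) H ` carrier (obj (cob P (m + 1)) H)"
          using homology_zero_imp[OF C hz H x] by blast
      qed
    qed
    then have "dif P (m + 1) \<in> mackey_epi G k (cob P (m + 1)) (cob P m)" using dh by (simp add: mackey_epi_def)
    then obtain t where t: "t \<in> mackey_hom G k (cob P m) (cob P (m + 1))"
      "\<forall>H. subgroup H G \<longrightarrow> (\<forall>x\<in>carrier (obj (cob P m) H). dif P (m + 1) H (t H x) = x)"
      using projective_epi_splits[OF assms(3) M pr M] by blast
    \<comment> \<open>The dichotomy is used at \<open>j = m + 1\<close>, as \<open>t\<close> raises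
      the degree from \<open>j - 1\<close> to \<open>j\<close>. The section property gives both
      identities required of \<open>t\<close>.\<close>
    have "(\<forall>H. subgroup H G \<longrightarrow>
        (\<forall>x\<in>carrier (obj (cob P (m + 1)) H). t H (dif P (m + 1) H x) = \<zero>\<^bsub>obj (cob P (m + 1)) H\<^esub>) \<and>
        (\<forall>y\<in>carrier (obj (cob P (m + 1 - 1)) H). dif P (m + 1) H (t H y) = \<zero>\<^bsub>obj (cob P (m + 1 - 1)) H\<^esub>)) \<or>
      contractible G k P"
      by (rule quasi_inverse_dichotomy[OF C assms(9)]) (use t cl[of _ _ "m + 1"] in simp_all)
    then have "\<forall>H. subgroup H G \<longrightarrow> (\<forall>y\<in>carrier (obj (cob P m) H). y = \<zero>\<^bsub>obj (cob P m) H\<^esub>)"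
      using assms(10) t(2) by simp
    then show False using nonzero_object[OF M assms(7)] by blast
  qed
  moreover have "\<not> mackey_zero G (homology G P n)"
  proof
    assume hz: "mackey_zero G (homology G P n)"
    \<comment> \<open>A cycle of degree \<open>n\<close> is a boundary, and degree
      \<open>n + 1\<close> is zero; so vanishing homology at this end means that the differential is
      injective.\<close>
    have inj: "x = \<zero>\<^bsub>obj (cob P n) H\<^esub>"
      if H: "subgroup H G" and x: "x \<in> carrier (obj (cob P n) H)" "dif P n H x = \<zero>\<^bsub>obj (cob P (n - 1)) H\<^esub>" for H x
    proof -
      obtain y where y: "y \<in> carrier (obj (cob P (n + 1)) H)" "dif P (n + 1) H y = x"
        using homology_zero_imp[OF C hz H x] by blast
      have y0: "y = \<zero>\<^bsub>obj (cob P (n + 1)) H\<^esub>" by (rule zero[OF _ H y(1)]) simp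
      have dh: "dif P (n + 1) \<in> mackey_hom G k (cob P (n + 1)) (cob P n)" using C.dif_hom[of "n + 1"] by simp
      show ?thesis
        using lin_map_zero[OF mackey_homD(1)[OF dh H] mackey_functor.module_obj[OF M H] mackey_functor.module_obj[OF M H]]
          y(2) y0 by simp
    qed
    obtain t where t: "t \<in> mackey_hom G k (cob P (n - 1)) (cob P n)"
      "\<forall>K x. subgroup K G \<longrightarrow> x \<in> carrier (obj (cob P n) K) \<longrightarrow> t K (dif P n K x) = x"
      using projective_mono_splits[OF assms(3) M fg pr M fg pr C.dif_hom[of n] inj] by blast
    have "(\<forall>H. subgroup H G \<longrightarrow> (\<forall>x\<in>carrier (obj (cob P n) H). t H (dif P n H x) = \<zero>\<^bsub>obj (cob P n) H\<^esub>) \<and>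
      (\<forall>y\<in>carrier (obj (cob P (n - 1)) H). dif P n H (t H y) = \<zero>\<^bsub>obj (cob P (n - 1)) H\<^esub>)) \<or> contractible G k P"
      by (rule quasi_inverse_dichotomy[OF C assms(9) t(1)]) (use t(2) mackey_homD(5)[OF t(1)] in simp_all)
    then have "\<forall>H. subgroup H G \<longrightarrow> (\<forall>x\<in>carrier (obj (cob P n) H). x = \<zero>\<^bsub>obj (cob P n) H\<^esub>)"
      using assms(10) t(2) by simp
    then show False using nonzero_object[OF M assms(8)] by blast
  qed
  ultimately show ?thesis by blast
qed

end
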